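(* Let $G=\mathbb{Q}_8=\langle x,y\mid x^4=1,\ y^2=x^2,\ xy=yx^{-1}\rangle$ be the quaternion group and let $\Bbbk=\mathbb{C}$. Up to isomorphism of the underlying Yetter-Drinfeld modules, the Nichols algebras $\mathcal{B}(V)$ of the finite-dimensional irreducible Yetter-Drinfeld modules $V$ over $\Bbbk G$ that have finite dimension as vector spaces are exactly those in the following list (that is, for a finite-dimensional irreducible $V\in{}^G_G\mathcal{YD}$ one has $\dim\mathcal{B}(V)<\infty$ if and only if $V$ is isomorphic to the Yetter-Drinfeld module defining one of the following Nichols algebras): (1) $\mathcal{B}(\mathcal{O}_x,\phi_2)$; (2) $\mathcal{B}(\mathcal{O}_{x^2},\rho_5)$; (3) $\mathcal{B}(\mathcal{O}_y,\phi_2)$; (4) $\mathcal{B}(\mathcal{O}_{xy},\phi_2)$.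
   Context: The base field is $\Bbbk=\mathbb{C}$ and $\mathbf{i}=\sqrt{-1}$. For a group $G$ and $g,h\in G$, write $g\rhd h=ghg^{-1}$, let $\mathcal{O}_g$ be the conjugacy class of $g$, and let $G^g=\{h\in G\mid hg=gh\}$ be its centralizer. Yetter-Drinfeld modules: a Yetter-Drinfeld module over $\Bbbk G$ is a $G$-graded vector space $M=\bigoplus_{g\in G}M_g$ with a (left) $\Bbbk G$-module structure such that $g\cdot M_h=M_{ghg^{-1}}$ for all $g,h\in G$. The coaction is $\delta(m)=g\otimes m$ for $m\in M_g$. Morphisms are the $G$-linear maps preserving the grading; the category is denoted ${}^G_G\mathcal{YD}$, and irreducible means simple in this category. Each $V\in{}^G_G\mathcal{YD}$ is a braided vector space with braiding $c(u\otimes v)=g\cdot v\otimes u$ for $u\in V_g$, $v\in V$. Nichols algebra: for $V\in{}^G_G\mathcal{YD}$, the tensor algebra $T(V)$ is a braided Hopf algebra in ${}^G_G\mathcal{YD}$ whose comultiplication is the algebra map (into $T(V)\otimes T(V)$ with the multiplication twisted by the braiding) such that the elements of $V$ are primitive. Let $I(V)$ be the largest coideal of $T(V)$ contained in $\bigoplus_{n\ge 2}T^n(V)$. The Nichols algebra of $V$ is $\mathcal{B}(V)=T(V)/I(V)$. The modules $M(\mathcal{O}_g,\rho)$: for $g\in G$ and a representation $(\rho,W)$ of $G^g$, let $M(\mathcal{O}_g,\rho)=\Bbbk G\otimes_{\Bbbk G^g}W$ be the induced $\Bbbk G$-module with grading $\deg(h\otimes w)=h\rhd g$ for $h\in G$,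 $w\in W$; this is an object of ${}^G_G\mathcal{YD}$. Write $\mathcal{B}(\mathcal{O}_g,\rho)=\mathcal{B}(M(\mathcal{O}_g,\rho))$. The quaternion group: for $G=\mathbb{Q}_8$ the conjugacy classes are $\mathcal{O}_1=\{1\}$, $\mathcal{O}_{x^2}=\{x^2\}$, $\mathcal{O}_x=\{x,x^3\}$, $\mathcal{O}_y=\{y,x^2y\}$, $\mathcal{O}_{xy}=\{xy,x^3y\}$, with chosen representatives $1,x^2,x,y,xy$. The centralizers are $G^1=G^{x^2}=G$, and $G^g=\langle g\rangle\cong\mathbb{Z}/4$ for $g\in\{x,y,xy\}$. Representations: $\rho_5$ is the two-dimensional irreducible complex representation of $\mathbb{Q}_8$, with character $2,-2,0,0,0$ on $1,x^2,x,y,xy$; explicitly, on a basis $v_1,v_2$: $x v_1=\mathbf{i}v_1$, $x v_2=-\mathbf{i}v_2$, $y v_1=v_2$, $y v_2=-v_1$. For $g\in\{x,y,xy\}$, $\phi_2$ denotes the one-dimensional representation of $G^g=\langle g\rangle$ given by $\phi_2(g^k)=e^{2\pi\mathbf{i}k/2}=(-1)^k$. *)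

theory Defs
  imports
    Complex_Main
    "HOL-Library.Poly_Mapping"
    "HOL-Algebra.QuotRing"
    "Jordan_Normal_Form.VS_Connect"
begin

text \<open>All vector spaces are modules in the sense of HOL-Algebra over the field of complex numbers,
  given by the record \<^term>\<open>class_ring :: complex ring\<close>. Where such a record merely describes a
  vector space, its fields for multiplication and unit are irrelevant.\<close>

abbreviation CC :: "complex ring" where
  "CC \<equiv> class_ring"

abbreviation CC_span :: "(complex, 'v, 'z) module_scheme \<Rightarrow> 'v set \<Rightarrow> 'v set" where
  "CC_span V S \<equiv> LinearCombinations.module.span CC V S"

abbreviation CC_fin_dim :: "(complex, 'v, 'z) module_scheme \<Rightarrow> bool" where
  "CC_fin_dim V \<equiv> vectorspace.fin_dim CC V"


section \<open>Free vector spaces, quotients and tensor products\<close>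

definition free_space :: "'x set \<Rightarrow> (complex, 'x \<Rightarrow>\<^sub>0 complex) module" where
  "free_space S =
    \<lparr>carrier = {p. Poly_Mapping.keys p \<subseteq> S}, mult = (\<lambda>p q. 0), one = 0, zero = 0, add = (+),
     smult = (\<lambda>c. Poly_Mapping.map ((*) c))\<rparr>"

definition lin_ext :: "('x \<Rightarrow> 'y \<Rightarrow>\<^sub>0 complex) \<Rightarrow> ('x \<Rightarrow>\<^sub>0 complex) \<Rightarrow> 'y \<Rightarrow>\<^sub>0 complex" where
  "lin_ext f p = (\<Sum>k\<in>Poly_Mapping.keys p. Poly_Mapping.map ((*) (Poly_Mapping.lookup p k)) (f k))"

text \<open>The map on cosets induced by a linear endomorphism \<open>f\<close> of \<open>M\<close> that preserves \<open>N\<close>.\<close>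

definition coset_map ::
    "('k, 'v, 'z) module_scheme \<Rightarrow> 'v set \<Rightarrow> ('v \<Rightarrow> 'v) \<Rightarrow> 'v set \<Rightarrow> 'v set" where
  "coset_map M N f X = (\<Union>x\<in>X. N +>\<^bsub>M\<^esub> f x)"

definition quot_module :: "('k, 'v, 'z) module_scheme \<Rightarrow> 'v set \<Rightarrow> ('k, 'v set) module" where
  "quot_module M N =
    \<lparr>carrier = carrier (M Quot N), mult = mult (M Quot N), one = one (M Quot N),
     zero = zero (M Quot N), add = add (M Quot N),
     smult = (\<lambda>c. coset_map M N (smult M c))\<rparr>"

text \<open>The relations presenting \<open>U \<otimes> W\<close> as a quotient of the free space on \<open>U \<times> W\<close>.\<close>

definition bilinear_rels ::
    "(complex, 'u, 'y) module_scheme \<Rightarrow> (complex, 'w, 'z) module_scheme \<Rightarrow>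
      ('u \<times> 'w \<Rightarrow>\<^sub>0 complex) set" where
  "bilinear_rels U W =
    {Poly_Mapping.single (u \<oplus>\<^bsub>U\<^esub> u', w) 1 - Poly_Mapping.single (u, w) 1
        - Poly_Mapping.single (u', w) 1
      | u u' w. u \<in> carrier U \<and> u' \<in> carrier U \<and> w \<in> carrier W} \<union>
    {Poly_Mapping.single (u, w \<oplus>\<^bsub>W\<^esub> w') 1 - Poly_Mapping.single (u, w) 1
        - Poly_Mapping.single (u, w') 1
      | u w w'. u \<in> carrier U \<and> w \<in> carrier W \<and> w' \<in> carrier W} \<union>
    {Poly_Mapping.single (c \<odot>\<^bsub>U\<^esub> u, w) 1 - Poly_Mapping.single (u, w) c
      | c u w. u \<in> carrier U \<and> w \<in> carrier W} \<union>
    {Poly_Mapping.single (u, c \<odot>\<^bsub>W\<^esub> w) 1 - Poly_Mapping.single (u, w) c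
      | c u w. u \<in> carrier U \<and> w \<in> carrier W}"


section \<open>Yetter-Drinfeld modules over a group algebra\<close>

text \<open>\<open>homog V g\<close> is the homogeneous component \<open>V\<^sub>g\<close>.\<close>

record ('g, 'v) ydmod = "(complex, 'v) module" +
  act :: "'g \<Rightarrow> 'v \<Rightarrow> 'v"
  homog :: "'g \<Rightarrow> 'v set"

definition is_homog_decomp ::
    "('g, 'm) monoid_scheme \<Rightarrow> ('g, 'v, 'z) ydmod_scheme \<Rightarrow> 'v \<Rightarrow> ('g \<Rightarrow> 'v) \<Rightarrow> bool" where
  "is_homog_decomp G V v f \<longleftrightarrow>
    f \<in> (\<Pi>\<^sub>E g\<in>carrier G. homog V g) \<and>
    finite {g \<in> carrier G. f g \<noteq> \<zero>\<^bsub>V\<^esub>} \<and>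
    v = finsum V f {g \<in> carrier G. f g \<noteq> \<zero>\<^bsub>V\<^esub>}"

definition homog_part ::
    "('g, 'm) monoid_scheme \<Rightarrow> ('g, 'v, 'z) ydmod_scheme \<Rightarrow> 'v \<Rightarrow> 'g \<Rightarrow> 'v" where
  "homog_part G V v = (THE f. is_homog_decomp G V v f)"

locale yd_module =
  G: group G + V: vectorspace CC V
  for G :: "('g, 'm) monoid_scheme" and V :: "('g, 'v, 'z) ydmod_scheme" +
  assumes act_linear: "g \<in> carrier G \<Longrightarrow> act V g \<in> LinearCombinations.module_hom CC V V"
    and act_one: "v \<in> carrier V \<Longrightarrow> act V \<one>\<^bsub>G\<^esub> v = v"
    and act_mult: "g \<in> carrier G \<Longrightarrow> h \<in> carrier G \<Longrightarrow> v \<in> carrier V \<Longrightarrow>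
      act V (g \<otimes>\<^bsub>G\<^esub> h) v = act V g (act V h v)"
    and homog_subspace: "g \<in> carrier G \<Longrightarrow> VectorSpace.subspace CC (homog V g) V"
    and homog_direct_sum: "v \<in> carrier V \<Longrightarrow> \<exists>!f. is_homog_decomp G V v f"
    and act_homog: "g \<in> carrier G \<Longrightarrow> h \<in> carrier G \<Longrightarrow>
      act V g ` homog V h = homog V (g \<otimes>\<^bsub>G\<^esub> h \<otimes>\<^bsub>G\<^esub> inv\<^bsub>G\<^esub> g)"

definition yd_submodule ::
    "('g, 'm) monoid_scheme \<Rightarrow> 'v set \<Rightarrow> ('g, 'v, 'z) ydmod_scheme \<Rightarrow> bool" where
  "yd_submodule G N V \<longleftrightarrow>
    VectorSpace.subspace CC N V \<and>
    yd_module G (V\<lparr>carrier := N, homog := (\<lambda>g. homog V g \<inter> N)\<rparr>)"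

definition yd_irreducible ::
    "('g, 'm) monoid_scheme \<Rightarrow> ('g, 'v, 'z) ydmod_scheme \<Rightarrow> bool" where
  "yd_irreducible G V \<longleftrightarrow>
    yd_module G V \<and> carrier V \<noteq> {\<zero>\<^bsub>V\<^esub>} \<and>
    (\<forall>N. yd_submodule G N V \<longrightarrow> N = {\<zero>\<^bsub>V\<^esub>} \<or> N = carrier V)"

definition yd_hom ::
    "('g, 'm) monoid_scheme \<Rightarrow> ('g, 'v, 'y) ydmod_scheme \<Rightarrow> ('g, 'w, 'z) ydmod_scheme \<Rightarrow>
      ('v \<Rightarrow> 'w) set" where
  "yd_hom G V W = {f \<in> LinearCombinations.module_hom CC V W.
    (\<forall>g\<in>carrier G. \<forall>v\<in>carrier V. f (act V g v) = act W g (f v)) \<and>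
    (\<forall>g\<in>carrier G. f ` homog V g \<subseteq> homog W g)}"

text \<open>The inverse of a bijective morphism is again a morphism.\<close>

definition yd_isomorphic ::
    "('g, 'm) monoid_scheme \<Rightarrow> ('g, 'v, 'y) ydmod_scheme \<Rightarrow> ('g, 'w, 'z) ydmod_scheme \<Rightarrow> bool"
where
  "yd_isomorphic G V W \<longleftrightarrow> (\<exists>f \<in> yd_hom G V W. bij_betw f (carrier V) (carrier W))"


section \<open>The tensor algebra\<close>

text \<open>The free algebra on the set \<open>S\<close>, with the words over \<open>S\<close> as basis.\<close>

definition free_algebra :: "'v set \<Rightarrow> (complex, 'v list \<Rightarrow>\<^sub>0 complex) module" where
  "free_algebra S = (free_space (lists S))
    \<lparr>mult := (\<lambda>p q. lin_ext (\<lambda>u. lin_ext (\<lambda>w. Poly_Mapping.single (u @ w) 1) q) p),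
     one := Poly_Mapping.single [] 1\<rparr>"

definition tensor_ideal :: "(complex, 'v, 'z) module_scheme \<Rightarrow> ('v list \<Rightarrow>\<^sub>0 complex) set" where
  "tensor_ideal V = genideal (free_algebra (carrier V))
    ({Poly_Mapping.single [v \<oplus>\<^bsub>V\<^esub> w] 1 - Poly_Mapping.single [v] 1 - Poly_Mapping.single [w] 1
        | v w. v \<in> carrier V \<and> w \<in> carrier V} \<union>
     {Poly_Mapping.single [c \<odot>\<^bsub>V\<^esub> v] 1 - Poly_Mapping.single [v] c
        | c v. v \<in> carrier V})"

text \<open>\<open>tensor_word V [v\<^sub>1, \<dots>, v\<^sub>n]\<close> is \<open>v\<^sub>1 \<otimes> \<dots> \<otimes> v\<^sub>n\<close> in \<open>T(V)\<close>.\<close>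

definition tensor_word ::
    "(complex, 'v, 'z) module_scheme \<Rightarrow> 'v list \<Rightarrow> ('v list \<Rightarrow>\<^sub>0 complex) set" where
  "tensor_word V vs =
    tensor_ideal V +>\<^bsub>free_algebra (carrier V)\<^esub> Poly_Mapping.single vs 1"

text \<open>\<open>T(V)\<close> as an algebra in the category of Yetter-Drinfeld modules: the group acts diagonally
  and degrees of homogeneous elements are multiplied.\<close>

definition tensor_algebra ::
    "('g, 'm) monoid_scheme \<Rightarrow> ('g, 'v, 'z) ydmod_scheme \<Rightarrow>
      ('g, ('v list \<Rightarrow>\<^sub>0 complex) set) ydmod" where
  "tensor_algebra G V =
    (let A = free_algebra (carrier V); T = quot_module A (tensor_ideal V) in
     module.extend T (ydmod.fields
       (\<lambda>g. coset_map A (tensor_ideal V)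
         (lin_ext (\<lambda>vs. Poly_Mapping.single (map (act V g) vs) 1)))
       (\<lambda>g. CC_span T {tensor_word V vs | vs gs.
         list_all2 (\<lambda>v h. h \<in> carrier G \<and> v \<in> homog V h) vs gs \<and>
         foldr (mult G) gs \<one>\<^bsub>G\<^esub> = g})))"

definition tensor_power ::
    "('g, 'm) monoid_scheme \<Rightarrow> ('g, 'v, 'z) ydmod_scheme \<Rightarrow> nat \<Rightarrow> ('v list \<Rightarrow>\<^sub>0 complex) set set"
where
  "tensor_power G V n = CC_span (tensor_algebra G V)
    {tensor_word V vs | vs. vs \<in> lists (carrier V) \<and> length vs = n}"


section \<open>The braided tensor square and the comultiplication\<close>

text \<open>The braiding \<open>c(u \<otimes> w) = \<Sum>\<^sub>g g \<cdot> w \<otimes> u\<^sub>g\<close> on a Yetter-Drinfeld module, as an element of the free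
  space on pairs, where \<open>u\<^sub>g\<close> are the homogeneous components of \<open>u\<close>.\<close>

definition braiding ::
    "('g, 'm) monoid_scheme \<Rightarrow> ('g, 'a, 'z) ydmod_scheme \<Rightarrow> 'a \<Rightarrow> 'a \<Rightarrow> 'a \<times> 'a \<Rightarrow>\<^sub>0 complex" where
  "braiding G A u w =
    (\<Sum>g \<in> {g \<in> carrier G. homog_part G A u g \<noteq> \<zero>\<^bsub>A\<^esub>}.
      Poly_Mapping.single (act A g w, homog_part G A u g) 1)"

text \<open>\<open>(a \<otimes> b)(c \<otimes> d) = \<Sum> a c' \<otimes> b' d\<close> where the braiding maps \<open>b \<otimes> c\<close> to \<open>\<Sum> c' \<otimes> b'\<close>.\<close>

definition braided_mult ::
    "('g, 'm) monoid_scheme \<Rightarrow> ('g, 'a, 'z) ydmod_scheme \<Rightarrow>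
      ('a \<times> 'a \<Rightarrow>\<^sub>0 complex) \<Rightarrow> ('a \<times> 'a \<Rightarrow>\<^sub>0 complex) \<Rightarrow> 'a \<times> 'a \<Rightarrow>\<^sub>0 complex" where
  "braided_mult G A p q =
    lin_ext (\<lambda>(a, b). lin_ext (\<lambda>(c, d).
      lin_ext (\<lambda>(c', b'). Poly_Mapping.single (a \<otimes>\<^bsub>A\<^esub> c', b' \<otimes>\<^bsub>A\<^esub> d) 1) (braiding G A b c)) q) p"

definition braided_square ::
    "('g, 'm) monoid_scheme \<Rightarrow> ('g, 'a, 'z) ydmod_scheme \<Rightarrow>
      (complex, ('a \<times> 'a \<Rightarrow>\<^sub>0 complex) set) module" where
  "braided_square G A =
    (let F = free_space (carrier A \<times> carrier A) in
     quot_module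
       (F\<lparr>mult := braided_mult G A, one := Poly_Mapping.single (\<one>\<^bsub>A\<^esub>, \<one>\<^bsub>A\<^esub>) 1\<rparr>)
       (CC_span F (bilinear_rels A A)))"

definition pure_tensor ::
    "(complex, 'a, 'z) module_scheme \<Rightarrow> 'a \<Rightarrow> 'a \<Rightarrow> ('a \<times> 'a \<Rightarrow>\<^sub>0 complex) set" where
  "pure_tensor A a b =
    (let F = free_space (carrier A \<times> carrier A) in
     CC_span F (bilinear_rels A A) +>\<^bsub>F\<^esub> Poly_Mapping.single (a, b) 1)"

definition comultiplication ::
    "('g, 'm) monoid_scheme \<Rightarrow> ('g, 'v, 'z) ydmod_scheme \<Rightarrow>
      ('v list \<Rightarrow>\<^sub>0 complex) set \<Rightarrow> (('v list \<Rightarrow>\<^sub>0 complex) set \<times> ('v list \<Rightarrow>\<^sub>0 complex) set \<Rightarrow>\<^sub>0 complex) set"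
where
  "comultiplication G V =
    (let T = tensor_algebra G V; TT = braided_square G T in
     THE D. D \<in> extensional (carrier T) \<and> D \<in> Ring.ring_hom T TT \<and> D \<in> LinearCombinations.module_hom CC T TT \<and>
       (\<forall>v\<in>carrier V. D (tensor_word V [v]) =
          pure_tensor T (tensor_word V [v]) \<one>\<^bsub>T\<^esub> \<oplus>\<^bsub>TT\<^esub> pure_tensor T \<one>\<^bsub>T\<^esub> (tensor_word V [v])))"

definition CC_line :: "(complex, complex) module" where
  "CC_line = \<lparr>carrier = UNIV, mult = (*), one = 1, zero = 0, add = (+), smult = (*)\<rparr>"

definition counit ::
    "('g, 'm) monoid_scheme \<Rightarrow> ('g, 'v, 'z) ydmod_scheme \<Rightarrow> ('v list \<Rightarrow>\<^sub>0 complex) set \<Rightarrow> complex"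
where
  "counit G V =
    (let T = tensor_algebra G V in
     THE e. e \<in> extensional (carrier T) \<and> e \<in> Ring.ring_hom T CC_line \<and> e \<in> LinearCombinations.module_hom CC T CC_line \<and>
       (\<forall>v\<in>carrier V. e (tensor_word V [v]) = 0))"


section \<open>The Nichols algebra\<close>

definition is_coideal ::
    "('g, 'm) monoid_scheme \<Rightarrow> ('g, 'v, 'z) ydmod_scheme \<Rightarrow> ('v list \<Rightarrow>\<^sub>0 complex) set set \<Rightarrow> bool"
where
  "is_coideal G V J \<longleftrightarrow>
    (let T = tensor_algebra G V in
     VectorSpace.subspace CC J T \<and>
     comultiplication G V ` J \<subseteq> CC_span (braided_square G T)
       ({pure_tensor T a b | a b. a \<in> J \<and> b \<in> carrier T} \<union>
        {pure_tensor T a b | a b. a \<in> carrier T \<and> b \<in> J}) \<and>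
     (\<forall>a\<in>J. counit G V a = 0))"

definition nichols_ideal ::
    "('g, 'm) monoid_scheme \<Rightarrow> ('g, 'v, 'z) ydmod_scheme \<Rightarrow> ('v list \<Rightarrow>\<^sub>0 complex) set set" where
  "nichols_ideal G V =
    (GREATEST J. is_coideal G V J \<and>
       J \<subseteq> CC_span (tensor_algebra G V) (\<Union>n\<in>{2..}. tensor_power G V n))"

definition nichols_algebra ::
    "('g, 'm) monoid_scheme \<Rightarrow> ('g, 'v, 'z) ydmod_scheme \<Rightarrow>
      (complex, ('v list \<Rightarrow>\<^sub>0 complex) set set) module" where
  "nichols_algebra G V = quot_module (tensor_algebra G V) (nichols_ideal G V)"


section \<open>The Yetter-Drinfeld modules induced from centralizers\<close>

definition centralizer :: "('g, 'm) monoid_scheme \<Rightarrow> 'g \<Rightarrow> 'g set" where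
  "centralizer G g = {h \<in> carrier G. h \<otimes>\<^bsub>G\<^esub> g = g \<otimes>\<^bsub>G\<^esub> h}"

text \<open>Since \<open>G\<close> is a basis of its group algebra, the induced module is the quotient of the free space
  on the symbols \<open>h \<otimes> w\<close> with \<open>h \<in> G\<close>, \<open>w \<in> W\<close> by linearity in \<open>w\<close> and
  \<open>h k \<otimes> w = h \<otimes> \<rho>(k) w\<close> for \<open>k\<close> in the centralizer of \<open>g\<close>.\<close>

definition induced_rels ::
    "('g, 'm) monoid_scheme \<Rightarrow> 'g \<Rightarrow> (complex, 'w, 'z) module_scheme \<Rightarrow> ('g \<Rightarrow> 'w \<Rightarrow> 'w) \<Rightarrow>
      ('g \<times> 'w \<Rightarrow>\<^sub>0 complex) set" where
  "induced_rels G g W \<rho> =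
    {Poly_Mapping.single (h, w \<oplus>\<^bsub>W\<^esub> w') 1 - Poly_Mapping.single (h, w) 1
        - Poly_Mapping.single (h, w') 1
      | h w w'. h \<in> carrier G \<and> w \<in> carrier W \<and> w' \<in> carrier W} \<union>
    {Poly_Mapping.single (h, c \<odot>\<^bsub>W\<^esub> w) 1 - Poly_Mapping.single (h, w) c
      | c h w. h \<in> carrier G \<and> w \<in> carrier W} \<union>
    {Poly_Mapping.single (h \<otimes>\<^bsub>G\<^esub> k, w) 1 - Poly_Mapping.single (h, \<rho> k w) 1
      | h k w. h \<in> carrier G \<and> k \<in> centralizer G g \<and> w \<in> carrier W}"

definition induced_yd ::
    "('g, 'm) monoid_scheme \<Rightarrow> 'g \<Rightarrow> (complex, 'w, 'z) module_scheme \<Rightarrow> ('g \<Rightarrow> 'w \<Rightarrow> 'w) \<Rightarrow>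
      ('g, ('g \<times> 'w \<Rightarrow>\<^sub>0 complex) set) ydmod" where
  "induced_yd G g W \<rho> =
    (let F = free_space (carrier G \<times> carrier W);
         N = CC_span F (induced_rels G g W \<rho>);
         M = quot_module F N in
     module.extend M (ydmod.fields
       (\<lambda>u. coset_map F N (lin_ext (\<lambda>(h, w). Poly_Mapping.single (u \<otimes>\<^bsub>G\<^esub> h, w) 1)))
       (\<lambda>t. CC_span M {N +>\<^bsub>F\<^esub> Poly_Mapping.single (h, w) 1 | h w.
         h \<in> carrier G \<and> w \<in> carrier W \<and> h \<otimes>\<^bsub>G\<^esub> g \<otimes>\<^bsub>G\<^esub> inv\<^bsub>G\<^esub> h = t})))"


section \<open>The quaternion group and its representations\<close>

text \<open>The pair \<open>(a, b)\<close> with \<open>a < 4\<close>, \<open>b < 2\<close> stands for \<open>x\<^sup>a y\<^sup>b\<close>; note that \<open>y x = x\<^sup>3 y\<close> and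
  \<open>y\<^sup>2 = x\<^sup>2\<close>.\<close>

definition Q8 :: "(nat \<times> nat) monoid" where
  "Q8 = \<lparr>carrier = {..<4} \<times> {..<2},
    mult = (\<lambda>(a, b) (c, d). ((a + 3 ^ b * c + 2 * (b * d)) mod 4, (b + d) mod 2)),
    one = (0, 0)\<rparr>"

definition Q8x :: "nat \<times> nat" where "Q8x = (1, 0)"
definition Q8y :: "nat \<times> nat" where "Q8y = (0, 1)"

text \<open>On the basis \<open>v\<^sub>1 = (1, 0)\<close>, \<open>v\<^sub>2 = (0, 1)\<close>.\<close>

definition rho5 :: "nat \<times> nat \<Rightarrow> complex \<times> complex \<Rightarrow> complex \<times> complex" where
  "rho5 = (\<lambda>(a, b). ((\<lambda>(p, q). (\<i> * p, - \<i> * q)) ^^ a) \<circ> ((\<lambda>(p, q). (- q, p)) ^^ b))"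

text \<open>\<open>\<phi>\<^sub>2(g\<^sup>k) = (-1)\<^sup>k\<close>; this does not depend on the choice of \<open>k\<close> if \<open>g\<close> has even order.\<close>

definition phi2 :: "('g, 'm) monoid_scheme \<Rightarrow> 'g \<Rightarrow> 'g \<Rightarrow> complex \<Rightarrow> complex" where
  "phi2 G g h z = (- 1) ^ (LEAST k::nat. h = g [^]\<^bsub>G\<^esub> k) * z"

definition M_x_phi2 :: "(nat \<times> nat, ((nat \<times> nat) \<times> complex \<Rightarrow>\<^sub>0 complex) set) ydmod" where
  "M_x_phi2 = induced_yd Q8 Q8x CC_line (phi2 Q8 Q8x)"

definition M_y_phi2 :: "(nat \<times> nat, ((nat \<times> nat) \<times> complex \<Rightarrow>\<^sub>0 complex) set) ydmod" where
  "M_y_phi2 = induced_yd Q8 Q8y CC_line (phi2 Q8 Q8y)"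

definition M_xy_phi2 :: "(nat \<times> nat, ((nat \<times> nat) \<times> complex \<Rightarrow>\<^sub>0 complex) set) ydmod" where
  "M_xy_phi2 = induced_yd Q8 (Q8x \<otimes>\<^bsub>Q8\<^esub> Q8y) CC_line (phi2 Q8 (Q8x \<otimes>\<^bsub>Q8\<^esub> Q8y))"

definition M_x2_rho5 ::
    "(nat \<times> nat, ((nat \<times> nat) \<times> complex \<times> complex \<Rightarrow>\<^sub>0 complex) set) ydmod" where
  "M_x2_rho5 = induced_yd Q8 (Q8x \<otimes>\<^bsub>Q8\<^esub> Q8x) (direct_sum CC_line CC_line) rho5"

lemma Q8_group: "group Q8"
proof (rule groupI)
  fix u v w
  assume uvw: "u \<in> carrier Q8" "v \<in> carrier Q8" "w \<in> carrier Q8"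
  obtain a b c d e f where [simp]: "u = (a, b)" "v = (c, d)" "w = (e, f)"
    by (cases u; cases v; cases w)
  define L where "L = a + 3 ^ b * c + 2 * (b * d) + 3 ^ ((b + d) mod 2) * e + 2 * ((b + d) mod 2 * f)"
  define R where "R = a + 3 ^ b * (c + 3 ^ d * e + 2 * (d * f)) + 2 * (b * ((d + f) mod 2))"
  have "b = 0 \<or> b = 1" "d = 0 \<or> d = 1" "f = 0 \<or> f = 1"
    using uvw by (auto simp: Q8_def)
  then have "L = R \<or> L + 8 * e = R \<or> L + 4 = R \<or> L + 8 * e + 4 = R"
    by (elim disjE) (simp_all add: L_def R_def)
  moreover have "(n + 8 * e) mod 4 = n mod 4" "(n + 4) mod 4 = n mod 4" for n :: nat
    by presburger+
  ultimately have "L mod 4 = R mod 4" by metis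
  moreover have "u \<otimes>\<^bsub>Q8\<^esub> v \<otimes>\<^bsub>Q8\<^esub> w = (L mod 4, (b + d + f) mod 2)"
    by (simp add: Q8_def L_def add.assoc mod_add_left_eq)
  moreover have "u \<otimes>\<^bsub>Q8\<^esub> (v \<otimes>\<^bsub>Q8\<^esub> w) = (R mod 4, (b + d + f) mod 2)"
  proof -
    define n where "n = c + 3 ^ d * e + 2 * (d * f)"
    define k where "k = 2 * (b * ((d + f) mod 2))"
    have "(a + 3 ^ b * (n mod 4) + k) mod 4 = (a + 3 ^ b * n + k) mod 4"
      by (intro mod_add_cong mod_mult_right_eq refl)
    moreover have "(b + (d + f) mod 2) mod 2 = (b + d + f) mod 2"
      by (simp only: mod_add_right_eq add.assoc)
    moreover have "v \<otimes>\<^bsub>Q8\<^esub> w = (n mod 4, (d + f) mod 2)"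
      by (simp add: Q8_def n_def)
    then have "u \<otimes>\<^bsub>Q8\<^esub> (v \<otimes>\<^bsub>Q8\<^esub> w)
        = ((a + 3 ^ b * (n mod 4) + k) mod 4, (b + (d + f) mod 2) mod 2)"
      by (simp only:) (simp add: Q8_def k_def)
    moreover have "R = a + 3 ^ b * n + k"
      by (simp only: R_def n_def k_def)
    ultimately show ?thesis by (simp only:)
  qed
  ultimately show "u \<otimes>\<^bsub>Q8\<^esub> v \<otimes>\<^bsub>Q8\<^esub> w = u \<otimes>\<^bsub>Q8\<^esub> (v \<otimes>\<^bsub>Q8\<^esub> w)"
    by simp
next
  fix u assume "u \<in> carrier Q8"
  then obtain a b where u: "u = (a, b)" "a \<in> {0, 1, 2, 3}" "b \<in> {0, 1}"
    by (force simp: Q8_def)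
  define v :: "nat \<times> nat" where "v = (if b = 0 then ((4 - a) mod 4, 0) else ((a + 2) mod 4, 1))"
  have "v \<in> carrier Q8"
    by (simp add: v_def Q8_def)
  moreover have "v \<otimes>\<^bsub>Q8\<^esub> u = \<one>\<^bsub>Q8\<^esub>"
    using u(2,3) by (elim insertE; simp add: u(1) v_def Q8_def)
  ultimately show "\<exists>v\<in>carrier Q8. v \<otimes>\<^bsub>Q8\<^esub> u = \<one>\<^bsub>Q8\<^esub>"
    by blast
next
  fix u v assume "u \<in> carrier Q8" "v \<in> carrier Q8"
  then show "u \<otimes>\<^bsub>Q8\<^esub> v \<in> carrier Q8" by (cases u; cases v) (simp add: Q8_def)
next
  show "\<one>\<^bsub>Q8\<^esub> \<in> carrier Q8" by (simp add: Q8_def)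
next
  fix u assume "u \<in> carrier Q8"
  then show "\<one>\<^bsub>Q8\<^esub> \<otimes>\<^bsub>Q8\<^esub> u = u" by (cases u) (simp add: Q8_def)
qed

text \<open>The relations, and the universal property of the presentation.\<close>

lemma Q8_relations:
  "Q8x \<in> carrier Q8" "Q8y \<in> carrier Q8"
  "Q8x [^]\<^bsub>Q8\<^esub> (4::nat) = \<one>\<^bsub>Q8\<^esub>"
  "Q8y [^]\<^bsub>Q8\<^esub> (2::nat) = Q8x [^]\<^bsub>Q8\<^esub> (2::nat)"
  "Q8x \<otimes>\<^bsub>Q8\<^esub> Q8y = Q8y \<otimes>\<^bsub>Q8\<^esub> inv\<^bsub>Q8\<^esub> Q8x"
proof -
  interpret group Q8 by (rule Q8_group)
  have "inv\<^bsub>Q8\<^esub> Q8x = (3, 0)"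
    by (rule inv_equality) (auto simp: Q8_def Q8x_def)
  then show "Q8x \<otimes>\<^bsub>Q8\<^esub> Q8y = Q8y \<otimes>\<^bsub>Q8\<^esub> inv\<^bsub>Q8\<^esub> Q8x"
    by (simp add: Q8_def Q8x_def Q8y_def)
qed (simp_all add: Q8_def Q8x_def Q8y_def nat_pow_def)

lemma Q8_normal_form:
  assumes "a < 4" "b < 2"
  shows "Q8x [^]\<^bsub>Q8\<^esub> a \<otimes>\<^bsub>Q8\<^esub> Q8y [^]\<^bsub>Q8\<^esub> b = (a, b)"
proof -
  interpret group Q8 by (rule Q8_group)
  have x: "Q8x [^]\<^bsub>Q8\<^esub> a = (a mod 4, 0)" for a :: nat
    by (induction a) (auto simp: Q8_def Q8x_def mod_Suc_eq)
  have y: "Q8y [^]\<^bsub>Q8\<^esub> b = (0, b)"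
    using assms by (cases b) (auto simp: Q8_def Q8y_def)
  show ?thesis
    using assms by (simp add: x y) (simp add: Q8_def)
qed

lemma Q8_universal:
  assumes "group H" "s \<in> carrier H" "t \<in> carrier H"
    and s4: "s [^]\<^bsub>H\<^esub> (4::nat) = \<one>\<^bsub>H\<^esub>"
    and t2: "t [^]\<^bsub>H\<^esub> (2::nat) = s [^]\<^bsub>H\<^esub> (2::nat)"
    and st: "s \<otimes>\<^bsub>H\<^esub> t = t \<otimes>\<^bsub>H\<^esub> inv\<^bsub>H\<^esub> s"
  shows "\<exists>!f. f \<in> hom Q8 H \<and> f \<in> extensional (carrier Q8) \<and> f Q8x = s \<and> f Q8y = t"
proof -
  interpret H: group H by fact
  interpret Q: group Q8 by (rule Q8_group)
  note [simp] = assms(2,3)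
  have red: "s [^]\<^bsub>H\<^esub> (n mod 4) = s [^]\<^bsub>H\<^esub> n" for n :: nat
  proof -
    have "s [^]\<^bsub>H\<^esub> n = s [^]\<^bsub>H\<^esub> (4 * (n div 4) + n mod 4)" by simp
    also have "\<dots> = (s [^]\<^bsub>H\<^esub> (4::nat)) [^]\<^bsub>H\<^esub> (n div 4) \<otimes>\<^bsub>H\<^esub> s [^]\<^bsub>H\<^esub> (n mod 4)"
      by (simp add: H.nat_pow_mult H.nat_pow_pow)
    finally show ?thesis by (simp add: s4)
  qed
  have s3: "inv\<^bsub>H\<^esub> s = s [^]\<^bsub>H\<^esub> (3::nat)"
  proof (rule H.inv_equality)
    have "s [^]\<^bsub>H\<^esub> (3::nat) \<otimes>\<^bsub>H\<^esub> s = s [^]\<^bsub>H\<^esub> (4::nat)"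
      by (simp add: numeral_eq_Suc)
    then show "s [^]\<^bsub>H\<^esub> (3::nat) \<otimes>\<^bsub>H\<^esub> s = \<one>\<^bsub>H\<^esub>" by (simp add: s4)
  qed auto
  have ts: "t \<otimes>\<^bsub>H\<^esub> s = s [^]\<^bsub>H\<^esub> (3::nat) \<otimes>\<^bsub>H\<^esub> t"
  proof -
    have "s \<otimes>\<^bsub>H\<^esub> (t \<otimes>\<^bsub>H\<^esub> s) = t"
      by (simp add: H.m_assoc [symmetric] st) (simp add: H.m_assoc)
    then have "inv\<^bsub>H\<^esub> s \<otimes>\<^bsub>H\<^esub> t = t \<otimes>\<^bsub>H\<^esub> s"
      by (metis H.inv_solve_left' H.m_closed assms(2,3))
    then show ?thesis by (simp add: s3)
  qed
  have tsn: "t \<otimes>\<^bsub>H\<^esub> s [^]\<^bsub>H\<^esub> n = s [^]\<^bsub>H\<^esub> (3 * n) \<otimes>\<^bsub>H\<^esub> t" for n :: nat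
  proof (induction n)
    case (Suc n)
    have "t \<otimes>\<^bsub>H\<^esub> s [^]\<^bsub>H\<^esub> Suc n = s [^]\<^bsub>H\<^esub> (3 * n) \<otimes>\<^bsub>H\<^esub> (t \<otimes>\<^bsub>H\<^esub> s)"
      by (simp add: H.m_assoc [symmetric] Suc)
    also have "\<dots> = s [^]\<^bsub>H\<^esub> (3 * n + 3) \<otimes>\<^bsub>H\<^esub> t"
      by (simp add: ts H.m_assoc [symmetric] H.nat_pow_mult)
    finally show ?case by (simp add: add.commute)
  qed simp
  define f where "f = (\<lambda>(a, b) \<in> carrier Q8. s [^]\<^bsub>H\<^esub> (a::nat) \<otimes>\<^bsub>H\<^esub> t [^]\<^bsub>H\<^esub> (b::nat))"
  have f: "f (a, b) = s [^]\<^bsub>H\<^esub> a \<otimes>\<^bsub>H\<^esub> t [^]\<^bsub>H\<^esub> b" if "a < 4" "b < 2" for a b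
    using that by (simp add: f_def Q8_def)
  have tt: "t \<otimes>\<^bsub>H\<^esub> t = s [^]\<^bsub>H\<^esub> (2::nat)"
    using t2 by (simp add: numeral_eq_Suc)
  have mult: "f ((a, b) \<otimes>\<^bsub>Q8\<^esub> (c, d)) = f (a, b) \<otimes>\<^bsub>H\<^esub> f (c, d)"
    if lt: "a < 4" "b < 2" "c < 4" "d < 2" for a b c d
  proof -
    have "b = 0 \<or> b = 1" "d = 0 \<or> d = 1" using lt by auto
    then consider "b = 0" | "b = 1" "d = 0" | "b = 1" "d = 1" by blast
    then show ?thesis
    proof cases
      case 1
      then show ?thesis using lt
        by (simp add: Q8_def f red H.m_assoc [symmetric] H.nat_pow_mult)
    next
      case 2
      have "f (a, b) \<otimes>\<^bsub>H\<^esub> f (c, d) = s [^]\<^bsub>H\<^esub> a \<otimes>\<^bsub>H\<^esub> (t \<otimes>\<^bsub>H\<^esub> s [^]\<^bsub>H\<^esub> c)"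
        using 2 lt by (simp add: f H.m_assoc)
      also have "\<dots> = s [^]\<^bsub>H\<^esub> (a + 3 * c) \<otimes>\<^bsub>H\<^esub> t"
        by (simp add: tsn H.m_assoc [symmetric] H.nat_pow_mult)
      finally show ?thesis using 2 lt by (simp add: Q8_def f red)
    next
      case 3
      have "f (a, b) \<otimes>\<^bsub>H\<^esub> f (c, d) = s [^]\<^bsub>H\<^esub> a \<otimes>\<^bsub>H\<^esub> (t \<otimes>\<^bsub>H\<^esub> s [^]\<^bsub>H\<^esub> c) \<otimes>\<^bsub>H\<^esub> t"
        using 3 lt by (simp add: f H.m_assoc)
      also have "\<dots> = s [^]\<^bsub>H\<^esub> (a + 3 * c) \<otimes>\<^bsub>H\<^esub> (t \<otimes>\<^bsub>H\<^esub> t)"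
        by (simp add: tsn H.m_assoc [symmetric] H.nat_pow_mult)
      also have "\<dots> = s [^]\<^bsub>H\<^esub> (a + 3 * c + 2)"
        by (simp add: tt H.nat_pow_mult)
      finally show ?thesis using 3 lt by (simp add: Q8_def f red)
    qed
  qed
  have hom: "f \<in> hom Q8 H"
  proof (rule homI)
    fix u assume "u \<in> carrier Q8"
    then show "f u \<in> carrier H" by (auto simp: f_def split: prod.split)
  next
    fix u v assume "u \<in> carrier Q8" "v \<in> carrier Q8"
    then obtain a b c d where "u = (a, b)" "v = (c, d)" "a < 4" "b < 2" "c < 4" "d < 2"
      by (auto simp: Q8_def)
    then show "f (u \<otimes>\<^bsub>Q8\<^esub> v) = f u \<otimes>\<^bsub>H\<^esub> f v" using mult by simp
  qed
  have fxy: "f Q8x = s" "f Q8y = t"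
    by (simp_all add: Q8x_def Q8y_def f)
  show ?thesis
  proof (rule ex1I [of _ f])
    show "f \<in> hom Q8 H \<and> f \<in> extensional (carrier Q8) \<and> f Q8x = s \<and> f Q8y = t"
      using hom fxy by (simp add: f_def)
  next
    fix g assume g: "g \<in> hom Q8 H \<and> g \<in> extensional (carrier Q8) \<and> g Q8x = s \<and> g Q8y = t"
    interpret g: group_hom Q8 H g using g by unfold_locales auto
    show "g = f"
    proof (rule extensionalityI [of _ "carrier Q8"])
      fix u assume "u \<in> carrier Q8"
      then obtain a b where u: "u = (a, b)" "a < 4" "b < 2" by (auto simp: Q8_def)
      have "g (Q8x [^]\<^bsub>Q8\<^esub> a \<otimes>\<^bsub>Q8\<^esub> Q8y [^]\<^bsub>Q8\<^esub> b) = s [^]\<^bsub>H\<^esub> a \<otimes>\<^bsub>H\<^esub> t [^]\<^bsub>H\<^esub> b"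
        using g by (simp add: g.hom_nat_pow Q8_relations)
      then show "g u = f u" using u by (simp add: Q8_normal_form f)
    qed (use g in \<open>auto simp: f_def\<close>)
  qed
qed

end

theory Submission
  imports Defs
begin

text \<open>Let \<open>z = x\<^sup>2\<close> be the central element of order two. An irreducible Yetter-Drinfeld module \<open>V\<close> over
\<open>Q\<^sub>8\<close> contains a nonzero homogeneous vector, say of degree \<open>t\<close>, and is spanned by the orbit of any such
vector. Three kinds of braiding can occur.

\<^item> If \<open>t = 1\<close>, or if \<open>t = z\<close> and \<open>z\<close> acts as the identity, some element of the group acts
  trivially on \<open>V\<close> although it is the degree of a nonzero vector. The braiding restricts to the flip on
  the line of that vector, the Nichols algebra contains its polynomial ring and is infinite-dimensional.

\<^item> If \<open>t = z\<close> acts nontrivially, it acts as \<open>-1\<close> on all of \<open>V\<close>, which makes \<open>V\<close> the representation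
  \<open>\<rho>\<^sub>5\<close> in degree \<open>z\<close>. The braiding is minus the flip.

\<^item> If \<open>t\<close> is not central, choose an eigenvector \<open>a\<close> of \<open>g = t\<close> with eigenvalue \<open>q\<close>, \<open>q\<^sup>4 = 1\<close>, and
  \<open>h\<close> not commuting with \<open>g\<close>. Then \<open>a\<close> and \<open>b = h a\<close>, of degrees \<open>g\<close> and \<open>z g\<close>, span \<open>V\<close>, and both
  degrees act diagonally: the braiding has the matrix \<open>q\<close> on the diagonal and \<open>q\<^sup>3 = q\<^sup>-\<^sup>1\<close> off it.
  For \<open>q = 1\<close> the first argument applies again. For \<open>q = -1\<close> the braiding is minus the flip, and \<open>V\<close> is
  the module induced from \<open>\<phi>\<^sub>2\<close>. For \<open>q\<^sup>2 = -1\<close> the braiding is of affine Cartan type with Cartan matrix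
  \<open>(2, -2; -2, 2)\<close>, and the Nichols algebra is infinite-dimensional.

So the four modules of the list are exactly those on which the braiding is minus the flip. For these the
ideal generated by all \<open>v w + w v\<close> is a coideal, hence lies in the ideal of the Nichols algebra, and the
quotient is spanned by \<open>1, a, b, a b\<close> for a basis \<open>a, b\<close> (it is the exterior algebra). This is \<open>nichols_finite\<close>.

Infinite dimension is proved by skew derivations. Contracting the first tensor factor of the comultiplication with a
functional on \<open>V\<close> gives a linear endomorphism of \<open>T(V)\<close>, which preserves every coideal contained in the
degrees at least two (\<open>deriv_coideal\<close>), in particular the ideal of the Nichols algebra, and which satisfies a
twisted Leibniz rule (\<open>deriv_mult\<close>). If a composite \<open>E\<close> of such maps acts on the powers of some \<open>u \<in> T(V)\<close>
as a nonzero multiple of the derivative with respect to \<open>u\<close>, then the counit composed with \<open>E\<^sup>n\<close> separates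
\<open>u\<^sup>n\<close> from all other powers, so that these powers remain linearly independent in the Nichols algebra
(\<open>nichols_infinite\<close>). For the flip, \<open>u = v\<close> is the vector in question; in the affine case
\<open>u = a b - q\<^sup>-\<^sup>1 b a\<close>, which belongs to the imaginary root.

For these arguments the objects of the definition have to be made accessible: \<open>T(V)\<close> by its universal
property for multilinear functions of words, its grading by the group, the braided tensor square as an associative
algebra, and the comultiplication and the counit as the unique maps with the properties that describe them.\<close>

section \<open>Complex vector spaces, free spaces and their quotients\<close>

text \<open>The simplification rules of \<^locale>\<open>vectorspace\<close> mention operations of the coefficient ring record;
this locale restates what is used of them with ordinary complex arithmetic.\<close>

locale cspace = vectorspace CC V for V :: "(complex, 'v, 'z) module_scheme" (structure)
begin

lemma sm_closed [simp, intro]: "v \<in> carrier V \<Longrightarrow> c \<odot> v \<in> carrier V"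
  using smult_closed[of c v] by simp

lemma sm_ldistr: "v \<in> carrier V \<Longrightarrow> (a + b) \<odot> v = a \<odot> v \<oplus> b \<odot> v"
  using smult_l_distr[of a b v] by simp

lemma sm_rdistr: "v \<in> carrier V \<Longrightarrow> w \<in> carrier V \<Longrightarrow> a \<odot> (v \<oplus> w) = a \<odot> v \<oplus> a \<odot> w"
  using smult_r_distr[of a v w] by simp

lemma sm_assoc: "v \<in> carrier V \<Longrightarrow> a \<odot> (b \<odot> v) = (a * b) \<odot> v"
  using smult_assoc1[of a b v] by simp

lemma sm_one [simp]: "v \<in> carrier V \<Longrightarrow> 1 \<odot> v = v"
  using smult_one[of v] by simp

lemma sm_0 [simp]: "v \<in> carrier V \<Longrightarrow> 0 \<odot> v = \<zero>"
  using lmult_0[of v] by simp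

lemma sm_zero [simp]: "c \<odot> \<zero> = \<zero>"
  using rmult_0[of c] by simp

lemma minus_sm: "v \<in> carrier V \<Longrightarrow> w \<in> carrier V \<Longrightarrow> v \<ominus> w = v \<oplus> (-1) \<odot> w"
proof -
  assume vw: "v \<in> carrier V" "w \<in> carrier V"
  have "w \<oplus> (-1) \<odot> w = \<zero>" using sm_ldistr[of w 1 "-1"] vw by simp
  then have "\<ominus> w = (-1) \<odot> w" using vw by (metis a_comm minus_equality sm_closed)
  then show ?thesis by (simp add: a_minus_def)
qed

lemma minus_eq_zeroD: "v \<in> carrier V \<Longrightarrow> w \<in> carrier V \<Longrightarrow> v \<oplus> (-1) \<odot> w = \<zero> \<Longrightarrow> v = w"
  by (simp add: minus_sm[symmetric])

lemma subspaceD: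
  assumes "VectorSpace.subspace CC N V"
  shows "N \<subseteq> carrier V" "\<zero> \<in> N" "\<And>v w. v \<in> N \<Longrightarrow> w \<in> N \<Longrightarrow> v \<oplus> w \<in> N"
    "\<And>c v. v \<in> N \<Longrightarrow> c \<odot> v \<in> N"
  using assms unfolding VectorSpace.subspace_def LinearCombinations.submodule_def by auto

lemma subspaceI:
  assumes "N \<subseteq> carrier V" "\<zero> \<in> N" "\<And>v w. v \<in> N \<Longrightarrow> w \<in> N \<Longrightarrow> v \<oplus> w \<in> N"
    "\<And>c v. v \<in> N \<Longrightarrow> c \<odot> v \<in> N"
  shows "VectorSpace.subspace CC N V"
  using assms vectorspace_axioms module_axioms
  unfolding VectorSpace.subspace_def LinearCombinations.submodule_def by auto

lemma span_closed: "S \<subseteq> carrier V \<Longrightarrow> x \<in> span S \<Longrightarrow> x \<in> carrier V"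
  using span_is_subset2 by blast

lemma span_subset: "VectorSpace.subspace CC N V \<Longrightarrow> S \<subseteq> N \<Longrightarrow> span S \<subseteq> N"
  using span_is_subset by (simp add: VectorSpace.subspace_def)

lemma span_base: "S \<subseteq> carrier V \<Longrightarrow> x \<in> S \<Longrightarrow> x \<in> span S"
  using in_own_span by blast

lemma span_zero: "S \<subseteq> carrier V \<Longrightarrow> \<zero> \<in> span S"
  and span_add: "S \<subseteq> carrier V \<Longrightarrow> x \<in> span S \<Longrightarrow> y \<in> span S \<Longrightarrow> x \<oplus> y \<in> span S"
  and span_sm: "S \<subseteq> carrier V \<Longrightarrow> x \<in> span S \<Longrightarrow> c \<odot> x \<in> span S"
  using subspaceD[OF span_is_subspace] by auto

lemma span_induct [consumes 2, case_names zero add sm base]: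
  assumes "S \<subseteq> carrier V" "x \<in> span S" "P \<zero>"
    "\<And>v w. v \<in> carrier V \<Longrightarrow> w \<in> carrier V \<Longrightarrow> P v \<Longrightarrow> P w \<Longrightarrow> P (v \<oplus> w)"
    "\<And>c v. v \<in> carrier V \<Longrightarrow> P v \<Longrightarrow> P (c \<odot> v)" "\<And>v. v \<in> S \<Longrightarrow> P v"
  shows "P x"
proof -
  have "VectorSpace.subspace CC {v \<in> carrier V. P v} V"
    by (rule subspaceI) (use assms in auto)
  then have "span S \<subseteq> {v \<in> carrier V. P v}"
    by (rule span_subset) (use assms in auto)
  with assms(2) show ?thesis by auto
qed

lemma subspace_finsum:
  assumes "VectorSpace.subspace CC N V" "f \<in> A \<rightarrow> N"
  shows "finsum V f A \<in> N"
proof (use assms(2) in \<open>induction A rule: infinite_finite_induct\<close>)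
  case (insert a A)
  have "f a \<in> N" "f \<in> A \<rightarrow> N" "f \<in> A \<rightarrow> carrier V" "f a \<in> carrier V"
    using insert subspaceD(1)[OF assms(1)] by auto
  then show ?case using insert subspaceD(3)[OF assms(1)] by (simp add: finsum_insert)
qed (use subspaceD[OF assms(1)] in simp_all)

lemma finsum_sm:
  assumes "f \<in> A \<rightarrow> carrier V"
  shows "c \<odot> finsum V f A = finsum V (\<lambda>a. c \<odot> f a) A"
  using assms
proof (induction A rule: infinite_finite_induct)
  case (insert a A)
  then have f: "f a \<in> carrier V" "f \<in> A \<rightarrow> carrier V" "(\<lambda>a. c \<odot> f a) \<in> A \<rightarrow> carrier V" by auto
  from insert f show ?case by (simp add: finsum_insert sm_rdistr)
qed simp_all

lemma finsum_single:
  assumes "finite A" "a \<in> A" "x \<in> carrier V"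
  shows "finsum V (\<lambda>b. if b = a then x else \<zero>) A = x"
proof -
  have "finsum V (\<lambda>b. if a = b then (\<lambda>_. x) b else \<zero>) A = x"
    using assms by (intro finsum_singleton) auto
  then show ?thesis by (simp add: eq_commute)
qed

end

abbreviation lin_maps ::
    "(complex, 'v, 'y) module_scheme \<Rightarrow> (complex, 'w, 'z) module_scheme \<Rightarrow> ('v \<Rightarrow> 'w) set" where
  "lin_maps V W \<equiv> LinearCombinations.module_hom CC V W"

lemma cspaceI:
  fixes V (structure)
  assumes "\<zero> \<in> carrier V" "\<And>v w. v \<in> carrier V \<Longrightarrow> w \<in> carrier V \<Longrightarrow> v \<oplus> w \<in> carrier V"
    "\<And>v. v \<in> carrier V \<Longrightarrow> \<exists>w\<in>carrier V. v \<oplus> w = \<zero>"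
    "\<And>c v. v \<in> carrier V \<Longrightarrow> c \<odot> v \<in> carrier V"
    "\<And>v w. v \<in> carrier V \<Longrightarrow> w \<in> carrier V \<Longrightarrow> v \<oplus> w = w \<oplus> v"
    "\<And>u v w. u \<in> carrier V \<Longrightarrow> v \<in> carrier V \<Longrightarrow> w \<in> carrier V \<Longrightarrow> u \<oplus> v \<oplus> w = u \<oplus> (v \<oplus> w)"
    "\<And>v. v \<in> carrier V \<Longrightarrow> v \<oplus> \<zero> = v"
    "\<And>c v w. v \<in> carrier V \<Longrightarrow> w \<in> carrier V \<Longrightarrow> c \<odot> (v \<oplus> w) = c \<odot> v \<oplus> c \<odot> w"
    "\<And>a b v. v \<in> carrier V \<Longrightarrow> (a + b) \<odot> v = a \<odot> v \<oplus> b \<odot> v"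
    "\<And>a b v. v \<in> carrier V \<Longrightarrow> (a * b) \<odot> v = a \<odot> (b \<odot> v)"
    "\<And>v. v \<in> carrier V \<Longrightarrow> (1::complex) \<odot> v = v"
  shows "cspace V"
  unfolding cspace_def
  by (rule vs_criteria) (use assms in \<open>auto intro: class_field simp: ac_simps\<close>)

lemma linD:
  assumes "f \<in> lin_maps V W"
  shows "v \<in> carrier V \<Longrightarrow> f v \<in> carrier W"
    "v \<in> carrier V \<Longrightarrow> w \<in> carrier V \<Longrightarrow> f (v \<oplus>\<^bsub>V\<^esub> w) = f v \<oplus>\<^bsub>W\<^esub> f w"
    "v \<in> carrier V \<Longrightarrow> f (c \<odot>\<^bsub>V\<^esub> v) = c \<odot>\<^bsub>W\<^esub> f v"
  using assms by (auto simp: LinearCombinations.module_hom_def)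

lemma linI:
  assumes "\<And>v. v \<in> carrier V \<Longrightarrow> f v \<in> carrier W"
    "\<And>v w. v \<in> carrier V \<Longrightarrow> w \<in> carrier V \<Longrightarrow> f (v \<oplus>\<^bsub>V\<^esub> w) = f v \<oplus>\<^bsub>W\<^esub> f w"
    "\<And>c v. v \<in> carrier V \<Longrightarrow> f (c \<odot>\<^bsub>V\<^esub> v) = c \<odot>\<^bsub>W\<^esub> f v"
  shows "f \<in> lin_maps V W"
  using assms by (auto simp: LinearCombinations.module_hom_def)

lemma lin_zero:
  assumes "f \<in> lin_maps V W" "cspace V" "cspace W"
  shows "f \<zero>\<^bsub>V\<^esub> = \<zero>\<^bsub>W\<^esub>"
proof -
  interpret V: cspace V by fact
  interpret W: cspace W by fact
  have "f (0 \<odot>\<^bsub>V\<^esub> \<zero>\<^bsub>V\<^esub>) = 0 \<odot>\<^bsub>W\<^esub> f \<zero>\<^bsub>V\<^esub>" by (rule linD(3)[OF assms(1)]) simp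
  then show ?thesis using linD(1)[OF assms(1)] by simp
qed

lemma lin_finsum:
  assumes "f \<in> lin_maps V W" "cspace V" "cspace W" "g \<in> A \<rightarrow> carrier V"
  shows "f (finsum V g A) = finsum W (\<lambda>a. f (g a)) A"
proof -
  interpret V: cspace V by fact
  interpret W: cspace W by fact
  show ?thesis using assms(4)
  proof (induction A rule: infinite_finite_induct)
    case (insert a A)
    then have "g a \<in> carrier V" "g \<in> A \<rightarrow> carrier V" "(\<lambda>a. f (g a)) \<in> A \<rightarrow> carrier W"
      using linD(1)[OF assms(1)] by auto
    with insert linD[OF assms(1)] show ?case
      by (simp add: V.finsum_insert W.finsum_insert V.finsum_closed)
  qed (simp_all add: lin_zero[OF assms(1-3)])
qed

lemma lin_comp: "f \<in> lin_maps U V \<Longrightarrow> g \<in> lin_maps V W \<Longrightarrow> (\<lambda>x. g (f x)) \<in> lin_maps U W"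
  by (auto simp: LinearCombinations.module_hom_def Pi_iff)

lemma lin_id: "(\<lambda>x. x) \<in> lin_maps V V"
  by (auto simp: LinearCombinations.module_hom_def)

lemma lin_const_zero: "cspace W \<Longrightarrow> (\<lambda>_. \<zero>\<^bsub>W\<^esub>) \<in> lin_maps V W"
proof -
  assume "cspace W"
  then interpret W: cspace W .
  show ?thesis by (rule linI) auto
qed

lemma lin_plus:
  assumes "f \<in> lin_maps V W" "g \<in> lin_maps V W" "cspace W"
  shows "(\<lambda>x. f x \<oplus>\<^bsub>W\<^esub> g x) \<in> lin_maps V W"
proof -
  interpret W: cspace W by fact
  note [simp] = linD[OF assms(1)] linD[OF assms(2)]
  show ?thesis by (rule linI) (auto simp: W.a_ac W.sm_rdistr)
qed

lemma lin_scale: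
  assumes "f \<in> lin_maps V W" "cspace W"
  shows "(\<lambda>x. c \<odot>\<^bsub>W\<^esub> f x) \<in> lin_maps V W"
proof -
  interpret W: cspace W by fact
  note [simp] = linD[OF assms(1)]
  show ?thesis by (rule linI) (auto simp: W.sm_rdistr W.sm_assoc mult.commute)
qed

lemma lin_finsum_maps:
  assumes "\<And>a. a \<in> A \<Longrightarrow> f a \<in> lin_maps V W" "cspace W"
  shows "(\<lambda>x. finsum W (\<lambda>a. f a x) A) \<in> lin_maps V W"
proof -
  interpret W: cspace W by fact
  have c [simp]: "(\<lambda>a. f a v) \<in> A \<rightarrow> carrier W" if "v \<in> carrier V" for v
    using linD(1)[OF assms(1)] that by auto
  have "finsum W (\<lambda>a. f a (v \<oplus>\<^bsub>V\<^esub> w)) A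
      = finsum W (\<lambda>a. f a v \<oplus>\<^bsub>W\<^esub> f a w) A" if "v \<in> carrier V" "w \<in> carrier V" for v w
    using that linD[OF assms(1)] by (intro W.finsum_cong') auto
  moreover have "finsum W (\<lambda>a. f a (c \<odot>\<^bsub>V\<^esub> v)) A = finsum W (\<lambda>a. c \<odot>\<^bsub>W\<^esub> f a v) A"
    if "v \<in> carrier V" for c v
    using that linD[OF assms(1)] by (intro W.finsum_cong') auto
  ultimately show ?thesis
    by (intro linI) (auto simp: W.finsum_addf W.finsum_sm)
qed

text \<open>Nearly all identities between linear maps below are checked on a spanning set with this lemma, and nearly all
inclusions between subspaces with the next one.\<close>

lemma lin_eq_on_span:
  assumes "f \<in> lin_maps V W" "g \<in> lin_maps V W" "cspace V" "cspace W" "S \<subseteq> carrier V"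
    "x \<in> CC_span V S" "\<And>s. s \<in> S \<Longrightarrow> f s = g s"
  shows "f x = g x"
proof -
  interpret V: cspace V by fact
  show ?thesis using assms(5,6)
    by (induction rule: V.span_induct)
      (auto simp: assms linD[OF assms(1)] linD[OF assms(2)]
        lin_zero[OF assms(1,3,4)] lin_zero[OF assms(2,3,4)])
qed

lemma lin_span_image:
  assumes "f \<in> lin_maps V W" "cspace V" "cspace W" "S \<subseteq> carrier V"
    "VectorSpace.subspace CC N W" "\<And>s. s \<in> S \<Longrightarrow> f s \<in> N" "x \<in> CC_span V S"
  shows "f x \<in> N"
proof -
  interpret V: cspace V by fact
  interpret W: cspace W by fact
  note N = W.subspaceD[OF assms(5)]
  show ?thesis using assms(4,7)
    by (induction rule: V.span_induct)
      (auto simp: assms(6) linD[OF assms(1)] lin_zero[OF assms(1,2,3)] N)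
qed

text \<open>The records for \<open>T(V)\<close>, the free algebra and Yetter-Drinfeld modules extend one of a vector space by
  further fields. Spans and linear maps do not see these fields, which transfers all linear algebra.\<close>

lemma same_module:
  assumes W: "cspace W"
    and eq: "carrier V = carrier W" "add V = add W" "zero V = zero W" "smult V = smult W"
  shows "cspace V" "CC_span V = CC_span W" "CC_fin_dim V = CC_fin_dim W" "finsum V = finsum W"
proof -
  interpret W: cspace W by fact
  show f: "finsum V = finsum W"
    unfolding finsum_def finprod_def partial_object.simps monoid.simps eq ..
  show V: "cspace V"
  proof (rule cspaceI)
    show "\<exists>w\<in>carrier V. v \<oplus>\<^bsub>V\<^esub> w = \<zero>\<^bsub>V\<^esub>" if "v \<in> carrier V" for v
      using that W.r_neg[of v] by (intro bexI[of _ "\<ominus>\<^bsub>W\<^esub> v"]) (auto simp: eq)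
  qed (auto simp: eq W.a_ac W.sm_rdistr W.sm_ldistr W.sm_assoc)
  have m: "Module.module CC V" "Module.module CC W" "vectorspace CC V" "vectorspace CC W"
    using V W by (auto simp: cspace_def vectorspace_def)
  show s: "CC_span V = CC_span W"
    unfolding m(1,2)[THEN LinearCombinations.module.span_def]
      m(1,2)[THEN LinearCombinations.module.lincomb_def] by (simp only: f eq)
  show "CC_fin_dim V = CC_fin_dim W"
    unfolding m(3,4)[THEN vectorspace.fin_dim_def] by (simp only: s eq)
qed

lemma same_lin_maps:
  assumes "carrier V = carrier W" "add V = add W" "smult V = smult W"
  shows "lin_maps V X = lin_maps W X" "lin_maps Y V = lin_maps Y W"
  unfolding LinearCombinations.module_hom_def by (simp_all only: assms)

lemma same_cosets:
  assumes "carrier V = carrier W" "add V = add W"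
  shows "(+>\<^bsub>V\<^esub>) = (+>\<^bsub>W\<^esub>)" "a_rcosets\<^bsub>V\<^esub> N = a_rcosets\<^bsub>W\<^esub> N" "set_add V = set_add W"
  unfolding a_r_coset_def r_coset_def A_RCOSETS_def RCOSETS_def set_add_def set_mult_def
    partial_object.simps monoid.simps by (simp_all only: assms)

section \<open>Quotients of vector spaces\<close>

text \<open>The quotient of a vector space \<open>M\<close> by a subspace \<open>N\<close>, described by the linear surjection
  \<open>x \<mapsto> N + x\<close> with kernel \<open>N\<close>. Only the vector space fields of \<open>Q\<close> are fixed, so that the locale
  applies to quotients that carry a multiplication or an action as well.\<close>

locale cquot = cspace M for M :: "(complex, 'v, 'z) module_scheme" (structure) +
  fixes N :: "'v set" and Q :: "(complex, 'v set, 'y) module_scheme"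
  assumes sub: "VectorSpace.subspace CC N M"
    and Qeq: "carrier Q = carrier (quot_module M N)" "add Q = add (quot_module M N)"
      "zero Q = zero (quot_module M N)" "smult Q = smult (quot_module M N)"
begin

abbreviation cls :: "'v \<Rightarrow> 'v set" where "cls x \<equiv> N +>\<^bsub>M\<^esub> x"

lemma N_closed: "x \<in> N \<Longrightarrow> x \<in> carrier M"
  using subspaceD(1)[OF sub] by auto

lemma mem_cls_iff: "y \<in> cls x \<longleftrightarrow> (\<exists>n\<in>N. y = n \<oplus> x)"
  by (auto simp: a_r_coset_def')

lemma cls_eq_iff:
  assumes x: "x \<in> carrier M" and y: "y \<in> carrier M"
  shows "cls x = cls y \<longleftrightarrow> x \<oplus> (-1) \<odot> y \<in> N"
proof
  assume "cls x = cls y"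
  then have "x \<in> cls y"
    using mem_cls_iff[of x x] subspaceD(2)[OF sub] x by (metis l_zero)
  then obtain n where n: "n \<in> N" "x = n \<oplus> y" using mem_cls_iff by auto
  then have "x \<oplus> (-1) \<odot> y = n"
    using N_closed y by (simp add: minus_sm[symmetric] minus_eq a_assoc r_neg)
  with n show "x \<oplus> (-1) \<odot> y \<in> N" by simp
next
  assume d: "x \<oplus> (-1) \<odot> y \<in> N"
  have yy: "(-1) \<odot> y \<oplus> y = \<zero>" using sm_ldistr[of y "-1" 1] y by simp
  have xy: "x = (x \<oplus> (-1) \<odot> y) \<oplus> y" using x y by (simp add: a_assoc yy)
  have m: "(-1) \<odot> (x \<oplus> (-1) \<odot> y) \<in> N" by (rule subspaceD(4)[OF sub d])
  have yx: "y = (-1) \<odot> (x \<oplus> (-1) \<odot> y) \<oplus> x"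
  proof -
    have "(-1) \<odot> (x \<oplus> (-1) \<odot> y) \<oplus> x = y \<oplus> ((-1) \<odot> x \<oplus> x)"
      using x y by (simp add: sm_rdistr sm_assoc a_ac)
    also have "(-1) \<odot> x \<oplus> x = \<zero>" using sm_ldistr[of x "-1" 1] x by simp
    finally show ?thesis using y by simp
  qed
  have *: "cls a \<subseteq> cls b" if "a = n \<oplus> b" "n \<in> N" "b \<in> carrier M" for a b n
  proof
    fix z assume "z \<in> cls a"
    then obtain k where "k \<in> N" "z = k \<oplus> a" using mem_cls_iff by auto
    then have "z = (k \<oplus> n) \<oplus> b" "k \<oplus> n \<in> N"
      using that N_closed subspaceD(3)[OF sub] by (auto simp: a_assoc)
    then show "z \<in> cls b" using mem_cls_iff by blast
  qed
  show "cls x = cls y"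
    using *[OF xy d y] *[OF yx m x] by blast
qed

lemma mem_cls: "x \<in> carrier M \<Longrightarrow> x \<in> cls x"
  using mem_cls_iff[of x x] subspaceD(2)[OF sub] by (metis l_zero)

lemma cls_memD: "x \<in> carrier M \<Longrightarrow> y \<in> cls x \<Longrightarrow> y \<in> carrier M \<and> cls y = cls x"
proof -
  assume x: "x \<in> carrier M" and "y \<in> cls x"
  then obtain n where n: "n \<in> N" "y = n \<oplus> x" using mem_cls_iff by auto
  then have "y \<oplus> (-1) \<odot> x = n" "y \<in> carrier M"
    using N_closed x by (auto simp: minus_sm[symmetric] minus_eq a_assoc r_neg)
  with n x cls_eq_iff show ?thesis by auto
qed

lemma cls_zero_iff: "x \<in> carrier M \<Longrightarrow> cls x = cls \<zero> \<longleftrightarrow> x \<in> N"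
  by (simp add: cls_eq_iff)

lemma carrier_Q: "carrier Q = cls ` carrier M"
  by (auto simp: Qeq quot_module_def FactRing_def A_RCOSETS_def')

lemma zero_Q: "\<zero>\<^bsub>Q\<^esub> = cls \<zero>"
proof -
  have "cls \<zero> = N"
    using N_closed subspaceD(2)[OF sub] unfolding mem_cls_iff set_eq_iff by (metis r_zero)
  then show ?thesis by (simp add: Qeq quot_module_def FactRing_def)
qed

lemma add_Q: "x \<in> carrier M \<Longrightarrow> y \<in> carrier M \<Longrightarrow> cls x \<oplus>\<^bsub>Q\<^esub> cls y = cls (x \<oplus> y)"
proof -
  assume x: "x \<in> carrier M" and y: "y \<in> carrier M"
  have "z \<in> cls x <+> cls y \<longleftrightarrow> z \<in> cls (x \<oplus> y)" for z
  proof
    assume "z \<in> cls x <+> cls y"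
    then obtain n k where "n \<in> N" "k \<in> N" "z = (n \<oplus> x) \<oplus> (k \<oplus> y)"
      by (auto simp: set_add_def' mem_cls_iff)
    then have "z = (n \<oplus> k) \<oplus> (x \<oplus> y)" "n \<oplus> k \<in> N"
      using x y N_closed subspaceD(3)[OF sub] by (auto simp: a_ac)
    then show "z \<in> cls (x \<oplus> y)" using mem_cls_iff by blast
  next
    assume "z \<in> cls (x \<oplus> y)"
    then obtain n where "n \<in> N" "z = n \<oplus> (x \<oplus> y)" using mem_cls_iff by auto
    then have "z = (n \<oplus> x) \<oplus> y" "n \<oplus> x \<in> cls x"
      using x y N_closed mem_cls_iff by (auto simp: a_ac)
    then show "z \<in> cls x <+> cls y" using mem_cls[OF y] by (auto simp: set_add_def')
  qed
  then show ?thesis by (auto simp: Qeq quot_module_def FactRing_def)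
qed

text \<open>\<^const>\<open>coset_map\<close> is a union over all representatives of a coset; it equals the expected coset as soon as all
representatives have the same image modulo \<open>N\<close>.\<close>

lemma coset_map_cls:
  assumes "x \<in> carrier M" "\<And>y. y \<in> cls x \<Longrightarrow> f y \<in> carrier M \<and> f y \<oplus> (-1) \<odot> f x \<in> N"
  shows "coset_map M N f (cls x) = cls (f x)"
proof -
  have "cls (f y) = cls (f x)" if "y \<in> cls x" for y
    using assms(2)[OF that] assms(2)[OF mem_cls[OF assms(1)]] cls_eq_iff by auto
  then have "coset_map M N f (cls x) = (\<Union>y\<in>cls x. cls (f x))"
    unfolding coset_map_def by (intro SUP_cong refl)
  then show ?thesis using mem_cls[OF assms(1)] by blast
qed

lemma coset_map_lin:
  assumes f: "f \<in> lin_maps M M" and fN: "f ` N \<subseteq> N" and x: "x \<in> carrier M"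
  shows "coset_map M N f (cls x) = cls (f x)"
proof (rule coset_map_cls[OF x])
  fix y assume "y \<in> cls x"
  then obtain n where n: "n \<in> N" "y = n \<oplus> x" using mem_cls_iff by auto
  then have "f y = f n \<oplus> f x" using linD[OF f] x N_closed by auto
  then have "f y \<oplus> (-1) \<odot> f x = f n" "f y \<in> carrier M"
    using linD(1)[OF f] x n N_closed by (auto simp: minus_sm[symmetric] minus_eq a_assoc r_neg)
  then show "f y \<in> carrier M \<and> f y \<oplus> (-1) \<odot> f x \<in> N" using fN n by auto
qed

lemma sm_Q: "x \<in> carrier M \<Longrightarrow> c \<odot>\<^bsub>Q\<^esub> cls x = cls (c \<odot> x)"
proof -
  assume x: "x \<in> carrier M"
  have "(\<lambda>x. c \<odot> x) \<in> lin_maps M M"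
    by (rule lin_scale[OF lin_id]) (rule cspace_axioms)
  then show ?thesis
    using coset_map_lin[of "\<lambda>x. c \<odot> x" x] x subspaceD(4)[OF sub] by (auto simp: Qeq quot_module_def)
qed

lemma Q_cspace: "cspace Q"
proof (rule cspaceI)
  show "\<exists>w\<in>carrier Q. v \<oplus>\<^bsub>Q\<^esub> w = \<zero>\<^bsub>Q\<^esub>" if v: "v \<in> carrier Q" for v
  proof -
    obtain x where "x \<in> carrier M" "v = cls x" using v carrier_Q by auto
    then show ?thesis by (intro bexI[of _ "cls (\<ominus> x)"]) (auto simp: add_Q zero_Q carrier_Q r_neg)
  qed
qed (auto simp: carrier_Q zero_Q add_Q sm_Q a_ac sm_rdistr sm_ldistr sm_assoc)

lemma cls_lin: "cls \<in> lin_maps M Q"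
  by (rule linI) (auto simp: carrier_Q add_Q sm_Q)

text \<open>The lifted map applies \<open>h\<close> to an arbitrary representative; the choice does not matter since \<open>h\<close>
  vanishes on \<open>N\<close>.\<close>

lemma lift_quotient:
  assumes h: "h \<in> lin_maps M X" and X: "cspace X" and hN: "\<And>n. n \<in> N \<Longrightarrow> h n = \<zero>\<^bsub>X\<^esub>"
  shows "\<exists>k \<in> lin_maps Q X. \<forall>x\<in>carrier M. k (cls x) = h x"
proof -
  interpret X: cspace X by fact
  have *: "h y = h x" if "x \<in> carrier M" "y \<in> carrier M" "cls y = cls x" for x y
  proof -
    have "h (y \<oplus> (-1) \<odot> x) = \<zero>\<^bsub>X\<^esub>" using that cls_eq_iff hN by simp
    then have "h y \<oplus>\<^bsub>X\<^esub> (-1) \<odot>\<^bsub>X\<^esub> h x = \<zero>\<^bsub>X\<^esub>" using that linD[OF h] by simp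
    then show ?thesis
      by (rule X.minus_eq_zeroD[OF linD(1)[OF h that(2)] linD(1)[OF h that(1)]])
  qed
  define k where "k = (\<lambda>C. h (SOME x. x \<in> carrier M \<and> cls x = C))"
  have k: "k (cls x) = h x" if "x \<in> carrier M" for x
  proof -
    have "\<exists>y. y \<in> carrier M \<and> cls y = cls x" using that by auto
    from someI_ex[OF this] show ?thesis unfolding k_def using * that by blast
  qed
  have "k \<in> lin_maps Q X"
    by (rule linI) (auto simp: carrier_Q k add_Q sm_Q linD[OF h])
  with k show ?thesis by auto
qed

end

lemma same_quot_module:
  assumes "carrier M = carrier M'" "add M = add M'" "smult M = smult M'"
  shows "carrier (quot_module M N) = carrier (quot_module M' N)"
    "add (quot_module M N) = add (quot_module M' N)"
    "zero (quot_module M N) = zero (quot_module M' N)"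
    "smult (quot_module M N) = smult (quot_module M' N)"
  unfolding quot_module_def FactRing_def coset_map_def partial_object.simps ring.simps
    module.simps same_cosets[OF assms(1,2)] assms by simp_all

subsection \<open>Free spaces\<close>

lemma lookup_scale [simp]:
  "Poly_Mapping.lookup (Poly_Mapping.map ((*) c) p) k = c * Poly_Mapping.lookup p (k :: 'x)"
  for c :: complex
  by (transfer fixing: c k) (auto simp: when_def)

lemma keys_scale: "Poly_Mapping.keys (Poly_Mapping.map ((*) c) p) \<subseteq> Poly_Mapping.keys p"
  for c :: complex
  by (auto simp: in_keys_iff)

lemma scale_single [simp]:
  "Poly_Mapping.map ((*) c) (Poly_Mapping.single k d) = Poly_Mapping.single k (c * d)" for c :: complex
  by (rule poly_mapping_eqI) (simp add: lookup_single when_def)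

lemma scale_one [simp]: "Poly_Mapping.map ((*) (1::complex)) p = p"
  by (rule poly_mapping_eqI) simp

lemma free_space_simps [simp]:
  "carrier (free_space S) = {p. Poly_Mapping.keys p \<subseteq> S}" "add (free_space S) = (+)"
  "zero (free_space S) = 0" "smult (free_space S) c = Poly_Mapping.map ((*) c)"
  by (simp_all add: free_space_def)

lemma free_space_cspace: "cspace (free_space S)"
proof (rule cspaceI)
  show "\<exists>w\<in>carrier (free_space S). v \<oplus>\<^bsub>free_space S\<^esub> w = \<zero>\<^bsub>free_space S\<^esub>"
    if "v \<in> carrier (free_space S)" for v
    using that by (intro bexI[of _ "-v"]) (auto simp: in_keys_iff)
  show "c \<odot>\<^bsub>free_space S\<^esub> v \<in> carrier (free_space S)" if "v \<in> carrier (free_space S)" for c v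
    using that keys_scale[of c v] by auto
  show "v \<oplus>\<^bsub>free_space S\<^esub> w \<in> carrier (free_space S)"
    if "v \<in> carrier (free_space S)" "w \<in> carrier (free_space S)" for v w
    using that keys_add[of v w] by auto
qed (auto intro!: poly_mapping_eqI simp: lookup_add algebra_simps)

lemma free_space_minus:
  "p \<in> carrier (free_space S) \<Longrightarrow> q \<in> carrier (free_space S) \<Longrightarrow>
    p \<oplus>\<^bsub>free_space S\<^esub> (-1) \<odot>\<^bsub>free_space S\<^esub> q = p - q"
  by (auto intro!: poly_mapping_eqI simp: lookup_add lookup_minus)

lemma free_space_span:
  fixes S :: "'a set"
  assumes p: "p \<in> carrier (free_space S)"
  shows "p \<in> CC_span (free_space S) ((\<lambda>s. Poly_Mapping.single s 1) ` S)" (is "_ \<in> ?C")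
proof -
  interpret F: cspace "free_space S" by (rule free_space_cspace)
  have B: "(\<lambda>s. Poly_Mapping.single s 1) ` S \<subseteq> carrier (free_space S)" by auto
  have "finsum (free_space S) (\<lambda>k. Poly_Mapping.single k (Poly_Mapping.lookup p k)) (Poly_Mapping.keys p) \<in> ?C"
  proof (rule F.subspace_finsum[OF F.span_is_subspace[OF B]], rule Pi_I)
    fix k assume k: "k \<in> Poly_Mapping.keys p"
    have "Poly_Mapping.lookup p k \<odot>\<^bsub>free_space S\<^esub> Poly_Mapping.single k 1 \<in> ?C"
      using k p by (intro F.span_sm[OF B] F.span_base[OF B]) auto
    then show "Poly_Mapping.single k (Poly_Mapping.lookup p k) \<in> ?C" by simp
  qed
  moreover have "finsum (free_space S) f A = sum f A" if "f \<in> A \<rightarrow> carrier (free_space S)" for f :: "'a \<Rightarrow> _" and A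
    using that by (induction A rule: infinite_finite_induct) (simp_all add: F.finsum_insert)
  moreover have "(\<Sum>k\<in>Poly_Mapping.keys p. Poly_Mapping.single k (Poly_Mapping.lookup p k)) = p"
    by (rule poly_mapping_eqI)
      (auto simp: lookup_sum lookup_single when_def in_keys_iff intro: ccontr)
  ultimately show ?thesis
    using p by (simp add: Pi_iff subset_iff)
qed

lemma free_space_lin_eq:
  assumes "f \<in> lin_maps (free_space S) X" "g \<in> lin_maps (free_space S) X" "cspace X"
    "p \<in> carrier (free_space S)" "\<And>s. s \<in> S \<Longrightarrow> f (Poly_Mapping.single s 1) = g (Poly_Mapping.single s 1)"
  shows "f p = g p"
  by (rule lin_eq_on_span[OF assms(1,2) free_space_cspace assms(3) _ free_space_span[OF assms(4)]])
    (auto simp: assms(5))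

text \<open>Unlike \<^const>\<open>lin_ext\<close>, which is the special case of a free target, this takes values in any vector
  space.\<close>

definition extend :: "(complex, 'v, 'z) module_scheme \<Rightarrow> ('x \<Rightarrow> 'v) \<Rightarrow> ('x \<Rightarrow>\<^sub>0 complex) \<Rightarrow> 'v" where
  "extend X f p = finsum X (\<lambda>k. Poly_Mapping.lookup p k \<odot>\<^bsub>X\<^esub> f k) (Poly_Mapping.keys p)"

lemma extend_superset:
  assumes "cspace X" "finite K" "Poly_Mapping.keys p \<subseteq> K" "f \<in> K \<rightarrow> carrier X"
  shows "extend X f p = finsum X (\<lambda>k. Poly_Mapping.lookup p k \<odot>\<^bsub>X\<^esub> f k) K"
proof -
  interpret X: cspace X by fact
  show ?thesis unfolding extend_def
    by (rule X.add.finprod_mono_neutral_cong_left)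
      (use assms in \<open>auto simp: in_keys_iff Pi_iff\<close>)
qed

lemma extend_lin:
  assumes X: "cspace X" and f: "f \<in> S \<rightarrow> carrier X"
  shows "extend X f \<in> lin_maps (free_space S) X"
proof -
  interpret X: cspace X by fact
  show ?thesis
  proof (rule linI)
    fix p assume p: "p \<in> carrier (free_space S)"
    then show "extend X f p \<in> carrier X"
      unfolding extend_def using f by (intro X.finsum_closed) auto
    fix c
    have "extend X f (Poly_Mapping.map ((*) c) p)
        = finsum X (\<lambda>k. c \<odot>\<^bsub>X\<^esub> (Poly_Mapping.lookup p k \<odot>\<^bsub>X\<^esub> f k)) (Poly_Mapping.keys p)"
      using p f keys_scale[of c p]
      by (subst extend_superset[where K = "Poly_Mapping.keys p"])
        (auto intro!: X.finsum_cong' simp: X X.sm_assoc Pi_iff subset_iff)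
    then show "extend X f (c \<odot>\<^bsub>free_space S\<^esub> p) = c \<odot>\<^bsub>X\<^esub> extend X f p"
      using p f by (simp add: extend_def X.finsum_sm Pi_iff subset_iff)
  next
    fix p q assume pq: "p \<in> carrier (free_space S)" "q \<in> carrier (free_space S)"
    define K where "K = Poly_Mapping.keys p \<union> Poly_Mapping.keys q"
    have K: "finite K" "Poly_Mapping.keys p \<subseteq> K" "Poly_Mapping.keys q \<subseteq> K"
      "Poly_Mapping.keys (p + q) \<subseteq> K" "f \<in> K \<rightarrow> carrier X"
      using pq f keys_add[of p q] by (auto simp: K_def)
    have "finsum X (\<lambda>k. Poly_Mapping.lookup (p + q) k \<odot>\<^bsub>X\<^esub> f k) K
      = finsum X (\<lambda>k. Poly_Mapping.lookup p k \<odot>\<^bsub>X\<^esub> f k \<oplus>\<^bsub>X\<^esub> Poly_Mapping.lookup q k \<odot>\<^bsub>X\<^esub> f k) K"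
      using K by (intro X.finsum_cong') (auto simp: lookup_add X.sm_ldistr Pi_iff)
    then show "extend X f (p \<oplus>\<^bsub>free_space S\<^esub> q) = extend X f p \<oplus>\<^bsub>X\<^esub> extend X f q"
      using K by (simp add: extend_superset[OF X K(1)] X.finsum_addf Pi_iff)
  qed
qed

lemma extend_single:
  assumes "cspace X" "f k \<in> carrier X"
  shows "extend X f (Poly_Mapping.single k c) = c \<odot>\<^bsub>X\<^esub> f k"
proof -
  interpret X: cspace X by fact
  show ?thesis using assms(2) by (simp add: extend_def X.finsum_insert)
qed

lemma lin_ext_extend:
  fixes f :: "'a \<Rightarrow> 'b \<Rightarrow>\<^sub>0 complex"
  shows "lin_ext f p = extend (free_space UNIV) f p"
proof -
  interpret F: cspace "free_space UNIV :: (complex, 'b \<Rightarrow>\<^sub>0 complex) module"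
    by (rule free_space_cspace)
  have "finsum (free_space UNIV :: (complex, 'b \<Rightarrow>\<^sub>0 complex) module) g A = sum g A"
    for g :: "'a \<Rightarrow> _" and A
    by (induction A rule: infinite_finite_induct) (simp_all add: F.finsum_insert)
  then show ?thesis by (simp add: lin_ext_def extend_def)
qed

lemma lin_ext_single [simp]: "lin_ext f (Poly_Mapping.single k c) = Poly_Mapping.map ((*) c) (f k)"
  by (simp add: lin_ext_extend extend_single free_space_cspace)

lemma lin_ext_lin:
  assumes "\<And>s. s \<in> S \<Longrightarrow> Poly_Mapping.keys (f s) \<subseteq> S'"
  shows "lin_ext f \<in> lin_maps (free_space S) (free_space S')"
proof -
  have *: "lin_ext f \<in> lin_maps (free_space S) (free_space UNIV)"
    unfolding lin_ext_extend[abs_def] by (rule extend_lin) (auto simp: free_space_cspace)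
  show ?thesis
  proof (rule linI)
    fix p assume p: "p \<in> carrier (free_space S)"
    have "Poly_Mapping.keys (lin_ext f p)
        \<subseteq> (\<Union>k\<in>Poly_Mapping.keys p. Poly_Mapping.keys (Poly_Mapping.map ((*) (Poly_Mapping.lookup p k)) (f k)))"
      unfolding lin_ext_def by (rule keys_sum)
    also have "\<dots> \<subseteq> S'"
      using p assms keys_scale by fastforce
    finally show "lin_ext f p \<in> carrier (free_space S')" by simp
  qed (use linD[OF *] in simp_all)
qed

subsection \<open>Spaces given by generators and relations\<close>

text \<open>Three of the quotients that occur, namely the tensor algebra, the tensor square and the induced module,
are free spaces modulo the span of explicit relations. They share the two facts that linear maps are determined
by their values on generators and may be prescribed there subject to the relations.\<close>

locale presented = cquot "free_space S" N Q
  for S :: "'x set" and N and Q :: "(complex, ('x \<Rightarrow>\<^sub>0 complex) set, 'y) module_scheme" +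
  fixes R
  assumes rels: "R \<subseteq> carrier (free_space S)" and N: "N = CC_span (free_space S) R"
begin

abbreviation gen :: "'x \<Rightarrow> ('x \<Rightarrow>\<^sub>0 complex) set" where
  "gen s \<equiv> cls (Poly_Mapping.single s 1)"

lemma gen_closed [simp]: "s \<in> S \<Longrightarrow> gen s \<in> carrier Q"
  by (auto simp: carrier_Q)

lemma gens_span: "x \<in> carrier Q \<Longrightarrow> x \<in> CC_span Q (gen ` S)"
proof -
  interpret Q: cspace Q by (rule Q_cspace)
  assume "x \<in> carrier Q"
  then obtain p where p: "p \<in> carrier (free_space S)" "x = cls p" by (auto simp: carrier_Q)
  have g: "gen ` S \<subseteq> carrier Q" by auto
  have "cls p \<in> CC_span Q (gen ` S)"
    by (rule lin_span_image[OF cls_lin free_space_cspace Q_cspace _ Q.span_is_subspace[OF g] _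
          free_space_span[OF p(1)]]) (use Q.span_base[OF g] in auto)
  with p show ?thesis by simp
qed

lemma Q_lin_eq:
  assumes "f \<in> lin_maps Q X" "g \<in> lin_maps Q X" "cspace X" "\<And>s. s \<in> S \<Longrightarrow> f (gen s) = g (gen s)"
    "x \<in> carrier Q"
  shows "f x = g x"
  by (rule lin_eq_on_span[OF assms(1,2) Q_cspace assms(3) _ gens_span[OF assms(5)]])
    (auto simp: assms(4))

lemma lift_gens:
  assumes X: "cspace X" and f: "f \<in> S \<rightarrow> carrier X" and R: "\<And>r. r \<in> R \<Longrightarrow> extend X f r = \<zero>\<^bsub>X\<^esub>"
  shows "\<exists>k \<in> lin_maps Q X. \<forall>s\<in>S. k (gen s) = f s"
proof -
  note l = extend_lin[OF X f]
  interpret X: cspace X by fact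
  have "extend X f n = \<zero>\<^bsub>X\<^esub>" if "n \<in> N" for n
    by (rule lin_eq_on_span[OF l lin_const_zero[OF X] free_space_cspace X rels])
      (use that R N in auto)
  from lift_quotient[OF l X this] obtain k where
    k: "k \<in> lin_maps Q X" "\<And>x. x \<in> carrier (free_space S) \<Longrightarrow> k (cls x) = extend X f x" by auto
  have "k (gen s) = f s" if "s \<in> S" for s
  proof -
    have "f s \<in> carrier X" using f that by auto
    then show ?thesis using that k(2)[of "Poly_Mapping.single s 1"] by (simp add: extend_single[OF X])
  qed
  with k show ?thesis by blast
qed

end

lemma presentedI:
  assumes "R \<subseteq> carrier (free_space S)" "N = CC_span (free_space S) R"
    "carrier Q = carrier (quot_module (free_space S) N)" "add Q = add (quot_module (free_space S) N)"
    "zero Q = zero (quot_module (free_space S) N)" "smult Q = smult (quot_module (free_space S) N)"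
  shows "presented S N Q R"
proof -
  interpret F: cspace "free_space S" by (rule free_space_cspace)
  show ?thesis
    using F.span_is_subspace[OF assms(1)] assms
    by (intro presented.intro cquot.intro presented_axioms.intro cquot_axioms.intro free_space_cspace)
      (simp_all only:)
qed

section \<open>The tensor algebra\<close>

text \<open>Membership in \<^const>\<open>lists\<close> occurs as a side condition almost everywhere in what follows. As classical
rules these facts unfold it to membership of all letters, which makes proof search diverge.\<close>

declare in_listsD [rule del] in_listsI [rule del] in_listspD [rule del] in_listspI [rule del]

text \<open>Associative unital algebras over the complex numbers.\<close>

locale calg = cspace X + A: ring X for X :: "(complex, 'v, 'z) module_scheme" (structure) +
  assumes mult_sm_l: "x \<in> carrier X \<Longrightarrow> y \<in> carrier X \<Longrightarrow> (c \<odot> x) \<otimes> y = c \<odot> (x \<otimes> y)"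
    and mult_sm_r: "x \<in> carrier X \<Longrightarrow> y \<in> carrier X \<Longrightarrow> x \<otimes> (c \<odot> y) = c \<odot> (x \<otimes> y)"
begin

lemma mult_lin_l: "y \<in> carrier X \<Longrightarrow> (\<lambda>x. x \<otimes> y) \<in> lin_maps X X"
  by (rule linI) (auto simp: A.l_distr mult_sm_l)

lemma mult_lin_r: "x \<in> carrier X \<Longrightarrow> (\<lambda>y. x \<otimes> y) \<in> lin_maps X X"
  by (rule linI) (auto simp: A.r_distr mult_sm_r)

end

text \<open>Both sides of the associative law are linear in each argument, so it suffices to test it on a
  spanning set.\<close>

lemma calgI:
  fixes X :: "(complex, 'v, 'z) module_scheme" (structure)
  assumes X: "cspace X" and B: "B \<subseteq> carrier X" and span: "\<And>x. x \<in> carrier X \<Longrightarrow> x \<in> CC_span X B"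
    and l: "\<And>y. y \<in> carrier X \<Longrightarrow> (\<lambda>x. x \<otimes> y) \<in> lin_maps X X"
    and r: "\<And>x. x \<in> carrier X \<Longrightarrow> (\<lambda>y. x \<otimes> y) \<in> lin_maps X X"
    and assoc: "\<And>a b c. a \<in> B \<Longrightarrow> b \<in> B \<Longrightarrow> c \<in> B \<Longrightarrow> a \<otimes> b \<otimes> c = a \<otimes> (b \<otimes> c)"
    and one: "\<one> \<in> carrier X" "\<And>a. a \<in> B \<Longrightarrow> \<one> \<otimes> a = a" "\<And>a. a \<in> B \<Longrightarrow> a \<otimes> \<one> = a"
  shows "calg X"
proof -
  interpret cspace X by fact
  have cl [simp]: "x \<otimes> y \<in> carrier X" if "x \<in> carrier X" "y \<in> carrier X" for x y
    using linD(1)[OF l[OF that(2)] that(1)] .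
  have 1: "a \<otimes> b \<otimes> z = a \<otimes> (b \<otimes> z)" if "a \<in> B" "b \<in> B" "z \<in> carrier X" for a b z
    by (rule lin_eq_on_span[OF _ _ X X B span[OF that(3)]])
      (use that B in \<open>auto intro!: r lin_comp[OF r r] simp: assoc subset_iff\<close>)
  have 2: "a \<otimes> y \<otimes> z = a \<otimes> (y \<otimes> z)" if "a \<in> B" "y \<in> carrier X" "z \<in> carrier X" for a y z
    by (rule lin_eq_on_span[OF _ _ X X B span[OF that(2)]])
      (use that B in \<open>auto intro!: lin_comp[OF r l] lin_comp[OF l r] simp: 1 subset_iff\<close>)
  have 3: "x \<otimes> y \<otimes> z = x \<otimes> (y \<otimes> z)" if "x \<in> carrier X" "y \<in> carrier X" "z \<in> carrier X" for x y z
    by (rule lin_eq_on_span[OF _ _ X X B span[OF that(1)]])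
      (use that B in \<open>auto intro!: l lin_comp[OF l l] simp: 2 subset_iff\<close>)
  have 4: "\<one> \<otimes> x = x" if "x \<in> carrier X" for x
    by (rule lin_eq_on_span[OF r[OF one(1)] lin_id X X B span[OF that]]) (use one in auto)
  have 5: "x \<otimes> \<one> = x" if "x \<in> carrier X" for x
    by (rule lin_eq_on_span[OF l[OF one(1)] lin_id X X B span[OF that]]) (use one in auto)
  have "ring X"
    by (rule ringI)
      (use linD(2)[OF l] linD(2)[OF r] in \<open>auto simp: abelian_group_axioms 3 4 5 one intro!: monoidI\<close>)
  then show ?thesis
    using linD(3)[OF l] linD(3)[OF r] X by (intro calg.intro calg_axioms.intro) auto
qed

lemma lin_ext_add_fun: "lin_ext (\<lambda>k. f k + g k) p = lin_ext f p + lin_ext g p"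
  by (rule poly_mapping_eqI)
    (simp add: lin_ext_def lookup_sum lookup_add algebra_simps sum.distrib)

lemma lin_ext_scale_fun:
  "lin_ext (\<lambda>k. Poly_Mapping.map ((*) c) (f k)) p = Poly_Mapping.map ((*) c) (lin_ext f p)"
  by (rule poly_mapping_eqI)
    (simp add: lin_ext_def lookup_sum algebra_simps sum_distrib_left)

subsection \<open>Free algebras\<close>

lemma free_algebra_simps [simp]:
  "carrier (free_algebra S) = carrier (free_space (lists S))" "add (free_algebra S) = (+)"
  "zero (free_algebra S) = 0" "smult (free_algebra S) c = Poly_Mapping.map ((*) c)"
  "one (free_algebra S) = Poly_Mapping.single [] 1"
  by (simp_all add: free_algebra_def free_space_def)

lemma free_algebra_same:
  "carrier (free_algebra S) = carrier (free_space (lists S))"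
  "add (free_algebra S) = add (free_space (lists S))"
  "zero (free_algebra S) = zero (free_space (lists S))"
  "smult (free_algebra S) = smult (free_space (lists S))"
  by (simp_all add: free_algebra_def free_space_def)

lemma free_algebra_mult:
  "p \<otimes>\<^bsub>free_algebra S\<^esub> q = lin_ext (\<lambda>u. lin_ext (\<lambda>w. Poly_Mapping.single (u @ w) 1) q) p"
  by (simp add: free_algebra_def)

lemma free_algebra_words [simp]:
  "Poly_Mapping.single u c \<otimes>\<^bsub>free_algebra S\<^esub> Poly_Mapping.single w d = Poly_Mapping.single (u @ w) (c * d)"
  by (simp add: free_algebra_mult)

lemmas free_algebra_cspace = same_module(1)[OF free_space_cspace free_algebra_same]
lemmas free_algebra_span = same_module(2)[OF free_space_cspace free_algebra_same]
lemmas free_algebra_lin = same_lin_maps[OF free_algebra_same(1,2,4)]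

lemma free_algebra_calg: "calg (free_algebra S)"
proof (rule calgI[where B = "(\<lambda>w. Poly_Mapping.single w 1) ` lists S"])
  show "x \<in> CC_span (free_algebra S) ((\<lambda>w. Poly_Mapping.single w 1) ` lists S)"
    if "x \<in> carrier (free_algebra S)" for x
    using that by (simp only: free_algebra_span free_algebra_same free_space_span)
  have k: "Poly_Mapping.keys (lin_ext (\<lambda>w. Poly_Mapping.single (u @ w) 1) q) \<subseteq> lists S"
    if "u \<in> lists S" "Poly_Mapping.keys q \<subseteq> lists S" for u q
    using linD(1)[OF lin_ext_lin[of "lists S" "\<lambda>w. Poly_Mapping.single (u @ w) 1" "lists S"], of q] that
    by simp
  show l: "(\<lambda>x. x \<otimes>\<^bsub>free_algebra S\<^esub> y) \<in> lin_maps (free_algebra S) (free_algebra S)"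
    if "y \<in> carrier (free_algebra S)" for y
    unfolding free_algebra_mult free_algebra_lin using that by (intro lin_ext_lin k) auto
  show "(\<lambda>y. x \<otimes>\<^bsub>free_algebra S\<^esub> y) \<in> lin_maps (free_algebra S) (free_algebra S)"
    if "x \<in> carrier (free_algebra S)" for x
  proof (rule linI)
    show "x \<otimes>\<^bsub>free_algebra S\<^esub> v \<in> carrier (free_algebra S)" if "v \<in> carrier (free_algebra S)" for v
      using linD(1)[OF l[OF that] \<open>x \<in> _\<close>] .
    have L: "lin_ext (\<lambda>w. Poly_Mapping.single (u @ w) (1::complex)) \<in> lin_maps (free_space UNIV) (free_space UNIV)"
      for u :: "'a list" by (rule lin_ext_lin) auto
    show "x \<otimes>\<^bsub>free_algebra S\<^esub> (v \<oplus>\<^bsub>free_algebra S\<^esub> w)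
        = x \<otimes>\<^bsub>free_algebra S\<^esub> v \<oplus>\<^bsub>free_algebra S\<^esub> x \<otimes>\<^bsub>free_algebra S\<^esub> w" for v w
      using linD(2)[OF L] by (simp add: free_algebra_mult lin_ext_add_fun)
    show "x \<otimes>\<^bsub>free_algebra S\<^esub> (c \<odot>\<^bsub>free_algebra S\<^esub> v)
        = c \<odot>\<^bsub>free_algebra S\<^esub> (x \<otimes>\<^bsub>free_algebra S\<^esub> v)" for c v
      using linD(3)[OF L] by (simp add: free_algebra_mult lin_ext_scale_fun)
  qed
qed (auto simp: free_algebra_cspace)

text \<open>The generators of \<^const>\<open>tensor_ideal\<close> express linearity in a word of length one. Multiplying them
  by words on both sides gives linearity in one letter of an arbitrary word; these elements span the ideal
  already as a vector space, which is what makes \<open>T(V)\<close> a space given by generators and relations.\<close>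

definition tensor_rels :: "(complex, 'v, 'z) module_scheme \<Rightarrow> ('v list \<Rightarrow>\<^sub>0 complex) set" where
  "tensor_rels V =
    {Poly_Mapping.single (u @ (v \<oplus>\<^bsub>V\<^esub> w) # s) 1 - Poly_Mapping.single (u @ v # s) 1
        - Poly_Mapping.single (u @ w # s) 1
      | u s v w. u \<in> lists (carrier V) \<and> s \<in> lists (carrier V) \<and> v \<in> carrier V \<and> w \<in> carrier V} \<union>
    {Poly_Mapping.single (u @ (c \<odot>\<^bsub>V\<^esub> v) # s) 1 - Poly_Mapping.single (u @ v # s) c
      | u s c v. u \<in> lists (carrier V) \<and> s \<in> lists (carrier V) \<and> v \<in> carrier V}"

lemma tensor_relsE:
  assumes "r \<in> tensor_rels V"
  obtains (add) u s v w where "u \<in> lists (carrier V)" "s \<in> lists (carrier V)"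
      "v \<in> carrier V" "w \<in> carrier V"
      "r = Poly_Mapping.single (u @ (v \<oplus>\<^bsub>V\<^esub> w) # s) 1 - Poly_Mapping.single (u @ v # s) 1
        - Poly_Mapping.single (u @ w # s) 1"
  | (sm) u s c v where "u \<in> lists (carrier V)" "s \<in> lists (carrier V)" "v \<in> carrier V"
      "r = Poly_Mapping.single (u @ (c \<odot>\<^bsub>V\<^esub> v) # s) 1 - Poly_Mapping.single (u @ v # s) c"
  using assms unfolding tensor_rels_def Un_iff mem_Collect_eq
  by (elim disjE exE conjE) (rule that; assumption)+

lemma keys_diff_subset: "Poly_Mapping.keys p \<subseteq> S \<Longrightarrow> Poly_Mapping.keys q \<subseteq> S \<Longrightarrow> Poly_Mapping.keys (p - q) \<subseteq> S"
  using keys_diff[of p q] by auto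

lemma single_closed: "k \<in> S \<Longrightarrow> Poly_Mapping.keys (Poly_Mapping.single k c) \<subseteq> S"
  by simp

lemma tensor_rels_closed:
  assumes "cspace V"
  shows "tensor_rels V \<subseteq> carrier (free_space (lists (carrier V)))"
proof -
  interpret cspace V by fact
  show ?thesis
    unfolding tensor_rels_def free_space_simps Un_subset_iff
  proof (intro conjI subsetI; unfold mem_Collect_eq; elim exE conjE; hypsubst)
  qed (intro keys_diff_subset single_closed; simp; fail)+
qed

lemma subspace_ideal:
  assumes "calg X" and N: "VectorSpace.subspace CC N X"
    and l: "\<And>a x. a \<in> N \<Longrightarrow> x \<in> carrier X \<Longrightarrow> x \<otimes>\<^bsub>X\<^esub> a \<in> N"
    and r: "\<And>a x. a \<in> N \<Longrightarrow> x \<in> carrier X \<Longrightarrow> a \<otimes>\<^bsub>X\<^esub> x \<in> N"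
  shows "ideal N X"
proof -
  interpret calg X by fact
  note N = subspaceD[OF N]
  have "\<ominus>\<^bsub>X\<^esub> a \<in> N" if "a \<in> N" for a
    using N(4)[OF that, of "-1"] minus_sm[of "\<zero>\<^bsub>X\<^esub>" a] that N(1) by (simp add: minus_eq subset_iff)
  then have "subgroup N (add_monoid X)"
    by (intro subgroup.intro) (use N in \<open>auto simp: a_inv_def\<close>)
  then show ?thesis
    using l r A.ring_axioms by (intro idealI)
qed

lemma ideal_subspace:
  assumes "calg X" "ideal N X"
  shows "VectorSpace.subspace CC N X"
proof -
  interpret calg X by fact
  interpret I: ideal N X by fact
  show ?thesis
  proof (rule subspaceI)
    show "c \<odot>\<^bsub>X\<^esub> v \<in> N" if "v \<in> N" for c v
    proof -
      have "(c \<odot>\<^bsub>X\<^esub> \<one>\<^bsub>X\<^esub>) \<otimes>\<^bsub>X\<^esub> v \<in> N" using that by (intro I.I_l_closed) auto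
      then show ?thesis using that I.Icarr by (simp add: mult_sm_l)
    qed
  qed (use I.Icarr in auto)
qed

lemma free_algebra_rels_mult:
  assumes V: "cspace V" and r: "r \<in> tensor_rels V"
    and z: "z \<in> lists (carrier V)"
  shows "Poly_Mapping.single z 1 \<otimes>\<^bsub>free_algebra (carrier V)\<^esub> r \<in> tensor_rels V"
    "r \<otimes>\<^bsub>free_algebra (carrier V)\<^esub> Poly_Mapping.single z 1 \<in> tensor_rels V"
proof -
  interpret cspace V by fact
  let ?A = "free_algebra (carrier V)"
  interpret A: calg ?A by (rule free_algebra_calg)
  have d: "p \<otimes>\<^bsub>?A\<^esub> (q - q') = p \<otimes>\<^bsub>?A\<^esub> q - p \<otimes>\<^bsub>?A\<^esub> q'"
    "(q - q') \<otimes>\<^bsub>?A\<^esub> p = q \<otimes>\<^bsub>?A\<^esub> p - q' \<otimes>\<^bsub>?A\<^esub> p"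
    if "p \<in> carrier ?A" "q \<in> carrier ?A" "q' \<in> carrier ?A" for p q q'
  proof -
    have m: "a - b = a \<oplus>\<^bsub>?A\<^esub> (-1) \<odot>\<^bsub>?A\<^esub> b" for a b
      by (rule poly_mapping_eqI) (simp add: lookup_minus lookup_add)
    show "p \<otimes>\<^bsub>?A\<^esub> (q - q') = p \<otimes>\<^bsub>?A\<^esub> q - p \<otimes>\<^bsub>?A\<^esub> q'"
      "(q - q') \<otimes>\<^bsub>?A\<^esub> p = q \<otimes>\<^bsub>?A\<^esub> p - q' \<otimes>\<^bsub>?A\<^esub> p"
      unfolding m using that linD(2,3)[OF A.mult_lin_r[of p]] linD(2,3)[OF A.mult_lin_l[of p]]
      by (metis A.sm_closed)+
  qed
  have sc: "Poly_Mapping.single w c \<in> carrier ?A" if "w \<in> lists (carrier V)" for w c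
    using that by simp
  have dc: "q - q' \<in> carrier ?A" if "q \<in> carrier ?A" "q' \<in> carrier ?A" for q q'
    using that keys_diff_subset by simp
  from r have "Poly_Mapping.single z 1 \<otimes>\<^bsub>?A\<^esub> r \<in> tensor_rels V \<and> r \<otimes>\<^bsub>?A\<^esub> Poly_Mapping.single z 1 \<in> tensor_rels V"
  proof (cases rule: tensor_relsE)
    case (add u s v w)
    have "Poly_Mapping.single z 1 \<otimes>\<^bsub>?A\<^esub> r = Poly_Mapping.single ((z @ u) @ (v \<oplus>\<^bsub>V\<^esub> w) # s) 1
        - Poly_Mapping.single ((z @ u) @ v # s) 1 - Poly_Mapping.single ((z @ u) @ w # s) 1"
      "r \<otimes>\<^bsub>?A\<^esub> Poly_Mapping.single z 1 = Poly_Mapping.single (u @ (v \<oplus>\<^bsub>V\<^esub> w) # (s @ z)) 1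
        - Poly_Mapping.single (u @ v # (s @ z)) 1 - Poly_Mapping.single (u @ w # (s @ z)) 1"
      using add(1-4) z unfolding add(5) by (simp_all add: d sc dc del: free_algebra_simps(1))
    moreover have "z @ u \<in> lists (carrier V)" "s @ z \<in> lists (carrier V)" using add z by auto
    ultimately show ?thesis
      unfolding tensor_rels_def using add(1-4) by blast
  next
    case (sm u s c v)
    have "Poly_Mapping.single z 1 \<otimes>\<^bsub>?A\<^esub> r = Poly_Mapping.single ((z @ u) @ (c \<odot>\<^bsub>V\<^esub> v) # s) 1
        - Poly_Mapping.single ((z @ u) @ v # s) c"
      "r \<otimes>\<^bsub>?A\<^esub> Poly_Mapping.single z 1 = Poly_Mapping.single (u @ (c \<odot>\<^bsub>V\<^esub> v) # (s @ z)) 1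
        - Poly_Mapping.single (u @ v # (s @ z)) c"
      using sm(1-3) z unfolding sm(4) by (simp_all add: d sc dc del: free_algebra_simps(1))
    moreover have "z @ u \<in> lists (carrier V)" "s @ z \<in> lists (carrier V)" using sm z by auto
    ultimately show ?thesis
      unfolding tensor_rels_def using sm(1-3) by blast
  qed
  then show "Poly_Mapping.single z 1 \<otimes>\<^bsub>?A\<^esub> r \<in> tensor_rels V"
    "r \<otimes>\<^bsub>?A\<^esub> Poly_Mapping.single z 1 \<in> tensor_rels V" by auto
qed

text \<open>The span of the relations is stable under multiplication by words, hence by everything, so it is an
ideal containing the generators; conversely each relation is a generator multiplied by words.\<close>

lemma tensor_ideal_eq:
  assumes V: "cspace V"
  shows "tensor_ideal V = CC_span (free_space (lists (carrier V))) (tensor_rels V)" (is "_ = ?N")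
    and "ideal (tensor_ideal V) (free_algebra (carrier V))"
proof -
  interpret V: cspace V by fact
  let ?A = "free_algebra (carrier V)"
  let ?S = "{Poly_Mapping.single [v \<oplus>\<^bsub>V\<^esub> w] 1 - Poly_Mapping.single [v] 1 - Poly_Mapping.single [w] 1
        | v w. v \<in> carrier V \<and> w \<in> carrier V} \<union>
     {Poly_Mapping.single [c \<odot>\<^bsub>V\<^esub> v] 1 - Poly_Mapping.single [v] c
        | c v. v \<in> carrier V}"
  interpret A: calg ?A by (rule free_algebra_calg)
  note same = free_algebra_same[of "carrier V"]
  have rc: "tensor_rels V \<subseteq> carrier ?A"
    using tensor_rels_closed[OF V] same(1) by simp
  have Neq: "?N = CC_span ?A (tensor_rels V)" by (simp only: free_algebra_span)
  have Nsub: "VectorSpace.subspace CC ?N ?A"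
    unfolding Neq by (rule A.span_is_subspace[OF rc])
  have rN: "r \<in> ?N" if "r \<in> tensor_rels V" for r
    unfolding Neq by (rule A.span_base[OF rc that])
  let ?W = "(\<lambda>w. Poly_Mapping.single w (1::complex)) ` lists (carrier V)"
  have W: "?W \<subseteq> carrier ?A" by auto
  have span: "x \<in> CC_span ?A ?W" if "x \<in> carrier ?A" for x
    using that by (simp only: free_algebra_span same free_space_span)
  have Wr: "\<forall>s\<in>?W. s \<otimes>\<^bsub>?A\<^esub> r \<in> ?N \<and> r \<otimes>\<^bsub>?A\<^esub> s \<in> ?N" if "r \<in> tensor_rels V" for r
    using rN free_algebra_rels_mult[OF V that] by blast
  have l0: "x \<otimes>\<^bsub>?A\<^esub> r \<in> ?N" if "r \<in> tensor_rels V" "x \<in> carrier ?A" for x r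
    by (rule lin_span_image[OF A.mult_lin_l A.cspace_axioms A.cspace_axioms W Nsub _ span[OF that(2)]])
      (use that rc Wr[OF that(1)] in blast)+
  have l: "x \<otimes>\<^bsub>?A\<^esub> a \<in> ?N" if "a \<in> ?N" "x \<in> carrier ?A" for x a
    by (rule lin_span_image[OF A.mult_lin_r A.cspace_axioms A.cspace_axioms rc Nsub _])
      (use that l0 Neq in auto)
  have r0: "r \<otimes>\<^bsub>?A\<^esub> x \<in> ?N" if "r \<in> tensor_rels V" "x \<in> carrier ?A" for x r
    by (rule lin_span_image[OF A.mult_lin_r A.cspace_axioms A.cspace_axioms W Nsub _ span[OF that(2)]])
      (use that rc Wr[OF that(1)] in blast)+
  have r: "a \<otimes>\<^bsub>?A\<^esub> x \<in> ?N" if "a \<in> ?N" "x \<in> carrier ?A" for x a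
    by (rule lin_span_image[OF A.mult_lin_l A.cspace_axioms A.cspace_axioms rc Nsub _])
      (use that r0 Neq in auto)
  have idN: "ideal ?N ?A"
    by (rule subspace_ideal[OF free_algebra_calg Nsub l r])
  have SN: "?S \<subseteq> ?N"
  proof
    fix x assume "x \<in> ?S"
    then have "x \<in> tensor_rels V"
      unfolding tensor_rels_def Un_iff mem_Collect_eq
    proof (elim disjE exE conjE)
      fix v w assume "x = Poly_Mapping.single [v \<oplus>\<^bsub>V\<^esub> w] 1 - Poly_Mapping.single [v] 1 - Poly_Mapping.single [w] 1"
        "v \<in> carrier V" "w \<in> carrier V"
      then show "(\<exists>u s v w. x = Poly_Mapping.single (u @ (v \<oplus>\<^bsub>V\<^esub> w) # s) 1 - Poly_Mapping.single (u @ v # s) 1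
        - Poly_Mapping.single (u @ w # s) 1 \<and> u \<in> lists (carrier V) \<and> s \<in> lists (carrier V) \<and> v \<in> carrier V \<and> w \<in> carrier V) \<or> B" for B
        by (intro disjI1 exI[of _ "[]"] exI[of _ v] exI[of _ w]) simp
    next
      fix c v assume "x = Poly_Mapping.single [c \<odot>\<^bsub>V\<^esub> v] 1 - Poly_Mapping.single [v] c"
        "v \<in> carrier V"
      then show "B \<or> (\<exists>u s c v. x = Poly_Mapping.single (u @ (c \<odot>\<^bsub>V\<^esub> v) # s) 1 - Poly_Mapping.single (u @ v # s) c
         \<and> u \<in> lists (carrier V) \<and> s \<in> lists (carrier V) \<and> v \<in> carrier V)" for B
        by (intro disjI2 exI[of _ "[]"] exI[of _ c] exI[of _ v]) simp
    qed
    then show "x \<in> ?N" by (rule rN)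
  qed
  then have Sc: "?S \<subseteq> carrier ?A"
    using A.subspaceD(1)[OF Nsub] by blast
  have I: "ideal (tensor_ideal V) ?A" "?S \<subseteq> tensor_ideal V"
    unfolding tensor_ideal_def using A.A.genideal_ideal[OF Sc] A.A.genideal_self[OF Sc] by auto
  interpret I: ideal "tensor_ideal V" ?A by (rule I)
  have "tensor_rels V \<subseteq> tensor_ideal V"
  proof
    have sc: "Poly_Mapping.single w c \<in> carrier ?A" if "w \<in> lists (carrier V)" for w c
      using that by simp
    have ir: "Poly_Mapping.single u 1 \<otimes>\<^bsub>?A\<^esub> q \<otimes>\<^bsub>?A\<^esub> Poly_Mapping.single s 1 \<in> tensor_ideal V"
      if "q \<in> ?S" "u \<in> lists (carrier V)" "s \<in> lists (carrier V)" for q u s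
      using I.I_r_closed[OF I.I_l_closed[OF subsetD[OF I(2) that(1)] sc[OF that(2)]] sc[OF that(3)]] .
    have d: "Poly_Mapping.single u 1 \<otimes>\<^bsub>?A\<^esub> (q - q') \<otimes>\<^bsub>?A\<^esub> Poly_Mapping.single s 1
      = Poly_Mapping.single u 1 \<otimes>\<^bsub>?A\<^esub> q \<otimes>\<^bsub>?A\<^esub> Poly_Mapping.single s 1
        - Poly_Mapping.single u 1 \<otimes>\<^bsub>?A\<^esub> q' \<otimes>\<^bsub>?A\<^esub> Poly_Mapping.single s 1"
      if "q \<in> carrier ?A" "q' \<in> carrier ?A" "u \<in> lists (carrier V)" "s \<in> lists (carrier V)" for q q' u s
    proof -
      have m: "a - b = a \<oplus>\<^bsub>?A\<^esub> (-1) \<odot>\<^bsub>?A\<^esub> b" for a b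
        by (rule poly_mapping_eqI) (simp add: lookup_minus lookup_add)
      note L = lin_comp[OF A.mult_lin_r A.mult_lin_l, OF sc sc, OF that(3,4)]
      show ?thesis unfolding m using that linD(2,3)[OF L] by (metis A.sm_closed)
    qed
    have dc: "q - q' \<in> carrier ?A" if "q \<in> carrier ?A" "q' \<in> carrier ?A" for q q'
      using that keys_diff_subset by simp
    fix r assume "r \<in> tensor_rels V"
    then show "r \<in> tensor_ideal V"
    proof (cases rule: tensor_relsE)
      case (add u s v w)
      let ?q = "Poly_Mapping.single [v \<oplus>\<^bsub>V\<^esub> w] 1 - Poly_Mapping.single [v] 1 - Poly_Mapping.single [w] 1"
      have "?q \<in> ?S" using add by blast
      from ir[OF this add(1,2)] show ?thesis
        unfolding add(5) using add(1-4) by (simp add: d sc dc del: free_algebra_simps(1))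
    next
      case (sm u s c v)
      let ?q = "Poly_Mapping.single [c \<odot>\<^bsub>V\<^esub> v] 1 - Poly_Mapping.single [v] c"
      have "?q \<in> ?S" using sm by blast
      from ir[OF this sm(1,2)] show ?thesis
        unfolding sm(4) using sm(1-3) by (simp add: d sc dc del: free_algebra_simps(1))
    qed
  qed
  then have "?N \<subseteq> tensor_ideal V"
    unfolding Neq using ideal_subspace[OF free_algebra_calg I(1)] A.span_subset by blast
  moreover have "tensor_ideal V \<subseteq> ?N"
    unfolding tensor_ideal_def by (rule A.A.genideal_minimal[OF idN SN])
  ultimately show "tensor_ideal V = ?N" by auto
  show "ideal (tensor_ideal V) ?A" by (rule I)
qed

definition multilinear ::
    "(complex, 'v, 'y) module_scheme \<Rightarrow> (complex, 'w, 'z) module_scheme \<Rightarrow> ('v list \<Rightarrow> 'w) \<Rightarrow> bool" where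
  "multilinear V X f \<longleftrightarrow>
    (\<forall>ws\<in>lists (carrier V). f ws \<in> carrier X) \<and>
    (\<forall>u\<in>lists (carrier V). \<forall>s\<in>lists (carrier V). (\<lambda>v. f (u @ v # s)) \<in> lin_maps V X)"

text \<open>\<open>T\<close> may carry more structure than the quotient algebra; it will be the record with action and grading.\<close>

locale tensor = cspace V for V :: "(complex, 'v, 'z) module_scheme" +
  fixes T :: "(complex, ('v list \<Rightarrow>\<^sub>0 complex) set, 'y) module_scheme"
  assumes T_eq: "carrier T = carrier (quot_module (free_algebra (carrier V)) (tensor_ideal V))"
    "add T = add (quot_module (free_algebra (carrier V)) (tensor_ideal V))"
    "zero T = zero (quot_module (free_algebra (carrier V)) (tensor_ideal V))"
    "smult T = smult (quot_module (free_algebra (carrier V)) (tensor_ideal V))"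
    "mult T = mult (quot_module (free_algebra (carrier V)) (tensor_ideal V))"
    "one T = one (quot_module (free_algebra (carrier V)) (tensor_ideal V))"
begin

abbreviation "F \<equiv> free_space (lists (carrier V))"
abbreviation "W \<equiv> tensor_word V"

lemmas same_quot = same_quot_module[OF free_algebra_same(1,2,4)]

sublocale P: presented "lists (carrier V)" "tensor_ideal V" T "tensor_rels V"
  by (rule presentedI[OF tensor_rels_closed[OF cspace_axioms] tensor_ideal_eq(1)[OF cspace_axioms]])
    (simp_all only: T_eq same_quot)

lemma W_gen: "W ws = P.gen ws"
  unfolding tensor_word_def same_cosets(1)[OF free_algebra_same(1,2)] ..

lemma W_closed [simp]: "ws \<in> lists (carrier V) \<Longrightarrow> W ws \<in> carrier T"
  by (simp only: W_gen P.gen_closed)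

lemma W_span: "x \<in> carrier T \<Longrightarrow> x \<in> CC_span T (W ` lists (carrier V))"
  using P.gens_span[of x] unfolding ext[of W P.gen, OF W_gen] .

lemma W_lin_eq:
  assumes "f \<in> lin_maps T X" "g \<in> lin_maps T X" "cspace X"
    "\<And>ws. ws \<in> lists (carrier V) \<Longrightarrow> f (W ws) = g (W ws)" "x \<in> carrier T"
  shows "f x = g x"
  by (rule P.Q_lin_eq[OF assms(1,2,3) _ assms(5)]) (use assms(4) in \<open>simp only: W_gen\<close>)

text \<open>The universal property of \<open>T(V)\<close> as a vector space. It produces the grading, the comultiplication,
  the counit and the functionals \<open>letter\<close> below, each from its value on words.\<close>

lemma lift_multilinear:
  assumes X: "cspace X" and f: "multilinear V X f"
  shows "\<exists>k \<in> lin_maps T X. \<forall>ws\<in>lists (carrier V). k (W ws) = f ws"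
proof -
  interpret X: cspace X by fact
  have fc: "f ws \<in> carrier X" if "ws \<in> lists (carrier V)" for ws
    using f that unfolding multilinear_def by blast
  have fl: "(\<lambda>v. f (u @ v # s)) \<in> lin_maps V X" if "u \<in> lists (carrier V)" "s \<in> lists (carrier V)" for u s
    using f that unfolding multilinear_def by blast
  have e: "extend X f \<in> lin_maps F X" using fc by (intro extend_lin X) auto
  have sc: "Poly_Mapping.single w c \<in> carrier F" if "w \<in> lists (carrier V)" for w c
    using that by simp
  have dc: "q - q' \<in> carrier F" if "q \<in> carrier F" "q' \<in> carrier F" for q q'
    using that keys_diff_subset by simp
  have ed: "extend X f (p - q) = extend X f p \<oplus>\<^bsub>X\<^esub> (-1) \<odot>\<^bsub>X\<^esub> extend X f q"
    if "p \<in> carrier F" "q \<in> carrier F" for p q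
    unfolding free_space_minus[OF that, symmetric]
      linD(2)[OF e that(1) P.sm_closed[OF that(2)]] linD(3)[OF e that(2)] ..
  have es: "extend X f (Poly_Mapping.single w c) = c \<odot>\<^bsub>X\<^esub> f w" if "w \<in> lists (carrier V)" for w c
    by (rule extend_single[where f = f, OF X fc[OF that]])
  have "extend X f r = \<zero>\<^bsub>X\<^esub>" if "r \<in> tensor_rels V" for r
    using that
  proof (cases rule: tensor_relsE)
    case (add u s v w)
    have l: "u @ v # s \<in> lists (carrier V)" "u @ w # s \<in> lists (carrier V)"
      "u @ (v \<oplus>\<^bsub>V\<^esub> w) # s \<in> lists (carrier V)" using add by auto
    have "extend X f r = f (u @ v # s) \<oplus>\<^bsub>X\<^esub> f (u @ w # s) \<oplus>\<^bsub>X\<^esub> (-1) \<odot>\<^bsub>X\<^esub> f (u @ v # s) \<oplus>\<^bsub>X\<^esub> (-1) \<odot>\<^bsub>X\<^esub> f (u @ w # s)"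
      unfolding add(5) ed[OF dc[OF sc[OF l(3)] sc[OF l(1)]] sc[OF l(2)]] ed[OF sc[OF l(3)] sc[OF l(1)]]
        es[OF l(1)] es[OF l(2)] es[OF l(3)] linD(2)[OF fl[OF add(1,2)] add(3,4)]
      using fc[OF l(1)] fc[OF l(2)] by simp
    also have "\<dots> = (f (u @ v # s) \<oplus>\<^bsub>X\<^esub> (-1) \<odot>\<^bsub>X\<^esub> f (u @ v # s)) \<oplus>\<^bsub>X\<^esub> (f (u @ w # s) \<oplus>\<^bsub>X\<^esub> (-1) \<odot>\<^bsub>X\<^esub> f (u @ w # s))"
      using fc[OF l(1)] fc[OF l(2)] by (simp add: X.a_ac)
    finally show ?thesis
      using fc[OF l(1)] fc[OF l(2)] by (simp add: X.minus_sm[symmetric] X.minus_eq X.r_neg)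
  next
    case (sm u s c v)
    have l: "u @ v # s \<in> lists (carrier V)"
      "u @ (c \<odot>\<^bsub>V\<^esub> v) # s \<in> lists (carrier V)" using sm by auto
    show ?thesis
      unfolding sm(4) ed[OF sc[OF l(2)] sc[OF l(1)]]
        es[OF l(1)] es[OF l(2)] linD(3)[OF fl[OF sm(1,2)] sm(3)]
      using fc[OF l(1)] by (simp add: X.minus_sm[symmetric] X.minus_eq X.r_neg)
  qed
  from P.lift_gens[OF X _ this] fc show ?thesis by (simp add: W_gen)
qed

lemma mult_cls:
  assumes "p \<in> carrier F" "q \<in> carrier F"
  shows "P.cls p \<otimes>\<^bsub>T\<^esub> P.cls q = P.cls (p \<otimes>\<^bsub>free_algebra (carrier V)\<^esub> q)"
proof -
  interpret I: ideal "tensor_ideal V" "free_algebra (carrier V)"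
    by (rule tensor_ideal_eq(2)[OF cspace_axioms])
  have "rcoset_mult (free_algebra (carrier V)) (tensor_ideal V)
      (tensor_ideal V +>\<^bsub>free_algebra (carrier V)\<^esub> p) (tensor_ideal V +>\<^bsub>free_algebra (carrier V)\<^esub> q)
    = tensor_ideal V +>\<^bsub>free_algebra (carrier V)\<^esub> (p \<otimes>\<^bsub>free_algebra (carrier V)\<^esub> q)"
    by (rule I.rcoset_mult_add) (use assms in simp_all)
  then show ?thesis
    unfolding T_eq quot_module_def FactRing_def monoid.simps same_cosets(1)[OF free_algebra_same(1,2)] .
qed

lemma one_W: "\<one>\<^bsub>T\<^esub> = W []"
  unfolding T_eq quot_module_def FactRing_def monoid.simps tensor_word_def free_algebra_simps ..

lemma W_append: "u \<in> lists (carrier V) \<Longrightarrow> s \<in> lists (carrier V) \<Longrightarrow> W u \<otimes>\<^bsub>T\<^esub> W s = W (u @ s)"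
  unfolding W_gen by (subst mult_cls) auto

sublocale C: calg T
proof -
  interpret A: calg "free_algebra (carrier V)" by (rule free_algebra_calg)
  note same = free_algebra_same[of "carrier V"]
  have L: "f \<in> lin_maps T T" if "\<And>x. x \<in> carrier F \<Longrightarrow> f (P.cls x) = P.cls (g x)" "g \<in> lin_maps F F" for f g
    by (rule linI) (use linD[OF that(2)] in \<open>auto simp: P.carrier_Q that(1) P.add_Q P.sm_Q simp del: free_space_simps\<close>)
  show "calg T"
  proof (rule calgI[OF P.Q_cspace _ W_span])
    show "(\<lambda>x. x \<otimes>\<^bsub>T\<^esub> y) \<in> lin_maps T T" if y: "y \<in> carrier T" for y
    proof -
      obtain q where q: "q \<in> carrier F" "y = P.cls q" using y by (auto simp: P.carrier_Q)
      show ?thesis unfolding q(2)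
        by (rule L[of _ "\<lambda>p. p \<otimes>\<^bsub>free_algebra (carrier V)\<^esub> q"])
          (use q mult_cls A.mult_lin_l[of q] in \<open>simp_all only: free_algebra_lin same\<close>)
    qed
    show "(\<lambda>y. x \<otimes>\<^bsub>T\<^esub> y) \<in> lin_maps T T" if x: "x \<in> carrier T" for x
    proof -
      obtain q where q: "q \<in> carrier F" "x = P.cls q" using x by (auto simp: P.carrier_Q)
      show ?thesis unfolding q(2)
        by (rule L[of _ "\<lambda>p. q \<otimes>\<^bsub>free_algebra (carrier V)\<^esub> p"])
          (use q mult_cls A.mult_lin_r[of q] in \<open>simp_all only: free_algebra_lin same\<close>)
    qed
    show "W ` lists (carrier V) \<subseteq> carrier T" using W_closed by blast
  qed (auto simp: one_W W_append intro: W_closed)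
qed

lemma W_multilinear: "multilinear V T W"
  unfolding multilinear_def
proof (intro conjI ballI)
  fix u s assume us: "u \<in> lists (carrier V)" "s \<in> lists (carrier V)"
  have rel: "P.cls r = P.cls \<zero>\<^bsub>F\<^esub>" if "r \<in> tensor_rels V" for r
    using that P.rels P.N P.span_base P.cls_zero_iff by blast
  have sc: "Poly_Mapping.single w c \<in> carrier F" if "w \<in> lists (carrier V)" for w c
    using that by simp
  show "(\<lambda>v. W (u @ v # s)) \<in> lin_maps V T"
  proof (rule linI)
    fix v assume v: "v \<in> carrier V"
    then show "W (u @ v # s) \<in> carrier T" using us by (intro W_closed) simp
    fix c
    let ?p = "Poly_Mapping.single (u @ (c \<odot>\<^bsub>V\<^esub> v) # s) 1" and ?q = "Poly_Mapping.single (u @ v # s) c"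
    have pq: "?p \<in> carrier F" "?q \<in> carrier F" "Poly_Mapping.single (u @ v # s) 1 \<in> carrier F" using us v by auto
    have "?p - ?q \<in> tensor_rels V"
      unfolding tensor_rels_def using us v by blast
    then have "?p - ?q \<in> tensor_ideal V"
      using P.rels P.N P.span_base by blast
    then have "P.cls ?p = P.cls ?q"
      using pq by (simp add: P.cls_eq_iff free_space_minus del: free_space_simps)
    also have "\<dots> = c \<odot>\<^bsub>T\<^esub> W (u @ v # s)"
      unfolding W_gen P.sm_Q[OF pq(3)] by simp
    finally show "W (u @ (c \<odot>\<^bsub>V\<^esub> v) # s) = c \<odot>\<^bsub>T\<^esub> W (u @ v # s)" unfolding W_gen .
  next
    fix v w assume v: "v \<in> carrier V" and w: "w \<in> carrier V"
    let ?p = "Poly_Mapping.single (u @ (v \<oplus>\<^bsub>V\<^esub> w) # s) (1::complex)" and ?q = "Poly_Mapping.single (u @ v # s) (1::complex)"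
    let ?r = "Poly_Mapping.single (u @ w # s) (1::complex)"
    have pq: "?p \<in> carrier F" "?q \<in> carrier F" "?r \<in> carrier F" "?q + ?r \<in> carrier F"
      using us v w P.a_closed[of ?q ?r] by auto
    have "?p - ?q - ?r \<in> tensor_rels V"
      unfolding tensor_rels_def using us v w by blast
    then have "?p - ?q - ?r \<in> tensor_ideal V"
      using P.rels P.N P.span_base by blast
    then have "P.cls ?p = P.cls (?q + ?r)"
      using pq by (simp add: P.cls_eq_iff free_space_minus diff_diff_add del: free_space_simps)
    also have "\<dots> = W (u @ v # s) \<oplus>\<^bsub>T\<^esub> W (u @ w # s)"
      unfolding W_gen P.add_Q[OF pq(2,3)] by simp
    finally show "W (u @ (v \<oplus>\<^bsub>V\<^esub> w) # s) = W (u @ v # s) \<oplus>\<^bsub>T\<^esub> W (u @ w # s)" unfolding W_gen .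
  qed
qed (rule W_closed)

lemma bilinear_eq:
  assumes X: "cspace X"
    and f: "\<And>x. x \<in> carrier T \<Longrightarrow> f x \<in> lin_maps T X" "\<And>y. y \<in> carrier T \<Longrightarrow> (\<lambda>x. f x y) \<in> lin_maps T X"
    and g: "\<And>x. x \<in> carrier T \<Longrightarrow> g x \<in> lin_maps T X" "\<And>y. y \<in> carrier T \<Longrightarrow> (\<lambda>x. g x y) \<in> lin_maps T X"
    and eq: "\<And>u s. u \<in> lists (carrier V) \<Longrightarrow> s \<in> lists (carrier V) \<Longrightarrow> f (W u) (W s) = g (W u) (W s)"
    and x: "x \<in> carrier T" and y: "y \<in> carrier T"
  shows "f x y = g x y"
proof -
  have "f (W u) y = g (W u) y" if "u \<in> lists (carrier V)" for u
    by (rule W_lin_eq[OF f(1) g(1) X _ y]) (use that eq in auto)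
  then show ?thesis
    by (rule W_lin_eq[OF f(2)[OF y] g(2)[OF y] X _ x])
qed

lemma mult_hom_words:
  assumes X: "calg X" and f: "f \<in> lin_maps T X"
    and eq: "\<And>u s. u \<in> lists (carrier V) \<Longrightarrow> s \<in> lists (carrier V) \<Longrightarrow> f (W (u @ s)) = f (W u) \<otimes>\<^bsub>X\<^esub> f (W s)"
    and x: "x \<in> carrier T" and y: "y \<in> carrier T"
  shows "f (x \<otimes>\<^bsub>T\<^esub> y) = f x \<otimes>\<^bsub>X\<^esub> f y"
proof -
  interpret X: calg X by fact
  show ?thesis
    by (rule bilinear_eq[of X "\<lambda>x y. f (x \<otimes>\<^bsub>T\<^esub> y)" "\<lambda>x y. f x \<otimes>\<^bsub>X\<^esub> f y"])
      (auto intro: X.cspace_axioms lin_comp[OF C.mult_lin_l f] lin_comp[OF C.mult_lin_r f]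
        lin_comp[OF f X.mult_lin_l] lin_comp[OF f X.mult_lin_r] linD(1)[OF f]
        simp: W_append eq x y)
qed

end

section \<open>Gradings\<close>

text \<open>For a finite group the homogeneous decomposition can be summed over the whole group, which avoids supports.\<close>

locale graded = cspace X + G: group G
  for G :: "('g, 'm) monoid_scheme" and X :: "('g, 'v, 'z) ydmod_scheme" +
  assumes finG: "finite (carrier G)"
    and homog_sub: "g \<in> carrier G \<Longrightarrow> VectorSpace.subspace CC (homog X g) X"
    and decomp: "v \<in> carrier X \<Longrightarrow> \<exists>!f. is_homog_decomp G X v f"
begin

abbreviation part :: "'v \<Rightarrow> 'g \<Rightarrow> 'v" where "part \<equiv> homog_part G X"

lemma homog_closed: "g \<in> carrier G \<Longrightarrow> x \<in> homog X g \<Longrightarrow> x \<in> carrier X"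
  using subspaceD(1)[OF homog_sub] by auto

lemma finsum_support:
  assumes "f \<in> carrier G \<rightarrow> carrier X"
  shows "finsum X f {g \<in> carrier G. f g \<noteq> \<zero>\<^bsub>X\<^esub>} = finsum X f (carrier G)"
  by (rule add.finprod_mono_neutral_cong_left) (use assms finG in auto)

lemma part_unique:
  assumes v: "v \<in> carrier X" and f: "\<And>g. g \<in> carrier G \<Longrightarrow> f g \<in> homog X g"
    and sum: "v = finsum X f (carrier G)" and g: "g \<in> carrier G"
  shows "part v g = f g"
proof -
  let ?f = "restrict f (carrier G)"
  have fc: "?f \<in> carrier G \<rightarrow> carrier X" using f homog_closed by auto
  have "finsum X ?f (carrier G) = finsum X f (carrier G)"
    by (rule finsum_cong') (use f homog_closed in auto)
  then have "is_homog_decomp G X v ?f"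
    unfolding is_homog_decomp_def finsum_support[OF fc] using f finG sum by auto
  then have "part v = ?f"
    unfolding homog_part_def using decomp[OF v] by (intro the1_equality)
  then show ?thesis using g by simp
qed

lemma part_decomp: "v \<in> carrier X \<Longrightarrow> is_homog_decomp G X v (part v)"
  unfolding homog_part_def by (rule theI'[OF decomp])

lemma part_homog: "v \<in> carrier X \<Longrightarrow> g \<in> carrier G \<Longrightarrow> part v g \<in> homog X g"
  using part_decomp[of v] unfolding is_homog_decomp_def by (auto simp: PiE_iff)

lemma part_closed [simp]: "v \<in> carrier X \<Longrightarrow> g \<in> carrier G \<Longrightarrow> part v g \<in> carrier X"
  using part_homog homog_closed by blast

lemma part_sum: "v \<in> carrier X \<Longrightarrow> v = finsum X (part v) (carrier G)"
  using part_decomp[of v] finsum_support[of "part v"] unfolding is_homog_decomp_def by auto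

lemma part_lin: "g \<in> carrier G \<Longrightarrow> (\<lambda>v. part v g) \<in> lin_maps X X"
proof (rule linI)
  fix v w c assume g: "g \<in> carrier G" and v: "v \<in> carrier X"
  show "part v g \<in> carrier X" using g v by simp
  show "part (c \<odot>\<^bsub>X\<^esub> v) g = c \<odot>\<^bsub>X\<^esub> part v g"
  proof (rule part_unique[OF _ _ _ g, of _ "\<lambda>g. c \<odot>\<^bsub>X\<^esub> part v g"])
    have "c \<odot>\<^bsub>X\<^esub> v = c \<odot>\<^bsub>X\<^esub> finsum X (part v) (carrier G)" using part_sum[OF v] by simp
    also have "\<dots> = finsum X (\<lambda>g. c \<odot>\<^bsub>X\<^esub> part v g) (carrier G)"
      using v by (intro finsum_sm) auto
    finally show "c \<odot>\<^bsub>X\<^esub> v = finsum X (\<lambda>g. c \<odot>\<^bsub>X\<^esub> part v g) (carrier G)" .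
  qed (use v part_homog subspaceD(4)[OF homog_sub] in auto)
  assume w: "w \<in> carrier X"
  show "part (v \<oplus>\<^bsub>X\<^esub> w) g = part v g \<oplus>\<^bsub>X\<^esub> part w g"
  proof (rule part_unique[OF _ _ _ g, of _ "\<lambda>g. part v g \<oplus>\<^bsub>X\<^esub> part w g"])
    have "v \<oplus>\<^bsub>X\<^esub> w = finsum X (part v) (carrier G) \<oplus>\<^bsub>X\<^esub> finsum X (part w) (carrier G)"
      using part_sum[OF v] part_sum[OF w] by simp
    also have "\<dots> = finsum X (\<lambda>g. part v g \<oplus>\<^bsub>X\<^esub> part w g) (carrier G)"
      using v w by (intro finsum_addf[symmetric]) auto
    finally show "v \<oplus>\<^bsub>X\<^esub> w = finsum X (\<lambda>g. part v g \<oplus>\<^bsub>X\<^esub> part w g) (carrier G)" .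
  qed (use v w part_homog subspaceD(3)[OF homog_sub] in auto)
qed

lemma zero_homog: "g \<in> carrier G \<Longrightarrow> \<zero>\<^bsub>X\<^esub> \<in> homog X g"
  using subspaceD(2)[OF homog_sub] .

lemma part_of_homog:
  assumes "h \<in> carrier G" "x \<in> homog X h" "g \<in> carrier G"
  shows "part x g = (if g = h then x else \<zero>\<^bsub>X\<^esub>)"
proof (rule part_unique[OF _ _ _ assms(3), of _ "\<lambda>g. if g = h then x else \<zero>\<^bsub>X\<^esub>"])
  show "x \<in> carrier X" using assms homog_closed by auto
  then show "x = (\<Oplus>\<^bsub>X\<^esub>g\<in>carrier G. if g = h then x else \<zero>\<^bsub>X\<^esub>)"
    using assms(1) finG by (simp add: finsum_single)
qed (use assms zero_homog in auto)

lemma homog_span: "x \<in> carrier X \<Longrightarrow> x \<in> CC_span X (\<Union>g\<in>carrier G. homog X g)"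
proof -
  assume x: "x \<in> carrier X"
  have H: "(\<Union>g\<in>carrier G. homog X g) \<subseteq> carrier X" using homog_closed by auto
  have "finsum X (part x) (carrier G) \<in> CC_span X (\<Union>g\<in>carrier G. homog X g)"
    by (rule subspace_finsum[OF span_is_subspace[OF H]]) (use x part_homog span_base[OF H] in blast)
  then show ?thesis using part_sum[OF x] by simp
qed

end

text \<open>Existence and uniqueness of decompositions both follow from linear maps \<open>P g\<close> that behave like the
  projections on spanning sets \<open>H g\<close>: \<open>\<Sum>\<^sub>g P g\<close> is then the identity, and \<open>P g\<close> recovers the component of
  degree \<open>g\<close> from any decomposition.\<close>

lemma gradedI:
  assumes X: "cspace X" and G: "group G" and fin: "finite (carrier G)"
    and H: "\<And>g. g \<in> carrier G \<Longrightarrow> H g \<subseteq> carrier X" "\<And>g. g \<in> carrier G \<Longrightarrow> homog X g = CC_span X (H g)"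
    and sp: "\<And>x. x \<in> carrier X \<Longrightarrow> x \<in> CC_span X (\<Union>g\<in>carrier G. H g)"
    and P: "\<And>g. g \<in> carrier G \<Longrightarrow> P g \<in> lin_maps X X"
    and PH: "\<And>g h x. g \<in> carrier G \<Longrightarrow> h \<in> carrier G \<Longrightarrow> x \<in> H h \<Longrightarrow> P g x = (if g = h then x else \<zero>\<^bsub>X\<^esub>)"
  shows "graded G X"
proof -
  interpret X: cspace X by fact
  interpret G: group G by fact
  have HU: "(\<Union>g\<in>carrier G. H g) \<subseteq> carrier X" using H by auto
  have sub: "VectorSpace.subspace CC (homog X g) X" if "g \<in> carrier G" for g
    unfolding H(2)[OF that] by (rule X.span_is_subspace[OF H(1)[OF that]])
  have cl: "x \<in> carrier X" if "g \<in> carrier G" "x \<in> homog X g" for x g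
    using X.subspaceD(1)[OF sub[OF that(1)]] that by auto
  have Ph: "P g x = (if g = h then x else \<zero>\<^bsub>X\<^esub>)" if "g \<in> carrier G" "h \<in> carrier G" "x \<in> homog X h" for g h x
  proof (rule lin_eq_on_span[OF P[OF that(1)] _ X X H(1)[OF that(2)]])
    show "(\<lambda>x. if g = h then x else \<zero>\<^bsub>X\<^esub>) \<in> lin_maps X X"
      by (cases "g = h") (simp_all add: lin_id lin_const_zero X)
  qed (use that H PH in auto)
  have in_homog: "P g x \<in> homog X g" if "g \<in> carrier G" "x \<in> carrier X" for g x
    by (rule lin_span_image[OF P[OF that(1)] X X HU sub[OF that(1)] _ sp[OF that(2)]])
      (use PH that H X.span_base X.subspaceD(2)[OF sub[OF that(1)]] in auto)
  have total: "x = finsum X (\<lambda>g. P g x) (carrier G)" if x: "x \<in> carrier X" for x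
  proof (rule lin_eq_on_span[OF lin_id lin_finsum_maps[OF P X] X X HU sp[OF x]])
    fix s assume "s \<in> (\<Union>g\<in>carrier G. H g)"
    then obtain h where h: "h \<in> carrier G" "s \<in> H h" by auto
    have "finsum X (\<lambda>g. P g s) (carrier G) = finsum X (\<lambda>g. if g = h then s else \<zero>\<^bsub>X\<^esub>) (carrier G)"
      using h subsetD[OF H(1)[OF h(1)] h(2)] PH by (intro X.finsum_cong') auto
    then show "s = finsum X (\<lambda>g. P g s) (carrier G)"
      using h(1) subsetD[OF H(1)[OF h(1)] h(2)] fin by (simp add: X.finsum_single)
  qed auto
  have "\<exists>!f. is_homog_decomp G X x f" if x: "x \<in> carrier X" for x
  proof (rule ex1I)
    let ?f = "\<lambda>g\<in>carrier G. P g x"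
    have supp: "finsum X f {g \<in> carrier G. f g \<noteq> \<zero>\<^bsub>X\<^esub>} = finsum X f (carrier G)"
      if "f \<in> carrier G \<rightarrow> carrier X" for f
      by (rule X.add.finprod_mono_neutral_cong_left) (use that fin in auto)
    have fc: "?f \<in> carrier G \<rightarrow> carrier X" using cl in_homog x by auto
    have "finsum X ?f (carrier G) = finsum X (\<lambda>g. P g x) (carrier G)"
      by (rule X.finsum_cong') (use cl in_homog x in auto)
    then show "is_homog_decomp G X x ?f"
      unfolding is_homog_decomp_def supp[OF fc] using in_homog fin total x by auto
    fix f assume f: "is_homog_decomp G X x f"
    then have fh: "f g \<in> homog X g" if "g \<in> carrier G" for g
      using that by (auto simp: is_homog_decomp_def PiE_iff)
    then have fc: "f \<in> carrier G \<rightarrow> carrier X" using cl by auto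
    have xs: "x = finsum X f (carrier G)" using f supp[OF fc] by (simp add: is_homog_decomp_def)
    have "P g x = f g" if g: "g \<in> carrier G" for g
    proof -
      have "P g x = finsum X (\<lambda>h. P g (f h)) (carrier G)"
        using lin_finsum[OF P[OF g] X X fc] xs by simp
      also have "\<dots> = finsum X (\<lambda>h. if h = g then f g else \<zero>\<^bsub>X\<^esub>) (carrier G)"
        using Ph[OF g] fh cl g by (intro X.finsum_cong') auto
      finally show ?thesis using X.finsum_single[OF fin g cl[OF g fh[OF g]]] by simp
    qed
    then show "f = ?f"
      using f by (intro extensionalityI[of f "carrier G"]) (auto simp: is_homog_decomp_def PiE_iff)
  qed
  then show ?thesis using X G fin sub by (intro graded.intro graded_axioms.intro)
qed

section \<open>The tensor algebra of a Yetter-Drinfeld module\<close>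

locale yd_tensor = yd_module G V for G :: "('g, 'm) monoid_scheme" and V :: "('g, 'v, 'z) ydmod_scheme" +
  assumes finite_group: "finite (carrier G)"
begin

abbreviation "T \<equiv> tensor_algebra G V"

lemma V_cspace: "cspace V"
  unfolding cspace_def ..

sublocale V: graded G V
  using V_cspace G.group_axioms finite_group homog_subspace homog_direct_sum
  by (intro graded.intro graded_axioms.intro)

sublocale T: tensor V T
  by (intro tensor.intro tensor_axioms.intro V_cspace)
    (simp_all add: tensor_algebra_def module.defs ydmod.defs Let_def)

abbreviation "W \<equiv> tensor_word V"
abbreviation "words \<equiv> lists (carrier V)"

lemma act_T: "act T g = coset_map (free_algebra (carrier V)) (tensor_ideal V)
         (lin_ext (\<lambda>vs. Poly_Mapping.single (map (act V g) vs) 1))"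
  by (simp add: tensor_algebra_def module.defs ydmod.defs Let_def)

definition hwords :: "'g \<Rightarrow> ('v list \<Rightarrow>\<^sub>0 complex) set set" where
  "hwords g = {W vs | vs gs. list_all2 (\<lambda>v h. h \<in> carrier G \<and> v \<in> homog V h) vs gs \<and>
         foldr (mult G) gs \<one>\<^bsub>G\<^esub> = g}"

lemma homog_T: "homog T g = CC_span T (hwords g)"
proof -
  have "homog T g = CC_span (quot_module (free_algebra (carrier V)) (tensor_ideal V)) (hwords g)"
    by (simp add: tensor_algebra_def module.defs ydmod.defs Let_def hwords_def)
  then show ?thesis
    by (subst same_module(2)[OF T.P.Q_cspace, symmetric]) (simp_all add: T.T_eq)
qed

lemma act_V_closed [simp]: "g \<in> carrier G \<Longrightarrow> v \<in> carrier V \<Longrightarrow> act V g v \<in> carrier V"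
  using linD(1)[OF act_linear] .

lemma map_act_words [simp]: "g \<in> carrier G \<Longrightarrow> ws \<in> words \<Longrightarrow> map (act V g) ws \<in> words"
  by (induction ws) auto

lemma act_W_and_lin:
  assumes g: "g \<in> carrier G"
  shows act_W: "ws \<in> words \<Longrightarrow> act T g (W ws) = W (map (act V g) ws)"
    and act_lin: "act T g \<in> lin_maps T T"
proof -
  let ?f = "lin_ext (\<lambda>vs. Poly_Mapping.single (map (act V g) vs) (1::complex))"
  let ?m = "map (act V g)"
  have f: "?f \<in> lin_maps T.F T.F"
    by (rule lin_ext_lin) (use g in simp)
  have fd: "?f (p - q) = ?f p - ?f q" for p q
  proof -
    have f': "?f \<in> lin_maps (free_space UNIV) (free_space UNIV)" by (rule lin_ext_lin) simp
    have m: "a - b = a + Poly_Mapping.map ((*) (-1)) b" for a b :: "'w \<Rightarrow>\<^sub>0 complex"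
      by (rule poly_mapping_eqI) (simp add: lookup_minus lookup_add)
    show ?thesis unfolding m using linD(2,3)[OF f'] by simp
  qed
  have fr: "?f r \<in> tensor_rels V" if "r \<in> tensor_rels V" for r
    using that
  proof (cases rule: tensor_relsE)
    case (add u s v w)
    have "?f r = Poly_Mapping.single (?m u @ (act V g v \<oplus>\<^bsub>V\<^esub> act V g w) # ?m s) 1
        - Poly_Mapping.single (?m u @ act V g v # ?m s) 1 - Poly_Mapping.single (?m u @ act V g w # ?m s) 1"
      unfolding add(5) fd using add linD(2)[OF act_linear[OF g]] by simp
    moreover have "?m u \<in> words" "?m s \<in> words" "act V g v \<in> carrier V" "act V g w \<in> carrier V"
      using g add by auto
    ultimately show ?thesis unfolding tensor_rels_def by blast
  next
    case (sm u s c v)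
    have "?f r = Poly_Mapping.single (?m u @ (c \<odot>\<^bsub>V\<^esub> act V g v) # ?m s) 1
        - Poly_Mapping.single (?m u @ act V g v # ?m s) c"
      unfolding sm(4) fd using sm linD(3)[OF act_linear[OF g]] by simp
    moreover have "?m u \<in> words" "?m s \<in> words" "act V g v \<in> carrier V"
      using g sm by auto
    ultimately show ?thesis unfolding tensor_rels_def by blast
  qed
  have "?f n \<in> tensor_ideal V" if "n \<in> tensor_ideal V" for n
    by (rule lin_span_image[OF f free_space_cspace free_space_cspace T.P.rels T.P.sub])
      (use fr T.P.N T.P.span_base[OF T.P.rels] that in auto)
  then have fN: "?f ` tensor_ideal V \<subseteq> tensor_ideal V" by auto
  have c: "act T g = coset_map T.F (tensor_ideal V) ?f"
    unfolding act_T coset_map_def same_cosets(1)[OF free_algebra_same(1,2)] ..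
  have cl: "act T g (T.P.cls p) = T.P.cls (?f p)" if "p \<in> carrier T.F" for p
    unfolding c by (rule T.P.coset_map_lin[OF f fN that])
  show "act T g (W ws) = W (map (act V g) ws)" if "ws \<in> words"
  proof -
    have "Poly_Mapping.single ws 1 \<in> carrier T.F" using that by simp
    from cl[OF this] show ?thesis unfolding T.W_gen by simp
  qed
  show "act T g \<in> lin_maps T T"
    by (rule linI) (use linD[OF f] in \<open>auto simp: T.P.carrier_Q cl T.P.add_Q T.P.sm_Q simp del: free_space_simps\<close>)
qed

lemma act_closed [simp]: "g \<in> carrier G \<Longrightarrow> x \<in> carrier T \<Longrightarrow> act T g x \<in> carrier T"
  using linD(1)[OF act_lin] .

lemma act_mult_T:
  assumes g: "g \<in> carrier G" and "x \<in> carrier T" "y \<in> carrier T"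
  shows "act T g (x \<otimes>\<^bsub>T\<^esub> y) = act T g x \<otimes>\<^bsub>T\<^esub> act T g y"
  by (rule T.mult_hom_words[OF T.C.calg_axioms act_lin[OF g] _ assms(2,3)])
    (use g in \<open>simp add: act_W T.W_append\<close>)

lemma act_act_T:
  assumes "g \<in> carrier G" "h \<in> carrier G" "x \<in> carrier T"
  shows "act T g (act T h x) = act T (g \<otimes>\<^bsub>G\<^esub> h) x"
proof (rule T.W_lin_eq[OF lin_comp[OF act_lin act_lin] act_lin T.P.Q_cspace _ assms(3)])
  fix ws assume ws: "ws \<in> words"
  have "map (act V g) (map (act V h) ws) = map (act V (g \<otimes>\<^bsub>G\<^esub> h)) ws"
    using ws by (induction ws) (auto simp: act_mult assms)
  then show "act T g (act T h (W ws)) = act T (g \<otimes>\<^bsub>G\<^esub> h) (W ws)"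
    using ws map_act_words[OF assms(2) ws] G.m_closed[OF assms(1,2)] assms by (simp only: act_W)
qed (use assms in auto)

lemma act_one_T: "g \<in> carrier G \<Longrightarrow> act T g \<one>\<^bsub>T\<^esub> = \<one>\<^bsub>T\<^esub>"
  by (simp add: T.one_W act_W)

subsection \<open>The grading of the tensor algebra\<close>

lemma homog_words:
  "list_all2 (\<lambda>v h. h \<in> carrier G \<and> v \<in> homog V h) vs gs \<Longrightarrow> vs \<in> words"
  by (induction rule: list_all2_induct) (auto intro: V.homog_closed)

lemma hwordsI:
  "list_all2 (\<lambda>v h. h \<in> carrier G \<and> v \<in> homog V h) vs gs \<Longrightarrow> W vs \<in> hwords (foldr (mult G) gs \<one>\<^bsub>G\<^esub>)"
  unfolding hwords_def by (intro CollectI exI[of _ vs] exI[of _ gs]) simp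

lemma hwordsE:
  assumes "x \<in> hwords g"
  obtains vs gs where "x = W vs" "list_all2 (\<lambda>v h. h \<in> carrier G \<and> v \<in> homog V h) vs gs"
    "foldr (mult G) gs \<one>\<^bsub>G\<^esub> = g"
  using assms unfolding hwords_def mem_Collect_eq by (elim exE conjE) (rule that)

lemma hwords_closed: "hwords g \<subseteq> carrier T"
  unfolding hwords_def by (auto intro: T.W_closed homog_words)

lemma W1_lin: "(\<lambda>v. W [v]) \<in> lin_maps V T"
proof -
  have "(\<lambda>v. W ([] @ v # [])) \<in> lin_maps V T"
    using T.W_multilinear lists.Nil unfolding multilinear_def by blast
  then show ?thesis by simp
qed

lemma W_Cons: "v \<in> carrier V \<Longrightarrow> ws \<in> words \<Longrightarrow> W (v # ws) = W [v] \<otimes>\<^bsub>T\<^esub> W ws"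
  by (simp add: T.W_append)

text \<open>The component of degree \<open>g\<close> of the word \<open>v\<^sub>1 \<dots> v\<^sub>n\<close> is the sum of the words of components
\<open>(v\<^sub>1)\<^sub>h\<^sub>1 \<dots> (v\<^sub>n)\<^sub>h\<^sub>n\<close> with \<open>h\<^sub>1 \<dots> h\<^sub>n = g\<close>. Splitting off the first letter gives the recursion. It is
multilinear and therefore defines a projection of \<open>T(V)\<close>.\<close>

fun word_part :: "'v list \<Rightarrow> 'g \<Rightarrow> ('v list \<Rightarrow>\<^sub>0 complex) set" where
  "word_part [] g = (if g = \<one>\<^bsub>G\<^esub> then \<one>\<^bsub>T\<^esub> else \<zero>\<^bsub>T\<^esub>)"
| "word_part (v # ws) g =
    finsum T (\<lambda>h. W [V.part v h] \<otimes>\<^bsub>T\<^esub> word_part ws (inv\<^bsub>G\<^esub> h \<otimes>\<^bsub>G\<^esub> g)) (carrier G)"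

lemma word_part_closed [simp]: "ws \<in> words \<Longrightarrow> g \<in> carrier G \<Longrightarrow> word_part ws g \<in> carrier T"
  by (induction ws arbitrary: g)
    (auto intro!: T.C.finsum_closed T.C.A.m_closed T.W_closed simp: T.C.zero_closed)

lemma word_part_multilinear: "g \<in> carrier G \<Longrightarrow> multilinear V T (\<lambda>ws. word_part ws g)"
proof -
  have "(\<lambda>v. word_part (u @ v # s) g) \<in> lin_maps V T" if "u \<in> words" "s \<in> words" "g \<in> carrier G" for u s g
    using that
  proof (induction u arbitrary: g)
    case Nil
    have "(\<lambda>v. W [V.part v h] \<otimes>\<^bsub>T\<^esub> word_part s (inv\<^bsub>G\<^esub> h \<otimes>\<^bsub>G\<^esub> g)) \<in> lin_maps V T" if "h \<in> carrier G" for h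
      using that Nil
      by (intro lin_comp[OF lin_comp[OF V.part_lin W1_lin] T.C.mult_lin_l]) auto
    then show ?case using Nil by (simp add: lin_finsum_maps[OF _ T.P.Q_cspace])
  next
    case (Cons a u)
    have "(\<lambda>v. W [V.part a h] \<otimes>\<^bsub>T\<^esub> word_part (u @ v # s) (inv\<^bsub>G\<^esub> h \<otimes>\<^bsub>G\<^esub> g)) \<in> lin_maps V T" if "h \<in> carrier G" for h
      using that Cons
      by (intro lin_comp[OF Cons.IH T.C.mult_lin_r]) (auto intro: T.W_closed)
    then show ?case using Cons by (simp add: lin_finsum_maps[OF _ T.P.Q_cspace])
  qed
  then show "g \<in> carrier G \<Longrightarrow> ?thesis" unfolding multilinear_def by auto
qed

lemma foldr_closed:
  "list_all2 (\<lambda>v h. h \<in> carrier G \<and> v \<in> homog V h) vs gs \<Longrightarrow> foldr (mult G) gs \<one>\<^bsub>G\<^esub> \<in> carrier G"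
  by (induction rule: list_all2_induct) auto

lemma word_part_homog:
  assumes "list_all2 (\<lambda>v h. h \<in> carrier G \<and> v \<in> homog V h) vs gs" "g \<in> carrier G"
  shows "word_part vs g = (if g = foldr (mult G) gs \<one>\<^bsub>G\<^esub> then W vs else \<zero>\<^bsub>T\<^esub>)"
  using assms
proof (induction vs gs arbitrary: g rule: list_all2_induct)
  case Nil
  then show ?case by (simp add: T.one_W)
next
  case (Cons v vs k gs)
  have vs: "vs \<in> words" "v \<in> carrier V"
    using homog_words[OF Cons(2)] V.homog_closed Cons(1) by auto
  let ?c = "foldr (mult G) gs \<one>\<^bsub>G\<^esub>"
  have c: "?c \<in> carrier G" by (rule foldr_closed[OF Cons(2)])
  have z: "W [\<zero>\<^bsub>V\<^esub>] = \<zero>\<^bsub>T\<^esub>" by (rule lin_zero[OF W1_lin V_cspace T.P.Q_cspace])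
  have "word_part (v # vs) g
      = finsum T (\<lambda>h. if h = k then W [v] \<otimes>\<^bsub>T\<^esub> word_part vs (inv\<^bsub>G\<^esub> k \<otimes>\<^bsub>G\<^esub> g) else \<zero>\<^bsub>T\<^esub>) (carrier G)"
    unfolding word_part.simps
    by (rule T.C.finsum_cong')
      (use Cons vs z V.part_of_homog[of k v] T.W_closed in \<open>auto simp: T.C.A.l_null\<close>)
  also have "\<dots> = W [v] \<otimes>\<^bsub>T\<^esub> word_part vs (inv\<^bsub>G\<^esub> k \<otimes>\<^bsub>G\<^esub> g)"
    using Cons vs T.W_closed finite_group by (intro T.C.finsum_single) auto
  also have "\<dots> = (if g = k \<otimes>\<^bsub>G\<^esub> ?c then W (v # vs) else \<zero>\<^bsub>T\<^esub>)"
  proof -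
    have "inv\<^bsub>G\<^esub> k \<otimes>\<^bsub>G\<^esub> g = ?c \<longleftrightarrow> g = k \<otimes>\<^bsub>G\<^esub> ?c"
      using G.inv_solve_left[OF c _ Cons(4), of k] Cons(1) by auto
    moreover have "word_part vs (inv\<^bsub>G\<^esub> k \<otimes>\<^bsub>G\<^esub> g)
        = (if inv\<^bsub>G\<^esub> k \<otimes>\<^bsub>G\<^esub> g = ?c then W vs else \<zero>\<^bsub>T\<^esub>)"
      using Cons(1,4) by (intro Cons(3)) auto
    ultimately show ?thesis
      using W_Cons[OF vs(2,1)] T.C.A.r_null[OF T.W_closed, of "[v]"] vs by (cases "g = k \<otimes>\<^bsub>G\<^esub> ?c") simp_all
  qed
  finally show ?case by simp
qed

lemma hwords_span:
  assumes x: "x \<in> carrier T"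
  shows "x \<in> CC_span T (\<Union>g\<in>carrier G. hwords g)" (is "_ \<in> ?U")
proof -
  let ?H = "\<Union>g\<in>carrier G. hwords g"
  have H: "?H \<subseteq> carrier T" using hwords_closed by auto
  note sub = T.C.span_is_subspace[OF H]
  have hom: "W [v] \<otimes>\<^bsub>T\<^esub> x \<in> ?U" if "x \<in> ?U" "h \<in> carrier G" "v \<in> homog V h" for v h x
  proof (rule lin_span_image[OF T.C.mult_lin_r T.P.Q_cspace T.P.Q_cspace H sub _ that(1)])
    show "W [v] \<in> carrier T" using V.homog_closed[OF that(2,3)] by (simp add: T.W_closed)
    fix s assume "s \<in> ?H"
    then obtain vs gs where s: "s = W vs" "list_all2 (\<lambda>v h. h \<in> carrier G \<and> v \<in> homog V h) vs gs"
      by (auto elim: hwordsE)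
    have "list_all2 (\<lambda>v h. h \<in> carrier G \<and> v \<in> homog V h) (v # vs) (h # gs)" using s that by simp
    then have "W (v # vs) \<in> ?H"
      using hwordsI[of "v # vs" "h # gs"] foldr_closed[of "v # vs" "h # gs"] by (intro UN_I)
    moreover have "W [v] \<otimes>\<^bsub>T\<^esub> s = W (v # vs)"
      using W_Cons[OF V.homog_closed[OF that(2,3)] homog_words[OF s(2)]] s by simp
    ultimately show "W [v] \<otimes>\<^bsub>T\<^esub> s \<in> ?U" using T.C.span_base[OF H] by simp
  qed
  have mult: "W [v] \<otimes>\<^bsub>T\<^esub> x \<in> ?U" if "x \<in> ?U" "v \<in> carrier V" for v x
    by (rule lin_span_image[OF lin_comp[OF W1_lin T.C.mult_lin_l] V_cspace T.P.Q_cspace _ sub _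
          V.homog_span[OF that(2)]])
      (use hom that T.C.span_closed[OF H] V.homog_closed in auto)
  have "W ws \<in> ?U" if "ws \<in> words" for ws
    using that
  proof (induction ws)
    case Nil
    have "W [] \<in> hwords \<one>\<^bsub>G\<^esub>" using hwordsI[of "[]" "[]"] by simp
    then show ?case by (intro T.C.span_base[OF H]) auto
  next
    case (Cons v ws)
    then show ?case using mult[of "W ws" v] W_Cons[of v ws] by simp
  qed
  then have "W ` words \<subseteq> ?U" by auto
  from T.C.span_subset[OF sub this] T.W_span[OF x] show ?thesis by auto
qed

sublocale TG: graded G T
proof -
  have "\<forall>g\<in>carrier G. \<exists>P. P \<in> lin_maps T T \<and> (\<forall>ws\<in>words. P (W ws) = word_part ws g)"
    using T.lift_multilinear[OF T.P.Q_cspace word_part_multilinear] by blast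
  then obtain P where P: "\<And>g. g \<in> carrier G \<Longrightarrow> P g \<in> lin_maps T T"
    "\<And>g ws. g \<in> carrier G \<Longrightarrow> ws \<in> words \<Longrightarrow> P g (W ws) = word_part ws g"
    by metis
  show "graded G T"
  proof (rule gradedI[OF T.P.Q_cspace G.group_axioms finite_group hwords_closed homog_T hwords_span P(1)])
    fix g h x assume "g \<in> carrier G" "h \<in> carrier G" "x \<in> hwords h"
    then show "P g x = (if g = h then x else \<zero>\<^bsub>T\<^esub>)"
      using P(2) homog_words word_part_homog by (auto elim!: hwordsE)
  qed
qed

lemma W1_homog: "g \<in> carrier G \<Longrightarrow> v \<in> homog V g \<Longrightarrow> W [v] \<in> homog T g"
proof -
  assume g: "g \<in> carrier G" "v \<in> homog V g"
  then have "list_all2 (\<lambda>v h. h \<in> carrier G \<and> v \<in> homog V h) [v] [g]" "foldr (mult G) [g] \<one>\<^bsub>G\<^esub> = g"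
    by auto
  then have "W [v] \<in> hwords g" using hwordsI[of "[v]" "[g]"] by simp
  then show ?thesis unfolding homog_T by (rule T.C.span_base[OF hwords_closed])
qed

lemma one_homog: "\<one>\<^bsub>T\<^esub> \<in> homog T \<one>\<^bsub>G\<^esub>"
proof -
  have "W [] \<in> hwords \<one>\<^bsub>G\<^esub>" using hwordsI[of "[]" "[]"] by simp
  then show ?thesis unfolding homog_T T.one_W by (rule T.C.span_base[OF hwords_closed])
qed

lemma mult_homog:
  assumes "g \<in> carrier G" "h \<in> carrier G" "x \<in> homog T g" "y \<in> homog T h"
  shows "x \<otimes>\<^bsub>T\<^esub> y \<in> homog T (g \<otimes>\<^bsub>G\<^esub> h)"
proof -
  note sub = TG.homog_sub[OF G.m_closed[OF assms(1,2)]]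
  have ww: "a \<otimes>\<^bsub>T\<^esub> b \<in> homog T (g \<otimes>\<^bsub>G\<^esub> h)" if "a \<in> hwords g" "b \<in> hwords h" for a b
  proof -
    obtain vs gs ws hs where a: "a = W vs" "list_all2 (\<lambda>v h. h \<in> carrier G \<and> v \<in> homog V h) vs gs"
        "foldr (mult G) gs \<one>\<^bsub>G\<^esub> = g"
      and b: "b = W ws" "list_all2 (\<lambda>v h. h \<in> carrier G \<and> v \<in> homog V h) ws hs"
        "foldr (mult G) hs \<one>\<^bsub>G\<^esub> = h"
      using \<open>a \<in> hwords g\<close> \<open>b \<in> hwords h\<close> by (elim hwordsE)
    have "foldr (mult G) (gs @ hs) \<one>\<^bsub>G\<^esub> = foldr (mult G) gs \<one>\<^bsub>G\<^esub> \<otimes>\<^bsub>G\<^esub> h"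
      using a(2) assms(2) b(3)
    proof (induction vs gs rule: list_all2_induct)
      case (Cons v vs k gs)
      then show ?case using foldr_closed[OF Cons(2)] by (simp add: G.m_assoc)
    qed simp
    moreover have "list_all2 (\<lambda>v h. h \<in> carrier G \<and> v \<in> homog V h) (vs @ ws) (gs @ hs)"
      using a(2) b(2) by (rule list_all2_appendI)
    ultimately have "W (vs @ ws) \<in> hwords (g \<otimes>\<^bsub>G\<^esub> h)"
      using hwordsI[of "vs @ ws" "gs @ hs"] a(3) by simp
    then show ?thesis
      unfolding homog_T a(1) b(1) T.W_append[OF homog_words[OF a(2)] homog_words[OF b(2)]]
      by (rule T.C.span_base[OF hwords_closed])
  qed
  have y: "y \<in> carrier T" using TG.homog_closed assms by auto
  have "a \<otimes>\<^bsub>T\<^esub> y \<in> homog T (g \<otimes>\<^bsub>G\<^esub> h)" if "a \<in> hwords g" for a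
    by (rule lin_span_image[OF T.C.mult_lin_r T.P.Q_cspace T.P.Q_cspace hwords_closed sub])
      (use that ww assms(4) hwords_closed homog_T in auto)
  then show ?thesis
    by (rule lin_span_image[OF T.C.mult_lin_l[OF y] T.P.Q_cspace T.P.Q_cspace hwords_closed sub _ assms(3)[unfolded homog_T]])
qed

end

lemma lin_cong:
  assumes "f \<in> lin_maps V W" "cspace V" "\<And>v. v \<in> carrier V \<Longrightarrow> g v = f v"
  shows "g \<in> lin_maps V W"
proof -
  interpret cspace V by fact
  show ?thesis by (rule linI) (use assms(3) linD[OF assms(1)] in auto)
qed

lemma extend_cong:
  assumes X: "cspace X" and "p \<in> carrier (free_space S)" and f: "\<And>s. s \<in> S \<Longrightarrow> f s \<in> carrier X"
    and eq: "\<And>s. s \<in> S \<Longrightarrow> f s = g s"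
  shows "extend X f p = extend X g p"
proof (rule free_space_lin_eq[OF extend_lin extend_lin X assms(2)])
  fix s assume "s \<in> S"
  then show "extend X f (Poly_Mapping.single s 1) = extend X g (Poly_Mapping.single s 1)"
    using f eq extend_single[OF X, of f s] extend_single[OF X, of g s] by metis
qed (use X f eq in \<open>auto simp: Pi_iff\<close>)

lemma extend_lin_comp:
  assumes X: "cspace X" and h: "h \<in> lin_maps (free_space S) X" and f: "\<And>s. s \<in> S' \<Longrightarrow> f s \<in> carrier (free_space S)"
    and p: "p \<in> carrier (free_space S')"
  shows "h (lin_ext f p) = extend X (\<lambda>s. h (f s)) p"
proof (rule free_space_lin_eq[OF lin_comp[OF lin_ext_lin h] extend_lin[OF X] X p])
  interpret X: cspace X by fact
  have hf: "h (f s) \<in> carrier X" if "s \<in> S'" for s using linD(1)[OF h f[OF that]] .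
  then show "(\<lambda>s. h (f s)) \<in> S' \<rightarrow> carrier X" by auto
  show "h (lin_ext f (Poly_Mapping.single s 1)) = extend X (\<lambda>s. h (f s)) (Poly_Mapping.single s 1)"
    if "s \<in> S'" for s
    using hf[OF that] extend_single[where f = "\<lambda>s. h (f s)" and k = s, OF X hf[OF that], of 1] by simp
qed (use f in auto)

lemma free_space_finsum:
  assumes "f \<in> A \<rightarrow> carrier (free_space S)"
  shows "finsum (free_space S) f A = sum f A"
proof -
  interpret F: cspace "free_space S" by (rule free_space_cspace)
  show ?thesis
    using assms by (induction A rule: infinite_finite_induct) (simp_all add: F.finsum_insert)
qed

section \<open>The braided tensor square\<close>

lemma bilinear_relsE:
  assumes "r \<in> bilinear_rels U W"
  obtains (add_l) u u' w where "u \<in> carrier U" "u' \<in> carrier U" "w \<in> carrier W"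
      "r = Poly_Mapping.single (u \<oplus>\<^bsub>U\<^esub> u', w) 1 - Poly_Mapping.single (u, w) 1 - Poly_Mapping.single (u', w) 1"
  | (add_r) u w w' where "u \<in> carrier U" "w \<in> carrier W" "w' \<in> carrier W"
      "r = Poly_Mapping.single (u, w \<oplus>\<^bsub>W\<^esub> w') 1 - Poly_Mapping.single (u, w) 1 - Poly_Mapping.single (u, w') 1"
  | (sm_l) c u w where "u \<in> carrier U" "w \<in> carrier W"
      "r = Poly_Mapping.single (c \<odot>\<^bsub>U\<^esub> u, w) 1 - Poly_Mapping.single (u, w) c"
  | (sm_r) c u w where "u \<in> carrier U" "w \<in> carrier W"
      "r = Poly_Mapping.single (u, c \<odot>\<^bsub>W\<^esub> w) 1 - Poly_Mapping.single (u, w) c"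
  using assms unfolding bilinear_rels_def Un_iff mem_Collect_eq
  by (elim disjE exE conjE) (rule that; assumption)+

lemma bilinear_rels_closed:
  assumes "cspace U" "cspace W"
  shows "bilinear_rels U W \<subseteq> carrier (free_space (carrier U \<times> carrier W))"
proof
  interpret U: cspace U by fact
  interpret W: cspace W by fact
  fix r assume "r \<in> bilinear_rels U W"
  then show "r \<in> carrier (free_space (carrier U \<times> carrier W))"
    unfolding free_space_simps mem_Collect_eq
    by (cases rule: bilinear_relsE)
      (hypsubst, intro keys_diff_subset single_closed; simp; fail)+
qed

locale tensor_square = cspace A for A :: "(complex, 'a, 'z) module_scheme" +
  fixes Q :: "(complex, ('a \<times> 'a \<Rightarrow>\<^sub>0 complex) set, 'y) module_scheme"
  assumes Q: "presented (carrier A \<times> carrier A)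
    (CC_span (free_space (carrier A \<times> carrier A)) (bilinear_rels A A)) Q (bilinear_rels A A)"
begin

sublocale P: presented "carrier A \<times> carrier A"
  "CC_span (free_space (carrier A \<times> carrier A)) (bilinear_rels A A)" Q "bilinear_rels A A"
  by (rule Q)

abbreviation "F \<equiv> free_space (carrier A \<times> carrier A)"

lemma pure_gen: "pure_tensor A a b = P.gen (a, b)"
  unfolding pure_tensor_def Let_def ..

lemma pure_closed [simp]: "a \<in> carrier A \<Longrightarrow> b \<in> carrier A \<Longrightarrow> pure_tensor A a b \<in> carrier Q"
  unfolding pure_gen by (rule P.gen_closed) simp

lemma cls_diff:
  assumes "p \<in> carrier F" "q \<in> carrier F" "p - q \<in> bilinear_rels A A"
  shows "P.cls p = P.cls q"
  using assms P.span_base[OF P.rels] by (simp add: P.cls_eq_iff free_space_minus del: free_space_simps)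

lemma single_F: "a \<in> carrier A \<Longrightarrow> b \<in> carrier A \<Longrightarrow> Poly_Mapping.single (a, b) c \<in> carrier F"
  by simp

lemma cls_single: "a \<in> carrier A \<Longrightarrow> b \<in> carrier A \<Longrightarrow>
    P.cls (Poly_Mapping.single (a, b) c) = c \<odot>\<^bsub>Q\<^esub> pure_tensor A a b"
  unfolding pure_gen using P.sm_Q[OF single_F[of a b 1], of c] by simp

lemma cls_two: "a \<in> carrier A \<Longrightarrow> b \<in> carrier A \<Longrightarrow> a' \<in> carrier A \<Longrightarrow> b' \<in> carrier A \<Longrightarrow>
    P.cls (Poly_Mapping.single (a, b) 1 + Poly_Mapping.single (a', b') 1)
    = pure_tensor A a b \<oplus>\<^bsub>Q\<^esub> pure_tensor A a' b'"
  unfolding pure_gen using P.add_Q[OF single_F[of a b 1] single_F[of a' b' 1]] by simp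

lemma two_closed: "a \<in> carrier A \<Longrightarrow> b \<in> carrier A \<Longrightarrow> a' \<in> carrier A \<Longrightarrow> b' \<in> carrier A \<Longrightarrow>
    Poly_Mapping.single (a, b) 1 + Poly_Mapping.single (a', b') 1 \<in> carrier F"
  using P.a_closed[OF single_F[of a b 1] single_F[of a' b' 1]] by simp

lemma pure_lin_l: "b \<in> carrier A \<Longrightarrow> (\<lambda>a. pure_tensor A a b) \<in> lin_maps A Q"
proof (rule linI)
  fix v w c assume b: "b \<in> carrier A" and v: "v \<in> carrier A"
  show "pure_tensor A v b \<in> carrier Q" using v b by simp
  have "Poly_Mapping.single (c \<odot>\<^bsub>A\<^esub> v, b) 1 - Poly_Mapping.single (v, b) c \<in> bilinear_rels A A"
    unfolding bilinear_rels_def using v b by blast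
  from cls_diff[OF _ _ this] show "pure_tensor A (c \<odot>\<^bsub>A\<^esub> v) b = c \<odot>\<^bsub>Q\<^esub> pure_tensor A v b"
    using v b by (simp only: cls_single pure_gen[symmetric] single_F sm_closed)
  assume w: "w \<in> carrier A"
  have "Poly_Mapping.single (v \<oplus>\<^bsub>A\<^esub> w, b) 1 - (Poly_Mapping.single (v, b) 1 + Poly_Mapping.single (w, b) 1) \<in> bilinear_rels A A"
    unfolding bilinear_rels_def diff_diff_add[symmetric] using v w b by blast
  from cls_diff[OF _ _ this] show "pure_tensor A (v \<oplus>\<^bsub>A\<^esub> w) b = pure_tensor A v b \<oplus>\<^bsub>Q\<^esub> pure_tensor A w b"
    using v w b by (simp only: cls_two pure_gen[symmetric] single_F two_closed a_closed)
qed

lemma pure_lin_r: "a \<in> carrier A \<Longrightarrow> (\<lambda>b. pure_tensor A a b) \<in> lin_maps A Q"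
proof (rule linI)
  fix v w c assume a: "a \<in> carrier A" and v: "v \<in> carrier A"
  show "pure_tensor A a v \<in> carrier Q" using v a by simp
  have "Poly_Mapping.single (a, c \<odot>\<^bsub>A\<^esub> v) 1 - Poly_Mapping.single (a, v) c \<in> bilinear_rels A A"
    unfolding bilinear_rels_def using v a by blast
  from cls_diff[OF _ _ this] show "pure_tensor A a (c \<odot>\<^bsub>A\<^esub> v) = c \<odot>\<^bsub>Q\<^esub> pure_tensor A a v"
    using v a by (simp only: cls_single pure_gen[symmetric] single_F sm_closed)
  assume w: "w \<in> carrier A"
  have "Poly_Mapping.single (a, v \<oplus>\<^bsub>A\<^esub> w) 1 - (Poly_Mapping.single (a, v) 1 + Poly_Mapping.single (a, w) 1) \<in> bilinear_rels A A"
    unfolding bilinear_rels_def diff_diff_add[symmetric] using v w a by blast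
  from cls_diff[OF _ _ this] show "pure_tensor A a (v \<oplus>\<^bsub>A\<^esub> w) = pure_tensor A a v \<oplus>\<^bsub>Q\<^esub> pure_tensor A a w"
    using v w a by (simp only: cls_two pure_gen[symmetric] single_F two_closed a_closed)
qed

lemma pure_span: "x \<in> carrier Q \<Longrightarrow> x \<in> CC_span Q {pure_tensor A a b | a b. a \<in> carrier A \<and> b \<in> carrier A}"
proof -
  have "P.gen ` (carrier A \<times> carrier A) = {pure_tensor A a b | a b. a \<in> carrier A \<and> b \<in> carrier A}"
    by (auto simp: pure_gen)
  then show "x \<in> carrier Q \<Longrightarrow> ?thesis" using P.gens_span[of x] by simp
qed

lemma pure_lin_eq:
  assumes "f \<in> lin_maps Q X" "g \<in> lin_maps Q X" "cspace X"
    "\<And>a b. a \<in> carrier A \<Longrightarrow> b \<in> carrier A \<Longrightarrow> f (pure_tensor A a b) = g (pure_tensor A a b)" "x \<in> carrier Q"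
  shows "f x = g x"
  by (rule P.Q_lin_eq[OF assms(1,2,3) _ assms(5)]) (use assms(4) in \<open>auto simp: pure_gen\<close>)

text \<open>The extension of \<open>f\<close> to the free space on pairs kills the bilinear relations because \<open>f\<close> is linear in
each argument.\<close>

lemma lift_bilinear:
  assumes X: "cspace X" and l: "\<And>b. b \<in> carrier A \<Longrightarrow> (\<lambda>a. f a b) \<in> lin_maps A X"
    and r: "\<And>a. a \<in> carrier A \<Longrightarrow> (\<lambda>b. f a b) \<in> lin_maps A X"
  shows "\<exists>k \<in> lin_maps Q X. \<forall>a\<in>carrier A. \<forall>b\<in>carrier A. k (pure_tensor A a b) = f a b"
proof -
  interpret X: cspace X by fact
  let ?f = "\<lambda>(a, b). f a b"
  have fc: "f a b \<in> carrier X" if "a \<in> carrier A" "b \<in> carrier A" for a b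
    using linD(1)[OF l[OF that(2)] that(1)] .
  then have e: "extend X ?f \<in> lin_maps F X" by (intro extend_lin X) auto
  have dc: "q - q' \<in> carrier F" if "q \<in> carrier F" "q' \<in> carrier F" for q q'
    using that keys_diff_subset by simp
  have ed: "extend X ?f (p - q) = extend X ?f p \<oplus>\<^bsub>X\<^esub> (-1) \<odot>\<^bsub>X\<^esub> extend X ?f q"
    if "p \<in> carrier F" "q \<in> carrier F" for p q
    unfolding free_space_minus[OF that, symmetric]
      linD(2)[OF e that(1) P.sm_closed[OF that(2)]] linD(3)[OF e that(2)] ..
  have es: "extend X ?f (Poly_Mapping.single (a, b) c) = c \<odot>\<^bsub>X\<^esub> f a b" if "a \<in> carrier A" "b \<in> carrier A" for a b c
    using extend_single[OF X, of ?f "(a, b)" c] fc[OF that] by simp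
  have z1: "x \<oplus>\<^bsub>X\<^esub> (-1) \<odot>\<^bsub>X\<^esub> x = \<zero>\<^bsub>X\<^esub>" if "x \<in> carrier X" for x
    using that by (simp add: X.minus_sm[symmetric] X.minus_eq X.r_neg)
  have z2: "x \<oplus>\<^bsub>X\<^esub> y \<oplus>\<^bsub>X\<^esub> (-1) \<odot>\<^bsub>X\<^esub> x \<oplus>\<^bsub>X\<^esub> (-1) \<odot>\<^bsub>X\<^esub> y = \<zero>\<^bsub>X\<^esub>"
    if "x \<in> carrier X" "y \<in> carrier X" for x y
  proof -
    have "x \<oplus>\<^bsub>X\<^esub> y \<oplus>\<^bsub>X\<^esub> (-1) \<odot>\<^bsub>X\<^esub> x \<oplus>\<^bsub>X\<^esub> (-1) \<odot>\<^bsub>X\<^esub> y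
        = (x \<oplus>\<^bsub>X\<^esub> (-1) \<odot>\<^bsub>X\<^esub> x) \<oplus>\<^bsub>X\<^esub> (y \<oplus>\<^bsub>X\<^esub> (-1) \<odot>\<^bsub>X\<^esub> y)"
      using that by (simp add: X.a_ac)
    then show ?thesis using z1 that by simp
  qed
  note z = z1 z2
  have "extend X ?f r = \<zero>\<^bsub>X\<^esub>" if "r \<in> bilinear_rels A A" for r
    using that
  proof (cases rule: bilinear_relsE)
    case (add_l u u' w)
    then show ?thesis
      using fc linD(2)[OF l[OF add_l(3)] add_l(1,2)]
      by (simp add: ed es dc single_F z del: free_space_simps)
  next
    case (add_r u w w')
    then show ?thesis
      using fc linD(2)[OF r[OF add_r(1)] add_r(2,3)]
      by (simp add: ed es dc single_F z del: free_space_simps)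
  next
    case (sm_l c u w)
    then show ?thesis
      using fc linD(3)[OF l[OF sm_l(2)] sm_l(1)]
      by (simp add: ed es dc single_F z del: free_space_simps)
  next
    case (sm_r c u w)
    then show ?thesis
      using fc linD(3)[OF r[OF sm_r(1)] sm_r(2)]
      by (simp add: ed es dc single_F z del: free_space_simps)
  qed
  moreover have "?f \<in> carrier A \<times> carrier A \<rightarrow> carrier X" using fc by auto
  ultimately show ?thesis using P.lift_gens[OF X, of ?f] unfolding pure_gen by simp
qed

end

context yd_tensor
begin

abbreviation "TT \<equiv> braided_square G T"
abbreviation "pt \<equiv> pure_tensor T"

sublocale S: tensor_square T TT
proof (intro tensor_square.intro tensor_square_axioms.intro T.P.Q_cspace)
  let ?F = "free_space (carrier T \<times> carrier T)"
  let ?N = "CC_span ?F (bilinear_rels T T)"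
  let ?F' = "?F\<lparr>mult := braided_mult G T, one := Poly_Mapping.single (\<one>\<^bsub>T\<^esub>, \<one>\<^bsub>T\<^esub>) 1\<rparr>"
  have "carrier ?F' = carrier ?F" "add ?F' = add ?F" "smult ?F' = smult ?F" by simp_all
  note same = same_quot_module[OF this]
  show "presented (carrier T \<times> carrier T) ?N TT (bilinear_rels T T)"
    by (rule presentedI[OF bilinear_rels_closed[OF T.P.Q_cspace T.P.Q_cspace] refl])
      (simp_all only: braided_square_def Let_def same)
qed

text \<open>The product \<open>(a \<otimes> b)(c \<otimes> d)\<close> for arbitrary \<open>b\<close>. Summing over the whole group instead of the
  support of \<open>b\<close>, as \<^const>\<open>braiding\<close> does, makes the expression visibly linear in \<open>b\<close>.\<close>

definition braid4 where
  "braid4 a b c d = finsum TT (\<lambda>g. pt (a \<otimes>\<^bsub>T\<^esub> act T g c) (TG.part b g \<otimes>\<^bsub>T\<^esub> d)) (carrier G)"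

lemma braid4_lin:
  shows braid4_lin1: "b \<in> carrier T \<Longrightarrow> c \<in> carrier T \<Longrightarrow> d \<in> carrier T \<Longrightarrow> (\<lambda>a. braid4 a b c d) \<in> lin_maps T TT"
    and braid4_lin2: "a \<in> carrier T \<Longrightarrow> c \<in> carrier T \<Longrightarrow> d \<in> carrier T \<Longrightarrow> (\<lambda>b. braid4 a b c d) \<in> lin_maps T TT"
    and braid4_lin3: "a \<in> carrier T \<Longrightarrow> b \<in> carrier T \<Longrightarrow> d \<in> carrier T \<Longrightarrow> (\<lambda>c. braid4 a b c d) \<in> lin_maps T TT"
    and braid4_lin4: "a \<in> carrier T \<Longrightarrow> b \<in> carrier T \<Longrightarrow> c \<in> carrier T \<Longrightarrow> (\<lambda>d. braid4 a b c d) \<in> lin_maps T TT"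
  unfolding braid4_def
  subgoal by (intro lin_finsum_maps S.P.Q_cspace lin_comp[OF T.C.mult_lin_l S.pure_lin_l]) auto
  subgoal by (intro lin_finsum_maps S.P.Q_cspace lin_comp[OF lin_comp[OF TG.part_lin T.C.mult_lin_l] S.pure_lin_r]) auto
  subgoal by (intro lin_finsum_maps S.P.Q_cspace lin_comp[OF lin_comp[OF act_lin T.C.mult_lin_r] S.pure_lin_l]) auto
  subgoal by (intro lin_finsum_maps S.P.Q_cspace lin_comp[OF T.C.mult_lin_r S.pure_lin_r]) auto
  done

lemma braid4_homog:
  assumes "a \<in> carrier T" "c \<in> carrier T" "d \<in> carrier T" "g \<in> carrier G" "b \<in> homog T g"
  shows "braid4 a b c d = pt (a \<otimes>\<^bsub>T\<^esub> act T g c) (b \<otimes>\<^bsub>T\<^esub> d)"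
proof -
  have b: "b \<in> carrier T" using assms TG.homog_closed by auto
  interpret TT: cspace TT by (rule S.P.Q_cspace)
  have z: "pt (a \<otimes>\<^bsub>T\<^esub> act T h c) (\<zero>\<^bsub>T\<^esub> \<otimes>\<^bsub>T\<^esub> d) = \<zero>\<^bsub>TT\<^esub>" if "h \<in> carrier G" for h
    using lin_zero[OF S.pure_lin_r T.P.Q_cspace S.P.Q_cspace, of "a \<otimes>\<^bsub>T\<^esub> act T h c"] assms that
    by (simp add: T.C.A.l_null)
  have "braid4 a b c d = finsum TT (\<lambda>h. if h = g then pt (a \<otimes>\<^bsub>T\<^esub> act T g c) (b \<otimes>\<^bsub>T\<^esub> d) else \<zero>\<^bsub>TT\<^esub>) (carrier G)"
    unfolding braid4_def
    by (rule TT.finsum_cong') (use assms b z TG.part_of_homog[OF assms(4,5)] in auto)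
  then show ?thesis using assms b finite_group by (simp add: TT.finsum_single)
qed

lemma cls_braiding:
  assumes "a \<in> carrier T" "b \<in> carrier T" "c \<in> carrier T" "d \<in> carrier T"
  shows "S.P.cls (lin_ext (\<lambda>(c', b'). Poly_Mapping.single (a \<otimes>\<^bsub>T\<^esub> c', b' \<otimes>\<^bsub>T\<^esub> d) 1) (braiding G T b c))
    = braid4 a b c d"
proof -
  interpret TT: cspace TT by (rule S.P.Q_cspace)
  let ?f = "\<lambda>(c', b'). Poly_Mapping.single (a \<otimes>\<^bsub>T\<^esub> c', b' \<otimes>\<^bsub>T\<^esub> d) (1::complex)"
  let ?s = "\<lambda>g. Poly_Mapping.single (act T g c, TG.part b g) (1::complex)"
  let ?t = "\<lambda>g. pt (a \<otimes>\<^bsub>T\<^esub> act T g c) (TG.part b g \<otimes>\<^bsub>T\<^esub> d)"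
  let ?K = "{g \<in> carrier G. TG.part b g \<noteq> \<zero>\<^bsub>T\<^esub>}"
  have f: "lin_ext ?f \<in> lin_maps S.F S.F"
    by (rule lin_ext_lin) (use assms in auto)
  have s: "?s g \<in> carrier S.F" if "g \<in> carrier G" for g using that assms by simp
  have t: "?t g \<in> carrier TT" if "g \<in> carrier G" for g using that assms by simp
  have "braiding G T b c = finsum S.F ?s ?K"
    unfolding braiding_def by (rule free_space_finsum[symmetric]) (use s in blast)
  then have "S.P.cls (lin_ext ?f (braiding G T b c)) = finsum TT (\<lambda>g. S.P.cls (lin_ext ?f (?s g))) ?K"
    using lin_finsum[OF lin_comp[OF f S.P.cls_lin] free_space_cspace S.P.Q_cspace, of ?s ?K] s
    by fastforce
  also have "\<dots> = finsum TT ?t ?K"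
    by (rule TT.finsum_cong') (use t in \<open>auto simp: S.pure_gen\<close>)
  also have "\<dots> = finsum TT ?t (carrier G)"
  proof (rule TT.add.finprod_mono_neutral_cong_left)
    fix g assume g: "g \<in> carrier G - ?K"
    then have "TG.part b g = \<zero>\<^bsub>T\<^esub>" by auto
    then show "?t g = \<zero>\<^bsub>TT\<^esub>"
      using lin_zero[OF S.pure_lin_r T.P.Q_cspace S.P.Q_cspace, of "a \<otimes>\<^bsub>T\<^esub> act T g c"] assms g
      by (simp add: T.C.A.l_null)
  qed (use finite_group t in auto)
  finally show ?thesis unfolding braid4_def .
qed

lemma cls_braided_mult:
  assumes p: "p \<in> carrier S.F" and q: "q \<in> carrier S.F"
  shows "S.P.cls (braided_mult G T p q)
    = extend TT (\<lambda>(a, b). extend TT (\<lambda>(c, d). braid4 a b c d) q) p"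
proof -
  let ?h = "\<lambda>a b (c, d). lin_ext (\<lambda>(c', b'). Poly_Mapping.single (a \<otimes>\<^bsub>T\<^esub> c', b' \<otimes>\<^bsub>T\<^esub> d) 1) (braiding G T b c)"
  have br: "braiding G T b c \<in> carrier S.F" if "b \<in> carrier T" "c \<in> carrier T" for b c
  proof -
    have "(\<Sum>g\<in>{g \<in> carrier G. TG.part b g \<noteq> \<zero>\<^bsub>T\<^esub>}. Poly_Mapping.single (act T g c, TG.part b g) (1::complex)) \<in> carrier S.F"
      by (subst free_space_finsum[symmetric, where S = "carrier T \<times> carrier T"])
        (use that in \<open>auto intro!: S.P.finsum_closed simp del: free_space_simps intro: S.single_F\<close>)
    then show ?thesis unfolding braiding_def .
  qed
  have h: "?h a b s \<in> carrier S.F" if "a \<in> carrier T" "b \<in> carrier T" "s \<in> carrier T \<times> carrier T" for a b s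
  proof -
    from that(3) obtain c d where s: "s = (c, d)" "c \<in> carrier T" "d \<in> carrier T" by auto
    show ?thesis unfolding s(1) split
      by (rule linD(1)[OF lin_ext_lin br]) (use that s in auto)
  qed
  have 1: "S.P.cls (lin_ext (?h a b) q) = extend TT (\<lambda>(c, d). braid4 a b c d) q"
    if "a \<in> carrier T" "b \<in> carrier T" for a b
  proof -
    have "S.P.cls (lin_ext (?h a b) q) = extend TT (\<lambda>s. S.P.cls (?h a b s)) q"
      by (rule extend_lin_comp[OF S.P.Q_cspace S.P.cls_lin h q]) (use that in auto)
    also have "\<dots> = extend TT (\<lambda>(c, d). braid4 a b c d) q"
      by (rule extend_cong[OF S.P.Q_cspace q])
        (use that h linD(1)[OF S.P.cls_lin] cls_braiding in auto)
    finally show ?thesis .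
  qed
  have 2: "lin_ext (?h a b) q \<in> carrier S.F" if "a \<in> carrier T" "b \<in> carrier T" for a b
    by (rule linD(1)[OF lin_ext_lin q]) (use that h in auto)
  define H where "H = (\<lambda>(a, b). lin_ext (?h a b) q)"
  have H: "H s \<in> carrier S.F" "S.P.cls (H s) \<in> carrier TT"
    "S.P.cls (H s) = (\<lambda>(a, b). extend TT (\<lambda>(c, d). braid4 a b c d) q) s"
    if "s \<in> carrier T \<times> carrier T" for s
  proof -
    from that obtain a b where s: "s = (a, b)" "a \<in> carrier T" "b \<in> carrier T" by auto
    show "H s \<in> carrier S.F" unfolding s(1) H_def split by (rule 2[OF s(2,3)])
    then show "S.P.cls (H s) \<in> carrier TT" by (rule linD(1)[OF S.P.cls_lin])
    show "S.P.cls (H s) = (\<lambda>(a, b). extend TT (\<lambda>(c, d). braid4 a b c d) q) s"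
      unfolding s(1) H_def split by (rule 1[OF s(2,3)])
  qed
  have "braided_mult G T p q = lin_ext H p"
    unfolding braided_mult_def H_def ..
  also have "S.P.cls \<dots> = extend TT (\<lambda>s. S.P.cls (H s)) p"
    by (rule extend_lin_comp[OF S.P.Q_cspace S.P.cls_lin H(1) p])
  also have "\<dots> = extend TT (\<lambda>(a, b). extend TT (\<lambda>(c, d). braid4 a b c d) q) p"
    by (rule extend_cong[OF S.P.Q_cspace p H(2,3)])
  finally show ?thesis .
qed

text \<open>The multiplication of the braided square is the union of the classes of all products of
  representatives. It is well defined because \<open>braid4\<close> is linear in each of its four arguments and therefore
  extends to a bilinear map on the tensor square, with which every one of these classes agrees.\<close>

lemma TT_mult:
  shows TT_mult_lin_l: "y \<in> carrier TT \<Longrightarrow> (\<lambda>x. x \<otimes>\<^bsub>TT\<^esub> y) \<in> lin_maps TT TT"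
    and TT_mult_lin_r: "x \<in> carrier TT \<Longrightarrow> (\<lambda>y. x \<otimes>\<^bsub>TT\<^esub> y) \<in> lin_maps TT TT"
    and TT_mult_pure: "a \<in> carrier T \<Longrightarrow> b \<in> carrier T \<Longrightarrow> c \<in> carrier T \<Longrightarrow> d \<in> carrier T \<Longrightarrow>
      pt a b \<otimes>\<^bsub>TT\<^esub> pt c d = braid4 a b c d"
proof -
  interpret TT: cspace TT by (rule S.P.Q_cspace)
  note Q = S.P.Q_cspace
  have "\<exists>k \<in> lin_maps TT TT. \<forall>c\<in>carrier T. \<forall>d\<in>carrier T. k (pt c d) = braid4 a b c d"
    if "a \<in> carrier T" "b \<in> carrier T" for a b
    by (rule S.lift_bilinear[OF Q]) (use that braid4_lin in auto)
  note ex1 = this[unfolded Bex_def]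
  \<comment> \<open>\<open>m1 a b\<close> is multiplication by \<open>a \<otimes> b\<close> from the left, \<open>m2 y\<close> multiplication by \<open>y\<close> from the right.\<close>
  define m1 where "m1 a b = (SOME k. k \<in> lin_maps TT TT \<and> (\<forall>c\<in>carrier T. \<forall>d\<in>carrier T. k (pt c d) = braid4 a b c d))" for a b
  have m1: "m1 a b \<in> lin_maps TT TT"
    "\<And>c d. c \<in> carrier T \<Longrightarrow> d \<in> carrier T \<Longrightarrow> m1 a b (pt c d) = braid4 a b c d"
    if "a \<in> carrier T" "b \<in> carrier T" for a b
    using someI_ex[OF ex1[OF that]] unfolding m1_def[symmetric] by auto
  have m1_l: "(\<lambda>a. m1 a b y) \<in> lin_maps T TT" if "b \<in> carrier T" "y \<in> carrier TT" for b y
  proof (rule linI)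
    fix v w c assume v: "v \<in> carrier T"
    show "m1 v b y \<in> carrier TT" using linD(1)[OF m1(1)] v that by auto
    show "m1 (c \<odot>\<^bsub>T\<^esub> v) b y = c \<odot>\<^bsub>TT\<^esub> m1 v b y"
      by (rule S.pure_lin_eq[OF m1(1) lin_scale[OF m1(1) Q] Q _ that(2)])
        (use v that linD(3)[OF braid4_lin1] in \<open>auto simp: m1(2)\<close>)
    assume w: "w \<in> carrier T"
    show "m1 (v \<oplus>\<^bsub>T\<^esub> w) b y = m1 v b y \<oplus>\<^bsub>TT\<^esub> m1 w b y"
      by (rule S.pure_lin_eq[OF m1(1) lin_plus[OF m1(1) m1(1) Q] Q _ that(2)])
        (use v w that linD(2)[OF braid4_lin1] in \<open>auto simp: m1(2)\<close>)
  qed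
  have m1_r: "(\<lambda>b. m1 a b y) \<in> lin_maps T TT" if "a \<in> carrier T" "y \<in> carrier TT" for a y
  proof (rule linI)
    fix v w c assume v: "v \<in> carrier T"
    show "m1 a v y \<in> carrier TT" using linD(1)[OF m1(1)] v that by auto
    show "m1 a (c \<odot>\<^bsub>T\<^esub> v) y = c \<odot>\<^bsub>TT\<^esub> m1 a v y"
      by (rule S.pure_lin_eq[OF m1(1) lin_scale[OF m1(1) Q] Q _ that(2)])
        (use v that linD(3)[OF braid4_lin2] in \<open>auto simp: m1(2)\<close>)
    assume w: "w \<in> carrier T"
    show "m1 a (v \<oplus>\<^bsub>T\<^esub> w) y = m1 a v y \<oplus>\<^bsub>TT\<^esub> m1 a w y"
      by (rule S.pure_lin_eq[OF m1(1) lin_plus[OF m1(1) m1(1) Q] Q _ that(2)])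
        (use v w that linD(2)[OF braid4_lin2] in \<open>auto simp: m1(2)\<close>)
  qed
  have "\<exists>k \<in> lin_maps TT TT. \<forall>a\<in>carrier T. \<forall>b\<in>carrier T. k (pt a b) = m1 a b y" if "y \<in> carrier TT" for y
    by (rule S.lift_bilinear[OF Q]) (use that m1_l m1_r in auto)
  note ex2 = this[unfolded Bex_def]
  define m2 where "m2 y = (SOME k. k \<in> lin_maps TT TT \<and> (\<forall>a\<in>carrier T. \<forall>b\<in>carrier T. k (pt a b) = m1 a b y))" for y
  have m2: "m2 y \<in> lin_maps TT TT"
    "\<And>a b. a \<in> carrier T \<Longrightarrow> b \<in> carrier T \<Longrightarrow> m2 y (pt a b) = m1 a b y" if "y \<in> carrier TT" for y
    using someI_ex[OF ex2[OF that]] unfolding m2_def[symmetric] by auto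
  have cls_mult: "S.P.cls (braided_mult G T p q) = m2 (S.P.cls q) (S.P.cls p)"
    if p: "p \<in> carrier S.F" and q: "q \<in> carrier S.F" for p q
  proof -
    have cq: "S.P.cls q \<in> carrier TT" by (rule linD(1)[OF S.P.cls_lin q])
    have e: "extend TT (\<lambda>(c, d). braid4 a b c d) q = m1 a b (S.P.cls q)" if ab: "a \<in> carrier T" "b \<in> carrier T" for a b
    proof (rule free_space_lin_eq[OF extend_lin[OF Q] lin_comp[OF S.P.cls_lin m1(1)[OF ab]] Q q])
      show "(\<lambda>(c, d). braid4 a b c d) \<in> carrier T \<times> carrier T \<rightarrow> carrier TT"
        using ab linD(1)[OF braid4_lin4] by auto
      fix s assume "s \<in> carrier T \<times> carrier T"
      then obtain c d where s: "s = (c, d)" "c \<in> carrier T" "d \<in> carrier T" by auto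
      have "braid4 a b c d \<in> carrier TT" using linD(1)[OF braid4_lin4] ab s by auto
      then show "extend TT (\<lambda>(c, d). braid4 a b c d) (Poly_Mapping.single s 1) = m1 a b (S.P.gen s)"
        using extend_single[OF Q, of "\<lambda>(c, d). braid4 a b c d" s 1] s m1(2)[OF ab s(2,3)]
        by (simp add: S.pure_gen)
    qed
    have "S.P.cls (braided_mult G T p q) = extend TT (\<lambda>(a, b). m1 a b (S.P.cls q)) p"
      unfolding cls_braided_mult[OF p q]
      by (rule extend_cong[OF Q p]) (use e linD(1)[OF m1(1) cq] in auto)
    also have "\<dots> = m2 (S.P.cls q) (S.P.cls p)"
    proof (rule free_space_lin_eq[OF extend_lin[OF Q] lin_comp[OF S.P.cls_lin m2(1)[OF cq]] Q p])
      show "(\<lambda>(a, b). m1 a b (S.P.cls q)) \<in> carrier T \<times> carrier T \<rightarrow> carrier TT"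
        using linD(1)[OF m1(1) cq] by auto
      fix s assume "s \<in> carrier T \<times> carrier T"
      then obtain a b where s: "s = (a, b)" "a \<in> carrier T" "b \<in> carrier T" by auto
      have "m1 a b (S.P.cls q) \<in> carrier TT" using linD(1)[OF m1(1) cq] s by auto
      then show "extend TT (\<lambda>(a, b). m1 a b (S.P.cls q)) (Poly_Mapping.single s 1) = m2 (S.P.cls q) (S.P.gen s)"
        using extend_single[OF Q, of "\<lambda>(a, b). m1 a b (S.P.cls q)" s 1] s m2(2)[OF cq s(2,3)]
        by (simp add: S.pure_gen)
    qed
    finally show ?thesis .
  qed
  have mult: "x \<otimes>\<^bsub>TT\<^esub> y = m2 y x" if xy: "x \<in> carrier TT" "y \<in> carrier TT" for x y
  proof -
    obtain p q where pq: "p \<in> carrier S.F" "q \<in> carrier S.F" "x = S.P.cls p" "y = S.P.cls q"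
      using xy unfolding S.P.carrier_Q by blast
    let ?F' = "S.F\<lparr>mult := braided_mult G T, one := Poly_Mapping.single (\<one>\<^bsub>T\<^esub>, \<one>\<^bsub>T\<^esub>) 1\<rparr>"
    have sc: "(+>\<^bsub>?F'\<^esub>) = (+>\<^bsub>S.F\<^esub>)" by (rule same_cosets) simp_all
    have "x \<otimes>\<^bsub>TT\<^esub> y = (\<Union>a\<in>x. \<Union>b\<in>y. S.P.cls (braided_mult G T a b))"
      unfolding braided_square_def Let_def quot_module_def monoid.simps FactRing_def rcoset_mult_def sc by simp
    also have "\<dots> = (\<Union>a\<in>x. \<Union>b\<in>y. m2 y x)"
    proof (intro SUP_cong refl)
      fix a b assume "a \<in> x" "b \<in> y"
      then have "a \<in> carrier S.F \<and> S.P.cls a = x" "b \<in> carrier S.F \<and> S.P.cls b = y"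
        using S.P.cls_memD pq by blast+
      then show "S.P.cls (braided_mult G T a b) = m2 y x" using cls_mult by metis
    qed
    also have "\<dots> = m2 y x"
      using S.P.mem_cls[OF pq(1)] S.P.mem_cls[OF pq(2)] pq by blast
    finally show ?thesis .
  qed
  show "(\<lambda>x. x \<otimes>\<^bsub>TT\<^esub> y) \<in> lin_maps TT TT" if "y \<in> carrier TT" for y
    by (rule lin_cong[OF m2(1)[OF that] Q mult[OF _ that]])
  show "pt a b \<otimes>\<^bsub>TT\<^esub> pt c d = braid4 a b c d"
    if "a \<in> carrier T" "b \<in> carrier T" "c \<in> carrier T" "d \<in> carrier T" for a b c d
    using that by (simp add: mult m2(2) m1(2))
  have m2_lin: "(\<lambda>y. m2 y x) \<in> lin_maps TT TT" if x: "x \<in> carrier TT" for x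
  proof (rule linI)
    fix v w c assume v: "v \<in> carrier TT"
    show "m2 v x \<in> carrier TT" using linD(1)[OF m2(1)[OF v] x] .
    show "m2 (c \<odot>\<^bsub>TT\<^esub> v) x = c \<odot>\<^bsub>TT\<^esub> m2 v x"
      by (rule S.pure_lin_eq[OF m2(1) lin_scale[OF m2(1) Q] Q _ x])
        (use v linD(3)[OF m1(1)] in \<open>auto simp: m2(2)\<close>)
    assume w: "w \<in> carrier TT"
    show "m2 (v \<oplus>\<^bsub>TT\<^esub> w) x = m2 v x \<oplus>\<^bsub>TT\<^esub> m2 w x"
      by (rule S.pure_lin_eq[OF m2(1) lin_plus[OF m2(1) m2(1) Q] Q _ x])
        (use v w linD(2)[OF m1(1)] in \<open>auto simp: m2(2)\<close>)
  qed
  show "(\<lambda>y. x \<otimes>\<^bsub>TT\<^esub> y) \<in> lin_maps TT TT" if "x \<in> carrier TT" for x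
    by (rule lin_cong[OF m2_lin[OF that] Q mult[OF that]])
qed

lemma TT_mult_homog:
  assumes "a \<in> carrier T" "c \<in> carrier T" "d \<in> carrier T" "g \<in> carrier G" "b \<in> homog T g"
  shows "pt a b \<otimes>\<^bsub>TT\<^esub> pt c d = pt (a \<otimes>\<^bsub>T\<^esub> act T g c) (b \<otimes>\<^bsub>T\<^esub> d)"
  using TT_mult_pure[of a b c d] braid4_homog[OF assms] TG.homog_closed[OF assms(4,5)] assms by simp

lemma one_TT: "\<one>\<^bsub>TT\<^esub> = pt \<one>\<^bsub>T\<^esub> \<one>\<^bsub>T\<^esub>"
proof -
  let ?F' = "S.F\<lparr>mult := braided_mult G T, one := Poly_Mapping.single (\<one>\<^bsub>T\<^esub>, \<one>\<^bsub>T\<^esub>) 1\<rparr>"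
  have sc: "(+>\<^bsub>?F'\<^esub>) = (+>\<^bsub>S.F\<^esub>)" by (rule same_cosets) simp_all
  show ?thesis
    unfolding braided_square_def Let_def quot_module_def monoid.simps FactRing_def sc S.pure_gen by simp
qed

lemma act_one_group: "x \<in> carrier T \<Longrightarrow> act T \<one>\<^bsub>G\<^esub> x = x"
proof (rule T.W_lin_eq[OF act_lin lin_id T.P.Q_cspace])
  fix ws assume "ws \<in> words"
  moreover from this have "map (act V \<one>\<^bsub>G\<^esub>) ws = ws" by (induction ws) (auto simp: act_one)
  ultimately show "act T \<one>\<^bsub>G\<^esub> (W ws) = W ws" by (simp add: act_W)
qed auto

text \<open>On homogeneous pure tensors associativity reduces to the action of \<open>G\<close> on \<open>T(V)\<close> being by algebra
  automorphisms.\<close>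

sublocale TT: calg TT
proof (rule calgI[where B = "{pt a b | a b g. a \<in> carrier T \<and> g \<in> carrier G \<and> b \<in> homog T g}"])
  let ?B = "{pt a b | a b g. a \<in> carrier T \<and> g \<in> carrier G \<and> b \<in> homog T g}"
  interpret TT: cspace TT by (rule S.P.Q_cspace)
  show B: "?B \<subseteq> carrier TT" using TG.homog_closed by auto
  show "x \<in> CC_span TT ?B" if "x \<in> carrier TT" for x
  proof -
    have "pt a b \<in> CC_span TT ?B" if "a \<in> carrier T" "b \<in> carrier T" for a b
      by (rule lin_span_image[OF S.pure_lin_r[OF that(1)] T.P.Q_cspace S.P.Q_cspace _
            TT.span_is_subspace[OF B] _ TG.homog_span[OF that(2)]])
        (use TG.homog_closed that(1) in \<open>blast intro: TT.span_base[OF B]\<close>)+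
    then have "{pt a b | a b. a \<in> carrier T \<and> b \<in> carrier T} \<subseteq> CC_span TT ?B" by auto
    from TT.span_subset[OF TT.span_is_subspace[OF B] this] S.pure_span[OF that] show ?thesis by auto
  qed
  show "x \<otimes>\<^bsub>TT\<^esub> y \<otimes>\<^bsub>TT\<^esub> z = x \<otimes>\<^bsub>TT\<^esub> (y \<otimes>\<^bsub>TT\<^esub> z)" if xyz: "x \<in> ?B" "y \<in> ?B" "z \<in> ?B" for x y z
  proof -
    from xyz obtain a b g c d h e f where [simp]: "x = pt a b" "y = pt c d" "z = pt e f"
      and c: "a \<in> carrier T" "c \<in> carrier T" "e \<in> carrier T" "f \<in> carrier T"
        "g \<in> carrier G" "h \<in> carrier G" "b \<in> homog T g" "d \<in> homog T h"
      using TG.homog_closed by blast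
    have bd: "b \<in> carrier T" "d \<in> carrier T" using TG.homog_closed c by auto
    have "x \<otimes>\<^bsub>TT\<^esub> y \<otimes>\<^bsub>TT\<^esub> z = pt (a \<otimes>\<^bsub>T\<^esub> act T g c \<otimes>\<^bsub>T\<^esub> act T (g \<otimes>\<^bsub>G\<^esub> h) e) (b \<otimes>\<^bsub>T\<^esub> d \<otimes>\<^bsub>T\<^esub> f)"
      using c bd TT_mult_homog[of a c d g b]
        TT_mult_homog[of "a \<otimes>\<^bsub>T\<^esub> act T g c" e f "g \<otimes>\<^bsub>G\<^esub> h" "b \<otimes>\<^bsub>T\<^esub> d"] mult_homog[of g h b d] by simp
    moreover have "x \<otimes>\<^bsub>TT\<^esub> (y \<otimes>\<^bsub>TT\<^esub> z) = pt (a \<otimes>\<^bsub>T\<^esub> act T g (c \<otimes>\<^bsub>T\<^esub> act T h e)) (b \<otimes>\<^bsub>T\<^esub> (d \<otimes>\<^bsub>T\<^esub> f))"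
      using c bd TT_mult_homog[of c e f h d]
        TT_mult_homog[of a "c \<otimes>\<^bsub>T\<^esub> act T h e" "d \<otimes>\<^bsub>T\<^esub> f" g b] by simp
    ultimately show ?thesis
      using c bd by (simp add: act_mult_T act_act_T T.C.A.m_assoc)
  qed
  show "\<one>\<^bsub>TT\<^esub> \<in> carrier TT" unfolding one_TT by simp
  fix x assume "x \<in> ?B"
  then obtain a b g where x: "x = pt a b" "a \<in> carrier T" "g \<in> carrier G" "b \<in> homog T g" by blast
  have b: "b \<in> carrier T" using TG.homog_closed x by auto
  show "\<one>\<^bsub>TT\<^esub> \<otimes>\<^bsub>TT\<^esub> x = x"
    using TT_mult_homog[of "\<one>\<^bsub>T\<^esub>" a b "\<one>\<^bsub>G\<^esub>" "\<one>\<^bsub>T\<^esub>"] x b one_homog act_one_group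
    unfolding one_TT by simp
  show "x \<otimes>\<^bsub>TT\<^esub> \<one>\<^bsub>TT\<^esub> = x"
    using TT_mult_homog[of a "\<one>\<^bsub>T\<^esub>" "\<one>\<^bsub>T\<^esub>" g b] x b act_one_T
    unfolding one_TT by simp
qed (rule S.P.Q_cspace TT_mult_lin_l TT_mult_lin_r; assumption?)+

end

section \<open>Comultiplication, counit and skew derivations\<close>

lemma CC_line_simps [simp]:
  "carrier CC_line = UNIV" "mult CC_line = (*)" "one CC_line = 1" "zero CC_line = 0"
  "add CC_line = (+)" "smult CC_line = (*)"
  by (simp_all add: CC_line_def)

lemma CC_line_cspace: "cspace CC_line"
proof (rule cspaceI)
  show "\<exists>w\<in>carrier CC_line. v \<oplus>\<^bsub>CC_line\<^esub> w = \<zero>\<^bsub>CC_line\<^esub>" for v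
    by (rule bexI[of _ "- v"]) simp_all
qed (simp_all add: algebra_simps)

lemma zero_functional: "(\<lambda>_. 0) \<in> lin_maps V CC_line"
  by (rule linI) simp_all

lemma CC_line_calg: "calg CC_line"
proof (rule calgI[where B = UNIV])
  interpret cspace CC_line by (rule CC_line_cspace)
  show "x \<in> CC_span CC_line UNIV" for x
    by (rule span_base) simp_all
qed (auto intro: linI CC_line_cspace simp: algebra_simps)

lemma CC_line_finsum: "finsum CC_line f A = sum f A"
proof -
  interpret cspace CC_line by (rule CC_line_cspace)
  show ?thesis by (induction A rule: infinite_finite_induct) (simp_all add: finsum_insert)
qed

context yd_tensor
begin

lemma pt_homog_span:
  assumes "x \<in> carrier TT"
  shows "x \<in> CC_span TT {pt a b | a b g. a \<in> carrier T \<and> g \<in> carrier G \<and> b \<in> homog T g}"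
    (is "_ \<in> CC_span TT ?B")
proof -
  have B: "?B \<subseteq> carrier TT" using TG.homog_closed by auto
  have "pt a b \<in> CC_span TT ?B" if "a \<in> carrier T" "b \<in> carrier T" for a b
    by (rule lin_span_image[OF S.pure_lin_r[OF that(1)] T.P.Q_cspace S.P.Q_cspace _
          TT.span_is_subspace[OF B] _ TG.homog_span[OF that(2)]])
      (use TG.homog_closed that(1) in \<open>blast intro: TT.span_base[OF B]\<close>)+
  then have "{pt a b | a b. a \<in> carrier T \<and> b \<in> carrier T} \<subseteq> CC_span TT ?B" by auto
  from TT.span_subset[OF TT.span_is_subspace[OF B] this] S.pure_span[OF assms] show ?thesis by auto
qed

text \<open>The value \<open>v \<otimes> 1 + 1 \<otimes> v\<close> prescribed for the comultiplication on \<open>V\<close>.\<close>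

definition prim where
  "prim v = pt (W [v]) \<one>\<^bsub>T\<^esub> \<oplus>\<^bsub>TT\<^esub> pt \<one>\<^bsub>T\<^esub> (W [v])"

lemma W1_closed [simp]: "v \<in> carrier V \<Longrightarrow> W [v] \<in> carrier T"
  by (rule T.W_closed) simp

lemma prim_lin: "prim \<in> lin_maps V TT"
  unfolding prim_def[abs_def]
  by (intro lin_plus S.P.Q_cspace lin_comp[OF W1_lin S.pure_lin_l] lin_comp[OF W1_lin S.pure_lin_r]) auto

lemma prim_closed [simp]: "v \<in> carrier V \<Longrightarrow> prim v \<in> carrier TT"
  using linD(1)[OF prim_lin] .

lemma prim_mult:
  assumes g: "g \<in> carrier G" and v: "v \<in> homog V g" and c: "c \<in> carrier T" and d: "d \<in> carrier T"
  shows "prim v \<otimes>\<^bsub>TT\<^esub> pt c d = pt (W [v] \<otimes>\<^bsub>T\<^esub> c) d \<oplus>\<^bsub>TT\<^esub> pt (act T g c) (W [v] \<otimes>\<^bsub>T\<^esub> d)"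
proof -
  have v': "v \<in> carrier V" using V.homog_closed g v by auto
  have "pt (W [v]) \<one>\<^bsub>T\<^esub> \<otimes>\<^bsub>TT\<^esub> pt c d = pt (W [v] \<otimes>\<^bsub>T\<^esub> c) d"
    using TT_mult_homog[of "W [v]" c d "\<one>\<^bsub>G\<^esub>" "\<one>\<^bsub>T\<^esub>"] one_homog v' c d by (simp add: act_one_group)
  moreover have "pt \<one>\<^bsub>T\<^esub> (W [v]) \<otimes>\<^bsub>TT\<^esub> pt c d = pt (act T g c) (W [v] \<otimes>\<^bsub>T\<^esub> d)"
    using TT_mult_homog[of "\<one>\<^bsub>T\<^esub>" c d g "W [v]"] W1_homog[OF g v] g c d by simp
  ultimately show ?thesis
    unfolding prim_def using v' c d by (simp add: TT.A.l_distr)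
qed

fun word_comult where
  "word_comult [] = \<one>\<^bsub>TT\<^esub>"
| "word_comult (v # ws) = prim v \<otimes>\<^bsub>TT\<^esub> word_comult ws"

lemma word_comult_closed [simp]: "ws \<in> words \<Longrightarrow> word_comult ws \<in> carrier TT"
  by (induction ws) auto

lemma word_comult_append: "u \<in> words \<Longrightarrow> s \<in> words \<Longrightarrow>
    word_comult (u @ s) = word_comult u \<otimes>\<^bsub>TT\<^esub> word_comult s"
  by (induction u) (auto simp: TT.A.m_assoc)

lemma word_comult_multilinear: "multilinear V TT word_comult"
proof -
  have "(\<lambda>v. word_comult (u @ v # s)) \<in> lin_maps V TT" if "u \<in> words" "s \<in> words" for u s
    using that
  proof (induction u)
    case Nil
    then show ?case using lin_comp[OF prim_lin TT.mult_lin_l] by simp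
  next
    case (Cons a u)
    then show ?case using lin_comp[OF Cons.IH TT.mult_lin_r] by auto
  qed
  then show ?thesis unfolding multilinear_def by auto
qed

abbreviation "D \<equiv> comultiplication G V"

text \<open>Definite descriptions carry no information until existence and uniqueness are known. Existence: the products of
the elements \<open>v \<otimes> 1 + 1 \<otimes> v\<close> along a word are multilinear in the word. Uniqueness: an algebra map is determined
on words by its values on letters.\<close>

lemma comult:
  shows D_lin: "D \<in> lin_maps T TT"
    and D_word: "\<And>ws. ws \<in> words \<Longrightarrow> D (W ws) = word_comult ws"
proof -
  let ?P = "\<lambda>D. D \<in> extensional (carrier T) \<and> D \<in> Ring.ring_hom T TT \<and> D \<in> lin_maps T TT \<and>
       (\<forall>v\<in>carrier V. D (W [v]) = pt (W [v]) \<one>\<^bsub>T\<^esub> \<oplus>\<^bsub>TT\<^esub> pt \<one>\<^bsub>T\<^esub> (W [v]))"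
  obtain k where k: "k \<in> lin_maps T TT" "\<And>ws. ws \<in> words \<Longrightarrow> k (W ws) = word_comult ws"
    using T.lift_multilinear[OF S.P.Q_cspace word_comult_multilinear] by blast
  let ?k = "restrict k (carrier T)"
  have k': "?k \<in> lin_maps T TT" by (rule lin_cong[OF k(1) T.P.Q_cspace]) simp
  have "?k \<in> Ring.ring_hom T TT"
  proof (rule ring_hom_memI)
    fix x y assume xy: "x \<in> carrier T" "y \<in> carrier T"
    have "k (x \<otimes>\<^bsub>T\<^esub> y) = k x \<otimes>\<^bsub>TT\<^esub> k y"
      by (rule T.mult_hom_words[OF TT.calg_axioms k(1) _ xy]) (simp add: k(2) word_comult_append)
    then show "?k (x \<otimes>\<^bsub>T\<^esub> y) = ?k x \<otimes>\<^bsub>TT\<^esub> ?k y" using xy by simp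
  next
    show "?k \<one>\<^bsub>T\<^esub> = \<one>\<^bsub>TT\<^esub>" using k(2)[of "[]"] by (simp add: T.one_W[symmetric])
  qed (use linD[OF k(1)] in auto)
  moreover have "k (W [v]) = prim v" if "v \<in> carrier V" for v
    using k(2)[of "[v]"] that by simp
  ultimately have Pk: "?P ?k" using k' by (auto simp: prim_def)
  have words: "D' (W ws) = word_comult ws" if "?P D'" "ws \<in> words" for D' ws
    using that(2)
  proof (induction ws)
    case Nil
    then show ?case using that(1) ring_hom_one[of D' T TT] by (simp add: T.one_W)
  next
    case (Cons v ws)
    have "D' (W (v # ws)) = D' (W [v] \<otimes>\<^bsub>T\<^esub> W ws)" using Cons W_Cons[of v ws] by simp
    also have "\<dots> = D' (W [v]) \<otimes>\<^bsub>TT\<^esub> D' (W ws)"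
      using that(1) Cons T.W_closed by (intro ring_hom_mult[of D' T TT]) auto
    finally show ?case using Cons that(1) by (simp add: prim_def)
  qed
  have uniq: "D' = ?k" if P: "?P D'" for D'
  proof (rule extensionalityI[of _ "carrier T"])
    fix x assume x: "x \<in> carrier T"
    have "D' x = k x"
      by (rule T.W_lin_eq[OF _ k(1) S.P.Q_cspace _ x]) (use P words k(2) in auto)
    then show "D' x = ?k x" using x by simp
  qed (use P in auto)
  have "?P D" unfolding comultiplication_def Let_def by (rule theI[of ?P, OF Pk uniq])
  then show "D \<in> lin_maps T TT" "\<And>ws. ws \<in> words \<Longrightarrow> D (W ws) = word_comult ws"
    using words by auto
qed

lemma D_closed [simp]: "x \<in> carrier T \<Longrightarrow> D x \<in> carrier TT"
  using linD(1)[OF D_lin] .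

lemma D_mult: "x \<in> carrier T \<Longrightarrow> y \<in> carrier T \<Longrightarrow> D (x \<otimes>\<^bsub>T\<^esub> y) = D x \<otimes>\<^bsub>TT\<^esub> D y"
  by (rule T.mult_hom_words[OF TT.calg_axioms D_lin]) (simp_all add: D_word word_comult_append)

lemma D_one: "D \<one>\<^bsub>T\<^esub> = pt \<one>\<^bsub>T\<^esub> \<one>\<^bsub>T\<^esub>"
  using D_word[of "[]"] by (simp add: T.one_W[symmetric] one_TT)

lemma D_W1: "v \<in> carrier V \<Longrightarrow> D (W [v]) = prim v"
  using D_word[of "[v]"] by simp

abbreviation "eps \<equiv> counit G V"

lemma counit:
  shows eps_lin: "eps \<in> lin_maps T CC_line"
    and eps_word: "\<And>ws. ws \<in> words \<Longrightarrow> eps (W ws) = (if ws = [] then 1 else 0)"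
proof -
  let ?P = "\<lambda>e. e \<in> extensional (carrier T) \<and> e \<in> Ring.ring_hom T CC_line \<and> e \<in> lin_maps T CC_line \<and>
       (\<forall>v\<in>carrier V. e (W [v]) = 0)"
  let ?f = "\<lambda>ws. if ws = [] then 1 else (0::complex)"
  have "multilinear V CC_line ?f"
    unfolding multilinear_def by (simp add: zero_functional)
  then obtain k where k: "k \<in> lin_maps T CC_line" "\<And>ws. ws \<in> words \<Longrightarrow> k (W ws) = ?f ws"
    using T.lift_multilinear[OF CC_line_cspace] by blast
  let ?k = "restrict k (carrier T)"
  have k': "?k \<in> lin_maps T CC_line" by (rule lin_cong[OF k(1) T.P.Q_cspace]) simp
  have "?k \<in> Ring.ring_hom T CC_line"
  proof (rule ring_hom_memI)
    fix x y assume xy: "x \<in> carrier T" "y \<in> carrier T"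
    have "k (x \<otimes>\<^bsub>T\<^esub> y) = k x \<otimes>\<^bsub>CC_line\<^esub> k y"
      by (rule T.mult_hom_words[OF CC_line_calg k(1) _ xy]) (simp add: k(2))
    then show "?k (x \<otimes>\<^bsub>T\<^esub> y) = ?k x \<otimes>\<^bsub>CC_line\<^esub> ?k y" using xy by simp
  next
    show "?k \<one>\<^bsub>T\<^esub> = \<one>\<^bsub>CC_line\<^esub>" using k(2)[of "[]"] by (simp add: T.one_W[symmetric])
  qed (use linD[OF k(1)] in auto)
  moreover have "k (W [v]) = 0" if "v \<in> carrier V" for v
    using k(2)[of "[v]"] that by simp
  ultimately have Pk: "?P ?k" using k' by auto
  have words: "e (W ws) = ?f ws" if "?P e" "ws \<in> words" for e ws
    using that(2)
  proof (induction ws)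
    case Nil
    then show ?case using that(1) ring_hom_one[of e T CC_line] by (simp add: T.one_W)
  next
    case (Cons v ws)
    have "e (W (v # ws)) = e (W [v] \<otimes>\<^bsub>T\<^esub> W ws)" using Cons W_Cons[of v ws] by simp
    also have "\<dots> = e (W [v]) \<otimes>\<^bsub>CC_line\<^esub> e (W ws)"
      using that(1) Cons T.W_closed by (intro ring_hom_mult[of e T CC_line]) auto
    finally show ?case using Cons that(1) by simp
  qed
  have uniq: "e = ?k" if P: "?P e" for e
  proof (rule extensionalityI[of _ "carrier T"])
    fix x assume x: "x \<in> carrier T"
    have "e x = k x"
      by (rule T.W_lin_eq[OF _ k(1) CC_line_cspace _ x]) (use P words k(2) in auto)
    then show "e x = ?k x" using x by simp
  qed (use P in auto)
  have "?P eps" unfolding counit_def Let_def by (rule theI[of ?P, OF Pk uniq])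
  then show "eps \<in> lin_maps T CC_line" "\<And>ws. ws \<in> words \<Longrightarrow> eps (W ws) = ?f ws"
    using words by auto
qed

lemma eps_mult: "x \<in> carrier T \<Longrightarrow> y \<in> carrier T \<Longrightarrow> eps (x \<otimes>\<^bsub>T\<^esub> y) = eps x * eps y"
  using T.mult_hom_words[OF CC_line_calg eps_lin, of x y] by (simp add: eps_word)

lemma eps_one: "eps \<one>\<^bsub>T\<^esub> = 1"
  using eps_word[of "[]"] by (simp add: T.one_W)

lemma eps_act: "g \<in> carrier G \<Longrightarrow> x \<in> carrier T \<Longrightarrow> eps (act T g x) = eps x"
  by (rule T.W_lin_eq[OF lin_comp[OF act_lin eps_lin] eps_lin CC_line_cspace])
    (simp_all add: act_W eps_word)

text \<open>The functional on \<open>T(V)\<close> that is \<open>l\<close> on \<open>V\<close> and zero in all other degrees.\<close>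

definition letter where
  "letter l = (SOME p. p \<in> lin_maps T CC_line \<and>
    (\<forall>ws\<in>words. p (W ws) = (case ws of [v] \<Rightarrow> l v | _ \<Rightarrow> (0::complex))))"

lemma letter:
  assumes l: "l \<in> lin_maps V CC_line"
  shows letter_lin: "letter l \<in> lin_maps T CC_line"
    and letter_word: "ws \<in> words \<Longrightarrow> letter l (W ws) = (case ws of [v] \<Rightarrow> l v | _ \<Rightarrow> 0)"
proof -
  let ?f = "\<lambda>ws. case ws of [v] \<Rightarrow> l v | _ \<Rightarrow> (0::complex)"
  have "(\<lambda>v. ?f (u @ v # s)) \<in> lin_maps V CC_line" for u s
  proof (cases "u = [] \<and> s = []")
    case True
    then show ?thesis using l by simp
  next
    case False
    then have "(\<lambda>v. ?f (u @ v # s)) = (\<lambda>_. 0)"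
      by (auto simp: fun_eq_iff append_eq_Cons_conv split: list.splits)
    then show ?thesis by (simp only: zero_functional)
  qed
  then have "multilinear V CC_line ?f" unfolding multilinear_def by simp
  then have "\<exists>p. p \<in> lin_maps T CC_line \<and> (\<forall>ws\<in>words. p (W ws) = ?f ws)"
    using T.lift_multilinear[OF CC_line_cspace] by blast
  from someI_ex[OF this] show "letter l \<in> lin_maps T CC_line"
    "ws \<in> words \<Longrightarrow> letter l (W ws) = ?f ws"
    unfolding letter_def[symmetric] by auto
qed

lemma letter_mult:
  assumes l: "l \<in> lin_maps V CC_line" and v: "v \<in> carrier V" and x: "x \<in> carrier T"
  shows "letter l (W [v] \<otimes>\<^bsub>T\<^esub> x) = l v * eps x"
proof -
  have "(\<lambda>x. l v * eps x) \<in> lin_maps T CC_line"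
    using lin_scale[OF eps_lin CC_line_cspace, of "l v"] by simp
  then show ?thesis
    by (rule T.W_lin_eq[OF lin_comp[OF T.C.mult_lin_r[OF W1_closed[OF v]] letter_lin[OF l]] _
          CC_line_cspace _ x])
      (use v letter_word[OF l] eps_word in \<open>auto simp: T.W_append split: list.splits\<close>)
qed

text \<open>The map \<open>p \<otimes> id\<close> followed by the identification of \<open>\<complex> \<otimes> T(V)\<close> with \<open>T(V)\<close>.\<close>

definition contract where
  "contract p = (SOME k. k \<in> lin_maps TT T \<and>
    (\<forall>a\<in>carrier T. \<forall>b\<in>carrier T. k (pt a b) = (p a :: complex) \<odot>\<^bsub>T\<^esub> b))"

lemma contract:
  assumes p: "p \<in> lin_maps T CC_line"
  shows contract_lin: "contract p \<in> lin_maps TT T"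
    and contract_pure: "a \<in> carrier T \<Longrightarrow> b \<in> carrier T \<Longrightarrow> contract p (pt a b) = p a \<odot>\<^bsub>T\<^esub> b"
proof -
  have "\<exists>k\<in>lin_maps TT T. \<forall>a\<in>carrier T. \<forall>b\<in>carrier T. k (pt a b) = p a \<odot>\<^bsub>T\<^esub> b"
  proof (rule S.lift_bilinear[OF T.P.Q_cspace])
    show "(\<lambda>a. p a \<odot>\<^bsub>T\<^esub> b) \<in> lin_maps T T" if "b \<in> carrier T" for b
      by (rule linI) (use that linD[OF p] in \<open>auto simp: T.C.sm_ldistr T.C.sm_assoc\<close>)
    show "(\<lambda>b. p a \<odot>\<^bsub>T\<^esub> b) \<in> lin_maps T T" if "a \<in> carrier T" for a
      by (rule lin_scale[OF lin_id T.P.Q_cspace])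
  qed
  then have "\<exists>k. k \<in> lin_maps TT T \<and> (\<forall>a\<in>carrier T. \<forall>b\<in>carrier T. k (pt a b) = p a \<odot>\<^bsub>T\<^esub> b)"
    by blast
  from someI_ex[OF this] show "contract p \<in> lin_maps TT T"
    "a \<in> carrier T \<Longrightarrow> b \<in> carrier T \<Longrightarrow> contract p (pt a b) = p a \<odot>\<^bsub>T\<^esub> b"
    unfolding contract_def[symmetric] by auto
qed

lemma contract_cong:
  assumes "p \<in> lin_maps T CC_line" "q \<in> lin_maps T CC_line" "\<And>x. x \<in> carrier T \<Longrightarrow> p x = q x" "x \<in> carrier TT"
  shows "contract p x = contract q x"
  by (rule S.pure_lin_eq[OF contract_lin[OF assms(1)] contract_lin[OF assms(2)] T.P.Q_cspace _ assms(4)])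
    (use assms contract_pure in simp)

lemma contract_scale:
  assumes p: "p \<in> lin_maps T CC_line" and x: "x \<in> carrier TT"
  shows "contract (\<lambda>x. c * p x) x = c \<odot>\<^bsub>T\<^esub> contract p x"
proof -
  have cp: "(\<lambda>x. c * p x) \<in> lin_maps T CC_line"
    using lin_scale[OF p CC_line_cspace, of c] by simp
  show ?thesis
    by (rule S.pure_lin_eq[OF contract_lin[OF cp] lin_scale[OF contract_lin[OF p] T.P.Q_cspace] T.P.Q_cspace _ x])
      (simp add: contract_pure[OF p] contract_pure[OF cp] T.C.sm_assoc)
qed

lemma contract_prim:
  assumes p: "p \<in> lin_maps T CC_line" and g: "g \<in> carrier G" and v: "v \<in> homog V g" and x: "x \<in> carrier TT"
  shows "contract p (prim v \<otimes>\<^bsub>TT\<^esub> x) =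
    contract (\<lambda>c. p (W [v] \<otimes>\<^bsub>T\<^esub> c)) x \<oplus>\<^bsub>T\<^esub> W [v] \<otimes>\<^bsub>T\<^esub> contract (\<lambda>c. p (act T g c)) x"
proof -
  have v': "v \<in> carrier V" using V.homog_closed g v by auto
  have l: "(\<lambda>c. p (W [v] \<otimes>\<^bsub>T\<^esub> c)) \<in> lin_maps T CC_line" "(\<lambda>c. p (act T g c)) \<in> lin_maps T CC_line"
    using lin_comp[OF T.C.mult_lin_r p] lin_comp[OF act_lin p] v' g by auto
  show ?thesis
  proof (rule S.pure_lin_eq[OF lin_comp[OF TT.mult_lin_r contract_lin[OF p]]
      lin_plus[OF contract_lin[OF l(1)] lin_comp[OF contract_lin[OF l(2)] T.C.mult_lin_r] T.P.Q_cspace]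
      T.P.Q_cspace _ x])
    fix c d assume cd: "c \<in> carrier T" "d \<in> carrier T"
    show "contract p (prim v \<otimes>\<^bsub>TT\<^esub> pt c d) =
      contract (\<lambda>c. p (W [v] \<otimes>\<^bsub>T\<^esub> c)) (pt c d) \<oplus>\<^bsub>T\<^esub> W [v] \<otimes>\<^bsub>T\<^esub> contract (\<lambda>c. p (act T g c)) (pt c d)"
      using cd v' g linD(2)[OF contract_lin[OF p]]
      by (simp add: prim_mult[OF g v] contract_pure[OF p] contract_pure[OF l(1)] contract_pure[OF l(2)]
          T.C.mult_sm_r)
  qed (use v' in auto)
qed

text \<open>The counit law, by induction on words: the counit kills the summand \<open>v \<otimes> 1\<close> of each letter and is invariant under
the group.\<close>

lemma contract_eps_D:
  assumes x: "x \<in> carrier T"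
  shows "contract eps (D x) = x"
proof -
  have H: "(\<Union>g\<in>carrier G. hwords g) \<subseteq> carrier T" using hwords_closed by auto
  have "contract eps (D (W vs)) = W vs"
    if "list_all2 (\<lambda>v h. h \<in> carrier G \<and> v \<in> homog V h) vs gs" for vs gs
    using that
  proof (induction vs gs rule: list_all2_induct)
    case Nil
    then show ?case using contract_pure[OF eps_lin] by (simp add: T.one_W[symmetric] D_one eps_one)
  next
    case (Cons v vs h gs)
    have vs: "vs \<in> words" by (rule homog_words[OF Cons(2)])
    have v: "v \<in> carrier V" using Cons V.homog_closed by auto
    have 1: "contract (\<lambda>c. eps (W [v] \<otimes>\<^bsub>T\<^esub> c)) X = \<zero>\<^bsub>T\<^esub>" if X: "X \<in> carrier TT" for X
    proof -
      have "(\<lambda>c. eps (W [v] \<otimes>\<^bsub>T\<^esub> c)) \<in> lin_maps T CC_line"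
        using lin_comp[OF T.C.mult_lin_r eps_lin] v by simp
      then have "contract (\<lambda>c. eps (W [v] \<otimes>\<^bsub>T\<^esub> c)) X = contract (\<lambda>c. 0 * eps c) X"
        using lin_scale[OF eps_lin CC_line_cspace, of 0] v X
        by (intro contract_cong) (simp_all add: eps_mult eps_word)
      then show ?thesis
        using linD(1)[OF contract_lin[OF eps_lin] X] by (simp only: contract_scale[OF eps_lin X] T.C.sm_0)
    qed
    have 2: "contract (\<lambda>c. eps (act T h c)) X = contract eps X" if X: "X \<in> carrier TT" for X
      by (rule contract_cong[OF lin_comp[OF act_lin eps_lin] eps_lin _ X]) (use Cons eps_act in auto)
    have "D (W (v # vs)) = prim v \<otimes>\<^bsub>TT\<^esub> D (W vs)" using D_word v vs by simp
    then show ?case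
      using contract_prim[OF eps_lin _ _ D_closed, of h v "W vs"] Cons vs v T.W_closed[OF vs] W_Cons[OF v vs]
      by (simp add: 1 2)
  qed
  then show ?thesis
    by (intro lin_eq_on_span[OF lin_comp[OF D_lin contract_lin[OF eps_lin]] lin_id T.P.Q_cspace T.P.Q_cspace H
          hwords_span[OF x]]) (auto elim!: hwordsE)
qed

text \<open>The skew derivation of \<open>T(V)\<close> attached to a functional \<open>l\<close> on \<open>V\<close>.\<close>

definition deriv where "deriv l x = contract (letter l) (D x)"

lemma deriv_lin: "l \<in> lin_maps V CC_line \<Longrightarrow> deriv l \<in> lin_maps T T"
  unfolding deriv_def[abs_def] by (rule lin_comp[OF D_lin contract_lin[OF letter_lin]])

lemma deriv_one: "l \<in> lin_maps V CC_line \<Longrightarrow> deriv l \<one>\<^bsub>T\<^esub> = \<zero>\<^bsub>T\<^esub>"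
  unfolding deriv_def D_one using letter_word[of l "[]"] contract_pure[OF letter_lin]
  by (simp add: T.one_W[symmetric])

text \<open>The twisted Leibniz rule: expanding \<open>\<Delta>(v x) = (v \<otimes> 1 + 1 \<otimes> v) \<Delta>(x)\<close>, the first summand contributes only
through the counit part of \<open>\<Delta>(x)\<close>, the second one moves \<open>g\<close> past the contracted factor. The rule has this simple
form because \<open>l\<close> is an eigenvector of \<open>g\<close>.\<close>

lemma deriv_mult:
  assumes l: "l \<in> lin_maps V CC_line" and g: "g \<in> carrier G" and v: "v \<in> homog V g" and x: "x \<in> carrier T"
    and lg: "\<And>w. w \<in> carrier V \<Longrightarrow> l (act V g w) = c * l w"
  shows "deriv l (W [v] \<otimes>\<^bsub>T\<^esub> x) = l v \<odot>\<^bsub>T\<^esub> x \<oplus>\<^bsub>T\<^esub> c \<odot>\<^bsub>T\<^esub> (W [v] \<otimes>\<^bsub>T\<^esub> deriv l x)"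
proof -
  have v': "v \<in> carrier V" using V.homog_closed g v by auto
  have Dx: "D x \<in> carrier TT" using x by simp
  have 1: "contract (\<lambda>c. letter l (W [v] \<otimes>\<^bsub>T\<^esub> c)) (D x) = l v \<odot>\<^bsub>T\<^esub> x"
  proof -
    have "contract (\<lambda>c. letter l (W [v] \<otimes>\<^bsub>T\<^esub> c)) (D x) = contract (\<lambda>c. l v * eps c) (D x)"
      using lin_comp[OF T.C.mult_lin_r letter_lin[OF l]] lin_scale[OF eps_lin CC_line_cspace, of "l v"] v' Dx
      by (intro contract_cong) (simp_all add: letter_mult[OF l])
    then show ?thesis by (simp only: contract_scale[OF eps_lin Dx] contract_eps_D[OF x])
  qed
  have 2: "contract (\<lambda>c. letter l (act T g c)) (D x) = c \<odot>\<^bsub>T\<^esub> contract (letter l) (D x)"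
  proof -
    have "letter l (act T g y) = c * letter l y" if "y \<in> carrier T" for y
    proof (rule T.W_lin_eq[OF lin_comp[OF act_lin letter_lin[OF l]] _ CC_line_cspace _ that])
      show "(\<lambda>y. c * letter l y) \<in> lin_maps T CC_line"
        using lin_scale[OF letter_lin[OF l] CC_line_cspace, of c] by simp
      show "letter l (act T g (W ws)) = c * letter l (W ws)" if "ws \<in> words" for ws
        using that g lg letter_word[OF l] by (auto simp: act_W split: list.splits)
    qed (rule g)
    then have "contract (\<lambda>c. letter l (act T g c)) (D x) = contract (\<lambda>y. c * letter l y) (D x)"
      using lin_comp[OF act_lin[OF g] letter_lin[OF l]] lin_scale[OF letter_lin[OF l] CC_line_cspace, of c] Dx
      by (intro contract_cong) simp_all
    then show ?thesis by (simp only: contract_scale[OF letter_lin[OF l] Dx])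
  qed
  have "deriv l (W [v] \<otimes>\<^bsub>T\<^esub> x) = contract (letter l) (prim v \<otimes>\<^bsub>TT\<^esub> D x)"
    unfolding deriv_def using D_mult[of "W [v]" x] D_W1[OF v'] x v' by simp
  also have "\<dots> = l v \<odot>\<^bsub>T\<^esub> x \<oplus>\<^bsub>T\<^esub> W [v] \<otimes>\<^bsub>T\<^esub> (c \<odot>\<^bsub>T\<^esub> deriv l x)"
    unfolding contract_prim[OF letter_lin[OF l] g v Dx] 1 2 deriv_def ..
  finally show ?thesis
    using linD(1)[OF deriv_lin[OF l] x] v' by (simp add: T.C.mult_sm_r)
qed

section \<open>The ideal of the Nichols algebra\<close>

abbreviation "T2 \<equiv> CC_span T (\<Union>n\<in>{2..}. tensor_power G V n)"

text \<open>The subspace \<open>J \<otimes> T + T \<otimes> J\<close> of the tensor square.\<close>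

abbreviation cosum where
  "cosum J \<equiv> CC_span TT ({pt a b | a b. a \<in> J \<and> b \<in> carrier T} \<union> {pt a b | a b. a \<in> carrier T \<and> b \<in> J})"

lemma coideal_iff:
  "is_coideal G V J \<longleftrightarrow> VectorSpace.subspace CC J T \<and> D ` J \<subseteq> cosum J \<and> (\<forall>a\<in>J. eps a = 0)"
  unfolding is_coideal_def Let_def ..

lemma power_closed: "tensor_power G V n \<subseteq> carrier T"
  unfolding tensor_power_def by (rule T.C.span_is_subset2) (auto intro: T.W_closed)

lemma T2_subspace: "VectorSpace.subspace CC T2 T"
  by (rule T.C.span_is_subspace) (use power_closed in auto)

lemma W_T2: "ws \<in> words \<Longrightarrow> 2 \<le> length ws \<Longrightarrow> W ws \<in> T2"
proof -
  assume ws: "ws \<in> words" "2 \<le> length ws"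
  have "W ws \<in> tensor_power G V (length ws)"
    unfolding tensor_power_def by (rule T.C.span_base) (use ws in \<open>auto intro: T.W_closed\<close>)
  then show ?thesis using ws power_closed by (intro T.C.span_base) auto
qed

lemma letter_T2:
  assumes l: "l \<in> lin_maps V CC_line" and x: "x \<in> T2"
  shows "letter l x = 0"
proof -
  have z: "VectorSpace.subspace CC {0} CC_line"
    by (rule cspace.subspaceI[OF CC_line_cspace]) auto
  have "letter l y \<in> {0}" if "y \<in> tensor_power G V n" "2 \<le> n" for y n
  proof (rule lin_span_image[OF letter_lin[OF l] T.P.Q_cspace CC_line_cspace _ z _ that(1)[unfolded tensor_power_def]])
    fix s assume "s \<in> {W vs |vs. vs \<in> words \<and> length vs = n}"
    then obtain vs where vs: "s = W vs" "vs \<in> words" "length vs = n" by blast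
    then obtain a b ws where "vs = a # b # ws"
      using \<open>2 \<le> n\<close> by (cases vs; cases "tl vs") auto
    then show "letter l s \<in> {0}" using letter_word[OF l vs(2)] vs(1) by simp
  qed (auto intro: T.W_closed)
  then have "letter l x \<in> {0}"
    by (intro lin_span_image[OF letter_lin[OF l] T.P.Q_cspace CC_line_cspace _ z _ x]) (use power_closed in auto)
  then show ?thesis by simp
qed

text \<open>Contracting \<open>J \<otimes> T + T \<otimes> J\<close> with \<open>letter l\<close> lands in \<open>J\<close>, since \<open>letter l\<close> vanishes in all degrees
at least two and hence on \<open>J\<close>.\<close>

lemma deriv_coideal:
  assumes J: "is_coideal G V J" "J \<subseteq> T2" and l: "l \<in> lin_maps V CC_line" and x: "x \<in> J"
  shows "deriv l x \<in> J"
proof -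
  have sub: "VectorSpace.subspace CC J T" and Dx: "D x \<in> cosum J"
    using J x by (auto simp: coideal_iff)
  note Jc = T.C.subspaceD[OF sub]
  show ?thesis unfolding deriv_def
  proof (rule lin_span_image[OF contract_lin[OF letter_lin[OF l]] S.P.Q_cspace T.P.Q_cspace _ sub _ Dx])
    fix s assume "s \<in> {pt a b |a b. a \<in> J \<and> b \<in> carrier T} \<union> {pt a b |a b. a \<in> carrier T \<and> b \<in> J}"
    then obtain a b where s: "s = pt a b" "(a \<in> J \<and> b \<in> carrier T) \<or> (a \<in> carrier T \<and> b \<in> J)" by auto
    then have ab: "a \<in> carrier T" "b \<in> carrier T" using Jc(1) by auto
    from s(2) show "contract (letter l) s \<in> J"
    proof
      assume "a \<in> J \<and> b \<in> carrier T"
      then show ?thesis using letter_T2[OF l, of a] J(2) Jc(2) ab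
        by (auto simp: s(1) contract_pure[OF letter_lin[OF l]])
    next
      assume "a \<in> carrier T \<and> b \<in> J"
      then show ?thesis using Jc(4) ab by (simp add: s(1) contract_pure[OF letter_lin[OF l]])
    qed
  qed (use Jc(1) in auto)
qed

abbreviation "NI \<equiv> nichols_ideal G V"

text \<open>The greatest coideal in question exists because the span of a union of coideals is again one.\<close>

lemma nichols_ideal:
  shows NI_coideal: "is_coideal G V NI" and NI_T2: "NI \<subseteq> T2"
    and NI_greatest: "\<And>J. is_coideal G V J \<Longrightarrow> J \<subseteq> T2 \<Longrightarrow> J \<subseteq> NI"
proof -
  let ?P = "\<lambda>J. is_coideal G V J \<and> J \<subseteq> T2"
  let ?U = "\<Union>{J. ?P J}"
  let ?I = "CC_span T ?U"
  have U: "?U \<subseteq> carrier T" using T.C.subspaceD(1) by (auto simp: coideal_iff)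
  have UI: "?U \<subseteq> ?I" using T.C.span_base[OF U] by auto
  have sub: "VectorSpace.subspace CC ?I T" by (rule T.C.span_is_subspace[OF U])
  have gc: "{pt a b |a b. a \<in> J \<and> b \<in> carrier T} \<union> {pt a b |a b. a \<in> carrier T \<and> b \<in> J} \<subseteq> carrier TT"
    if "J \<subseteq> carrier T" for J using that by auto
  have IT: "?I \<subseteq> carrier T" by (rule T.C.span_is_subset2[OF U])
  have "D x \<in> cosum ?I" if "x \<in> ?I" for x
  proof (rule lin_span_image[OF D_lin T.P.Q_cspace S.P.Q_cspace U TT.span_is_subspace[OF gc[OF IT]] _ that])
    fix s assume "s \<in> ?U"
    then obtain J where J: "?P J" "s \<in> J" by auto
    then have "D s \<in> cosum J" by (auto simp: coideal_iff)
    moreover have "J \<subseteq> ?I" using UI J by auto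
    then have "cosum J \<subseteq> cosum ?I" by (intro TT.span_is_monotone) blast
    ultimately show "D s \<in> cosum ?I" by auto
  qed
  moreover have "eps x = 0" if "x \<in> ?I" for x
  proof -
    have z: "VectorSpace.subspace CC {0} CC_line"
      by (rule cspace.subspaceI[OF CC_line_cspace]) auto
    have "eps x \<in> {0}"
      by (rule lin_span_image[OF eps_lin T.P.Q_cspace CC_line_cspace U z _ that]) (auto simp: coideal_iff)
    then show ?thesis by simp
  qed
  ultimately have P: "?P ?I"
    using sub T.C.span_subset[OF T2_subspace, of ?U] by (auto simp: coideal_iff)
  have "NI = ?I"
    unfolding nichols_ideal_def by (rule Greatest_equality) (use P UI in auto)
  then show "is_coideal G V NI" "NI \<subseteq> T2" "\<And>J. is_coideal G V J \<Longrightarrow> J \<subseteq> T2 \<Longrightarrow> J \<subseteq> NI"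
    using P UI by auto
qed

sublocale N: cquot T NI "nichols_algebra G V"
  using NI_coideal unfolding nichols_algebra_def
  by (intro cquot.intro cquot_axioms.intro T.P.Q_cspace) (simp_all add: coideal_iff)

end

section \<open>Criteria for infinite and finite dimension\<close>

text \<open>The functionals \<open>k n\<close> are, up to scalars, dual to the vectors \<open>x n\<close>, which are therefore linearly
independent.\<close>

lemma infinite_dim:
  assumes Q: "cspace Q" and x: "\<And>n. x n \<in> carrier Q"
    and k: "\<And>n. k n \<in> lin_maps Q CC_line" and kx: "\<And>n m. k n (x m) = (if m = n then d n else 0)"
    and d: "\<And>n::nat. d n \<noteq> 0"
  shows "\<not> CC_fin_dim Q"
proof
  interpret Q: cspace Q by fact
  assume fd: "CC_fin_dim Q"
  have inj: "inj x"
  proof (rule injI)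
    fix m n assume "x m = x n"
    then have "k n (x m) = k n (x n)" by simp
    then show "m = n" using kx d by (auto split: if_splits)
  qed
  have "Q.lin_indpt (range x)"
  proof
    assume "Q.lin_dep (range x)"
    then obtain A a v where A: "finite A" "A \<subseteq> range x" "Q.lincomb a A = \<zero>\<^bsub>Q\<^esub>" "v \<in> A" "a v \<noteq> 0"
      unfolding Q.lin_dep_def by auto
    then obtain n where n: "v = x n" by auto
    have Ac: "A \<subseteq> carrier Q" using A x by auto
    have "k n (Q.lincomb a A) = (\<Sum>w\<in>A. k n (a w \<odot>\<^bsub>Q\<^esub> w))"
      unfolding Q.lincomb_def using Ac
      by (subst lin_finsum[OF k Q CC_line_cspace]) (auto simp: CC_line_finsum)
    also have "\<dots> = (\<Sum>w\<in>A. if w = v then a v * d n else 0)"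
    proof (rule sum.cong)
      fix w assume w: "w \<in> A"
      then obtain m where m: "w = x m" using A by auto
      have "k n (a w \<odot>\<^bsub>Q\<^esub> w) = a w * k n w" using linD(3)[OF k] w Ac by auto
      then show "k n (a w \<odot>\<^bsub>Q\<^esub> w) = (if w = v then a v * d n else 0)"
        using kx m n injD[OF inj] by auto
    qed simp
    also have "\<dots> = a v * d n" using A by simp
    finally show False using A d lin_zero[OF k Q CC_line_cspace] by simp
  qed
  then have "finite (range x)"
    using Q.fin_dim_li_fin[OF fd] x by blast
  then show False using inj finite_imageD by blast
qed

lemma nonzero_functional:
  assumes V: "cspace V" and fd: "CC_fin_dim V" and v: "v \<in> carrier V" "v \<noteq> \<zero>\<^bsub>V\<^esub>"
  shows "\<exists>l\<in>lin_maps V CC_line. l v = 1"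
proof -
  interpret cspace V by fact
  obtain B where B: "finite B" "basis B" using finite_basis_exists[OF fd] by auto
  then have Bc: "B \<subseteq> carrier V" "lin_indpt B" "span B = carrier V" unfolding basis_def by auto
  have ex: "\<exists>a. lincomb a B = w" if "w \<in> carrier V" for w
    using finite_in_span[OF B(1) Bc(1), of w] that Bc(3) by auto
  have lc_add: "lincomb (\<lambda>w. a w + b w) B = lincomb a B \<oplus>\<^bsub>V\<^esub> lincomb b B" for a b
    using lincomb_sum[OF B(1) Bc(1), of a b] by simp
  have lc_sm: "lincomb (\<lambda>w. c * a w) B = c \<odot>\<^bsub>V\<^esub> lincomb a B" for a c
    using lincomb_smult[OF Bc(1), of a c] by simp
  have lc_closed: "lincomb a B \<in> carrier V" for a
    using lincomb_closed[OF Bc(1), of a] by simp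
  have zero: "a w = 0" if "lincomb a B = \<zero>\<^bsub>V\<^esub>" "w \<in> B" for a w
    using lin_dep_crit[OF B(1) subset_refl, of a w] that Bc(2) by auto
  have uniq: "a w = b w" if "lincomb a B = lincomb b B" "w \<in> B" for a b w
  proof -
    have "lincomb (\<lambda>w. a w + (-1) * b w) B = \<zero>\<^bsub>V\<^esub>"
      unfolding lc_add lc_sm that(1) using lc_closed by (simp add: minus_sm[symmetric] minus_eq r_neg)
    from zero[OF this that(2)] show ?thesis by simp
  qed
  define co where "co w = (SOME a. lincomb a B = w)" for w
  have co: "lincomb (co w) B = w" if "w \<in> carrier V" for w
    unfolding co_def by (rule someI_ex[OF ex[OF that]])
  have "\<exists>w\<in>B. co v w \<noteq> 0"
  proof (rule ccontr)
    assume "\<not> (\<exists>w\<in>B. co v w \<noteq> 0)"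
    then have "lincomb (co v) B = lincomb (\<lambda>w. 0 * co v w) B"
      using Bc(1) by (intro lincomb_cong) auto
    then show False using v lc_sm[of 0 "co v"] co lc_closed by simp
  qed
  then obtain w where w: "w \<in> B" "co v w \<noteq> 0" by auto
  have "(\<lambda>u. inverse (co v w) * co u w) \<in> lin_maps V CC_line"
  proof (rule linI)
    fix u u' c assume u: "u \<in> carrier V"
    have "co (c \<odot>\<^bsub>V\<^esub> u) w = c * co u w"
      by (rule uniq[OF _ w(1)]) (use u in \<open>simp add: co lc_sm\<close>)
    then show "inverse (co v w) * co (c \<odot>\<^bsub>V\<^esub> u) w = c \<odot>\<^bsub>CC_line\<^esub> (inverse (co v w) * co u w)" by simp
    assume u': "u' \<in> carrier V"
    have "co (u \<oplus>\<^bsub>V\<^esub> u') w = co u w + co u' w"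
      by (rule uniq[OF _ w(1)]) (use u u' in \<open>simp add: co lc_add\<close>)
    then show "inverse (co v w) * co (u \<oplus>\<^bsub>V\<^esub> u') w
        = inverse (co v w) * co u w \<oplus>\<^bsub>CC_line\<^esub> inverse (co v w) * co u' w" by (simp add: algebra_simps)
  qed simp
  then show ?thesis using w by (intro bexI[of _ "\<lambda>u. inverse (co v w) * co u w"]) simp_all
qed

context yd_tensor
begin

fun npow :: "('v list \<Rightarrow>\<^sub>0 complex) set \<Rightarrow> nat \<Rightarrow> ('v list \<Rightarrow>\<^sub>0 complex) set" where
  "npow z 0 = \<one>\<^bsub>T\<^esub>"
| "npow z (Suc n) = z \<otimes>\<^bsub>T\<^esub> npow z n"

lemma npow_closed [simp]: "z \<in> carrier T \<Longrightarrow> npow z n \<in> carrier T"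
  by (induction n) auto

text \<open>On the powers of \<open>z\<close> the map \<open>E\<close> is \<open>c\<close> times the derivative with respect to \<open>z\<close>. Thus \<open>E\<^sup>n\<close> maps \<open>z\<^sup>n\<close> to a
nonzero constant, lower powers to \<open>0\<close> and higher ones to multiples of positive powers of \<open>z\<close>, on which the counit
vanishes: the counit composed with \<open>E\<^sup>n\<close> is a functional dual to \<open>z\<^sup>n\<close>. It descends to the Nichols algebra because
\<open>E\<close> preserves the ideal and the counit vanishes on it.\<close>

lemma nichols_infinite:
  assumes E: "E \<in> lin_maps T T" and EI: "\<And>x. x \<in> NI \<Longrightarrow> E x \<in> NI"
    and z: "z \<in> carrier T" "eps z = 0" and E1: "E \<one>\<^bsub>T\<^esub> = \<zero>\<^bsub>T\<^esub>" and c: "c \<noteq> 0"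
    and Ez: "\<And>n. E (z \<otimes>\<^bsub>T\<^esub> npow z n) = c \<odot>\<^bsub>T\<^esub> npow z n \<oplus>\<^bsub>T\<^esub> z \<otimes>\<^bsub>T\<^esub> E (npow z n)"
  shows "\<not> CC_fin_dim (nichols_algebra G V)"
proof -
  have Ec [simp]: "E x \<in> carrier T" if "x \<in> carrier T" for x using linD(1)[OF E that] .
  have ES: "E (npow z (Suc n)) = (c * of_nat (Suc n)) \<odot>\<^bsub>T\<^esub> npow z n" for n
  proof (induction n)
    case 0
    then show ?case using Ez[of 0] z E1 by (simp add: T.C.A.r_null)
  next
    case (Suc n)
    have "E (npow z (Suc (Suc n))) = c \<odot>\<^bsub>T\<^esub> npow z (Suc n) \<oplus>\<^bsub>T\<^esub> z \<otimes>\<^bsub>T\<^esub> E (npow z (Suc n))"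
      using Ez[of "Suc n"] by simp
    also have "\<dots> = c \<odot>\<^bsub>T\<^esub> npow z (Suc n) \<oplus>\<^bsub>T\<^esub> (c * of_nat (Suc n)) \<odot>\<^bsub>T\<^esub> npow z (Suc n)"
      unfolding Suc using z by (simp add: T.C.mult_sm_r)
    also have "\<dots> = (c + c * of_nat (Suc n)) \<odot>\<^bsub>T\<^esub> npow z (Suc n)"
      using T.C.sm_ldistr[OF npow_closed[OF z(1)], of c "c * of_nat (Suc n)" "Suc n"] by simp
    finally show ?case by (simp add: algebra_simps)
  qed
  have El: "(E ^^ n) \<in> lin_maps T T" for n
    by (induction n) (use lin_id lin_comp[OF _ E] in \<open>auto simp: id_def comp_def\<close>)
  have EnI: "(E ^^ n) x \<in> NI" if "x \<in> NI" for n x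
    by (induction n) (use that EI in auto)
  have ep: "eps (npow z n) = (if n = 0 then 1 else 0)" for n
    by (cases n) (use z in \<open>simp_all add: eps_one eps_mult\<close>)
  have pos: "\<exists>e. e \<noteq> 0 \<and> (E ^^ n) (npow z (n + j)) = e \<odot>\<^bsub>T\<^esub> npow z j" for n j
  proof (induction n arbitrary: j)
    case 0
    then show ?case using z by (intro exI[of _ 1]) simp
  next
    case (Suc n)
    obtain e where e: "e \<noteq> 0" "(E ^^ n) (npow z (n + Suc j)) = e \<odot>\<^bsub>T\<^esub> npow z (Suc j)" using Suc by blast
    have "(E ^^ Suc n) (npow z (Suc n + j)) = (e * (c * of_nat (Suc j))) \<odot>\<^bsub>T\<^esub> npow z j"
      using e(2) z linD(3)[OF E npow_closed[OF z(1)], of e "Suc j"] ES[of j]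
      by (simp add: T.C.sm_assoc del: npow.simps)
    moreover have "e * (c * of_nat (Suc j)) \<noteq> 0" using e c by (simp del: of_nat_Suc)
    ultimately show ?case by blast
  qed
  have neg: "(E ^^ (m + Suc i)) (npow z m) = \<zero>\<^bsub>T\<^esub>" for m i
  proof -
    obtain e where e: "(E ^^ m) (npow z (m + 0)) = e \<odot>\<^bsub>T\<^esub> npow z 0" using pos by blast
    have "E ((E ^^ m) (npow z m)) = \<zero>\<^bsub>T\<^esub>" using e linD(3)[OF E, of "\<one>\<^bsub>T\<^esub>" e] E1 by simp
    then have "(E ^^ Suc m) (npow z m) = \<zero>\<^bsub>T\<^esub>" by simp
    then have "(E ^^ i) ((E ^^ Suc m) (npow z m)) = \<zero>\<^bsub>T\<^esub>"
      using lin_zero[OF El T.P.Q_cspace T.P.Q_cspace] by simp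
    then show ?thesis by (simp add: funpow_add[symmetric, THEN fun_cong, unfolded comp_def] add.commute del: funpow.simps)
  qed
  define f where "f n x = eps ((E ^^ n) x)" for n x
  have fl: "f n \<in> lin_maps T CC_line" for n
    unfolding f_def[abs_def] by (rule lin_comp[OF El eps_lin])
  have fI: "f n x = \<zero>\<^bsub>CC_line\<^esub>" if "x \<in> NI" for n x
    using EnI[OF that] NI_coideal unfolding f_def by (auto simp: coideal_iff)
  have "\<exists>k \<in> lin_maps (nichols_algebra G V) CC_line. \<forall>x\<in>carrier T. k (N.cls x) = f n x" for n
    by (rule N.lift_quotient[OF fl CC_line_cspace fI])
  then obtain k where k: "\<And>n. k n \<in> lin_maps (nichols_algebra G V) CC_line"
    "\<And>n x. x \<in> carrier T \<Longrightarrow> k n (N.cls x) = f n x" by metis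
  have f: "\<exists>e. e \<noteq> 0 \<and> (\<forall>m. f n (npow z m) = (if m = n then e else 0))" for n
  proof -
    obtain e where e: "e \<noteq> 0" "(E ^^ n) (npow z (n + 0)) = e \<odot>\<^bsub>T\<^esub> npow z 0" using pos by blast
    have "f n (npow z m) = (if m = n then e else 0)" for m
    proof -
      consider "m = n" | i where "n = m + Suc i" | i where "m = n + Suc i"
        by (metis less_imp_Suc_add add_Suc_right linorder_less_linear)
      then show ?thesis
      proof cases
        case 1
        then show ?thesis using e linD(3)[OF eps_lin, of "\<one>\<^bsub>T\<^esub>" e] by (simp add: f_def eps_one)
      next
        case 2
        then show ?thesis using neg[of m i] lin_zero[OF eps_lin T.P.Q_cspace CC_line_cspace]
          by (simp add: f_def del: funpow.simps)
      next
        case 3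
        obtain e' where "(E ^^ n) (npow z (n + Suc i)) = e' \<odot>\<^bsub>T\<^esub> npow z (Suc i)" using pos by blast
        then show ?thesis using 3 ep[of "Suc i"] linD(3)[OF eps_lin npow_closed[OF z(1)], of e' "Suc i"]
          by (simp add: f_def del: npow.simps)
      qed
    qed
    with e show ?thesis by blast
  qed
  then obtain d where d: "\<And>n. d n \<noteq> 0" "\<And>n m. f n (npow z m) = (if m = n then d n else 0)" by metis
  show ?thesis
    by (rule infinite_dim[OF N.Q_cspace, of "\<lambda>n. N.cls (npow z n)" k d])
      (use z k d in \<open>auto simp: N.carrier_Q\<close>)
qed

text \<open>The braiding fixes \<open>v \<otimes> v\<close>, and the skew derivation dual to \<open>v\<close> is an ordinary derivation on the powers
of \<open>v\<close>.\<close>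

lemma nichols_infinite_flip:
  assumes fd: "CC_fin_dim V" and g: "g \<in> carrier G" and v: "v \<in> homog V g" "v \<noteq> \<zero>\<^bsub>V\<^esub>"
    and triv: "\<And>w. w \<in> carrier V \<Longrightarrow> act V g w = w"
  shows "\<not> CC_fin_dim (nichols_algebra G V)"
proof -
  have v': "v \<in> carrier V" using V.homog_closed g v by auto
  obtain l where l: "l \<in> lin_maps V CC_line" "l v = 1"
    using nonzero_functional[OF V_cspace fd v' v(2)] by blast
  show ?thesis
  proof (rule nichols_infinite[of "deriv l" "W [v]" 1])
    show "deriv l x \<in> NI" if "x \<in> NI" for x by (rule deriv_coideal[OF NI_coideal NI_T2 l(1) that])
    fix n
    show "deriv l (W [v] \<otimes>\<^bsub>T\<^esub> npow (W [v]) n)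
        = 1 \<odot>\<^bsub>T\<^esub> npow (W [v]) n \<oplus>\<^bsub>T\<^esub> W [v] \<otimes>\<^bsub>T\<^esub> deriv l (npow (W [v]) n)"
      using deriv_mult[OF l(1) g v(1) npow_closed[OF W1_closed[OF v']], of 1 n] triv l(2) v'
        linD(1)[OF deriv_lin[OF l(1)]] by simp
  qed (use l v' deriv_lin deriv_one eps_word in simp_all)
qed

text \<open>The braiding is diagonal with entries \<open>q\<close> on and \<open>q' = q\<^sup>-\<^sup>1\<close> off the diagonal. As \<open>q' q' = q\<^sup>-\<^sup>2\<close> it is of Cartan type
with both off-diagonal Cartan integers equal to \<open>-2\<close>, the affine type \<open>A\<^sub>1\<^sup>(\<^sup>1\<^sup>)\<close>. Its imaginary root has the root vector
\<open>z = a b - q' b a\<close>. Since \<open>q q' = 1\<close>, both skew derivations pass \<open>z\<close> without a factor; the one dual to \<open>b\<close>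
kills \<open>z\<close>, the one dual to \<open>a\<close> maps it to \<open>2 b\<close>. Their composite is twice the derivative with respect to \<open>z\<close>.\<close>

lemma nichols_infinite_affine:
  assumes fd: "CC_fin_dim V" and g: "g \<in> carrier G" "h \<in> carrier G" "g \<noteq> h"
    and a: "a \<in> homog V g" "a \<noteq> \<zero>\<^bsub>V\<^esub>" and b: "b \<in> homog V h" "b \<noteq> \<zero>\<^bsub>V\<^esub>"
    and span: "\<And>v. v \<in> carrier V \<Longrightarrow> v \<in> CC_span V {a, b}"
    and ga: "act V g a = q \<odot>\<^bsub>V\<^esub> a" and gb: "act V g b = q' \<odot>\<^bsub>V\<^esub> b"
    and ha: "act V h a = q' \<odot>\<^bsub>V\<^esub> a" and hb: "act V h b = q \<odot>\<^bsub>V\<^esub> b"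
    and q: "q * q' = 1" "q * q = - 1"
  shows "\<not> CC_fin_dim (nichols_algebra G V)"
proof -
  have ab: "a \<in> carrier V" "b \<in> carrier V" using V.homog_closed g a b by auto
  obtain l0 m0 where lm0: "l0 \<in> lin_maps V CC_line" "l0 a = 1" "m0 \<in> lin_maps V CC_line" "m0 b = 1"
    using nonzero_functional[OF V_cspace fd] ab a b by metis
  \<comment> \<open>Taking components first makes the functionals vanish on the other basis vector, so that they are dual to
    \<open>a\<close> and \<open>b\<close>.\<close>
  define l where "l w = l0 (V.part w g)" for w
  define m where "m w = m0 (V.part w h)" for w
  have l: "l \<in> lin_maps V CC_line" unfolding l_def[abs_def] by (rule lin_comp[OF V.part_lin[OF g(1)] lm0(1)])
  have m: "m \<in> lin_maps V CC_line" unfolding m_def[abs_def] by (rule lin_comp[OF V.part_lin[OF g(2)] lm0(3)])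
  have lab: "l a = 1" "l b = 0" "m a = 0" "m b = 1"
    using V.part_of_homog[OF g(1) a(1)] V.part_of_homog[OF g(2) b(1)] g lm0
      lin_zero[OF lm0(1) V_cspace CC_line_cspace] lin_zero[OF lm0(3) V_cspace CC_line_cspace]
    by (auto simp: l_def m_def)
  have eig: "f (act V k w) = e * f w"
    if f: "f \<in> lin_maps V CC_line" and k: "k \<in> carrier G" and w: "w \<in> carrier V"
      and "f (act V k a) = e * f a" "f (act V k b) = e * f b" for f k w e
  proof (rule lin_eq_on_span[OF lin_comp[OF act_linear[OF k] f] _ V_cspace CC_line_cspace _ span[OF w]])
    show "(\<lambda>w. e * f w) \<in> lin_maps V CC_line" using lin_scale[OF f CC_line_cspace, of e] by simp
  qed (use ab that in auto)
  have lg: "l (act V g w) = q * l w" "m (act V g w) = q' * m w"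
    "l (act V h w) = q' * l w" "m (act V h w) = q * m w" if "w \<in> carrier V" for w
    by (rule eig[OF l g(1) that] eig[OF m g(1) that] eig[OF l g(2) that] eig[OF m g(2) that];
        simp add: ga gb ha hb linD(3)[OF l] linD(3)[OF m] lab ab)+
  let ?A = "W [a]" and ?B = "W [b]"
  note cl [simp] = W1_closed[OF ab(1)] W1_closed[OF ab(2)]
  have dc [simp]: "deriv l x \<in> carrier T" "deriv m x \<in> carrier T" if "x \<in> carrier T" for x
    using linD(1)[OF deriv_lin[OF l] that] linD(1)[OF deriv_lin[OF m] that] .
  have d: "deriv l (?A \<otimes>\<^bsub>T\<^esub> x) = x \<oplus>\<^bsub>T\<^esub> q \<odot>\<^bsub>T\<^esub> (?A \<otimes>\<^bsub>T\<^esub> deriv l x)"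
    "deriv l (?B \<otimes>\<^bsub>T\<^esub> x) = q' \<odot>\<^bsub>T\<^esub> (?B \<otimes>\<^bsub>T\<^esub> deriv l x)"
    "deriv m (?A \<otimes>\<^bsub>T\<^esub> x) = q' \<odot>\<^bsub>T\<^esub> (?A \<otimes>\<^bsub>T\<^esub> deriv m x)"
    "deriv m (?B \<otimes>\<^bsub>T\<^esub> x) = x \<oplus>\<^bsub>T\<^esub> q \<odot>\<^bsub>T\<^esub> (?B \<otimes>\<^bsub>T\<^esub> deriv m x)" if x: "x \<in> carrier T" for x
    using deriv_mult[OF l g(1) a(1) x lg(1)] deriv_mult[OF l g(2) b(1) x lg(3)]
      deriv_mult[OF m g(1) a(1) x lg(2)] deriv_mult[OF m g(2) b(1) x lg(4)] x
    by (simp_all add: lab)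
  note dl = linD(2)[OF deriv_lin[OF l]] linD(3)[OF deriv_lin[OF l]]
  note dm = linD(2)[OF deriv_lin[OF m]] linD(3)[OF deriv_lin[OF m]]
  define z where "z = ?A \<otimes>\<^bsub>T\<^esub> ?B \<oplus>\<^bsub>T\<^esub> (- q') \<odot>\<^bsub>T\<^esub> (?B \<otimes>\<^bsub>T\<^esub> ?A)"
  have z: "z \<in> carrier T" unfolding z_def by simp
  have zx: "z \<otimes>\<^bsub>T\<^esub> x = ?A \<otimes>\<^bsub>T\<^esub> (?B \<otimes>\<^bsub>T\<^esub> x) \<oplus>\<^bsub>T\<^esub> (- q') \<odot>\<^bsub>T\<^esub> (?B \<otimes>\<^bsub>T\<^esub> (?A \<otimes>\<^bsub>T\<^esub> x))"
    if x: "x \<in> carrier T" for x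
    unfolding z_def using x by (simp add: T.C.A.l_distr T.C.mult_sm_l T.C.A.m_assoc)
  have q'2: "q' * q' = -1"
  proof -
    have "(q * q') * (q * q') = (q * q) * (q' * q')" by (simp add: algebra_simps)
    then show ?thesis using q by (simp add: minus_equation_iff)
  qed
  have cancel: "u \<oplus>\<^bsub>T\<^esub> (v \<oplus>\<^bsub>T\<^esub> (-1) \<odot>\<^bsub>T\<^esub> u) = v" if "u \<in> carrier T" "v \<in> carrier T" for u v
  proof -
    have "u \<oplus>\<^bsub>T\<^esub> (v \<oplus>\<^bsub>T\<^esub> (-1) \<odot>\<^bsub>T\<^esub> u) = v \<oplus>\<^bsub>T\<^esub> (u \<oplus>\<^bsub>T\<^esub> (-1) \<odot>\<^bsub>T\<^esub> u)" using that by (simp add: T.C.a_ac)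
    also have "u \<oplus>\<^bsub>T\<^esub> (-1) \<odot>\<^bsub>T\<^esub> u = \<zero>\<^bsub>T\<^esub>" using that T.C.sm_ldistr[of u 1 "-1"] by simp
    finally show ?thesis using that by simp
  qed
  have dlz: "deriv l (z \<otimes>\<^bsub>T\<^esub> x) = 2 \<odot>\<^bsub>T\<^esub> (?B \<otimes>\<^bsub>T\<^esub> x) \<oplus>\<^bsub>T\<^esub> z \<otimes>\<^bsub>T\<^esub> deriv l x" if x: "x \<in> carrier T" for x
  proof -
    let ?d = "deriv l x"
    have "deriv l (z \<otimes>\<^bsub>T\<^esub> x) =
      (?B \<otimes>\<^bsub>T\<^esub> x \<oplus>\<^bsub>T\<^esub> (q * q') \<odot>\<^bsub>T\<^esub> (?A \<otimes>\<^bsub>T\<^esub> (?B \<otimes>\<^bsub>T\<^esub> ?d))) \<oplus>\<^bsub>T\<^esub>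
      ((- (q' * q')) \<odot>\<^bsub>T\<^esub> (?B \<otimes>\<^bsub>T\<^esub> x) \<oplus>\<^bsub>T\<^esub> (- q' * (q * q')) \<odot>\<^bsub>T\<^esub> (?B \<otimes>\<^bsub>T\<^esub> (?A \<otimes>\<^bsub>T\<^esub> ?d)))"
      using x unfolding zx[OF x]
      by (simp add: d dl T.C.mult_sm_r T.C.sm_assoc T.C.A.r_distr T.C.sm_rdistr ac_simps)
    also have "\<dots> = (?B \<otimes>\<^bsub>T\<^esub> x \<oplus>\<^bsub>T\<^esub> ?B \<otimes>\<^bsub>T\<^esub> x) \<oplus>\<^bsub>T\<^esub> z \<otimes>\<^bsub>T\<^esub> ?d"
      using x by (simp add: zx q q'2 T.C.a_ac)
    also have "?B \<otimes>\<^bsub>T\<^esub> x \<oplus>\<^bsub>T\<^esub> ?B \<otimes>\<^bsub>T\<^esub> x = 2 \<odot>\<^bsub>T\<^esub> (?B \<otimes>\<^bsub>T\<^esub> x)"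
      using x T.C.sm_ldistr[of "?B \<otimes>\<^bsub>T\<^esub> x" 1 1] by simp
    finally show ?thesis .
  qed
  have dmz: "deriv m (z \<otimes>\<^bsub>T\<^esub> x) = z \<otimes>\<^bsub>T\<^esub> deriv m x" if x: "x \<in> carrier T" for x
  proof -
    let ?d = "deriv m x" and ?u = "q' \<odot>\<^bsub>T\<^esub> (?A \<otimes>\<^bsub>T\<^esub> x)"
    have "deriv m (z \<otimes>\<^bsub>T\<^esub> x) =
      (?u \<oplus>\<^bsub>T\<^esub> (q * q') \<odot>\<^bsub>T\<^esub> (?A \<otimes>\<^bsub>T\<^esub> (?B \<otimes>\<^bsub>T\<^esub> ?d))) \<oplus>\<^bsub>T\<^esub>
      ((-1) \<odot>\<^bsub>T\<^esub> ?u \<oplus>\<^bsub>T\<^esub> (- q' * (q * q')) \<odot>\<^bsub>T\<^esub> (?B \<otimes>\<^bsub>T\<^esub> (?A \<otimes>\<^bsub>T\<^esub> ?d)))"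
      using x unfolding zx[OF x]
      by (simp add: d dm T.C.mult_sm_r T.C.sm_assoc T.C.A.r_distr T.C.sm_rdistr ac_simps)
    also have "\<dots> = ?u \<oplus>\<^bsub>T\<^esub> (z \<otimes>\<^bsub>T\<^esub> ?d \<oplus>\<^bsub>T\<^esub> (-1) \<odot>\<^bsub>T\<^esub> ?u)"
      using x by (simp add: zx q T.C.a_ac)
    also have "\<dots> = z \<otimes>\<^bsub>T\<^esub> ?d" using x z by (intro cancel) auto
    finally show ?thesis .
  qed
  have mz: "deriv m (npow z n) = \<zero>\<^bsub>T\<^esub>" for n
    by (induction n) (use z deriv_one[OF m] in \<open>simp_all add: dmz T.C.A.r_null\<close>)
  show ?thesis
  proof (rule nichols_infinite[of "\<lambda>x. deriv m (deriv l x)" z 2])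
    show "(\<lambda>x. deriv m (deriv l x)) \<in> lin_maps T T" by (rule lin_comp[OF deriv_lin[OF l] deriv_lin[OF m]])
    show "deriv m (deriv l x) \<in> NI" if "x \<in> NI" for x
      using deriv_coideal[OF NI_coideal NI_T2] l m that by blast
    show "deriv m (deriv l \<one>\<^bsub>T\<^esub>) = \<zero>\<^bsub>T\<^esub>"
      using deriv_one[OF l] lin_zero[OF deriv_lin[OF m] T.P.Q_cspace T.P.Q_cspace] by simp
    show "eps z = 0"
      unfolding z_def using linD(2,3)[OF eps_lin] ab eps_word by (simp add: eps_mult)
    fix n
    have "deriv m (deriv l (z \<otimes>\<^bsub>T\<^esub> npow z n))
      = 2 \<odot>\<^bsub>T\<^esub> (npow z n \<oplus>\<^bsub>T\<^esub> q \<odot>\<^bsub>T\<^esub> (?B \<otimes>\<^bsub>T\<^esub> deriv m (npow z n))) \<oplus>\<^bsub>T\<^esub> z \<otimes>\<^bsub>T\<^esub> deriv m (deriv l (npow z n))"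
      using z by (simp add: dlz dm d dmz)
    then show "deriv m (deriv l (z \<otimes>\<^bsub>T\<^esub> npow z n))
      = 2 \<odot>\<^bsub>T\<^esub> npow z n \<oplus>\<^bsub>T\<^esub> z \<otimes>\<^bsub>T\<^esub> deriv m (deriv l (npow z n))"
      using z by (simp add: mz T.C.A.r_null)
  qed (use z in simp_all)
qed

text \<open>The elements \<open>v w + w v\<close>, which are primitive when the braiding is minus the flip.\<close>

definition anti where "anti v w = W [v, w] \<oplus>\<^bsub>T\<^esub> W [w, v]"

definition anti_gens where
  "anti_gens = {x \<otimes>\<^bsub>T\<^esub> (anti v w \<otimes>\<^bsub>T\<^esub> y) | x y v w g h. x \<in> carrier T \<and> y \<in> carrier T \<and>
    g \<in> carrier G \<and> h \<in> carrier G \<and> v \<in> homog V g \<and> w \<in> homog V h}"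

definition anti_ideal where "anti_ideal = CC_span T anti_gens"

lemma W2: "v \<in> carrier V \<Longrightarrow> w \<in> carrier V \<Longrightarrow> W [v, w] = W [v] \<otimes>\<^bsub>T\<^esub> W [w]"
  by (simp add: T.W_append)

lemma anti_closed [simp]: "v \<in> carrier V \<Longrightarrow> w \<in> carrier V \<Longrightarrow> anti v w \<in> carrier T"
  unfolding anti_def by (intro T.C.a_closed T.W_closed) auto

lemma anti_gens_closed: "anti_gens \<subseteq> carrier T"
  unfolding anti_gens_def using V.homog_closed by auto

lemma anti_ideal_subspace: "VectorSpace.subspace CC anti_ideal T"
  unfolding anti_ideal_def by (rule T.C.span_is_subspace[OF anti_gens_closed])

lemma anti_ideal_closed: "anti_ideal \<subseteq> carrier T"
  using T.C.subspaceD(1)[OF anti_ideal_subspace] .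

lemma anti_gensI:
  "x \<in> carrier T \<Longrightarrow> y \<in> carrier T \<Longrightarrow> g \<in> carrier G \<Longrightarrow> h \<in> carrier G \<Longrightarrow>
    v \<in> homog V g \<Longrightarrow> w \<in> homog V h \<Longrightarrow> x \<otimes>\<^bsub>T\<^esub> (anti v w \<otimes>\<^bsub>T\<^esub> y) \<in> anti_gens"
  unfolding anti_gens_def by blast

lemma anti_gensE:
  assumes "s \<in> anti_gens"
  obtains x y v w g h where "s = x \<otimes>\<^bsub>T\<^esub> (anti v w \<otimes>\<^bsub>T\<^esub> y)" "x \<in> carrier T" "y \<in> carrier T"
    "g \<in> carrier G" "h \<in> carrier G" "v \<in> homog V g" "w \<in> homog V h" "v \<in> carrier V" "w \<in> carrier V"
  using assms unfolding anti_gens_def mem_Collect_eq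
  by (elim exE conjE) (rule that; (assumption | rule V.homog_closed; assumption))

lemma anti_gens_ideal: "s \<in> anti_gens \<Longrightarrow> s \<in> anti_ideal"
  unfolding anti_ideal_def by (rule T.C.span_base[OF anti_gens_closed])

lemma anti_mem: "g \<in> carrier G \<Longrightarrow> h \<in> carrier G \<Longrightarrow>
    v \<in> homog V g \<Longrightarrow> w \<in> homog V h \<Longrightarrow> y \<in> carrier T \<Longrightarrow> anti v w \<otimes>\<^bsub>T\<^esub> y \<in> anti_ideal"
  using anti_gens_ideal[OF anti_gensI[of "\<one>\<^bsub>T\<^esub>" y g h v w]] V.homog_closed by simp

lemma anti_ideal_l:
  assumes x: "x \<in> carrier T" and a: "a \<in> anti_ideal"
  shows "x \<otimes>\<^bsub>T\<^esub> a \<in> anti_ideal"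
proof (rule lin_span_image[OF T.C.mult_lin_r[OF x] T.P.Q_cspace T.P.Q_cspace anti_gens_closed
      anti_ideal_subspace _ a[unfolded anti_ideal_def]])
  fix s assume "s \<in> anti_gens"
  then obtain x' y v w g h where s: "s = x' \<otimes>\<^bsub>T\<^esub> (anti v w \<otimes>\<^bsub>T\<^esub> y)" "x' \<in> carrier T" "y \<in> carrier T"
    "g \<in> carrier G" "h \<in> carrier G" "v \<in> homog V g" "w \<in> homog V h" "v \<in> carrier V" "w \<in> carrier V"
    by (rule anti_gensE)
  have "x \<otimes>\<^bsub>T\<^esub> s = (x \<otimes>\<^bsub>T\<^esub> x') \<otimes>\<^bsub>T\<^esub> (anti v w \<otimes>\<^bsub>T\<^esub> y)"
    using s x by (simp add: T.C.A.m_assoc)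
  then show "x \<otimes>\<^bsub>T\<^esub> s \<in> anti_ideal"
    using anti_gens_ideal[OF anti_gensI[of "x \<otimes>\<^bsub>T\<^esub> x'" y g h v w]] s x by simp
qed

lemma act_anti:
  assumes k: "k \<in> carrier G" and a: "a \<in> anti_ideal"
  shows "act T k a \<in> anti_ideal"
proof (rule lin_span_image[OF act_lin[OF k] T.P.Q_cspace T.P.Q_cspace anti_gens_closed
      anti_ideal_subspace _ a[unfolded anti_ideal_def]])
  fix s assume "s \<in> anti_gens"
  then obtain x y v w g h where s: "s = x \<otimes>\<^bsub>T\<^esub> (anti v w \<otimes>\<^bsub>T\<^esub> y)" "x \<in> carrier T" "y \<in> carrier T"
    "g \<in> carrier G" "h \<in> carrier G" "v \<in> homog V g" "w \<in> homog V h" "v \<in> carrier V" "w \<in> carrier V"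
    by (rule anti_gensE)
  have "act T k (anti v w) = anti (act V k v) (act V k w)"
    unfolding anti_def using s k linD(2)[OF act_lin[OF k]] by (simp add: act_W T.W_closed)
  then have "act T k s = act T k x \<otimes>\<^bsub>T\<^esub> (anti (act V k v) (act V k w) \<otimes>\<^bsub>T\<^esub> act T k y)"
    using s k by (simp add: act_mult_T)
  moreover have "act V k v \<in> homog V (k \<otimes>\<^bsub>G\<^esub> g \<otimes>\<^bsub>G\<^esub> inv\<^bsub>G\<^esub> k)"
    "act V k w \<in> homog V (k \<otimes>\<^bsub>G\<^esub> h \<otimes>\<^bsub>G\<^esub> inv\<^bsub>G\<^esub> k)"
    using act_homog[OF k s(4)] act_homog[OF k s(5)] s by auto
  ultimately show "act T k s \<in> anti_ideal"
    using anti_gens_ideal[OF anti_gensI[OF act_closed[OF k s(2)] act_closed[OF k s(3)],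
        of "k \<otimes>\<^bsub>G\<^esub> g \<otimes>\<^bsub>G\<^esub> inv\<^bsub>G\<^esub> k" "k \<otimes>\<^bsub>G\<^esub> h \<otimes>\<^bsub>G\<^esub> inv\<^bsub>G\<^esub> k"]] s k by simp
qed

lemma anti_T2: "anti_ideal \<subseteq> T2"
  unfolding anti_ideal_def
proof (rule T.C.span_subset[OF T2_subspace], rule subsetI)
  fix s assume "s \<in> anti_gens"
  then obtain x y v w g h where s: "s = x \<otimes>\<^bsub>T\<^esub> (anti v w \<otimes>\<^bsub>T\<^esub> y)" "x \<in> carrier T" "y \<in> carrier T"
    "g \<in> carrier G" "h \<in> carrier G" "v \<in> homog V g" "w \<in> homog V h" and vw: "v \<in> carrier V" "w \<in> carrier V"
    by (rule anti_gensE)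
  note lin2 = lin_span_image[OF _ T.P.Q_cspace T.P.Q_cspace _ T2_subspace _ T.W_span]
  have Wc: "W ` words \<subseteq> carrier T" using T.W_closed by blast
  have 1: "W u \<otimes>\<^bsub>T\<^esub> (anti v w \<otimes>\<^bsub>T\<^esub> W t) \<in> T2" if "u \<in> words" "t \<in> words" for u t
  proof -
    have "W u \<otimes>\<^bsub>T\<^esub> (anti v w \<otimes>\<^bsub>T\<^esub> W t) = W (u @ [v, w] @ t) \<oplus>\<^bsub>T\<^esub> W (u @ [w, v] @ t)"
      unfolding anti_def using that vw
      by (simp add: T.C.A.l_distr T.C.A.r_distr T.W_closed T.W_append)
    moreover have "W (u @ [v, w] @ t) \<in> T2" "W (u @ [w, v] @ t) \<in> T2"
      using that vw by (auto intro!: W_T2)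
    ultimately show ?thesis using T.C.subspaceD(3)[OF T2_subspace] by simp
  qed
  have 2: "W u \<otimes>\<^bsub>T\<^esub> (anti v w \<otimes>\<^bsub>T\<^esub> y) \<in> T2" if "u \<in> words" for u
    by (rule lin2[OF lin_comp[OF T.C.mult_lin_r T.C.mult_lin_r] Wc _ s(3)])
      (use that 1 vw T.W_closed in auto)
  show "s \<in> T2" unfolding s(1)
    by (rule lin2[OF T.C.mult_lin_l Wc _ s(2)]) (use 2 vw s(3) in auto)
qed

text \<open>The hypothesis says that the braiding of \<open>V\<close> is minus the flip. Then every \<open>v w + w v\<close> is primitive, so the ideal
generated by these elements is a coideal. Modulo it, words in \<open>e1\<close> and \<open>e2\<close> can be sorted and repeated letters
removed, which leaves four of them.\<close>

lemma nichols_finite: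
  assumes flip: "\<And>g v w. g \<in> carrier G \<Longrightarrow> v \<in> homog V g \<Longrightarrow> v \<noteq> \<zero>\<^bsub>V\<^esub> \<Longrightarrow> w \<in> carrier V \<Longrightarrow>
      act V g w = (-1) \<odot>\<^bsub>V\<^esub> w"
    and e1: "g1 \<in> carrier G" "e1 \<in> homog V g1" and e2: "g2 \<in> carrier G" "e2 \<in> homog V g2"
    and span: "\<And>v. v \<in> carrier V \<Longrightarrow> v \<in> CC_span V {e1, e2}"
  shows "CC_fin_dim (nichols_algebra G V)"
proof -
  note J = anti_ideal_subspace
  let ?X = "cosum anti_ideal"
  have Xg: "{pt a b |a b. a \<in> anti_ideal \<and> b \<in> carrier T} \<union> {pt a b |a b. a \<in> carrier T \<and> b \<in> anti_ideal} \<subseteq> carrier TT"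
    using anti_ideal_closed by auto
  note X = TT.span_is_subspace[OF Xg]
  have X1: "pt a b \<in> ?X" if "a \<in> anti_ideal" "b \<in> carrier T" for a b
    using that by (intro TT.span_base[OF Xg]) blast
  have X2: "pt a b \<in> ?X" if "a \<in> carrier T" "b \<in> anti_ideal" for a b
    using that by (intro TT.span_base[OF Xg]) blast
  have act_flip: "act T g (W [w]) = (-1) \<odot>\<^bsub>T\<^esub> W [w]"
    if "g \<in> carrier G" "v \<in> homog V g" "v \<noteq> \<zero>\<^bsub>V\<^esub>" "w \<in> carrier V" for g v w
    using that act_W[of g "[w]"] flip[OF that] linD(3)[OF W1_lin, of w "-1"] by simp
  have W0: "W [\<zero>\<^bsub>V\<^esub>] = \<zero>\<^bsub>T\<^esub>" by (rule lin_zero[OF W1_lin V_cspace T.P.Q_cspace])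
  have pt0: "pt x \<zero>\<^bsub>T\<^esub> = \<zero>\<^bsub>TT\<^esub>" if "x \<in> carrier T" for x
    by (rule lin_zero[OF S.pure_lin_r[OF that] T.P.Q_cspace S.P.Q_cspace])
  have D2: "D (W [v, w]) = (pt (W [v, w]) \<one>\<^bsub>T\<^esub> \<oplus>\<^bsub>TT\<^esub> (-1) \<odot>\<^bsub>TT\<^esub> pt (W [w]) (W [v])) \<oplus>\<^bsub>TT\<^esub>
      (pt (W [v]) (W [w]) \<oplus>\<^bsub>TT\<^esub> pt \<one>\<^bsub>T\<^esub> (W [v, w]))"
    if g: "g \<in> carrier G" and v: "v \<in> homog V g" and w: "w \<in> carrier V" for g v w
  proof -
    have v': "v \<in> carrier V" using V.homog_closed g v by auto
    have "pt (act T g (W [w])) (W [v]) = (-1) \<odot>\<^bsub>TT\<^esub> pt (W [w]) (W [v])"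
    proof (cases "v = \<zero>\<^bsub>V\<^esub>")
      case True
      then show ?thesis using pt0[of "act T g (W [w])"] pt0[of "W [w]"] g w W0 by simp
    next
      case False
      then show ?thesis using act_flip[OF g v False w] linD(3)[OF S.pure_lin_l[OF W1_closed[OF v']]] w by simp
    qed
    moreover have "D (W [v, w]) = prim v \<otimes>\<^bsub>TT\<^esub> prim w"
      using D_mult[of "W [v]" "W [w]"] v' w by (simp add: W2 D_W1)
    moreover have "prim v \<otimes>\<^bsub>TT\<^esub> prim w
      = prim v \<otimes>\<^bsub>TT\<^esub> pt (W [w]) \<one>\<^bsub>T\<^esub> \<oplus>\<^bsub>TT\<^esub> prim v \<otimes>\<^bsub>TT\<^esub> pt \<one>\<^bsub>T\<^esub> (W [w])"
      using v' w unfolding prim_def[of w] by (simp add: TT.A.r_distr)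
    ultimately show ?thesis
      using v' w g act_one_T[OF g] by (simp add: prim_mult[OF g v] W2[OF v' w])
  qed
  have Dr: "D (anti v w) = pt (anti v w) \<one>\<^bsub>T\<^esub> \<oplus>\<^bsub>TT\<^esub> pt \<one>\<^bsub>T\<^esub> (anti v w)"
    if g: "g \<in> carrier G" "h \<in> carrier G" and v: "v \<in> homog V g" and w: "w \<in> homog V h" for g h v w
  proof -
    have vw: "v \<in> carrier V" "w \<in> carrier V" using V.homog_closed g v w by auto
    have Wc: "W [v, w] \<in> carrier T" "W [w, v] \<in> carrier T" using vw by (auto intro!: T.W_closed)
    \<comment> \<open>The mixed terms of \<open>\<Delta>(v w)\<close> and \<open>\<Delta>(w v)\<close> cancel.\<close>
    have c: "x \<oplus>\<^bsub>TT\<^esub> (-1) \<odot>\<^bsub>TT\<^esub> a \<oplus>\<^bsub>TT\<^esub> (b \<oplus>\<^bsub>TT\<^esub> y) \<oplus>\<^bsub>TT\<^esub> (x' \<oplus>\<^bsub>TT\<^esub> (-1) \<odot>\<^bsub>TT\<^esub> b \<oplus>\<^bsub>TT\<^esub> (a \<oplus>\<^bsub>TT\<^esub> y'))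
      = (x \<oplus>\<^bsub>TT\<^esub> x') \<oplus>\<^bsub>TT\<^esub> (y \<oplus>\<^bsub>TT\<^esub> y')"
      if "x \<in> carrier TT" "x' \<in> carrier TT" "y \<in> carrier TT" "y' \<in> carrier TT" "a \<in> carrier TT" "b \<in> carrier TT"
      for x x' y y' a b
    proof -
      have "x \<oplus>\<^bsub>TT\<^esub> (-1) \<odot>\<^bsub>TT\<^esub> a \<oplus>\<^bsub>TT\<^esub> (b \<oplus>\<^bsub>TT\<^esub> y) \<oplus>\<^bsub>TT\<^esub> (x' \<oplus>\<^bsub>TT\<^esub> (-1) \<odot>\<^bsub>TT\<^esub> b \<oplus>\<^bsub>TT\<^esub> (a \<oplus>\<^bsub>TT\<^esub> y'))
        = (a \<oplus>\<^bsub>TT\<^esub> (-1) \<odot>\<^bsub>TT\<^esub> a) \<oplus>\<^bsub>TT\<^esub> (b \<oplus>\<^bsub>TT\<^esub> (-1) \<odot>\<^bsub>TT\<^esub> b) \<oplus>\<^bsub>TT\<^esub> ((x \<oplus>\<^bsub>TT\<^esub> x') \<oplus>\<^bsub>TT\<^esub> (y \<oplus>\<^bsub>TT\<^esub> y'))"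
        using that by (simp add: TT.a_ac)
      also have "a \<oplus>\<^bsub>TT\<^esub> (-1) \<odot>\<^bsub>TT\<^esub> a = \<zero>\<^bsub>TT\<^esub>" using that TT.sm_ldistr[of a 1 "-1"] by simp
      also have "b \<oplus>\<^bsub>TT\<^esub> (-1) \<odot>\<^bsub>TT\<^esub> b = \<zero>\<^bsub>TT\<^esub>" using that TT.sm_ldistr[of b 1 "-1"] by simp
      finally show ?thesis using that by simp
    qed
    show ?thesis
      unfolding anti_def linD(2)[OF D_lin Wc] D2[OF g(1) v vw(2)] D2[OF g(2) w vw(1)]
        linD(2)[OF S.pure_lin_l Wc, OF T.C.A.one_closed] linD(2)[OF S.pure_lin_r Wc, OF T.C.A.one_closed]
      by (rule c) (use vw Wc in auto)
  qed
  have Dr_X: "D (anti v w) \<otimes>\<^bsub>TT\<^esub> Y \<in> ?X"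
    if g: "g \<in> carrier G" "h \<in> carrier G" and v: "v \<in> homog V g" and w: "w \<in> homog V h"
      and Y: "Y \<in> carrier TT" for g h v w Y
  proof -
    have vw: "v \<in> carrier V" "w \<in> carrier V" using V.homog_closed g v w by auto
    have X0: "\<zero>\<^bsub>TT\<^esub> \<in> ?X" by (rule TT.span_zero[OF Xg])
    show ?thesis
    proof (cases "v = \<zero>\<^bsub>V\<^esub> \<or> w = \<zero>\<^bsub>V\<^esub>")
      case True
      then have "anti v w = \<zero>\<^bsub>T\<^esub>"
      proof
        assume "v = \<zero>\<^bsub>V\<^esub>"
        then show ?thesis unfolding anti_def W2[OF vw] W2[OF vw(2,1)]
          using W0 W1_closed[OF vw(2)] by (simp only: T.C.A.l_null T.C.A.r_null T.C.l_zero T.C.zero_closed)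
      next
        assume "w = \<zero>\<^bsub>V\<^esub>"
        then show ?thesis unfolding anti_def W2[OF vw] W2[OF vw(2,1)]
          using W0 W1_closed[OF vw(1)] by (simp only: T.C.A.l_null T.C.A.r_null T.C.l_zero T.C.zero_closed)
      qed
      then show ?thesis
        using lin_zero[OF D_lin T.P.Q_cspace S.P.Q_cspace] Y X0 by (simp add: TT.A.l_null)
    next
      case False
      \<comment> \<open>\<open>g\<close> maps \<open>w\<close> to \<open>- w\<close>, and degree \<open>h\<close> to degree \<open>g h g\<inverse>\<close>. So \<open>g\<close> and \<open>h\<close> commute, and
        \<open>v w + w v\<close> is homogeneous.\<close>
      have "act V g w \<in> homog V (g \<otimes>\<^bsub>G\<^esub> h \<otimes>\<^bsub>G\<^esub> inv\<^bsub>G\<^esub> g)" using act_homog[OF g] w by auto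
      then have "(-1) \<odot>\<^bsub>V\<^esub> act V g w \<in> homog V (g \<otimes>\<^bsub>G\<^esub> h \<otimes>\<^bsub>G\<^esub> inv\<^bsub>G\<^esub> g)"
        using V.subspaceD(4)[OF V.homog_sub] g by simp
      moreover have "(-1) \<odot>\<^bsub>V\<^esub> act V g w = w"
        using flip[OF g(1) v _ vw(2)] False vw by (simp add: V.sm_assoc)
      ultimately have "w \<in> homog V (g \<otimes>\<^bsub>G\<^esub> h \<otimes>\<^bsub>G\<^esub> inv\<^bsub>G\<^esub> g)" by simp
      from V.part_of_homog[OF _ this, of h] V.part_of_homog[OF g(2) w g(2)]
      have "h = g \<otimes>\<^bsub>G\<^esub> h \<otimes>\<^bsub>G\<^esub> inv\<^bsub>G\<^esub> g" using False g by (auto split: if_splits)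
      then have comm: "h \<otimes>\<^bsub>G\<^esub> g = g \<otimes>\<^bsub>G\<^esub> h"
        using G.inv_solve_right'[of h "g \<otimes>\<^bsub>G\<^esub> h" g] g by auto
      have hom: "anti v w \<in> homog T (g \<otimes>\<^bsub>G\<^esub> h)"
        using mult_homog[OF g W1_homog[OF g(1) v] W1_homog[OF g(2) w]]
          mult_homog[OF g(2,1) W1_homog[OF g(2) w] W1_homog[OF g(1) v]]
          T.C.subspaceD(3)[OF TG.homog_sub[of "g \<otimes>\<^bsub>G\<^esub> h"]] g
        by (simp add: anti_def W2 vw comm)
      have pure: "D (anti v w) \<otimes>\<^bsub>TT\<^esub> pt c d \<in> ?X" if cd: "c \<in> carrier T" "d \<in> carrier T" for c d
      proof -
        have "pt (anti v w) \<one>\<^bsub>T\<^esub> \<otimes>\<^bsub>TT\<^esub> pt c d = pt (anti v w \<otimes>\<^bsub>T\<^esub> c) d"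
          using TT_mult_homog[of "anti v w" c d "\<one>\<^bsub>G\<^esub>" "\<one>\<^bsub>T\<^esub>"] one_homog vw cd
          by (simp add: act_one_group)
        moreover have "pt \<one>\<^bsub>T\<^esub> (anti v w) \<otimes>\<^bsub>TT\<^esub> pt c d = pt (act T (g \<otimes>\<^bsub>G\<^esub> h) c) (anti v w \<otimes>\<^bsub>T\<^esub> d)"
          using TT_mult_homog[of "\<one>\<^bsub>T\<^esub>" c d "g \<otimes>\<^bsub>G\<^esub> h" "anti v w"] hom cd g by simp
        moreover have "pt (anti v w \<otimes>\<^bsub>T\<^esub> c) d \<in> ?X"
          by (rule X1[OF anti_mem[OF g v w cd(1)] cd(2)])
        moreover have "pt (act T (g \<otimes>\<^bsub>G\<^esub> h) c) (anti v w \<otimes>\<^bsub>T\<^esub> d) \<in> ?X"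
          by (rule X2[OF _ anti_mem[OF g v w cd(2)]]) (use g cd in simp)
        ultimately show ?thesis
          unfolding Dr[OF g v w] using vw cd TT.span_add[OF Xg] by (simp add: TT.A.l_distr)
      qed
      show ?thesis
        by (rule lin_span_image[OF TT.mult_lin_r S.P.Q_cspace S.P.Q_cspace _ X _ S.pure_span[OF Y]])
          (use pure vw in auto)
    qed
  qed
  \<comment> \<open>\<open>J \<otimes> T + T \<otimes> J\<close> is stable under multiplication from the left, as \<open>J\<close> is a left ideal stable under \<open>G\<close>.\<close>
  have X_l: "Y \<otimes>\<^bsub>TT\<^esub> Z \<in> ?X" if Y: "Y \<in> carrier TT" and Z: "Z \<in> ?X" for Y Z
  proof -
    have Zc: "Z \<in> carrier TT" by (rule TT.span_closed[OF Xg Z])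
    have gen: "pt c d \<otimes>\<^bsub>TT\<^esub> s \<in> ?X" if cd: "c \<in> carrier T" "h \<in> carrier G" "d \<in> homog T h"
      and s: "s \<in> {pt a b |a b. a \<in> anti_ideal \<and> b \<in> carrier T} \<union> {pt a b |a b. a \<in> carrier T \<and> b \<in> anti_ideal}"
      for c d h s
    proof -
      have d: "d \<in> carrier T" using TG.homog_closed cd by auto
      from s obtain a b where ab: "s = pt a b"
        "(a \<in> anti_ideal \<and> b \<in> carrier T) \<or> (a \<in> carrier T \<and> b \<in> anti_ideal)" by auto
      then have abc: "a \<in> carrier T" "b \<in> carrier T" using anti_ideal_closed by auto
      have "pt c d \<otimes>\<^bsub>TT\<^esub> s = pt (c \<otimes>\<^bsub>T\<^esub> act T h a) (d \<otimes>\<^bsub>T\<^esub> b)"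
        unfolding ab(1) by (rule TT_mult_homog) (use cd abc in auto)
      also have "\<dots> \<in> ?X"
        using ab(2) X1[of "c \<otimes>\<^bsub>T\<^esub> act T h a" "d \<otimes>\<^bsub>T\<^esub> b"] X2[of "c \<otimes>\<^bsub>T\<^esub> act T h a" "d \<otimes>\<^bsub>T\<^esub> b"]
          anti_ideal_l[OF cd(1) act_anti[OF cd(2), of a]] anti_ideal_l[OF d, of b] cd abc d
        by auto
      finally show ?thesis .
    qed
    have 1: "pt c d \<otimes>\<^bsub>TT\<^esub> Z \<in> ?X" if "c \<in> carrier T" "h \<in> carrier G" "d \<in> homog T h" for c d h
      by (rule lin_span_image[OF TT.mult_lin_r S.P.Q_cspace S.P.Q_cspace Xg X gen[OF that] Z])
        (use that TG.homog_closed in auto)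
    show ?thesis
      by (rule lin_span_image[OF TT.mult_lin_l[OF Zc] S.P.Q_cspace S.P.Q_cspace _ X _ pt_homog_span[OF Y]])
        (use 1 TG.homog_closed in auto)
  qed
  have DJ: "D x \<in> ?X" if x: "x \<in> anti_ideal" for x
  proof (rule lin_span_image[OF D_lin T.P.Q_cspace S.P.Q_cspace anti_gens_closed X _ x[unfolded anti_ideal_def]])
    fix s assume "s \<in> anti_gens"
    then obtain x y v w g h where s: "s = x \<otimes>\<^bsub>T\<^esub> (anti v w \<otimes>\<^bsub>T\<^esub> y)" "x \<in> carrier T" "y \<in> carrier T"
      "g \<in> carrier G" "h \<in> carrier G" "v \<in> homog V g" "w \<in> homog V h" "v \<in> carrier V" "w \<in> carrier V"
      by (rule anti_gensE)
    have "D s = D x \<otimes>\<^bsub>TT\<^esub> (D (anti v w) \<otimes>\<^bsub>TT\<^esub> D y)"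
      using s by (simp add: D_mult)
    also have "\<dots> \<in> ?X" by (rule X_l[OF D_closed[OF s(2)] Dr_X[OF s(4-7) D_closed[OF s(3)]]])
    finally show "D s \<in> ?X" .
  qed
  have epsJ: "eps x = 0" if x: "x \<in> anti_ideal" for x
  proof -
    have z: "VectorSpace.subspace CC {0} CC_line"
      by (rule cspace.subspaceI[OF CC_line_cspace]) auto
    have "eps x \<in> {0}"
    proof (rule lin_span_image[OF eps_lin T.P.Q_cspace CC_line_cspace anti_gens_closed z _ x[unfolded anti_ideal_def]])
      fix s assume "s \<in> anti_gens"
      then show "eps s \<in> {0}"
        by (rule anti_gensE) (use linD(2)[OF eps_lin] eps_word in \<open>simp add: eps_mult anti_def T.W_closed\<close>)
    qed
    then show ?thesis by simp
  qed
  have JNI: "anti_ideal \<subseteq> NI"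
    by (rule NI_greatest[OF _ anti_T2]) (use J DJ epsJ in \<open>auto simp: coideal_iff\<close>)
  have e: "e1 \<in> carrier V" "e2 \<in> carrier V" using V.homog_closed e1 e2 by auto
  let ?a = "W [e1]" and ?b = "W [e2]"
  have ab [simp]: "?a \<in> carrier T" "?b \<in> carrier T" using e by auto
  let ?B = "{\<one>\<^bsub>T\<^esub>, ?a, ?b, ?a \<otimes>\<^bsub>T\<^esub> ?b}"
  have Bc: "?B \<union> anti_ideal \<subseteq> carrier T" using anti_ideal_closed by auto
  let ?U = "CC_span T (?B \<union> anti_ideal)"
  note U = T.C.span_is_subspace[OF Bc]
  have UB: "x \<in> ?U" if "x \<in> ?B \<union> anti_ideal" for x by (rule T.C.span_base[OF Bc that])
  have sq: "(W [v] \<otimes>\<^bsub>T\<^esub> W [v]) \<otimes>\<^bsub>T\<^esub> x \<in> anti_ideal"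
    if "g \<in> carrier G" "v \<in> homog V g" "x \<in> carrier T" for g v x
  proof -
    have v: "v \<in> carrier V" using V.homog_closed that by auto
    have "(W [v] \<otimes>\<^bsub>T\<^esub> W [v]) = (1 / 2) \<odot>\<^bsub>T\<^esub> anti v v"
      unfolding anti_def W2[OF v v] using v T.C.sm_ldistr[of "W [v] \<otimes>\<^bsub>T\<^esub> W [v]" "1/2" "1/2"]
      by (simp add: T.C.sm_rdistr)
    then have "(W [v] \<otimes>\<^bsub>T\<^esub> W [v]) \<otimes>\<^bsub>T\<^esub> x = (1 / 2) \<odot>\<^bsub>T\<^esub> (anti v v \<otimes>\<^bsub>T\<^esub> x)"
      using v that by (simp add: T.C.mult_sm_l)
    then show ?thesis using T.C.subspaceD(4)[OF J anti_mem[OF that(1,1,2,2,3)]] by simp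
  qed
  have ba: "?b \<otimes>\<^bsub>T\<^esub> ?a = anti e2 e1 \<oplus>\<^bsub>T\<^esub> (-1) \<odot>\<^bsub>T\<^esub> (?a \<otimes>\<^bsub>T\<^esub> ?b)"
  proof -
    have "?a \<otimes>\<^bsub>T\<^esub> ?b \<oplus>\<^bsub>T\<^esub> (-1) \<odot>\<^bsub>T\<^esub> (?a \<otimes>\<^bsub>T\<^esub> ?b) = \<zero>\<^bsub>T\<^esub>"
      using T.C.sm_ldistr[of "?a \<otimes>\<^bsub>T\<^esub> ?b" 1 "-1"] by simp
    then show ?thesis
      unfolding anti_def W2[OF e] W2[OF e(2,1)] by (simp add: T.C.a_assoc)
  qed
  have baJ: "anti e2 e1 \<otimes>\<^bsub>T\<^esub> x \<in> anti_ideal" if "x \<in> carrier T" for x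
    by (rule anti_mem[OF e2(1) e1(1) e2(2) e1(2) that])
  \<comment> \<open>The span of \<open>?B\<close> and the ideal is stable under multiplication by \<open>e1\<close> and \<open>e2\<close> from the left and contains \<open>1\<close>,
    so it is everything.\<close>
  have aU: "?a \<otimes>\<^bsub>T\<^esub> x \<in> ?U" if x: "x \<in> ?U" for x
  proof (rule lin_span_image[OF T.C.mult_lin_r[OF ab(1)] T.P.Q_cspace T.P.Q_cspace Bc U _ x])
    fix s assume "s \<in> ?B \<union> anti_ideal"
    then consider "s = \<one>\<^bsub>T\<^esub>" | "s = ?a" | "s = ?b" | "s = ?a \<otimes>\<^bsub>T\<^esub> ?b" | "s \<in> anti_ideal" by blast
    then show "?a \<otimes>\<^bsub>T\<^esub> s \<in> ?U"
    proof cases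
      case 2
      then show ?thesis using sq[OF e1, of "\<one>\<^bsub>T\<^esub>"] UB by simp
    next
      case 4
      then show ?thesis using sq[OF e1, of ?b] UB by (simp add: T.C.A.m_assoc)
    qed (use UB anti_ideal_l in auto)
  qed
  have bU: "?b \<otimes>\<^bsub>T\<^esub> x \<in> ?U" if x: "x \<in> ?U" for x
  proof (rule lin_span_image[OF T.C.mult_lin_r[OF ab(2)] T.P.Q_cspace T.P.Q_cspace Bc U _ x])
    fix s assume "s \<in> ?B \<union> anti_ideal"
    then consider "s = \<one>\<^bsub>T\<^esub>" | "s = ?a" | "s = ?b" | "s = ?a \<otimes>\<^bsub>T\<^esub> ?b" | "s \<in> anti_ideal" by blast
    then show "?b \<otimes>\<^bsub>T\<^esub> s \<in> ?U"
    proof cases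
      case 2
      have "anti e2 e1 \<in> anti_ideal" using baJ[of "\<one>\<^bsub>T\<^esub>"] e by simp
      then show ?thesis unfolding 2 ba using UB T.C.subspaceD(3,4)[OF U] by simp
    next
      case 3
      then show ?thesis using sq[OF e2, of "\<one>\<^bsub>T\<^esub>"] UB by simp
    next
      case 4
      have "?b \<otimes>\<^bsub>T\<^esub> s = anti e2 e1 \<otimes>\<^bsub>T\<^esub> ?b \<oplus>\<^bsub>T\<^esub> (-1) \<odot>\<^bsub>T\<^esub> (?a \<otimes>\<^bsub>T\<^esub> (?b \<otimes>\<^bsub>T\<^esub> ?b))"
        unfolding 4 using e
        by (simp add: T.C.A.m_assoc[symmetric] ba T.C.A.l_distr T.C.mult_sm_l)
      moreover have "?b \<otimes>\<^bsub>T\<^esub> ?b \<in> anti_ideal" using sq[OF e2, of "\<one>\<^bsub>T\<^esub>"] by simp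
      then have "?a \<otimes>\<^bsub>T\<^esub> (?b \<otimes>\<^bsub>T\<^esub> ?b) \<in> anti_ideal" by (rule anti_ideal_l[OF ab(1)])
      ultimately show ?thesis
        using UB[of "anti e2 e1 \<otimes>\<^bsub>T\<^esub> ?b"] UB[of "?a \<otimes>\<^bsub>T\<^esub> (?b \<otimes>\<^bsub>T\<^esub> ?b)"] baJ[of ?b]
          T.C.subspaceD(3,4)[OF U] by simp
    qed (use UB anti_ideal_l in auto)
  qed
  have vU: "W [v] \<otimes>\<^bsub>T\<^esub> x \<in> ?U" if x: "x \<in> ?U" and v: "v \<in> carrier V" for x v
    by (rule lin_span_image[OF lin_comp[OF W1_lin T.C.mult_lin_l] V_cspace T.P.Q_cspace _ U _ span[OF v]])
      (use e aU bU x T.C.span_closed[OF Bc x] in auto)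
  have "W ws \<in> ?U" if "ws \<in> words" for ws
    using that
  proof (induction ws)
    case Nil
    then show ?case using UB by (simp add: T.one_W[symmetric])
  next
    case (Cons v ws)
    then show ?case using vU[of "W ws" v] W_Cons[of v ws] by simp
  qed
  then have "W ` words \<subseteq> ?U" by auto
  from T.C.span_subset[OF U this] have TU: "x \<in> ?U" if "x \<in> carrier T" for x
    using T.W_span[OF that] by auto
  interpret Q: cspace "nichols_algebra G V" by (rule N.Q_cspace)
  have NB: "N.cls ` ?B \<subseteq> carrier (nichols_algebra G V)" unfolding N.carrier_Q by auto
  have "N.cls x \<in> Q.span (N.cls ` ?B)" if "x \<in> carrier T" for x
  proof (rule lin_span_image[OF N.cls_lin T.P.Q_cspace N.Q_cspace Bc Q.span_is_subspace[OF NB] _ TU[OF that]])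
    fix s assume "s \<in> ?B \<union> anti_ideal"
    then show "N.cls s \<in> Q.span (N.cls ` ?B)"
    proof
      assume s: "s \<in> anti_ideal"
      then have "N.cls s = \<zero>\<^bsub>nichols_algebra G V\<^esub>"
        using JNI anti_ideal_closed N.cls_zero_iff[of s] by (auto simp: N.zero_Q)
      then show ?thesis using Q.span_zero[OF NB] by simp
    qed (use Q.span_base[OF NB] in blast)
  qed
  then have "Q.span (N.cls ` ?B) = carrier (nichols_algebra G V)"
    using Q.span_is_subset2[OF NB] unfolding N.carrier_Q by blast
  then show ?thesis unfolding Q.fin_dim_def using NB by (intro exI[of _ "N.cls ` ?B"]) simp
qed

end

section \<open>Submodules and isomorphisms of Yetter-Drinfeld modules\<close>

lemma sub_finsum:
  assumes V: "cspace V" and V': "cspace V'" and eq: "add V' = add V" "zero V' = zero V"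
    and c: "carrier V' \<subseteq> carrier V" and f: "f \<in> A \<rightarrow> carrier V'"
  shows "finsum V' f A = finsum V f A"
proof -
  interpret V: cspace V by fact
  interpret V': cspace V' by fact
  show ?thesis using f
  proof (induction A rule: infinite_finite_induct)
    case (insert a A)
    then have "f a \<in> carrier V'" "f \<in> A \<rightarrow> carrier V'" "f a \<in> carrier V" "f \<in> A \<rightarrow> carrier V"
      using c by auto
    with insert show ?case by (simp add: V.finsum_insert V'.finsum_insert eq)
  qed (simp_all add: eq)
qed

lemma yd_moduleI:
  assumes "graded G V" "\<And>g. g \<in> carrier G \<Longrightarrow> act V g \<in> lin_maps V V"
    "\<And>v. v \<in> carrier V \<Longrightarrow> act V \<one>\<^bsub>G\<^esub> v = v"
    "\<And>g h v. g \<in> carrier G \<Longrightarrow> h \<in> carrier G \<Longrightarrow> v \<in> carrier V \<Longrightarrow>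
      act V (g \<otimes>\<^bsub>G\<^esub> h) v = act V g (act V h v)"
    and sub: "\<And>g h v. g \<in> carrier G \<Longrightarrow> h \<in> carrier G \<Longrightarrow> v \<in> homog V h \<Longrightarrow>
      act V g v \<in> homog V (g \<otimes>\<^bsub>G\<^esub> h \<otimes>\<^bsub>G\<^esub> inv\<^bsub>G\<^esub> g)"
  shows "yd_module G V"
proof -
  interpret graded G V by fact
  have "act V g ` homog V h = homog V (g \<otimes>\<^bsub>G\<^esub> h \<otimes>\<^bsub>G\<^esub> inv\<^bsub>G\<^esub> g)" (is "_ = homog V ?c")
    if g: "g \<in> carrier G" "h \<in> carrier G" for g h
  proof
    show "act V g ` homog V h \<subseteq> homog V ?c" using sub g by auto
    have c: "?c \<in> carrier G" and ig: "inv\<^bsub>G\<^esub> g \<in> carrier G" using g by auto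
    show "homog V ?c \<subseteq> act V g ` homog V h"
    proof
      fix v assume v: "v \<in> homog V ?c"
      then have v': "v \<in> carrier V" using homog_closed[OF c] by auto
      have "act V (inv\<^bsub>G\<^esub> g) v \<in> homog V (inv\<^bsub>G\<^esub> g \<otimes>\<^bsub>G\<^esub> ?c \<otimes>\<^bsub>G\<^esub> inv\<^bsub>G\<^esub> (inv\<^bsub>G\<^esub> g))"
        by (rule sub[OF ig c v])
      also have "inv\<^bsub>G\<^esub> g \<otimes>\<^bsub>G\<^esub> ?c \<otimes>\<^bsub>G\<^esub> inv\<^bsub>G\<^esub> (inv\<^bsub>G\<^esub> g) = h"
        using g by (simp add: G.m_assoc G.inv_solve_left')
      finally have h: "act V (inv\<^bsub>G\<^esub> g) v \<in> homog V h" .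
      have "act V g (act V (inv\<^bsub>G\<^esub> g) v) = v"
        using assms(4)[OF g(1) ig v'] assms(3)[OF v'] g by simp
      then show "v \<in> act V g ` homog V h" using h by (metis imageI)
    qed
  qed
  then show ?thesis
    using assms vectorspace_axioms G.group_axioms homog_sub decomp
    by (intro yd_module.intro yd_module_axioms.intro)
qed

context yd_tensor
begin

lemma sub_cspace:
  assumes N: "VectorSpace.subspace CC N V"
  shows "cspace (V\<lparr>carrier := N, homog := (\<lambda>g. homog V g \<inter> N)\<rparr>)"
proof -
  note s = V.subspaceD[OF N]
  show ?thesis
  proof (rule cspaceI)
    fix v assume "v \<in> carrier (V\<lparr>carrier := N, homog := (\<lambda>g. homog V g \<inter> N)\<rparr>)"
    then have v: "v \<in> N" by simp
    have "v \<oplus>\<^bsub>V\<^esub> (-1) \<odot>\<^bsub>V\<^esub> v = \<zero>\<^bsub>V\<^esub>" using v s(1) V.sm_ldistr[of v 1 "-1"] by auto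
    then show "\<exists>w\<in>carrier (V\<lparr>carrier := N, homog := (\<lambda>g. homog V g \<inter> N)\<rparr>).
        v \<oplus>\<^bsub>V\<lparr>carrier := N, homog := (\<lambda>g. homog V g \<inter> N)\<rparr>\<^esub> w
        = \<zero>\<^bsub>V\<lparr>carrier := N, homog := (\<lambda>g. homog V g \<inter> N)\<rparr>\<^esub>"
      using s(4)[OF v, of "-1"] by auto
  qed (use s in \<open>auto simp: subset_iff V.a_ac V.sm_rdistr V.sm_ldistr V.sm_assoc\<close>)
qed

text \<open>The definition of a submodule demands that the restricted structure be a module. All axioms are
  inherited except the existence of decompositions, which is stability under homogeneous components.\<close>

lemma submodule_iff:
  "yd_submodule G N V \<longleftrightarrow> VectorSpace.subspace CC N V \<and>
    (\<forall>g\<in>carrier G. \<forall>n\<in>N. act V g n \<in> N \<and> V.part n g \<in> N)" (is "_ \<longleftrightarrow> ?R")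
proof
  let ?V = "V\<lparr>carrier := N, homog := (\<lambda>g. homog V g \<inter> N)\<rparr>"
  assume "yd_submodule G N V"
  then have sub: "VectorSpace.subspace CC N V" and m: "yd_module G ?V" by (auto simp: yd_submodule_def)
  interpret M: yd_tensor G ?V using m finite_group by (intro yd_tensor.intro yd_tensor_axioms.intro)
  have "act V g n \<in> N" if "g \<in> carrier G" "n \<in> N" for g n
    using M.act_V_closed[of g n] that by simp
  moreover have "V.part n g \<in> N" if g: "g \<in> carrier G" and n: "n \<in> N" for g n
  proof -
    have h: "M.V.part n k \<in> homog V k \<inter> N" if "k \<in> carrier G" for k
      using M.V.part_homog[of n k] that n by simp
    have "finsum ?V (M.V.part n) (carrier G) = finsum V (M.V.part n) (carrier G)"
      by (rule sub_finsum[OF V_cspace M.V_cspace]) (use h V.subspaceD(1)[OF sub] in auto)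
    then have "n = finsum V (M.V.part n) (carrier G)" using M.V.part_sum[of n] n by simp
    then have "V.part n g = M.V.part n g"
      using V.subspaceD(1)[OF sub] n h g by (intro V.part_unique) auto
    then show ?thesis using h[OF g] by simp
  qed
  ultimately show ?R using sub by auto
next
  let ?V = "V\<lparr>carrier := N, homog := (\<lambda>g. homog V g \<inter> N)\<rparr>"
  assume R: ?R
  then have sub: "VectorSpace.subspace CC N V" by auto
  note s = V.subspaceD[OF sub]
  have c: "cspace ?V" by (rule sub_cspace[OF sub])
  interpret C: cspace ?V by (rule c)
  have hsub: "VectorSpace.subspace CC (homog V g \<inter> N) ?V" if g: "g \<in> carrier G" for g
    by (rule C.subspaceI) (use V.subspaceD[OF V.homog_sub[OF g]] s in auto)
  have "graded G ?V"
  proof (rule gradedI[OF c G.group_axioms finite_group, where H = "\<lambda>g. homog V g \<inter> N" and P = "\<lambda>g v. V.part v g"])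
    show "homog ?V g = CC_span ?V (homog V g \<inter> N)" if "g \<in> carrier G" for g
      using C.span_subset[OF hsub[OF that] subset_refl] C.in_own_span[of "homog V g \<inter> N"] by auto
    show "(\<lambda>v. V.part v g) \<in> lin_maps ?V ?V" if g: "g \<in> carrier G" for g
      by (rule linI) (use R g s(3,4) subsetD[OF s(1)] linD[OF V.part_lin[OF g]] in auto)
    show "V.part x g = (if g = h then x else \<zero>\<^bsub>?V\<^esub>)"
      if "g \<in> carrier G" "h \<in> carrier G" "x \<in> homog V h \<inter> N" for g h x
      using V.part_of_homog[OF that(2) _ that(1)] that by simp
    fix x assume x: "x \<in> carrier ?V"
    then have xN: "x \<in> N" by simp
    let ?U = "\<Union>g\<in>carrier G. homog V g \<inter> N"
    have U: "?U \<subseteq> carrier ?V" by auto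
    have p: "V.part x g \<in> ?U" if "g \<in> carrier G" for g
      using that R xN V.part_homog[of x g] s(1) by blast
    have "finsum ?V (V.part x) (carrier G) = finsum V (V.part x) (carrier G)"
      by (rule sub_finsum[OF V_cspace c]) (use s(1) R xN in auto)
    also have "\<dots> = x" using V.part_sum[of x] xN s(1) by auto
    finally show "x \<in> CC_span ?V ?U"
      using C.subspace_finsum[OF C.span_is_subspace[OF U], of "V.part x" "carrier G"] p C.span_base[OF U]
      by (metis (no_types, lifting) Pi_I)
  qed auto
  moreover have "act ?V g \<in> lin_maps ?V ?V" if g: "g \<in> carrier G" for g
    by (rule linI) (use R g subsetD[OF s(1)] linD[OF act_linear[OF g]] in auto)
  moreover have "act V g v \<in> homog V (g \<otimes>\<^bsub>G\<^esub> h \<otimes>\<^bsub>G\<^esub> inv\<^bsub>G\<^esub> g) \<inter> N"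
    if "g \<in> carrier G" "h \<in> carrier G" "v \<in> homog V h \<inter> N" for g h v
    using act_homog[OF that(1,2)] that R by auto
  ultimately have "yd_module G ?V"
    by (intro yd_moduleI) (use s(1) act_one act_mult in auto)
  then show "yd_submodule G N V" using sub by (simp add: yd_submodule_def)
qed

lemma span_submodule:
  assumes S: "S \<subseteq> (\<Union>g\<in>carrier G. homog V g)"
    and a: "\<And>g s. g \<in> carrier G \<Longrightarrow> s \<in> S \<Longrightarrow> act V g s \<in> CC_span V S"
  shows "yd_submodule G (CC_span V S) V"
proof -
  have Sc: "S \<subseteq> carrier V" using S V.homog_closed by auto
  note sub = V.span_is_subspace[OF Sc]
  have "act V g n \<in> CC_span V S" if "g \<in> carrier G" "n \<in> CC_span V S" for g n
    by (rule lin_span_image[OF act_linear[OF that(1)] V_cspace V_cspace Sc sub a[OF that(1)] that(2)])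
  moreover have "V.part n g \<in> CC_span V S" if "g \<in> carrier G" "n \<in> CC_span V S" for g n
  proof (rule lin_span_image[OF V.part_lin[OF that(1)] V_cspace V_cspace Sc sub _ that(2)])
    fix s assume s: "s \<in> S"
    then obtain h where "h \<in> carrier G" "s \<in> homog V h" using S by auto
    then have "V.part s g = (if g = h then s else \<zero>\<^bsub>V\<^esub>)" using V.part_of_homog that by auto
    then show "V.part s g \<in> CC_span V S" using V.span_base[OF Sc s] V.span_zero[OF Sc] by auto
  qed
  ultimately show ?thesis using sub unfolding submodule_iff by auto
qed

end

lemma yd_tensorI: "yd_module G V \<Longrightarrow> finite (carrier G) \<Longrightarrow> yd_tensor G V"
  by (intro yd_tensor.intro yd_tensor_axioms.intro)

lemma yd_homD:
  assumes "f \<in> yd_hom G V W"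
  shows "f \<in> lin_maps V W" "\<And>g v. g \<in> carrier G \<Longrightarrow> v \<in> carrier V \<Longrightarrow> f (act V g v) = act W g (f v)"
    "\<And>g v. g \<in> carrier G \<Longrightarrow> v \<in> homog V g \<Longrightarrow> f v \<in> homog W g"
  using assms unfolding yd_hom_def by blast+

lemma yd_homI:
  assumes "f \<in> lin_maps V W" "\<And>g v. g \<in> carrier G \<Longrightarrow> v \<in> carrier V \<Longrightarrow> f (act V g v) = act W g (f v)"
    "\<And>g v. g \<in> carrier G \<Longrightarrow> v \<in> homog V g \<Longrightarrow> f v \<in> homog W g"
  shows "f \<in> yd_hom G V W"
  using assms unfolding yd_hom_def by auto

lemma yd_isomorphic_trans:
  assumes "yd_isomorphic G U V" "yd_isomorphic G V W"
  shows "yd_isomorphic G U W"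
proof -
  obtain f k where f: "f \<in> yd_hom G U V" "bij_betw f (carrier U) (carrier V)"
    and k: "k \<in> yd_hom G V W" "bij_betw k (carrier V) (carrier W)"
    using assms unfolding yd_isomorphic_def by auto
  have "(\<lambda>x. k (f x)) \<in> yd_hom G U W"
    by (rule yd_homI[OF lin_comp[OF yd_homD(1)[OF f(1)] yd_homD(1)[OF k(1)]]])
      (use yd_homD(2,3)[OF f(1)] yd_homD(2,3)[OF k(1)] linD(1)[OF yd_homD(1)[OF f(1)]] in auto)
  moreover have "bij_betw (\<lambda>x. k (f x)) (carrier U) (carrier W)"
    using bij_betw_trans[OF f(2) k(2)] by (simp add: comp_def)
  ultimately show ?thesis unfolding yd_isomorphic_def by auto
qed

lemma yd_hom_part:
  assumes V: "yd_module G V" and W: "yd_module G W" and fin: "finite (carrier G)"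
    and f: "f \<in> yd_hom G V W" and v: "v \<in> carrier V" and g: "g \<in> carrier G"
  shows "f (homog_part G V v g) = homog_part G W (f v) g"
proof -
  interpret V: yd_tensor G V by (rule yd_tensorI[OF V fin])
  interpret W: yd_tensor G W by (rule yd_tensorI[OF W fin])
  note l = yd_homD(1)[OF f]
  have "f v = f (finsum V (V.V.part v) (carrier G))" using V.V.part_sum[OF v] by simp
  also have "\<dots> = finsum W (\<lambda>g. f (V.V.part v g)) (carrier G)"
    by (rule lin_finsum[OF l V.V_cspace W.V_cspace]) (use v in auto)
  finally show ?thesis
    by (intro W.V.part_unique[symmetric, of "f v" "\<lambda>g. f (V.V.part v g)"])
      (use linD(1)[OF l v] yd_homD(3)[OF f] V.V.part_homog[OF v] g in auto)
qed

lemma yd_hom_inverse: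
  assumes V: "yd_module G V" and W: "yd_module G W" and fin: "finite (carrier G)"
    and f: "f \<in> yd_hom G V W" and bij: "bij_betw f (carrier V) (carrier W)"
  shows "\<exists>k \<in> yd_hom G W V. bij_betw k (carrier W) (carrier V) \<and> (\<forall>v\<in>carrier V. k (f v) = v) \<and>
    (\<forall>w\<in>carrier W. f (k w) = w)"
proof -
  interpret V: yd_tensor G V by (rule yd_tensorI[OF V fin])
  interpret W: yd_tensor G W by (rule yd_tensorI[OF W fin])
  note l = yd_homD(1)[OF f]
  define k where "k = inv_into (carrier V) f"
  have kf: "k (f v) = v" if "v \<in> carrier V" for v
    unfolding k_def using bij that by (simp add: bij_betw_inv_into_left)
  have fk: "f (k w) = w" if "w \<in> carrier W" for w
    unfolding k_def using bij that by (simp add: bij_betw_inv_into_right)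
  have kb: "bij_betw k (carrier W) (carrier V)" unfolding k_def by (rule bij_betw_inv_into[OF bij])
  then have kc: "k w \<in> carrier V" if "w \<in> carrier W" for w using that bij_betwE by auto
  have "k \<in> yd_hom G W V"
  proof (rule yd_homI)
    show "k \<in> lin_maps W V"
    proof (rule linI)
      show "k v \<in> carrier V" if "v \<in> carrier W" for v by (rule kc[OF that])
      fix v w c assume v: "v \<in> carrier W"
      show "k (c \<odot>\<^bsub>W\<^esub> v) = c \<odot>\<^bsub>V\<^esub> k v"
        using kf[of "c \<odot>\<^bsub>V\<^esub> k v"] v kc linD(3)[OF l kc[OF v], of c] fk by simp
      assume w: "w \<in> carrier W"
      show "k (v \<oplus>\<^bsub>W\<^esub> w) = k v \<oplus>\<^bsub>V\<^esub> k w"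
        using kf[of "k v \<oplus>\<^bsub>V\<^esub> k w"] v w kc linD(2)[OF l kc[OF v] kc[OF w]] fk by simp
    qed
    show "k (act W g w) = act V g (k w)" if "g \<in> carrier G" "w \<in> carrier W" for g w
      using kf[of "act V g (k w)"] that kc yd_homD(2)[OF f] fk by simp
    show "k w \<in> homog V g" if g: "g \<in> carrier G" and w: "w \<in> homog W g" for g w
    proof -
      have w': "w \<in> carrier W" using W.V.homog_closed g w by auto
      have "f (V.V.part (k w) g) = W.V.part w g"
        using yd_hom_part[OF V W fin f kc[OF w'] g] fk[OF w'] by simp
      also have "\<dots> = w" using W.V.part_of_homog[OF g w g] by simp
      finally have "V.V.part (k w) g = k w" using kf[of "V.V.part (k w) g"] kc[OF w'] g by simp
      then show ?thesis using V.V.part_homog[OF kc[OF w'] g] by simp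
    qed
  qed
  with kb kf fk show ?thesis by blast
qed

lemma yd_isomorphic_sym:
  assumes "yd_module G V" "yd_module G W" "finite (carrier G)" "yd_isomorphic G V W"
  shows "yd_isomorphic G W V"
  using assms(4) yd_hom_inverse[OF assms(1-3)] unfolding yd_isomorphic_def by blast

lemma yd_irreducible_iso:
  assumes M: "yd_module G M" and N: "yd_irreducible G N" and fin: "finite (carrier G)" and iso: "yd_isomorphic G M N"
  shows "yd_irreducible G M"
proof -
  have N': "yd_module G N" and Nz: "carrier N \<noteq> {\<zero>\<^bsub>N\<^esub>}"
    and Ns: "\<And>K. yd_submodule G K N \<Longrightarrow> K = {\<zero>\<^bsub>N\<^esub>} \<or> K = carrier N"
    using N unfolding yd_irreducible_def by auto
  interpret M: yd_tensor G M by (rule yd_tensorI[OF M fin])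
  interpret N: yd_tensor G N by (rule yd_tensorI[OF N' fin])
  obtain f where f: "f \<in> yd_hom G M N" "bij_betw f (carrier M) (carrier N)"
    using iso unfolding yd_isomorphic_def by auto
  note l = yd_homD(1)[OF f(1)]
  have inj: "inj_on f (carrier M)" and im: "f ` carrier M = carrier N" using f(2) unfolding bij_betw_def by auto
  have z: "f \<zero>\<^bsub>M\<^esub> = \<zero>\<^bsub>N\<^esub>" by (rule lin_zero[OF l M.V_cspace N.V_cspace])
  have sub: "K = {\<zero>\<^bsub>M\<^esub>} \<or> K = carrier M" if K: "yd_submodule G K M" for K
  proof -
    have Ks: "VectorSpace.subspace CC K M" and Ka: "\<forall>g\<in>carrier G. \<forall>n\<in>K. act M g n \<in> K \<and> M.V.part n g \<in> K"
      using K unfolding M.submodule_iff by auto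
    note s = M.V.subspaceD[OF Ks]
    have "VectorSpace.subspace CC (f ` K) N"
    proof (rule N.V.subspaceI)
      show "\<zero>\<^bsub>N\<^esub> \<in> f ` K" using s(2) z by (metis imageI)
      show "v \<oplus>\<^bsub>N\<^esub> w \<in> f ` K" if "v \<in> f ` K" "w \<in> f ` K" for v w
      proof -
        from that obtain a b where "a \<in> K" "b \<in> K" "v = f a" "w = f b" by auto
        then show ?thesis using linD(2)[OF l, of a b] s(1,3) by (metis imageI subsetD)
      qed
      show "c \<odot>\<^bsub>N\<^esub> v \<in> f ` K" if "v \<in> f ` K" for c v
      proof -
        from that obtain a where "a \<in> K" "v = f a" by auto
        then show ?thesis using linD(3)[OF l, of a c] s(1,4) by (metis imageI subsetD)
      qed
    qed (use s(1) im in auto)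
    moreover have "act N g n \<in> f ` K \<and> N.V.part n g \<in> f ` K" if "g \<in> carrier G" "n \<in> f ` K" for g n
    proof -
      obtain a where a: "a \<in> K" "n = f a" using \<open>n \<in> f ` K\<close> by auto
      then have "act N g n = f (act M g a)" "N.V.part n g = f (M.V.part a g)"
        using yd_homD(2)[OF f(1) that(1), of a] yd_hom_part[OF M N' fin f(1) _ that(1), of a] s(1) by auto
      then show ?thesis using Ka a that by auto
    qed
    ultimately have "f ` K = {\<zero>\<^bsub>N\<^esub>} \<or> f ` K = carrier N"
      using Ns[of "f ` K"] unfolding N.submodule_iff by auto
    then show ?thesis
    proof
      assume *: "f ` K = {\<zero>\<^bsub>N\<^esub>}"
      have "a = \<zero>\<^bsub>M\<^esub>" if a: "a \<in> K" for a
      proof (rule inj_onD[OF inj])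
        have "f a \<in> f ` K" using a by (rule imageI)
        then show "f a = f \<zero>\<^bsub>M\<^esub>" unfolding * z by simp
        show "a \<in> carrier M" using a s(1) by blast
      qed simp
      then have "K = {\<zero>\<^bsub>M\<^esub>}" using s(2) by blast
      then show ?thesis ..
    next
      assume "f ` K = carrier N"
      then show ?thesis using inj_on_image_eq_iff[OF inj s(1) subset_refl] im by auto
    qed
  qed
  have "carrier M \<noteq> {\<zero>\<^bsub>M\<^esub>}"
  proof
    assume "carrier M = {\<zero>\<^bsub>M\<^esub>}"
    then have "carrier N = {\<zero>\<^bsub>N\<^esub>}" using im z by (metis image_empty image_insert)
    then show False using Nz by contradiction
  qed
  then show ?thesis using M sub unfolding yd_irreducible_def by blast
qed

text \<open>The kernel is a proper submodule of an irreducible module, hence zero.\<close>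

lemma schur_iso:
  assumes N: "yd_irreducible G N" and W: "yd_module G W" and fin: "finite (carrier G)"
    and f: "f \<in> yd_hom G N W" and surj: "f ` carrier N = carrier W"
    and n: "n \<in> carrier N" "f n \<noteq> \<zero>\<^bsub>W\<^esub>"
  shows "yd_isomorphic G N W"
proof -
  have N': "yd_module G N" and Ns: "\<And>K. yd_submodule G K N \<Longrightarrow> K = {\<zero>\<^bsub>N\<^esub>} \<or> K = carrier N"
    using N unfolding yd_irreducible_def by auto
  interpret N: yd_tensor G N by (rule yd_tensorI[OF N' fin])
  interpret W: yd_tensor G W by (rule yd_tensorI[OF W fin])
  note l = yd_homD(1)[OF f]
  have z: "f \<zero>\<^bsub>N\<^esub> = \<zero>\<^bsub>W\<^esub>" by (rule lin_zero[OF l N.V_cspace W.V_cspace])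
  let ?K = "{v \<in> carrier N. f v = \<zero>\<^bsub>W\<^esub>}"
  have "VectorSpace.subspace CC ?K N"
    by (rule N.V.subspaceI) (use z linD[OF l] in auto)
  moreover have "act N g v \<in> ?K \<and> N.V.part v g \<in> ?K" if "g \<in> carrier G" "v \<in> ?K" for g v
    using that yd_homD(2)[OF f that(1), of v] yd_hom_part[OF N' W fin f, of v g]
      lin_zero[OF W.V.part_lin[OF that(1)] W.V_cspace W.V_cspace]
      lin_zero[OF W.act_linear[OF that(1)] W.V_cspace W.V_cspace] by simp
  ultimately have "?K = {\<zero>\<^bsub>N\<^esub>} \<or> ?K = carrier N" using Ns[of ?K] unfolding N.submodule_iff by auto
  then have K: "?K = {\<zero>\<^bsub>N\<^esub>}" using n by auto
  have "inj_on f (carrier N)"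
  proof (rule inj_onI)
    fix v w assume vw: "v \<in> carrier N" "w \<in> carrier N" "f v = f w"
    have "f (v \<oplus>\<^bsub>N\<^esub> (-1) \<odot>\<^bsub>N\<^esub> w) = f w \<oplus>\<^bsub>W\<^esub> (-1) \<odot>\<^bsub>W\<^esub> f w"
      using vw linD(2,3)[OF l] by simp
    also have "\<dots> = \<zero>\<^bsub>W\<^esub>" using W.V.sm_ldistr[of "f w" 1 "-1"] linD(1)[OF l vw(2)] by simp
    finally have "v \<oplus>\<^bsub>N\<^esub> (-1) \<odot>\<^bsub>N\<^esub> w \<in> ?K" using vw by simp
    then show "v = w" using N.V.minus_eq_zeroD[OF vw(1,2)] K by auto
  qed
  then show ?thesis using f surj unfolding yd_isomorphic_def bij_betw_def by auto
qed

text \<open>The quotient presenting an induced module is not known to be a Yetter-Drinfeld module at first. This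
  is read off from a linear bijection, compatible with action and degrees, to a module for which the axioms have been
  verified by computation.\<close>

lemma yd_transport:
  assumes N: "yd_module G N" and fin: "finite (carrier G)" and M: "cspace M"
    and f: "f \<in> lin_maps M N" and k: "k \<in> lin_maps N M"
    and kf: "\<And>m. m \<in> carrier M \<Longrightarrow> k (f m) = m" and fk: "\<And>n. n \<in> carrier N \<Longrightarrow> f (k n) = n"
    and a: "\<And>g m. g \<in> carrier G \<Longrightarrow> m \<in> carrier M \<Longrightarrow> act M g m \<in> carrier M \<and> f (act M g m) = act N g (f m)"
    and h: "\<And>g. g \<in> carrier G \<Longrightarrow> homog M g \<subseteq> carrier M" "\<And>g m. g \<in> carrier G \<Longrightarrow> m \<in> homog M g \<Longrightarrow> f m \<in> homog N g"
      "\<And>g n. g \<in> carrier G \<Longrightarrow> n \<in> homog N g \<Longrightarrow> k n \<in> homog M g"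
  shows "yd_module G M" "yd_isomorphic G M N"
proof -
  interpret N: yd_tensor G N by (rule yd_tensorI[OF N fin])
  interpret M: cspace M by (rule M)
  have hs: "VectorSpace.subspace CC (homog M g) M" if g: "g \<in> carrier G" for g
  proof -
    have "homog M g = {m \<in> carrier M. f m \<in> homog N g}"
    proof
      show "{m \<in> carrier M. f m \<in> homog N g} \<subseteq> homog M g"
        using h(3)[OF g] kf by (metis (no_types, lifting) mem_Collect_eq subsetI)
    qed (use h g in auto)
    then show ?thesis
      using N.V.subspaceD[OF N.V.homog_sub[OF g]] linD[OF f] lin_zero[OF f M N.V_cspace]
      by (intro M.subspaceI) auto
  qed
  have am: "act M g m = k (act N g (f m))" if "g \<in> carrier G" "m \<in> carrier M" for g m
    using a[OF that] kf by metis
  have gr: "graded G M"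
  proof (rule gradedI[OF M N.G.group_axioms fin h(1), where P = "\<lambda>g m. k (N.V.part (f m) g)"])
    show "homog M g = CC_span M (homog M g)" if "g \<in> carrier G" for g
      using M.span_subset[OF hs[OF that] subset_refl] M.in_own_span[OF h(1)[OF that]] by auto
    show "(\<lambda>m. k (N.V.part (f m) g)) \<in> lin_maps M M" if "g \<in> carrier G" for g
      by (rule lin_comp[OF lin_comp[OF f N.V.part_lin[OF that]] k])
    show "k (N.V.part (f x) g) = (if g = h' then x else \<zero>\<^bsub>M\<^esub>)"
      if "g \<in> carrier G" "h' \<in> carrier G" "x \<in> homog M h'" for g h' x
      using N.V.part_of_homog[OF that(2) h(2)[OF that(2,3)] that(1)] kf h(1)[OF that(2)] that(3)
        lin_zero[OF k N.V_cspace M] by auto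
    fix m assume m: "m \<in> carrier M"
    have U: "(\<Union>g\<in>carrier G. homog M g) \<subseteq> carrier M" using h(1) by auto
    have "k (f m) \<in> CC_span M (\<Union>g\<in>carrier G. homog M g)"
    proof (rule lin_span_image[OF k N.V_cspace M _ M.span_is_subspace[OF U] _ N.V.homog_span[OF linD(1)[OF f m]]])
      show "k s \<in> CC_span M (\<Union>g\<in>carrier G. homog M g)" if "s \<in> (\<Union>g\<in>carrier G. homog N g)" for s
        using that h(3) by (intro M.span_base[OF U]) auto
    qed (use N.V.homog_closed in auto)
    then show "m \<in> CC_span M (\<Union>g\<in>carrier G. homog M g)" using kf m by simp
  qed
  show Mm: "yd_module G M"
  proof (rule yd_moduleI[OF gr])
    show "act M g \<in> lin_maps M M" if g: "g \<in> carrier G" for g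
      by (rule lin_cong[OF lin_comp[OF lin_comp[OF f N.act_linear[OF g]] k] M]) (use am g in auto)
    show "act M \<one>\<^bsub>G\<^esub> v = v" if "v \<in> carrier M" for v
      using that am N.act_one linD(1)[OF f] kf by simp
    show "act M (g \<otimes>\<^bsub>G\<^esub> g') v = act M g (act M g' v)"
      if "g \<in> carrier G" "g' \<in> carrier G" "v \<in> carrier M" for g g' v
      using that a[OF that(2,3)] am[of "g \<otimes>\<^bsub>G\<^esub> g'" v] am[of g "act M g' v"] N.act_mult linD(1)[OF f] by simp
    show "act M g v \<in> homog M (g \<otimes>\<^bsub>G\<^esub> g' \<otimes>\<^bsub>G\<^esub> inv\<^bsub>G\<^esub> g)"
      if "g \<in> carrier G" "g' \<in> carrier G" "v \<in> homog M g'" for g g' v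
    proof -
      have "act N g (f v) \<in> homog N (g \<otimes>\<^bsub>G\<^esub> g' \<otimes>\<^bsub>G\<^esub> inv\<^bsub>G\<^esub> g)"
        using N.act_homog[OF that(1,2)] h(2)[OF that(2,3)] by auto
      then show ?thesis using am[OF that(1), of v] h(1)[OF that(2)] h(3) that by auto
    qed
  qed
  have "f \<in> yd_hom G M N" by (rule yd_homI[OF f]) (use a h(2) in auto)
  moreover have "bij_betw f (carrier M) (carrier N)"
    by (rule bij_betwI[of _ _ _ k]) (use linD(1)[OF f] linD(1)[OF k] kf fk in auto)
  ultimately show "yd_isomorphic G M N" unfolding yd_isomorphic_def by auto
qed

section \<open>Induced modules\<close>

lemma induced_relsE:
  assumes "r \<in> induced_rels G g W \<rho>"
  obtains (add) h w w' where "h \<in> carrier G" "w \<in> carrier W" "w' \<in> carrier W"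
      "r = Poly_Mapping.single (h, w \<oplus>\<^bsub>W\<^esub> w') 1 - Poly_Mapping.single (h, w) 1 - Poly_Mapping.single (h, w') 1"
  | (sm) c h w where "h \<in> carrier G" "w \<in> carrier W"
      "r = Poly_Mapping.single (h, c \<odot>\<^bsub>W\<^esub> w) 1 - Poly_Mapping.single (h, w) c"
  | (centr) h k w where "h \<in> carrier G" "k \<in> centralizer G g" "w \<in> carrier W"
      "r = Poly_Mapping.single (h \<otimes>\<^bsub>G\<^esub> k, w) 1 - Poly_Mapping.single (h, \<rho> k w) 1"
  using assms unfolding induced_rels_def Un_iff mem_Collect_eq
  by (elim disjE exE conjE) (rule that; assumption)+

locale induced = G: group G + W: cspace W
  for G :: "('g, 'm) monoid_scheme" and g :: 'g and W :: "(complex, 'w, 'z) module_scheme"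
    and \<rho> :: "'g \<Rightarrow> 'w \<Rightarrow> 'w" +
  assumes fin: "finite (carrier G)" and g: "g \<in> carrier G"
    and \<rho>_closed: "\<And>k w. k \<in> centralizer G g \<Longrightarrow> w \<in> carrier W \<Longrightarrow> \<rho> k w \<in> carrier W"
begin

abbreviation "M \<equiv> induced_yd G g W \<rho>"
abbreviation "F \<equiv> free_space (carrier G \<times> carrier W)"
abbreviation "R \<equiv> induced_rels G g W \<rho>"

lemma centr: "k \<in> centralizer G g \<Longrightarrow> k \<in> carrier G"
  unfolding centralizer_def by auto

lemma R_closed: "R \<subseteq> carrier F"
proof
  fix r assume "r \<in> R"
  then show "r \<in> carrier F"
    unfolding free_space_simps mem_Collect_eq
    by (cases rule: induced_relsE)
      (hypsubst, intro keys_diff_subset single_closed; simp add: centr \<rho>_closed; fail)+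
qed

sublocale P: presented "carrier G \<times> carrier W" "CC_span F R" M R
  by (rule presentedI[OF R_closed refl]) (simp_all add: induced_yd_def module.defs ydmod.defs Let_def)

lemma cls_diff:
  assumes "p \<in> carrier F" "q \<in> carrier F" "p - q \<in> R"
  shows "P.cls p = P.cls q"
  using assms P.span_base[OF R_closed] by (simp add: P.cls_eq_iff free_space_minus del: free_space_simps)

lemma single_F: "h \<in> carrier G \<Longrightarrow> w \<in> carrier W \<Longrightarrow> Poly_Mapping.single (h, w) c \<in> carrier F"
  by simp

lemma gen_lin: "h \<in> carrier G \<Longrightarrow> (\<lambda>w. P.gen (h, w)) \<in> lin_maps W M"
proof (rule linI)
  fix v w c assume h: "h \<in> carrier G" and v: "v \<in> carrier W"
  show "P.gen (h, v) \<in> carrier M" using h v by simp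
  have "Poly_Mapping.single (h, c \<odot>\<^bsub>W\<^esub> v) 1 - Poly_Mapping.single (h, v) c \<in> R"
    unfolding induced_rels_def using h v by blast
  then have "P.gen (h, c \<odot>\<^bsub>W\<^esub> v) = P.cls (Poly_Mapping.single (h, v) c)"
    using h v by (intro cls_diff single_F) auto
  then show "P.gen (h, c \<odot>\<^bsub>W\<^esub> v) = c \<odot>\<^bsub>M\<^esub> P.gen (h, v)"
    using P.sm_Q[OF single_F[OF h v, of 1], of c] by simp
  assume w: "w \<in> carrier W"
  have c: "Poly_Mapping.single (h, v) 1 + Poly_Mapping.single (h, w) 1 \<in> carrier F"
    using P.a_closed[OF single_F[OF h v, of 1] single_F[OF h w, of 1]] by simp
  have "Poly_Mapping.single (h, v \<oplus>\<^bsub>W\<^esub> w) 1 - (Poly_Mapping.single (h, v) 1 + Poly_Mapping.single (h, w) 1) \<in> R"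
    unfolding induced_rels_def diff_diff_add[symmetric] using h v w by blast
  then have "P.gen (h, v \<oplus>\<^bsub>W\<^esub> w) = P.cls (Poly_Mapping.single (h, v) 1 + Poly_Mapping.single (h, w) 1)"
    using h v w by (intro cls_diff single_F c) auto
  then show "P.gen (h, v \<oplus>\<^bsub>W\<^esub> w) = P.gen (h, v) \<oplus>\<^bsub>M\<^esub> P.gen (h, w)"
    using P.add_Q[OF single_F[OF h v, of 1] single_F[OF h w, of 1]] by simp
qed

lemma gen_centr:
  assumes "h \<in> carrier G" "k \<in> centralizer G g" "w \<in> carrier W"
  shows "P.gen (h \<otimes>\<^bsub>G\<^esub> k, w) = P.gen (h, \<rho> k w)"
proof (rule cls_diff)
  show "Poly_Mapping.single (h \<otimes>\<^bsub>G\<^esub> k, w) 1 - Poly_Mapping.single (h, \<rho> k w) 1 \<in> R"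
    unfolding induced_rels_def using assms by blast
qed (use assms centr \<rho>_closed in \<open>auto intro!: single_F\<close>)

lemma homog_M: "homog M t = CC_span M {P.gen (h, w) | h w.
    h \<in> carrier G \<and> w \<in> carrier W \<and> h \<otimes>\<^bsub>G\<^esub> g \<otimes>\<^bsub>G\<^esub> inv\<^bsub>G\<^esub> h = t}"
proof -
  let ?S = "{P.gen (h, w) | h w. h \<in> carrier G \<and> w \<in> carrier W \<and> h \<otimes>\<^bsub>G\<^esub> g \<otimes>\<^bsub>G\<^esub> inv\<^bsub>G\<^esub> h = t}"
  have "homog M t = CC_span (quot_module F (CC_span F R)) ?S"
    by (simp add: induced_yd_def module.defs ydmod.defs Let_def)
  then show ?thesis
    by (subst same_module(2)[OF P.Q_cspace, symmetric])
      (simp_all add: induced_yd_def module.defs ydmod.defs Let_def)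
qed

lemma act_M_gen_lin:
  assumes u: "u \<in> carrier G"
  shows act_gen: "h \<in> carrier G \<Longrightarrow> w \<in> carrier W \<Longrightarrow> act M u (P.gen (h, w)) = P.gen (u \<otimes>\<^bsub>G\<^esub> h, w)"
    and act_M_lin: "act M u \<in> lin_maps M M"
proof -
  let ?f = "lin_ext (\<lambda>(h, w :: 'w). Poly_Mapping.single (u \<otimes>\<^bsub>G\<^esub> h, w) (1::complex))"
  have f: "?f \<in> lin_maps F F"
    by (rule lin_ext_lin) (use u in auto)
  have f': "?f \<in> lin_maps (free_space UNIV) (free_space UNIV)" by (rule lin_ext_lin) auto
  have fd: "?f (p - q) = ?f p - ?f q" for p q
  proof -
    have m: "a - b = a + Poly_Mapping.map ((*) (-1)) b" for a b :: "'y \<Rightarrow>\<^sub>0 complex"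
      by (rule poly_mapping_eqI) (simp add: lookup_minus lookup_add)
    show ?thesis unfolding m using linD(2,3)[OF f'] by simp
  qed
  have fr: "?f r \<in> R" if "r \<in> R" for r
    using that
  proof (cases rule: induced_relsE)
    case (add h w w')
    have "?f r = Poly_Mapping.single (u \<otimes>\<^bsub>G\<^esub> h, w \<oplus>\<^bsub>W\<^esub> w') 1
        - Poly_Mapping.single (u \<otimes>\<^bsub>G\<^esub> h, w) 1 - Poly_Mapping.single (u \<otimes>\<^bsub>G\<^esub> h, w') 1"
      unfolding add(4) fd by simp
    moreover have "u \<otimes>\<^bsub>G\<^esub> h \<in> carrier G" using u add by simp
    ultimately show ?thesis unfolding induced_rels_def using add(2,3) by blast
  next
    case (sm c h w)
    have "?f r = Poly_Mapping.single (u \<otimes>\<^bsub>G\<^esub> h, c \<odot>\<^bsub>W\<^esub> w) 1 - Poly_Mapping.single (u \<otimes>\<^bsub>G\<^esub> h, w) c"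
      unfolding sm(3) fd by simp
    moreover have "u \<otimes>\<^bsub>G\<^esub> h \<in> carrier G" using u sm by simp
    ultimately show ?thesis unfolding induced_rels_def using sm(2) by blast
  next
    case (centr h k w)
    have "?f r = Poly_Mapping.single ((u \<otimes>\<^bsub>G\<^esub> h) \<otimes>\<^bsub>G\<^esub> k, w) 1 - Poly_Mapping.single (u \<otimes>\<^bsub>G\<^esub> h, \<rho> k w) 1"
      unfolding centr(4) fd using u centr by (simp add: G.m_assoc induced.centr[OF induced_axioms])
    moreover have "u \<otimes>\<^bsub>G\<^esub> h \<in> carrier G" using u centr by simp
    ultimately show ?thesis unfolding induced_rels_def using centr(2,3) by blast
  qed
  have "?f n \<in> CC_span F R" if "n \<in> CC_span F R" for n
    by (rule lin_span_image[OF f free_space_cspace free_space_cspace R_closed P.sub _ that])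
      (use fr P.span_base[OF R_closed] in auto)
  then have fN: "?f ` CC_span F R \<subseteq> CC_span F R" by auto
  have c: "act M u = coset_map F (CC_span F R) ?f"
    by (simp add: induced_yd_def module.defs ydmod.defs Let_def)
  have cl: "act M u (P.cls p) = P.cls (?f p)" if "p \<in> carrier F" for p
    unfolding c by (rule P.coset_map_lin[OF f fN that])
  show "act M u (P.gen (h, w)) = P.gen (u \<otimes>\<^bsub>G\<^esub> h, w)" if "h \<in> carrier G" "w \<in> carrier W"
    using cl[OF single_F[OF that, of 1]] by simp
  show "act M u \<in> lin_maps M M"
    by (rule linI) (use linD[OF f] in \<open>auto simp: P.carrier_Q cl P.add_Q P.sm_Q simp del: free_space_simps\<close>)
qed

text \<open>Recognition of the induced module: the candidate \<open>N\<close> contains \<open>W\<close> in degree \<open>g\<close>,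
  and \<open>k\<close> sends \<open>h \<cdot> w\<close> back to \<open>h \<otimes> w\<close>.\<close>

lemma recognize:
  assumes N: "yd_module G N" and i: "i \<in> lin_maps W N" and ih: "\<And>w. w \<in> carrier W \<Longrightarrow> i w \<in> homog N g"
    and i\<rho>: "\<And>k w. k \<in> centralizer G g \<Longrightarrow> w \<in> carrier W \<Longrightarrow> i (\<rho> k w) = act N k (i w)"
    and k: "k \<in> lin_maps N M" and ki: "\<And>h w. h \<in> carrier G \<Longrightarrow> w \<in> carrier W \<Longrightarrow> k (act N h (i w)) = P.gen (h, w)"
    and span: "\<And>n. n \<in> carrier N \<Longrightarrow> n \<in> CC_span N {act N h (i w) | h w. h \<in> carrier G \<and> w \<in> carrier W}"
    and kh: "\<And>t n. t \<in> carrier G \<Longrightarrow> n \<in> homog N t \<Longrightarrow> k n \<in> homog M t"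
  shows "yd_module G M \<and> yd_isomorphic G M N"
proof -
  interpret N: yd_tensor G N by (rule yd_tensorI[OF N fin])
  let ?f = "\<lambda>(h, w). act N h (i w)"
  have fc: "?f \<in> carrier G \<times> carrier W \<rightarrow> carrier N" using linD(1)[OF i] by auto
  have e: "extend N ?f \<in> lin_maps F N" by (rule extend_lin[OF N.V_cspace fc])
  have es: "extend N ?f (Poly_Mapping.single (h, w) c) = c \<odot>\<^bsub>N\<^esub> act N h (i w)" if "h \<in> carrier G" "w \<in> carrier W" for h w c
    using extend_single[OF N.V_cspace, of ?f "(h, w)" c] N.act_V_closed[OF that(1) linD(1)[OF i that(2)]] by simp
  have dc: "q - q' \<in> carrier F" if "q \<in> carrier F" "q' \<in> carrier F" for q q'
    using that keys_diff_subset by simp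
  have ed: "extend N ?f (p - q) = extend N ?f p \<oplus>\<^bsub>N\<^esub> (-1) \<odot>\<^bsub>N\<^esub> extend N ?f q"
    if "p \<in> carrier F" "q \<in> carrier F" for p q
    unfolding free_space_minus[OF that, symmetric]
      linD(2)[OF e that(1) P.sm_closed[OF that(2)]] linD(3)[OF e that(2)] ..
  have z1: "x \<oplus>\<^bsub>N\<^esub> (-1) \<odot>\<^bsub>N\<^esub> x = \<zero>\<^bsub>N\<^esub>" if "x \<in> carrier N" for x
    using that N.V.sm_ldistr[of x 1 "-1"] by simp
  have z2: "x \<oplus>\<^bsub>N\<^esub> y \<oplus>\<^bsub>N\<^esub> (-1) \<odot>\<^bsub>N\<^esub> x \<oplus>\<^bsub>N\<^esub> (-1) \<odot>\<^bsub>N\<^esub> y = \<zero>\<^bsub>N\<^esub>"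
    if "x \<in> carrier N" "y \<in> carrier N" for x y
  proof -
    have "x \<oplus>\<^bsub>N\<^esub> y \<oplus>\<^bsub>N\<^esub> (-1) \<odot>\<^bsub>N\<^esub> x \<oplus>\<^bsub>N\<^esub> (-1) \<odot>\<^bsub>N\<^esub> y
        = (x \<oplus>\<^bsub>N\<^esub> (-1) \<odot>\<^bsub>N\<^esub> x) \<oplus>\<^bsub>N\<^esub> (y \<oplus>\<^bsub>N\<^esub> (-1) \<odot>\<^bsub>N\<^esub> y)"
      using that by (simp add: N.V.a_ac)
    then show ?thesis using z1 that by simp
  qed
  have rel: "extend N ?f r = \<zero>\<^bsub>N\<^esub>" if "r \<in> R" for r
    using that
  proof (cases rule: induced_relsE)
    case (add h w w')
    then show ?thesis
      using linD(1)[OF i] linD(2)[OF i add(2,3)] linD(2)[OF N.act_linear[OF add(1)]]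
      by (simp add: ed es dc single_F z2 del: free_space_simps)
  next
    case (sm c h w)
    then show ?thesis
      using linD(1)[OF i] linD(3)[OF i sm(2)] linD(3)[OF N.act_linear[OF sm(1)]]
      by (simp add: ed es dc single_F z1 del: free_space_simps)
  next
    case (centr h k w)
    then show ?thesis
      using linD(1)[OF i] i\<rho>[OF centr(2,3)] N.act_mult \<rho>_closed[OF centr(2,3)] induced.centr[OF induced_axioms centr(2)]
      by (simp add: ed es dc single_F z1 del: free_space_simps)
  qed
  obtain f where f: "f \<in> lin_maps M N" "\<And>h w. h \<in> carrier G \<Longrightarrow> w \<in> carrier W \<Longrightarrow> f (P.gen (h, w)) = act N h (i w)"
    using P.lift_gens[OF N.V_cspace fc rel] by auto
  have kf: "k (f m) = m" if m: "m \<in> carrier M" for m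
    by (rule P.Q_lin_eq[OF lin_comp[OF f(1) k] lin_id P.Q_cspace _ m]) (use f(2) ki in auto)
  have fk: "f (k n) = n" if n: "n \<in> carrier N" for n
    by (rule lin_eq_on_span[OF lin_comp[OF k f(1)] lin_id N.V_cspace N.V_cspace _ span[OF n]])
      (use f(2) ki linD(1)[OF i] in auto)
  have fa: "f (act M u m) = act N u (f m)" if u: "u \<in> carrier G" and m: "m \<in> carrier M" for u m
  proof (rule P.Q_lin_eq[OF lin_comp[OF act_M_lin[OF u] f(1)] lin_comp[OF f(1) N.act_linear[OF u]] N.V_cspace _ m])
    fix s assume "s \<in> carrier G \<times> carrier W"
    then obtain h w where s: "s = (h, w)" "h \<in> carrier G" "w \<in> carrier W" by auto
    show "f (act M u (P.gen s)) = act N u (f (P.gen s))"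
      unfolding s(1) act_gen[OF u s(2,3)] f(2)[OF s(2,3)] using f(2)[of "u \<otimes>\<^bsub>G\<^esub> h" w] u s linD(1)[OF i]
      by (simp add: N.act_mult)
  qed
  let ?H = "\<lambda>t. {P.gen (h, w) | h w. h \<in> carrier G \<and> w \<in> carrier W \<and> h \<otimes>\<^bsub>G\<^esub> g \<otimes>\<^bsub>G\<^esub> inv\<^bsub>G\<^esub> h = t}"
  have Hc: "?H t \<subseteq> carrier M" for t by auto
  interpret M: cspace M by (rule P.Q_cspace)
  have "homog M t \<subseteq> carrier M" for t unfolding homog_M by (rule M.span_is_subset2[OF Hc])
  moreover have "f m \<in> homog N t" if t: "t \<in> carrier G" and m: "m \<in> homog M t" for t m
  proof (rule lin_span_image[OF f(1) P.Q_cspace N.V_cspace Hc N.V.homog_sub[OF t] _ m[unfolded homog_M]])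
    fix s assume "s \<in> ?H t"
    then obtain h w where s: "s = P.gen (h, w)" "h \<in> carrier G" "w \<in> carrier W" "h \<otimes>\<^bsub>G\<^esub> g \<otimes>\<^bsub>G\<^esub> inv\<^bsub>G\<^esub> h = t" by auto
    then show "f s \<in> homog N t" using f(2) N.act_homog[OF s(2) g] ih by auto
  qed
  ultimately show ?thesis
    using yd_transport[OF N fin P.Q_cspace f(1) k kf fk _ _ _ kh] fa linD(1)[OF act_M_lin] by auto
qed

end

section \<open>Two-dimensional models\<close>

abbreviation "C2 \<equiv> direct_sum CC_line CC_line"

lemma C2_simps [simp]:
  "carrier C2 = UNIV" "add C2 (a, b) (c, d) = (a + c, b + d)" "zero C2 = (0, 0)"
  "smult C2 e (a, b) = (e * a, e * b)"
  by (simp_all add: direct_sum_def)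

lemma C2_cspace: "cspace C2"
  unfolding cspace_def using CC_line_cspace by (intro direct_sum_is_vs) (simp_all add: cspace_def)

text \<open>A module with a basis of homogeneous vectors \<open>(1, 0)\<close>, \<open>(0, 1)\<close> of degrees \<open>d\<close>, \<open>e\<close>. All four modules
of the classification have this shape; the degrees coincide for the one with central support.\<close>

definition pair_yd :: "('g \<Rightarrow> complex \<times> complex \<Rightarrow> complex \<times> complex) \<Rightarrow> 'g \<Rightarrow> 'g \<Rightarrow> ('g, complex \<times> complex) ydmod" where
  "pair_yd \<rho> d e = module.extend C2 (ydmod.fields \<rho> (\<lambda>t. {(p, q). (t \<noteq> d \<longrightarrow> p = 0) \<and> (t \<noteq> e \<longrightarrow> q = 0)}))"

lemma pair_yd_simps [simp]:
  "carrier (pair_yd \<rho> d e) = UNIV" "add (pair_yd \<rho> d e) (a, b) (a', b') = (a + a', b + b')"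
  "zero (pair_yd \<rho> d e) = (0, 0)" "smult (pair_yd \<rho> d e) c (a, b) = (c * a, c * b)"
  "act (pair_yd \<rho> d e) = \<rho>"
  "homog (pair_yd \<rho> d e) t = {(p, q). (t \<noteq> d \<longrightarrow> p = 0) \<and> (t \<noteq> e \<longrightarrow> q = 0)}"
  by (simp_all add: pair_yd_def module.defs ydmod.defs)

lemma pair_yd_cspace: "cspace (pair_yd \<rho> d e)"
  by (rule same_module(1)[OF C2_cspace]) (simp_all add: pair_yd_def module.defs)

lemma pair_yd_same:
  "carrier (pair_yd \<rho> d e) = carrier C2" "add (pair_yd \<rho> d e) = add C2"
  "smult (pair_yd \<rho> d e) = smult C2"
  by (simp_all add: pair_yd_def module.defs)

lemma pair_yd_lin_maps: "lin_maps (pair_yd \<rho> d e) (pair_yd \<rho> d e) = lin_maps C2 C2"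
  by (rule trans[OF same_lin_maps(1)[OF pair_yd_same] same_lin_maps(2)[OF pair_yd_same]])

lemma pair_span:
  fixes X :: "(complex, complex \<times> complex, 'z) module_scheme"
  assumes X: "cspace X" and eq: "carrier X = UNIV" "\<And>a b a' b'. add X (a, b) (a', b') = (a + a', b + b')"
     "\<And>c a b. smult X c (a, b) = (c * a, c * b)"
    and S: "(1, 0) \<in> S" "(0, 1) \<in> S"
  shows "x \<in> CC_span X S"
proof -
  interpret X: cspace X by fact
  have c: "S \<subseteq> carrier X" by (simp add: eq)
  obtain a b where x: "x = (a, b)" by (cases x)
  have "a \<odot>\<^bsub>X\<^esub> (1, 0) \<oplus>\<^bsub>X\<^esub> b \<odot>\<^bsub>X\<^esub> (0, 1) \<in> CC_span X S"
    using S by (intro X.span_add[OF c] X.span_sm[OF c] X.span_base[OF c])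
  then show ?thesis by (simp add: x eq)
qed

lemma pair_yd_module:
  assumes G: "group G" "finite (carrier G)" and d: "d \<in> carrier G" "e \<in> carrier G"
    and lin: "\<And>u. u \<in> carrier G \<Longrightarrow> \<rho> u \<in> lin_maps C2 C2"
    and one: "\<And>v. \<rho> \<one>\<^bsub>G\<^esub> v = v"
    and mult: "\<And>u u' v. u \<in> carrier G \<Longrightarrow> u' \<in> carrier G \<Longrightarrow> \<rho> (u \<otimes>\<^bsub>G\<^esub> u') v = \<rho> u (\<rho> u' v)"
    and h: "\<And>u. u \<in> carrier G \<Longrightarrow> \<rho> u (1, 0) \<in> homog (pair_yd \<rho> d e) (u \<otimes>\<^bsub>G\<^esub> d \<otimes>\<^bsub>G\<^esub> inv\<^bsub>G\<^esub> u)"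
      "\<And>u. u \<in> carrier G \<Longrightarrow> \<rho> u (0, 1) \<in> homog (pair_yd \<rho> d e) (u \<otimes>\<^bsub>G\<^esub> e \<otimes>\<^bsub>G\<^esub> inv\<^bsub>G\<^esub> u)"
  shows "yd_module G (pair_yd \<rho> d e)"
proof -
  let ?N = "pair_yd \<rho> d e"
  interpret N: cspace ?N by (rule pair_yd_cspace)
  interpret G: group G by fact
  let ?H = "\<lambda>t. (if t = d then {(1, 0)} else {}) \<union> (if t = e then {(0, 1)} else {})"
  let ?P = "\<lambda>t (p, q). (if t = d then p else 0, if t = e then q else (0::complex))"
  have Hc: "?H t \<subseteq> carrier ?N" for t by simp
  have sub: "VectorSpace.subspace CC (homog ?N t) ?N" for t
    by (rule N.subspaceI) auto
  have lm: "lin_maps ?N ?N = lin_maps C2 C2"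
    by (rule pair_yd_lin_maps)
  have gr: "graded G ?N"
  proof (rule gradedI[OF pair_yd_cspace[of \<rho> d e] G, where H = ?H and P = ?P])
    show "homog ?N t = CC_span ?N (?H t)" for t
    proof
      show "CC_span ?N (?H t) \<subseteq> homog ?N t"
        by (rule N.span_subset[OF sub]) auto
      show "homog ?N t \<subseteq> CC_span ?N (?H t)"
      proof
        fix x assume x: "x \<in> homog ?N t"
        obtain p q where pq: "x = (p, q)" by (cases x)
        have "(p, 0) \<in> CC_span ?N (?H t)"
        proof (cases "t = d")
          case True
          have "p \<odot>\<^bsub>?N\<^esub> (1, 0) \<in> CC_span ?N (?H t)"
            by (intro N.span_sm[OF Hc] N.span_base[OF Hc]) (simp add: True)
          then show ?thesis by simp
        qed (use x pq N.span_zero[OF Hc, of t] in auto)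
        moreover have "(0, q) \<in> CC_span ?N (?H t)"
        proof (cases "t = e")
          case True
          have "q \<odot>\<^bsub>?N\<^esub> (0, 1) \<in> CC_span ?N (?H t)"
            by (intro N.span_sm[OF Hc] N.span_base[OF Hc]) (simp add: True)
          then show ?thesis by simp
        qed (use x pq N.span_zero[OF Hc, of t] in auto)
        ultimately have "(p, 0) \<oplus>\<^bsub>?N\<^esub> (0, q) \<in> CC_span ?N (?H t)" by (rule N.span_add[OF Hc])
        then show "x \<in> CC_span ?N (?H t)" by (simp add: pq)
      qed
    qed
    show "x \<in> CC_span ?N (\<Union>g\<in>carrier G. ?H g)" for x
      by (rule pair_span[OF pair_yd_cspace]) (use d in auto)
    show "?P t \<in> lin_maps ?N ?N" for t
      by (rule linI) (auto split: prod.splits)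
  qed (auto split: if_splits)
  show ?thesis
  proof (rule yd_moduleI[OF gr])
    show "act ?N u \<in> lin_maps ?N ?N" if "u \<in> carrier G" for u using lin[OF that] lm by simp
    fix u t v assume u: "u \<in> carrier G" and t: "t \<in> carrier G" and v: "v \<in> homog ?N t"
    obtain p q where pq: "v = (p, q)" by (cases v)
    let ?t = "u \<otimes>\<^bsub>G\<^esub> t \<otimes>\<^bsub>G\<^esub> inv\<^bsub>G\<^esub> u"
    note l = linD(2,3)[OF lin[OF u]]
    note s = N.subspaceD[OF sub[of ?t]]
    have "p \<odot>\<^bsub>?N\<^esub> \<rho> u (1, 0) \<in> homog ?N ?t"
    proof (cases "t = d")
      case True
      then show ?thesis using s(4)[of "\<rho> u (1, 0)" p] h(1)[OF u] by simp
    next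
      case False
      then have "p = 0" using v pq by simp
      then show ?thesis using s(2) N.sm_0[of "\<rho> u (1, 0)"] by simp
    qed
    moreover have "q \<odot>\<^bsub>?N\<^esub> \<rho> u (0, 1) \<in> homog ?N ?t"
    proof (cases "t = e")
      case True
      then show ?thesis using s(4)[of "\<rho> u (0, 1)" q] h(2)[OF u] by simp
    next
      case False
      then have "q = 0" using v pq by simp
      then show ?thesis using s(2) N.sm_0[of "\<rho> u (0, 1)"] by simp
    qed
    ultimately have "p \<odot>\<^bsub>?N\<^esub> \<rho> u (1, 0) \<oplus>\<^bsub>?N\<^esub> q \<odot>\<^bsub>?N\<^esub> \<rho> u (0, 1) \<in> homog ?N ?t" by (rule s(3))
    moreover have "act ?N u v = p \<odot>\<^bsub>?N\<^esub> \<rho> u (1, 0) \<oplus>\<^bsub>?N\<^esub> q \<odot>\<^bsub>?N\<^esub> \<rho> u (0, 1)"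
    proof -
      have ll: "act ?N u \<in> lin_maps ?N ?N" using lin[OF u] lm by simp
      have "v = p \<odot>\<^bsub>?N\<^esub> (1, 0) \<oplus>\<^bsub>?N\<^esub> q \<odot>\<^bsub>?N\<^esub> (0, 1)" by (simp add: pq)
      then show ?thesis using linD(2)[OF ll, of "p \<odot>\<^bsub>?N\<^esub> (1, 0)" "q \<odot>\<^bsub>?N\<^esub> (0, 1)"]
          linD(3)[OF ll, of "(1, 0)" p] linD(3)[OF ll, of "(0, 1)" q] by simp
    qed
    ultimately show "act ?N u v \<in> homog ?N ?t" by simp
  qed (use one mult in auto)
qed

section \<open>The quaternion group\<close>

lemma Q8_carrier: "carrier Q8 = {(0,0),(1,0),(2,0),(3,0),(0,1),(1,1),(2,1),(3,1)}"
proof -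
  have "{..<4::nat} = {0,1,2,3}" "{..<2::nat} = {0,1}" by auto
  then show ?thesis by (auto simp: Q8_def)
qed

lemma Q8_finite: "finite (carrier Q8)"
  by (simp add: Q8_carrier)

lemma Q8_mult: "(a, b) \<otimes>\<^bsub>Q8\<^esub> (c, d) = ((a + 3 ^ b * c + 2 * (b * d)) mod 4, (b + d) mod 2)"
  by (simp add: Q8_def)

lemma Q8_one: "\<one>\<^bsub>Q8\<^esub> = (0, 0)"
  by (simp add: Q8_def)

lemma Q8_conj:
  assumes "u \<in> carrier Q8" "d \<in> carrier Q8" "t \<in> carrier Q8" "u \<otimes>\<^bsub>Q8\<^esub> d = t \<otimes>\<^bsub>Q8\<^esub> u"
  shows "u \<otimes>\<^bsub>Q8\<^esub> d \<otimes>\<^bsub>Q8\<^esub> inv\<^bsub>Q8\<^esub> u = t"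
proof -
  interpret group Q8 by (rule Q8_group)
  show ?thesis using assms inv_solve_right'[of t "u \<otimes>\<^bsub>Q8\<^esub> d" u] by simp
qed

text \<open>In each pair \<open>(g, h)\<close> the element \<open>g\<close> represents a noncentral conjugacy class, and \<open>h\<close> does not commute
  with it. Any two such pairs are related by an automorphism of the group, which is why the three classes can be
  treated alike.\<close>

definition Q8_pairs :: "((nat \<times> nat) \<times> (nat \<times> nat)) set" where
  "Q8_pairs = {((1, 0), (0, 1)), ((0, 1), (1, 0)), ((1, 1), (1, 0))}"

lemma Q8_pairsE:
  assumes "(g, h) \<in> Q8_pairs"
  obtains "g = (1, 0)" "h = (0, 1)" | "g = (0, 1)" "h = (1, 0)" | "g = (1, 1)" "h = (1, 0)"
  using assms unfolding Q8_pairs_def by auto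

lemma Q8_pair:
  assumes "(g, h) \<in> Q8_pairs"
  shows "g \<in> carrier Q8" "h \<in> carrier Q8"
    "g \<otimes>\<^bsub>Q8\<^esub> g = (2, 0)" "h \<otimes>\<^bsub>Q8\<^esub> g = (2, 0) \<otimes>\<^bsub>Q8\<^esub> g \<otimes>\<^bsub>Q8\<^esub> h"
    "(2, 0) \<otimes>\<^bsub>Q8\<^esub> g \<noteq> g" "(2, 0) \<otimes>\<^bsub>Q8\<^esub> g \<in> carrier Q8"
    "carrier Q8 = {\<one>\<^bsub>Q8\<^esub>, g, g \<otimes>\<^bsub>Q8\<^esub> g, g \<otimes>\<^bsub>Q8\<^esub> (g \<otimes>\<^bsub>Q8\<^esub> g), h, h \<otimes>\<^bsub>Q8\<^esub> g, h \<otimes>\<^bsub>Q8\<^esub> (g \<otimes>\<^bsub>Q8\<^esub> g),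
      h \<otimes>\<^bsub>Q8\<^esub> (g \<otimes>\<^bsub>Q8\<^esub> (g \<otimes>\<^bsub>Q8\<^esub> g))}"
  using assms by (elim Q8_pairsE; force simp add: Q8_carrier Q8_mult Q8_one)+

text \<open>The group is generated by \<open>g\<close> and \<open>h\<close>; every element is of the form \<open>g\<^sup>n\<close> or \<open>h g\<^sup>n\<close>.\<close>

lemma Q8_generated:
  assumes gh: "(g, h) \<in> Q8_pairs" and P: "P \<one>\<^bsub>Q8\<^esub>" "P g" "P h"
    and m: "\<And>u v. u \<in> carrier Q8 \<Longrightarrow> v \<in> carrier Q8 \<Longrightarrow> P u \<Longrightarrow> P v \<Longrightarrow> P (u \<otimes>\<^bsub>Q8\<^esub> v)"
    and u: "u \<in> carrier Q8"
  shows "P u"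
proof -
  interpret group Q8 by (rule Q8_group)
  note c = Q8_pair(1,2)[OF gh]
  have gg: "P (g \<otimes>\<^bsub>Q8\<^esub> g)" "P (g \<otimes>\<^bsub>Q8\<^esub> (g \<otimes>\<^bsub>Q8\<^esub> g))" using m P c by auto
  have "P (h \<otimes>\<^bsub>Q8\<^esub> g)" "P (h \<otimes>\<^bsub>Q8\<^esub> (g \<otimes>\<^bsub>Q8\<^esub> g))" "P (h \<otimes>\<^bsub>Q8\<^esub> (g \<otimes>\<^bsub>Q8\<^esub> (g \<otimes>\<^bsub>Q8\<^esub> g)))"
    using m P c gg by auto
  with gg P u show ?thesis unfolding Q8_pair(7)[OF gh] by (elim insertE) auto
qed

definition sign_swap :: "nat \<Rightarrow> nat \<Rightarrow> complex \<times> complex \<Rightarrow> complex \<times> complex" where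
  "sign_swap m n = (\<lambda>(p, q). ((-1) ^ m * (if even n then p else q), (-1) ^ m * (if even n then q else p)))"

text \<open>The action on the module induced from \<open>\<phi>\<^sub>2\<close>, on the basis \<open>1 \<otimes> 1\<close>, \<open>h \<otimes> 1\<close>: \<open>g\<close> acts as \<open>-1\<close> and \<open>h\<close>
exchanges the two vectors. The central element \<open>z = g\<^sup>2\<close> acts trivially, so this is a representation of the Klein
four-group. In \<open>x\<^sup>k y\<^sup>l\<close> the numbers of factors \<open>g\<close> and \<open>h\<close> modulo two are \<open>k, l\<close> for \<open>g = x\<close>, they are \<open>l, k\<close> for
\<open>g = y\<close>, and \<open>l, k + l\<close> for \<open>g = x y\<close> and \<open>h = x\<close>.\<close>

definition klein :: "nat \<times> nat \<Rightarrow> nat \<times> nat \<Rightarrow> complex \<times> complex \<Rightarrow> complex \<times> complex" where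
  "klein g = (\<lambda>(k, l). if g = (1, 0) then sign_swap k l else if g = (0, 1) then sign_swap l k else sign_swap l (k + l))"

definition model :: "nat \<times> nat \<Rightarrow> (nat \<times> nat, complex \<times> complex) ydmod" where
  "model g = pair_yd (klein g) g ((2, 0) \<otimes>\<^bsub>Q8\<^esub> g)"

definition model_rho5 :: "(nat \<times> nat, complex \<times> complex) ydmod" where
  "model_rho5 = pair_yd rho5 (2, 0) (2, 0)"

lemma sign_swap_lin: "sign_swap m n \<in> lin_maps C2 C2"
  by (rule linI) (auto simp: sign_swap_def algebra_simps split: prod.splits)

lemma klein_values:
  assumes "(g, h) \<in> Q8_pairs"
  shows "klein g \<one>\<^bsub>Q8\<^esub> (p, q) = (p, q)" "klein g g (p, q) = (- p, - q)" "klein g h (p, q) = (q, p)"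
  using assms by (elim Q8_pairsE; simp add: klein_def sign_swap_def Q8_one)+

lemma klein_mult:
  assumes "(g, h) \<in> Q8_pairs" "u \<in> carrier Q8" "u' \<in> carrier Q8"
  shows "klein g (u \<otimes>\<^bsub>Q8\<^esub> u') v = klein g u (klein g u' v)"
proof -
  have "\<forall>u\<in>carrier Q8. \<forall>u'\<in>carrier Q8. klein g (u \<otimes>\<^bsub>Q8\<^esub> u') (p, q) = klein g u (klein g u' (p, q))" for p q
    by (rule Q8_pairsE[OF assms(1)]; simp add: Q8_carrier klein_def sign_swap_def Q8_mult)
  then show ?thesis using assms(2,3) by (cases v) blast
qed

text \<open>Either \<open>u\<close> commutes with \<open>g\<close> and fixes both lines, or it exchanges \<open>g\<close> with \<open>z g\<close> and also the two lines. This
is the compatibility of the action with the degrees.\<close>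

lemma klein_conj:
  assumes "(g, h) \<in> Q8_pairs" "u \<in> carrier Q8"
  shows "u \<otimes>\<^bsub>Q8\<^esub> g = g \<otimes>\<^bsub>Q8\<^esub> u \<and> u \<otimes>\<^bsub>Q8\<^esub> ((2, 0) \<otimes>\<^bsub>Q8\<^esub> g) = (2, 0) \<otimes>\<^bsub>Q8\<^esub> g \<otimes>\<^bsub>Q8\<^esub> u \<and>
      snd (klein g u (1, 0)) = 0 \<and> fst (klein g u (0, 1)) = 0 \<or>
    u \<otimes>\<^bsub>Q8\<^esub> g = (2, 0) \<otimes>\<^bsub>Q8\<^esub> g \<otimes>\<^bsub>Q8\<^esub> u \<and> u \<otimes>\<^bsub>Q8\<^esub> ((2, 0) \<otimes>\<^bsub>Q8\<^esub> g) = g \<otimes>\<^bsub>Q8\<^esub> u \<and>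
      fst (klein g u (1, 0)) = 0 \<and> snd (klein g u (0, 1)) = 0"
proof -
  let ?P = "\<lambda>u. u \<otimes>\<^bsub>Q8\<^esub> g = g \<otimes>\<^bsub>Q8\<^esub> u \<and> u \<otimes>\<^bsub>Q8\<^esub> ((2, 0) \<otimes>\<^bsub>Q8\<^esub> g) = (2, 0) \<otimes>\<^bsub>Q8\<^esub> g \<otimes>\<^bsub>Q8\<^esub> u \<and>
      snd (klein g u (1, 0)) = 0 \<and> fst (klein g u (0, 1)) = 0 \<or>
    u \<otimes>\<^bsub>Q8\<^esub> g = (2, 0) \<otimes>\<^bsub>Q8\<^esub> g \<otimes>\<^bsub>Q8\<^esub> u \<and> u \<otimes>\<^bsub>Q8\<^esub> ((2, 0) \<otimes>\<^bsub>Q8\<^esub> g) = g \<otimes>\<^bsub>Q8\<^esub> u \<and>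
      fst (klein g u (1, 0)) = 0 \<and> snd (klein g u (0, 1)) = 0"
  have "\<forall>u\<in>carrier Q8. ?P u"
    by (rule Q8_pairsE[OF assms(1)]; simp add: Q8_carrier klein_def sign_swap_def Q8_mult)
  then show ?thesis using assms(2) by blast
qed

lemma model_yd:
  assumes gh: "(g, h) \<in> Q8_pairs"
  shows "yd_module Q8 (model g)"
  unfolding model_def
proof (rule pair_yd_module[OF Q8_group Q8_finite])
  note c = Q8_pair(1,2,5,6)[OF gh]
  show "g \<in> carrier Q8" "(2, 0) \<otimes>\<^bsub>Q8\<^esub> g \<in> carrier Q8" using c by auto
  show "klein g u \<in> lin_maps C2 C2" for u
    by (cases u) (auto simp: klein_def sign_swap_lin)
  show "klein g \<one>\<^bsub>Q8\<^esub> v = v" for v using klein_values(1)[OF gh] by (cases v) simp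
  show "klein g (u \<otimes>\<^bsub>Q8\<^esub> u') v = klein g u (klein g u' v)" if "u \<in> carrier Q8" "u' \<in> carrier Q8" for u u' v
    by (rule klein_mult[OF gh that])
  fix u assume u: "u \<in> carrier Q8"
  note k = klein_conj[OF gh u] and cj = Q8_conj[OF u c(1,1)] Q8_conj[OF u c(1,4)]
    Q8_conj[OF u c(4,1)] Q8_conj[OF u c(4,4)]
  show "klein g u (1, 0) \<in> homog (pair_yd (klein g) g ((2, 0) \<otimes>\<^bsub>Q8\<^esub> g)) (u \<otimes>\<^bsub>Q8\<^esub> g \<otimes>\<^bsub>Q8\<^esub> inv\<^bsub>Q8\<^esub> u)"
    using k
  proof (elim disjE conjE)
    assume "u \<otimes>\<^bsub>Q8\<^esub> g = g \<otimes>\<^bsub>Q8\<^esub> u" "snd (klein g u (1, 0)) = 0"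
    then show ?thesis using cj(1) by (auto simp: case_prod_beta)
  next
    assume "u \<otimes>\<^bsub>Q8\<^esub> g = (2, 0) \<otimes>\<^bsub>Q8\<^esub> g \<otimes>\<^bsub>Q8\<^esub> u" "fst (klein g u (1, 0)) = 0"
    then show ?thesis using cj(2) by (auto simp: case_prod_beta)
  qed
  show "klein g u (0, 1) \<in> homog (pair_yd (klein g) g ((2, 0) \<otimes>\<^bsub>Q8\<^esub> g))
      (u \<otimes>\<^bsub>Q8\<^esub> ((2, 0) \<otimes>\<^bsub>Q8\<^esub> g) \<otimes>\<^bsub>Q8\<^esub> inv\<^bsub>Q8\<^esub> u)"
    using k
  proof (elim disjE conjE)
    assume "u \<otimes>\<^bsub>Q8\<^esub> ((2, 0) \<otimes>\<^bsub>Q8\<^esub> g) = (2, 0) \<otimes>\<^bsub>Q8\<^esub> g \<otimes>\<^bsub>Q8\<^esub> u" "fst (klein g u (0, 1)) = 0"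
    then show ?thesis using cj(4) by (auto simp: case_prod_beta)
  next
    assume "u \<otimes>\<^bsub>Q8\<^esub> ((2, 0) \<otimes>\<^bsub>Q8\<^esub> g) = g \<otimes>\<^bsub>Q8\<^esub> u" "snd (klein g u (0, 1)) = 0"
    then show ?thesis using cj(3) by (auto simp: case_prod_beta)
  qed
qed

text \<open>The hypothesis says that a nonzero vector generates both basis vectors, using only what is known of a submodule
\<open>K\<close>.\<close>

lemma pair_irreducible:
  assumes N: "yd_module Q8 (pair_yd \<rho> d e)"
    and K: "\<And>K p q. (\<And>x y. x \<in> K \<Longrightarrow> y \<in> K \<Longrightarrow> add C2 x y \<in> K) \<Longrightarrow> (\<And>c x. x \<in> K \<Longrightarrow> smult C2 c x \<in> K) \<Longrightarrow>
      (\<And>u x. u \<in> carrier Q8 \<Longrightarrow> x \<in> K \<Longrightarrow> \<rho> u x \<in> K) \<Longrightarrow>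
      (\<And>u x. u \<in> carrier Q8 \<Longrightarrow> x \<in> K \<Longrightarrow> homog_part Q8 (pair_yd \<rho> d e) x u \<in> K) \<Longrightarrow>
      (p, q) \<in> K \<Longrightarrow> (p, q) \<noteq> (0, 0) \<Longrightarrow> (1, 0) \<in> K \<and> (0, 1) \<in> K"
  shows "yd_irreducible Q8 (pair_yd \<rho> d e)"
proof -
  interpret N: yd_tensor Q8 "pair_yd \<rho> d e" by (rule yd_tensorI[OF N Q8_finite])
  have "K = {(0, 0)} \<or> K = UNIV" if "yd_submodule Q8 K (pair_yd \<rho> d e)" for K
  proof (cases "K \<subseteq> {(0, 0)}")
    case True
    then show ?thesis
      using that N.V.subspaceD(2)[of K] unfolding N.submodule_iff by auto
  next
    case False
    have sub: "VectorSpace.subspace CC K (pair_yd \<rho> d e)" using that unfolding N.submodule_iff by auto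
    note s = N.V.subspaceD[OF sub]
    from False obtain p q where pq: "(p, q) \<in> K" "(p, q) \<noteq> (0, 0)" by (metis insertI1 subrelI)
    have b: "(1, 0) \<in> K \<and> (0, 1) \<in> K"
      by (rule K[OF _ _ _ _ pq])
        (use that s(3,4) in \<open>auto simp: N.submodule_iff pair_yd_same\<close>)
    have "x \<in> K" for x
      using pair_span[OF pair_yd_cspace, of \<rho> d e "{(1, 0), (0, 1)}" x] N.V.span_subset[OF sub, of "{(1, 0), (0, 1)}"] b by auto
    then show ?thesis by auto
  qed
  moreover have "(1, 0) \<noteq> (0::complex, 0::complex)" by simp
  then have "UNIV \<noteq> {(0::complex, 0::complex)}" by blast
  ultimately show ?thesis using N unfolding yd_irreducible_def by simp
qed

lemma model_irreducible:
  assumes gh: "(g, h) \<in> Q8_pairs"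
  shows "yd_irreducible Q8 (model g)"
proof -
  let ?N = "pair_yd (klein g) g ((2, 0) \<otimes>\<^bsub>Q8\<^esub> g)"
  note c = Q8_pair(1,2,5,6)[OF gh]
  have N: "yd_module Q8 ?N" using model_yd[OF gh] unfolding model_def .
  interpret N: yd_tensor Q8 ?N by (rule yd_tensorI[OF N Q8_finite])
  show ?thesis unfolding model_def
  proof (rule pair_irreducible[OF N])
    fix K p q
    assume sm: "\<And>c x. x \<in> K \<Longrightarrow> c \<odot>\<^bsub>C2\<^esub> x \<in> K"
      and act: "\<And>u x. u \<in> carrier Q8 \<Longrightarrow> x \<in> K \<Longrightarrow> klein g u x \<in> K"
      and part: "\<And>u x. u \<in> carrier Q8 \<Longrightarrow> x \<in> K \<Longrightarrow> homog_part Q8 ?N x u \<in> K"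
      and pq: "(p, q) \<in> K" "(p, q) \<noteq> (0, 0)"
    have eq: "(p, q) = (p, 0) \<oplus>\<^bsub>?N\<^esub> (0, q)" by simp
    have "homog_part Q8 ?N (p, q) g = (p, 0)"
      unfolding eq using linD(2)[OF N.V.part_lin[OF c(1)], of "(p, 0)" "(0, q)"] c
        N.V.part_of_homog[OF c(1) _ c(1), of "(p, 0)"] N.V.part_of_homog[OF c(4) _ c(1), of "(0, q)"] by simp
    then have p: "(p, 0) \<in> K" using part[OF c(1) pq(1)] by simp
    have "homog_part Q8 ?N (p, q) ((2, 0) \<otimes>\<^bsub>Q8\<^esub> g) = (0, q)"
      unfolding eq using linD(2)[OF N.V.part_lin[OF c(4)], of "(p, 0)" "(0, q)"] c
        N.V.part_of_homog[OF c(1) _ c(4), of "(p, 0)"] N.V.part_of_homog[OF c(4) _ c(4), of "(0, q)"] by simp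
    then have q: "(0, q) \<in> K" using part[OF c(4) pq(1)] by simp
    have "(1, 0) \<in> K \<or> (0, 1) \<in> K"
      using sm[OF p, of "inverse p"] sm[OF q, of "inverse q"] pq(2) by auto
    then show "(1, 0) \<in> K \<and> (0, 1) \<in> K"
      using act[OF c(2), of "(1, 0)"] act[OF c(2), of "(0, 1)"] by (auto simp: klein_values[OF gh])
  qed
qed

lemma rho5_values:
  "rho5 (k, 0) (p, q) = (\<i> ^ k * p, (- \<i>) ^ k * q)" "rho5 (k, Suc 0) (p, q) = (- (\<i> ^ k * q), (- \<i>) ^ k * p)"
proof -
  have *: "((\<lambda>(p, q). (\<i> * p, - \<i> * q)) ^^ k) (p, q) = (\<i> ^ k * p, (- \<i>) ^ k * q)" for p q
    by (induction k) (simp_all add: mult.assoc)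
  show "rho5 (k, 0) (p, q) = (\<i> ^ k * p, (- \<i>) ^ k * q)" "rho5 (k, Suc 0) (p, q) = (- (\<i> ^ k * q), (- \<i>) ^ k * p)"
    by (simp_all only: rho5_def split comp_apply funpow.simps id_apply *) simp_all
qed

lemma rho5_table:
  "rho5 (0, 0) (p, q) = (p, q)" "rho5 (1, 0) (p, q) = (\<i> * p, - (\<i> * q))"
  "rho5 (2, 0) (p, q) = (- p, - q)" "rho5 (3, 0) (p, q) = (- (\<i> * p), \<i> * q)"
  "rho5 (0, 1) (p, q) = (- q, p)" "rho5 (1, 1) (p, q) = (- (\<i> * q), - (\<i> * p))"
  "rho5 (2, 1) (p, q) = (q, - p)" "rho5 (3, 1) (p, q) = (\<i> * q, \<i> * p)"
  by (simp_all add: rho5_values power2_eq_square power3_eq_cube)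

lemma rho5_mult: "\<forall>u\<in>carrier Q8. \<forall>u'\<in>carrier Q8. rho5 (u \<otimes>\<^bsub>Q8\<^esub> u') (p, q) = rho5 u (rho5 u' (p, q))"
  \<comment> \<open>Arithmetic on exponents produces \<open>Suc 0\<close> and numerals, so the table is supplied in all these forms.\<close>
  by (simp add: Q8_carrier Q8_mult rho5_table
    rho5_table[unfolded One_nat_def] rho5_table[unfolded One_nat_def numeral_2_eq_2])

lemma model_rho5_yd: "yd_module Q8 model_rho5"
  unfolding model_rho5_def
proof (rule pair_yd_module[OF Q8_group Q8_finite])
  show c: "(2, 0) \<in> carrier Q8" "(2, 0) \<in> carrier Q8" by (auto simp: Q8_carrier)
  show "rho5 u \<in> lin_maps C2 C2" if "u \<in> carrier Q8" for u
  proof -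
    obtain k l where u: "u = (k, l)" "l = 0 \<or> l = Suc 0" using \<open>u \<in> carrier Q8\<close> by (cases u) (auto simp: Q8_carrier)
    show ?thesis using u(2) unfolding u(1)
      by (elim disjE; hypsubst; intro linI) (auto simp: rho5_values algebra_simps)
  qed
  show "rho5 \<one>\<^bsub>Q8\<^esub> v = v" for v by (cases v) (simp add: Q8_one rho5_values)
  show "rho5 (u \<otimes>\<^bsub>Q8\<^esub> u') v = rho5 u (rho5 u' v)" if "u \<in> carrier Q8" "u' \<in> carrier Q8" for u u' v
    using rho5_mult that by (cases v) blast
  fix u assume u: "u \<in> carrier Q8"
  have "u \<otimes>\<^bsub>Q8\<^esub> (2, 0) \<otimes>\<^bsub>Q8\<^esub> inv\<^bsub>Q8\<^esub> u = (2, 0)"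
    by (rule Q8_conj[OF u c(1,1)]) (use u in \<open>auto simp: Q8_carrier Q8_mult\<close>)
  then show "rho5 u (1, 0) \<in> homog (pair_yd rho5 (2, 0) (2, 0)) (u \<otimes>\<^bsub>Q8\<^esub> (2, 0) \<otimes>\<^bsub>Q8\<^esub> inv\<^bsub>Q8\<^esub> u)"
    "rho5 u (0, 1) \<in> homog (pair_yd rho5 (2, 0) (2, 0)) (u \<otimes>\<^bsub>Q8\<^esub> (2, 0) \<otimes>\<^bsub>Q8\<^esub> inv\<^bsub>Q8\<^esub> u)"
    by (auto split: prod.splits)
qed

lemma model_rho5_irreducible: "yd_irreducible Q8 model_rho5"
  unfolding model_rho5_def
proof (rule pair_irreducible[OF model_rho5_yd[unfolded model_rho5_def]])
  fix K p q
  assume add: "\<And>x y. x \<in> K \<Longrightarrow> y \<in> K \<Longrightarrow> x \<oplus>\<^bsub>C2\<^esub> y \<in> K" and sm: "\<And>c x. x \<in> K \<Longrightarrow> c \<odot>\<^bsub>C2\<^esub> x \<in> K"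
    and act: "\<And>u x. u \<in> carrier Q8 \<Longrightarrow> x \<in> K \<Longrightarrow> rho5 u x \<in> K"
    and pq: "(p, q) \<in> K" "(p, q) \<noteq> (0, 0)"
  have x: "(\<i> * p, - (\<i> * q)) \<in> K" if "(p, q) \<in> K" for p q
    using act[OF _ that, of "(1, 0)"] by (simp add: Q8_carrier rho5_values)
  have y: "(- q, p) \<in> K" if "(p, q) \<in> K" for p q
    using act[OF _ that, of "(0, 1)"] by (simp add: Q8_carrier rho5_values)
  \<comment> \<open>\<open>x + \<i>\<close> annihilates the second coordinate.\<close>
  have 1: "(1, 0) \<in> K" if "(p, q) \<in> K" "p \<noteq> 0" for p q
  proof -
    have "(\<i> * p, \<i> * q) \<in> K" using sm[OF that(1), of \<i>] by simp
    from add[OF this x[OF that(1)]] have "(2 * (\<i> * p), 0) \<in> K" by simp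
    moreover have "inverse (2 * (\<i> * p)) * (2 * (\<i> * p)) = 1" using that(2) by (intro left_inverse) simp
    ultimately show ?thesis using sm[of "(2 * (\<i> * p), 0)" "inverse (2 * (\<i> * p))"] by (simp only: C2_simps mult_zero_right simp_thms)
  qed
  have "(1, 0) \<in> K"
  proof (cases "p = 0")
    case True
    then show ?thesis using 1[OF y[OF pq(1)]] pq(2) by simp
  qed (use 1 pq in blast)
  with y[OF this] show "(1, 0) \<in> K \<and> (0, 1) \<in> K" by simp
qed

lemma pair_fin_dim: "CC_fin_dim (pair_yd \<rho> d e)"
proof -
  interpret N: cspace "pair_yd \<rho> d e" by (rule pair_yd_cspace)
  have "CC_span (pair_yd \<rho> d e) {(1, 0), (0, 1)} = carrier (pair_yd \<rho> d e)"
    using pair_span[OF pair_yd_cspace, of \<rho> d e "{(1, 0), (0, 1)}"] by auto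
  then show ?thesis unfolding N.fin_dim_def by (intro exI[of _ "{(1, 0), (0, 1)}"]) simp
qed

lemma fin_dim_iso:
  assumes V: "cspace V" and W: "cspace W" and fd: "CC_fin_dim V"
    and f: "f \<in> lin_maps V W" and surj: "f ` carrier V = carrier W"
  shows "CC_fin_dim W"
proof -
  interpret V: cspace V by fact
  interpret W: cspace W by fact
  obtain A where A: "finite A" "A \<subseteq> carrier V" "V.span A = carrier V" using fd unfolding V.fin_dim_def by auto
  have fA: "f ` A \<subseteq> carrier W" using A linD(1)[OF f] by auto
  have "f v \<in> W.span (f ` A)" if "v \<in> carrier V" for v
    by (rule lin_span_image[OF f V W A(2) W.span_is_subspace[OF fA]]) (use that A W.span_base[OF fA] in auto)
  then have "carrier W \<subseteq> W.span (f ` A)" unfolding surj[symmetric] by auto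
  then have "W.span (f ` A) = carrier W" using W.span_is_subset2[OF fA] by auto
  then show ?thesis using A fA unfolding W.fin_dim_def by blast
qed

subsection \<open>The induced modules\<close>

lemma Q8_powers:
  assumes gh: "(g, h) \<in> Q8_pairs"
  shows "g [^]\<^bsub>Q8\<^esub> (0::nat) = \<one>\<^bsub>Q8\<^esub>" "g [^]\<^bsub>Q8\<^esub> (1::nat) = g" "g [^]\<^bsub>Q8\<^esub> (2::nat) = (2, 0)"
    "g [^]\<^bsub>Q8\<^esub> (3::nat) = (2, 0) \<otimes>\<^bsub>Q8\<^esub> g"
proof -
  interpret group Q8 by (rule Q8_group)
  have p: "g [^]\<^bsub>Q8\<^esub> (2::nat) = g \<otimes>\<^bsub>Q8\<^esub> g" "g [^]\<^bsub>Q8\<^esub> (3::nat) = g \<otimes>\<^bsub>Q8\<^esub> g \<otimes>\<^bsub>Q8\<^esub> g"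
    using Q8_pair(1)[OF gh] by (simp_all add: numeral_eq_Suc)
  show "g [^]\<^bsub>Q8\<^esub> (0::nat) = \<one>\<^bsub>Q8\<^esub>" "g [^]\<^bsub>Q8\<^esub> (1::nat) = g"
    using Q8_pair(1)[OF gh] by simp_all
  show "g [^]\<^bsub>Q8\<^esub> (2::nat) = (2, 0)" "g [^]\<^bsub>Q8\<^esub> (3::nat) = (2, 0) \<otimes>\<^bsub>Q8\<^esub> g"
    unfolding p using Q8_pair(3)[OF gh] by simp_all
qed

text \<open>The first four powers of \<open>g\<close> are distinct, so the least exponent in the definition of \<^const>\<open>phi2\<close> is \<open>n\<close>.\<close>

lemma phi2_power:
  assumes gh: "(g, h) \<in> Q8_pairs" and n: "n < 4"
  shows "phi2 Q8 g (g [^]\<^bsub>Q8\<^esub> n) z = (-1) ^ n * z"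
proof -
  interpret Q: group Q8 by (rule Q8_group)
  have d: "distinct [\<one>\<^bsub>Q8\<^esub>, g, (2, 0), (2, 0) \<otimes>\<^bsub>Q8\<^esub> g]"
    using gh by (elim Q8_pairsE; simp add: Q8_mult Q8_one)
  have cs: "m = 0 \<or> m = 1 \<or> m = 2 \<or> m = 3" if "m < 4" for m :: nat using that by auto
  have "n \<le> m" if "g [^]\<^bsub>Q8\<^esub> n = g [^]\<^bsub>Q8\<^esub> m" for m :: nat
  proof (rule ccontr)
    assume "\<not> n \<le> m"
    then show False using that d n cs[of n] cs[of m] Q.l_one[OF Q8_pair(1)[OF gh]]
      by (auto simp: Q8_powers[OF gh])
  qed
  then have "(LEAST k::nat. g [^]\<^bsub>Q8\<^esub> n = g [^]\<^bsub>Q8\<^esub> k) = n" by (intro Least_equality) auto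
  then show ?thesis unfolding phi2_def by simp
qed

lemma Q8_centralizer:
  assumes gh: "(g, h) \<in> Q8_pairs"
  shows "k \<in> centralizer Q8 g \<longleftrightarrow> (\<exists>n<4. k = g [^]\<^bsub>Q8\<^esub> (n::nat))"
proof -
  interpret Q: group Q8 by (rule Q8_group)
  have e: "(\<exists>n<4. k = g [^]\<^bsub>Q8\<^esub> (n::nat)) \<longleftrightarrow> k \<in> {\<one>\<^bsub>Q8\<^esub>, g, (2, 0), (2, 0) \<otimes>\<^bsub>Q8\<^esub> g}"
  proof -
    have "(\<exists>n<4. P n) \<longleftrightarrow> P 0 \<or> P 1 \<or> P 2 \<or> P 3" for P :: "nat \<Rightarrow> bool"
      by (metis (no_types) One_nat_def Suc_1 less_Suc_eq not_less0 numeral_3_eq_3 numeral_eq_Suc pred_numeral_simps(2) semiring_norm(26,27))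
    then show ?thesis using Q.l_one[OF Q8_pair(1)[OF gh]] by (simp add: Q8_powers[OF gh])
  qed
  show ?thesis
    unfolding e centralizer_def Q8_carrier
    by (rule Q8_pairsE[OF gh]; auto simp: Q8_mult Q8_one)
qed

lemma klein_power:
  assumes gh: "(g, h) \<in> Q8_pairs"
  shows "klein g (g [^]\<^bsub>Q8\<^esub> (n::nat)) (p, q) = ((-1) ^ n * p, (-1) ^ n * q)"
proof (induction n arbitrary: p q)
  case 0
  then show ?case using klein_values(1)[OF gh] by simp
next
  case (Suc n)
  interpret group Q8 by (rule Q8_group)
  have "klein g (g [^]\<^bsub>Q8\<^esub> Suc n) (p, q) = klein g (g [^]\<^bsub>Q8\<^esub> n) (klein g g (p, q))"
    unfolding nat_pow_Suc using klein_mult[OF gh] Q8_pair(1)[OF gh] by simp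
  then show ?case using Suc klein_values(2)[OF gh] by simp
qed

lemma Q8_cosets:
  assumes gh: "(g, h) \<in> Q8_pairs" and u: "u \<in> carrier Q8"
  obtains n :: nat where "n < 4" "u = g [^]\<^bsub>Q8\<^esub> n" | n :: nat where "n < 4" "u = h \<otimes>\<^bsub>Q8\<^esub> g [^]\<^bsub>Q8\<^esub> n"
proof -
  interpret group Q8 by (rule Q8_group)
  note c = Q8_pair(1,2)[OF gh]
  have p: "g [^]\<^bsub>Q8\<^esub> (1::nat) = g" "g [^]\<^bsub>Q8\<^esub> (2::nat) = g \<otimes>\<^bsub>Q8\<^esub> g" "g [^]\<^bsub>Q8\<^esub> (3::nat) = g \<otimes>\<^bsub>Q8\<^esub> (g \<otimes>\<^bsub>Q8\<^esub> g)"
    using c by (simp_all add: numeral_eq_Suc m_assoc)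
  have "(\<exists>n<4. u = g [^]\<^bsub>Q8\<^esub> (n::nat)) \<or> (\<exists>n<4. u = h \<otimes>\<^bsub>Q8\<^esub> g [^]\<^bsub>Q8\<^esub> (n::nat))"
    using u unfolding Q8_pair(7)[OF gh]
  proof (elim insertE emptyE)
    show ?thesis if "u = \<one>\<^bsub>Q8\<^esub>" using that by (intro disjI1 exI[of _ 0]) simp
    show ?thesis if "u = g" using that p by (intro disjI1 exI[of _ 1]) simp
    show ?thesis if "u = g \<otimes>\<^bsub>Q8\<^esub> g" using that p by (intro disjI1 exI[of _ 2]) simp
    show ?thesis if "u = g \<otimes>\<^bsub>Q8\<^esub> (g \<otimes>\<^bsub>Q8\<^esub> g)" using that p by (intro disjI1 exI[of _ 3]) simp
    show ?thesis if "u = h" using that c by (intro disjI2 exI[of _ 0]) simp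
    show ?thesis if "u = h \<otimes>\<^bsub>Q8\<^esub> g" using that p by (intro disjI2 exI[of _ 1]) simp
    show ?thesis if "u = h \<otimes>\<^bsub>Q8\<^esub> (g \<otimes>\<^bsub>Q8\<^esub> g)" using that p by (intro disjI2 exI[of _ 2]) simp
    show ?thesis if "u = h \<otimes>\<^bsub>Q8\<^esub> (g \<otimes>\<^bsub>Q8\<^esub> (g \<otimes>\<^bsub>Q8\<^esub> g))" using that p by (intro disjI2 exI[of _ 3]) simp
  qed
  then show ?thesis using that by blast
qed

text \<open>Since \<open>{1, h}\<close> represents the cosets of the centralizer \<open>\<langle>g\<rangle>\<close>, the inverse of the map \<open>u \<otimes> w \<mapsto> u \<cdot> (w, 0)\<close>
sends \<open>(p, q)\<close> to \<open>1 \<otimes> p + h \<otimes> q\<close>.\<close>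

lemma induced_phi2:
  assumes gh: "(g, h) \<in> Q8_pairs"
  shows "yd_module Q8 (induced_yd Q8 g CC_line (phi2 Q8 g))"
    "yd_isomorphic Q8 (induced_yd Q8 g CC_line (phi2 Q8 g)) (model g)"
proof -
  note c = Q8_pair(1,2,5,6)[OF gh]
  interpret Q: group Q8 by (rule Q8_group)
  interpret I: induced Q8 g CC_line "phi2 Q8 g"
    by (intro induced.intro induced_axioms.intro Q8_group CC_line_cspace Q8_finite c) simp
  interpret M: cspace I.M by (rule I.P.Q_cspace)
  define \<gamma> where "\<gamma> u w = I.P.gen (u, w)" for u w
  note gen_lin = I.gen_lin[folded \<gamma>_def] and gen_centr = I.gen_centr[folded \<gamma>_def]
    and homog_M = I.homog_M[folded \<gamma>_def]
  let ?i = "\<lambda>w. (w, 0)"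
  let ?k = "\<lambda>(p, q). \<gamma> \<one>\<^bsub>Q8\<^esub> (p) \<oplus>\<^bsub>I.M\<^esub> \<gamma> h (q)"
  have one: "\<one>\<^bsub>Q8\<^esub> \<in> carrier Q8" by simp
  note l1 = gen_lin[OF one] and lh = gen_lin[OF c(2)]
  have gc [simp]: "\<gamma> \<one>\<^bsub>Q8\<^esub> (p) \<in> carrier I.M" "\<gamma> h (p) \<in> carrier I.M" for p
    using linD(1)[OF l1, of p] linD(1)[OF lh, of p] by simp_all
  have g0: "\<gamma> \<one>\<^bsub>Q8\<^esub> (0) = \<zero>\<^bsub>I.M\<^esub>" "\<gamma> h (0) = \<zero>\<^bsub>I.M\<^esub>"
    using lin_zero[OF l1 CC_line_cspace I.P.Q_cspace] lin_zero[OF lh CC_line_cspace I.P.Q_cspace] by simp_all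
  have k: "?k \<in> lin_maps (model g) I.M"
  proof (rule linI)
    show "?k v \<in> carrier I.M" for v by (cases v) simp
    fix v w :: "complex \<times> complex" and e
    obtain p q p' q' where [simp]: "v = (p, q)" "w = (p', q')" by (cases v; cases w)
    show "?k (e \<odot>\<^bsub>model g\<^esub> v) = e \<odot>\<^bsub>I.M\<^esub> ?k v"
      using linD(3)[OF l1, of p e] linD(3)[OF lh, of q e] by (simp add: model_def M.sm_rdistr)
    show "?k (v \<oplus>\<^bsub>model g\<^esub> w) = ?k v \<oplus>\<^bsub>I.M\<^esub> ?k w"
      using linD(2)[OF l1, of p p'] linD(2)[OF lh, of q q'] by (simp add: model_def M.a_ac)
  qed
  have i: "?i \<in> lin_maps CC_line (model g)"
    by (rule linI) (simp_all add: model_def)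
  have ki: "?k (act (model g) u (?i w)) = \<gamma> u (w)" if u: "u \<in> carrier Q8" for u w
  proof (rule Q8_cosets[OF gh u])
    fix n :: nat assume n: "n < 4" "u = g [^]\<^bsub>Q8\<^esub> n"
    have z: "u \<in> centralizer Q8 g" unfolding Q8_centralizer[OF gh] using n by auto
    have "?k (act (model g) u (?i w)) = \<gamma> \<one>\<^bsub>Q8\<^esub> ((-1) ^ n * w)"
      using klein_power[OF gh] by (simp add: model_def n(2) g0)
    also have "\<dots> = \<gamma> u (w)"
      using gen_centr[OF one z, of w] phi2_power[OF gh n(1), of w] u n(2) by simp
    finally show ?thesis .
  next
    fix n :: nat assume n: "n < 4" "u = h \<otimes>\<^bsub>Q8\<^esub> g [^]\<^bsub>Q8\<^esub> n"
    have z: "g [^]\<^bsub>Q8\<^esub> n \<in> centralizer Q8 g" unfolding Q8_centralizer[OF gh] using n by auto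
    have "klein g u (?i w) = (0, (-1) ^ n * w)"
      using klein_power[OF gh] klein_values(3)[OF gh] klein_mult[OF gh c(2), of "g [^]\<^bsub>Q8\<^esub> n" "?i w"] c(1)
      by (simp add: n(2))
    then have "?k (act (model g) u (?i w)) = \<gamma> h ((-1) ^ n * w)"
      by (simp add: model_def g0)
    also have "\<dots> = \<gamma> u (w)"
      using gen_centr[OF c(2) z, of w] phi2_power[OF gh n(1), of w] n(2) by simp
    finally show ?thesis .
  qed
  have homog1: "\<gamma> u (w) \<in> homog I.M t"
    if "u \<in> carrier Q8" "u \<otimes>\<^bsub>Q8\<^esub> g \<otimes>\<^bsub>Q8\<^esub> inv\<^bsub>Q8\<^esub> u = t" for u w t
  proof -
    have "\<gamma> u w \<in> {\<gamma> h w |h w. h \<in> carrier Q8 \<and> w \<in> carrier CC_line \<and> h \<otimes>\<^bsub>Q8\<^esub> g \<otimes>\<^bsub>Q8\<^esub> inv\<^bsub>Q8\<^esub> h = t}"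
      using that by (intro CollectI exI[of _ u] exI[of _ w]) simp
    then show ?thesis unfolding homog_M by (rule M.span_base[rotated]) (use linD(1)[OF gen_lin] in blast)
  qed
  have ii: "yd_module Q8 I.M \<and> yd_isomorphic Q8 I.M (model g)"
  proof (rule I.recognize[OF model_yd[OF gh] i _ _ k, folded \<gamma>_def, OF _ _ ki])
    show "?i w \<in> homog (model g) g" for w by (simp add: model_def)
    show "?i (phi2 Q8 g u w) = act (model g) u (?i w)" if "u \<in> centralizer Q8 g" for u w
    proof -
      obtain n :: nat where "n < 4" "u = g [^]\<^bsub>Q8\<^esub> n" using \<open>u \<in> centralizer Q8 g\<close> unfolding Q8_centralizer[OF gh] by auto
      then show ?thesis using phi2_power[OF gh] klein_power[OF gh] by (simp add: model_def)
    qed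
    show "n \<in> CC_span (model g) {act (model g) u (?i w) | u w. u \<in> carrier Q8 \<and> w \<in> carrier CC_line}" for n
      unfolding model_def
    proof (rule pair_span[OF pair_yd_cspace])
      have "(1, 0) = act (model g) \<one>\<^bsub>Q8\<^esub> (?i 1)" "(0, 1) = act (model g) h (?i 1)"
        using klein_values[OF gh] by (simp_all add: model_def)
      note e = this[unfolded model_def]
      show "(1, 0) \<in> {act (pair_yd (klein g) g ((2, 0) \<otimes>\<^bsub>Q8\<^esub> g)) u (?i w) | u w. u \<in> carrier Q8 \<and> w \<in> carrier CC_line}"
        using e(1) one by (intro CollectI exI[of _ "\<one>\<^bsub>Q8\<^esub>"] exI[of _ 1] conjI; simp)
      show "(0, 1) \<in> {act (pair_yd (klein g) g ((2, 0) \<otimes>\<^bsub>Q8\<^esub> g)) u (?i w) | u w. u \<in> carrier Q8 \<and> w \<in> carrier CC_line}"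
        using e(2) c(2) by (intro CollectI exI[of _ h] exI[of _ 1] conjI; simp)
    qed simp_all
    fix t n assume t: "t \<in> carrier Q8" and n: "n \<in> homog (model g) t"
    obtain p q where pq: "n = (p, q)" by (cases n)
    have sub: "\<gamma> \<one>\<^bsub>Q8\<^esub> (p) \<in> homog I.M t" "\<gamma> h (q) \<in> homog I.M t"
    proof -
      have z: "\<zero>\<^bsub>I.M\<^esub> \<in> homog I.M t" unfolding homog_M by (rule M.span_zero) (use linD(1)[OF gen_lin] in auto)
      show "\<gamma> \<one>\<^bsub>Q8\<^esub> (p) \<in> homog I.M t"
      proof (cases "t = g")
        case True
        then show ?thesis by (intro homog1) (use c in auto)
      next
        case False
        then have "p = 0" using n pq by (simp add: model_def)
        then show ?thesis using z g0 by simp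
      qed
      show "\<gamma> h (q) \<in> homog I.M t"
      proof (cases "t = (2, 0) \<otimes>\<^bsub>Q8\<^esub> g")
        case True
        then show ?thesis using Q8_pair(4)[OF gh] c by (intro homog1 Q8_conj) auto
      next
        case False
        then have "q = 0" using n pq by (simp add: model_def)
        then show ?thesis using z g0 by simp
      qed
    qed
    then show "?k n \<in> homog I.M t"
      unfolding pq split homog_M by (intro M.span_add) (use linD(1)[OF gen_lin] in auto)
  qed auto
  then show "yd_module Q8 I.M" "yd_isomorphic Q8 I.M (model g)" by auto
qed

text \<open>The centralizer is the whole group, so every tensor equals some \<open>1 \<otimes> w\<close>.\<close>

lemma induced_rho5:
  "yd_module Q8 (induced_yd Q8 (2, 0) C2 rho5)"
  "yd_isomorphic Q8 (induced_yd Q8 (2, 0) C2 rho5) model_rho5"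
proof -
  interpret Q: group Q8 by (rule Q8_group)
  have c: "(2, 0) \<in> carrier Q8" by (simp add: Q8_carrier)
  interpret I: induced Q8 "(2, 0)" C2 rho5
    by (intro induced.intro induced_axioms.intro Q8_group C2_cspace Q8_finite c) simp
  interpret M: cspace I.M by (rule I.P.Q_cspace)
  define \<gamma> where "\<gamma> u w = I.P.gen (u, w)" for u w
  note gen_lin = I.gen_lin[folded \<gamma>_def] and gen_centr = I.gen_centr[folded \<gamma>_def]
    and homog_M = I.homog_M[folded \<gamma>_def]
  have one: "\<one>\<^bsub>Q8\<^esub> \<in> carrier Q8" by simp
  have z: "u \<in> centralizer Q8 (2, 0)" "u \<otimes>\<^bsub>Q8\<^esub> (2, 0) \<otimes>\<^bsub>Q8\<^esub> inv\<^bsub>Q8\<^esub> u = (2, 0)" if "u \<in> carrier Q8" for u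
  proof -
    have "u \<otimes>\<^bsub>Q8\<^esub> (2, 0) = (2, 0) \<otimes>\<^bsub>Q8\<^esub> u" using that by (auto simp: Q8_carrier Q8_mult)
    then show "u \<in> centralizer Q8 (2, 0)" "u \<otimes>\<^bsub>Q8\<^esub> (2, 0) \<otimes>\<^bsub>Q8\<^esub> inv\<^bsub>Q8\<^esub> u = (2, 0)"
      using that c Q8_conj[OF that c c] by (auto simp: centralizer_def)
  qed
  have k: "(\<lambda>w. \<gamma> \<one>\<^bsub>Q8\<^esub> (w)) \<in> lin_maps model_rho5 I.M"
    using gen_lin[OF one] unfolding model_rho5_def same_lin_maps(1)[OF pair_yd_same] .
  have i: "(\<lambda>w. w) \<in> lin_maps C2 model_rho5"
    using lin_id[of C2] unfolding model_rho5_def same_lin_maps(2)[OF pair_yd_same] .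
  have "yd_module Q8 I.M \<and> yd_isomorphic Q8 I.M model_rho5"
  proof (rule I.recognize[OF model_rho5_yd i _ _ k, folded \<gamma>_def])
    show "w \<in> homog model_rho5 (2, 0)" for w by (cases w) (simp add: model_rho5_def)
    show "rho5 u w = act model_rho5 u w" for u w by (simp add: model_rho5_def)
    show "\<gamma> \<one>\<^bsub>Q8\<^esub> (act model_rho5 u w) = \<gamma> u (w)" if "u \<in> carrier Q8" for u w
      using gen_centr[OF one z(1)[OF that], of w] that by (simp add: model_rho5_def)
    show "n \<in> CC_span model_rho5 {act model_rho5 u w | u w. u \<in> carrier Q8 \<and> w \<in> carrier C2}" for n
      unfolding model_rho5_def
    proof (rule pair_span[OF pair_yd_cspace])
      have "v \<in> {act (pair_yd rho5 (2, 0) (2, 0)) u w | u w. u \<in> carrier Q8 \<and> w \<in> carrier C2}" for v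
        using one by (cases v) (auto simp: Q8_one rho5_values intro!: exI[of _ "0::nat"])
      then show "(1, 0) \<in> {act (pair_yd rho5 (2, 0) (2, 0)) u w | u w. u \<in> carrier Q8 \<and> w \<in> carrier C2}"
        "(0, 1) \<in> {act (pair_yd rho5 (2, 0) (2, 0)) u w | u w. u \<in> carrier Q8 \<and> w \<in> carrier C2}" by blast+
    qed simp_all
    fix t n assume t: "t \<in> carrier Q8" and n: "n \<in> homog model_rho5 t"
    show "\<gamma> \<one>\<^bsub>Q8\<^esub> (n) \<in> homog I.M t"
    proof (cases "t = (2, 0)")
      case True
      have "\<gamma> \<one>\<^bsub>Q8\<^esub> n \<in> {\<gamma> h w |h w. h \<in> carrier Q8 \<and> w \<in> carrier C2 \<and> h \<otimes>\<^bsub>Q8\<^esub> (2, 0) \<otimes>\<^bsub>Q8\<^esub> inv\<^bsub>Q8\<^esub> h = t}"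
        using z(2)[OF one] one True by (intro CollectI exI[of _ "\<one>\<^bsub>Q8\<^esub>"] exI[of _ n]) simp
      then show ?thesis unfolding homog_M by (rule M.span_base[rotated]) (use linD(1)[OF gen_lin] in blast)
    next
      case False
      then have "n = \<zero>\<^bsub>C2\<^esub>" using n by (cases n) (simp add: model_rho5_def)
      then have "\<gamma> \<one>\<^bsub>Q8\<^esub> (n) = \<zero>\<^bsub>I.M\<^esub>" using lin_zero[OF gen_lin[OF one] C2_cspace I.P.Q_cspace] by simp
      moreover have "\<zero>\<^bsub>I.M\<^esub> \<in> homog I.M t" unfolding homog_M by (rule M.span_zero) (use linD(1)[OF gen_lin] in auto)
      ultimately show ?thesis by simp
    qed
  qed
  then show "yd_module Q8 I.M" "yd_isomorphic Q8 I.M model_rho5" by auto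
qed

section \<open>Irreducible modules over the quaternion group\<close>

text \<open>Eigenvectors without characteristic polynomials: \<open>f\<close> multiplies \<open>f v + r v\<close> by \<open>r\<close>, and if this vector
is zero, then \<open>v\<close> itself belongs to the eigenvalue \<open>-r\<close>.\<close>

lemma (in cspace) eigenvector:
  assumes f: "f \<in> lin_maps V V" and N: "VectorSpace.subspace CC N V" and fN: "\<And>v. v \<in> N \<Longrightarrow> f v \<in> N"
    and v: "v \<in> N" "v \<noteq> \<zero>" and ff: "f (f v) = (r * r) \<odot> v"
  obtains a q where "a \<in> N" "a \<noteq> \<zero>" "f a = q \<odot> a" "q * q = r * r"
proof (cases "f v \<oplus> r \<odot> v = \<zero>")
  case True
  have c: "v \<in> carrier V" "f v \<in> carrier V" using subspaceD(1)[OF N] v fN by auto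
  have "f v \<oplus> (- 1) \<odot> ((- r) \<odot> v) = \<zero>" using True c by (simp add: sm_assoc)
  then have "f v = (- r) \<odot> v" by (rule minus_eq_zeroD[OF c(2) sm_closed[OF c(1)]])
  then show ?thesis using v by (intro that[of v "- r"]) auto
next
  case False
  have c: "v \<in> carrier V" "f v \<in> carrier V" using subspaceD(1)[OF N] v fN by auto
  have "f (f v \<oplus> r \<odot> v) = r \<odot> (f v \<oplus> r \<odot> v)"
    using linD(2)[OF f c(2), of "r \<odot> v"] linD(3)[OF f c(1), of r] c ff by (simp add: sm_rdistr sm_assoc a_comm)
  then show ?thesis using False v fN subspaceD(3,4)[OF N] by (intro that[of "f v \<oplus> r \<odot> v" r]) auto
qed

text \<open>Both degrees act as \<open>-1\<close>, so the braiding is minus the flip.\<close>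

lemma nichols_finite_pair:
  assumes V: "yd_module Q8 V" and N: "yd_module Q8 (pair_yd \<rho> d e)"
    and iso: "yd_isomorphic Q8 V (pair_yd \<rho> d e)" and d: "d \<in> carrier Q8" "e \<in> carrier Q8"
    and \<rho>: "\<And>p q. \<rho> d (p, q) = (- p, - q)" "\<And>p q. \<rho> e (p, q) = (- p, - q)"
  shows "CC_fin_dim (nichols_algebra Q8 V)"
proof -
  let ?N = "pair_yd \<rho> d e"
  interpret V: yd_tensor Q8 V by (rule yd_tensorI[OF V Q8_finite])
  interpret N: yd_tensor Q8 ?N by (rule yd_tensorI[OF N Q8_finite])
  obtain f where f: "f \<in> yd_hom Q8 V ?N" "bij_betw f (carrier V) (carrier ?N)"
    using iso unfolding yd_isomorphic_def by auto
  obtain k where k: "k \<in> yd_hom Q8 ?N V" "\<And>v. v \<in> carrier V \<Longrightarrow> k (f v) = v"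
    using yd_hom_inverse[OF V N Q8_finite f] by auto
  note lf = yd_homD(1)[OF f(1)] and lk = yd_homD(1)[OF k(1)]
  show ?thesis
  proof (rule V.nichols_finite)
    fix t v w assume t: "t \<in> carrier Q8" and v: "v \<in> homog V t" "v \<noteq> \<zero>\<^bsub>V\<^esub>" and w: "w \<in> carrier V"
    have v': "v \<in> carrier V" using V.V.homog_closed t v by auto
    have "f v \<noteq> \<zero>\<^bsub>?N\<^esub>"
      using k(2)[OF v'] lin_zero[OF lk N.V_cspace V.V_cspace] v(2) by metis
    then have "t = d \<or> t = e" using yd_homD(3)[OF f(1) t v(1)] by (cases "f v") (auto split: if_splits)
    then have "\<rho> t (f w) = (- 1) \<odot>\<^bsub>?N\<^esub> f w" using \<rho> by (cases "f w") auto
    then have "f (act V t w) = f ((- 1) \<odot>\<^bsub>V\<^esub> w)"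
      using yd_homD(2)[OF f(1) t w] linD(3)[OF lf w, of "-1"] by simp
    then show "act V t w = (- 1) \<odot>\<^bsub>V\<^esub> w" using k(2) t w by (metis V.V.sm_closed V.act_V_closed)
  next
    show "d \<in> carrier Q8" "e \<in> carrier Q8" by fact+
    show "k (1, 0) \<in> homog V d" "k (0, 1) \<in> homog V e" using yd_homD(3)[OF k(1)] d by simp_all
    fix v assume v: "v \<in> carrier V"
    have kc: "{k (1, 0), k (0, 1)} \<subseteq> carrier V" using linD(1)[OF lk] by simp
    have "f v \<in> CC_span ?N {(1, 0), (0, 1)}" by (rule pair_span[OF N.V_cspace]) auto
    then have "k (f v) \<in> CC_span V {k (1, 0), k (0, 1)}"
      by (rule lin_span_image[OF lk N.V_cspace V.V_cspace _ V.V.span_is_subspace[OF kc], rotated 2])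
        (use V.V.span_base[OF kc] in auto)
    then show "v \<in> CC_span V {k (1, 0), k (0, 1)}" using k(2)[OF v] by simp
  qed
qed

locale Q8_irreducible = yd_tensor Q8 V for V :: "(nat \<times> nat, 'v, 'z) ydmod_scheme" +
  assumes irreducible: "yd_irreducible Q8 V"
begin

text \<open>The span of a stable set of homogeneous vectors is a submodule.\<close>

lemma spanning:
  assumes S: "S \<subseteq> (\<Union>g\<in>carrier Q8. homog V g)"
    and a: "\<And>g s. g \<in> carrier Q8 \<Longrightarrow> s \<in> S \<Longrightarrow> act V g s \<in> CC_span V S"
    and s: "s \<in> S" "s \<noteq> \<zero>\<^bsub>V\<^esub>" and v: "v \<in> carrier V"
  shows "v \<in> CC_span V S"
proof -
  have Sc: "S \<subseteq> carrier V" using S V.homog_closed by auto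
  have "CC_span V S \<noteq> {\<zero>\<^bsub>V\<^esub>}" using V.span_base[OF Sc s(1)] s(2) by auto
  then show ?thesis using irreducible span_submodule[OF S a] v unfolding yd_irreducible_def by auto
qed

lemma pair_spanning:
  assumes gh: "(g, h) \<in> Q8_pairs" and d: "d \<in> carrier Q8" "e \<in> carrier Q8"
    and a: "a \<in> homog V d" "a \<noteq> \<zero>\<^bsub>V\<^esub>" and b: "b \<in> homog V e"
    and st: "\<And>u s. u \<in> {g, h} \<Longrightarrow> s \<in> {a, b} \<Longrightarrow> act V u s \<in> CC_span V {a, b}"
    and v: "v \<in> carrier V"
  shows "v \<in> CC_span V {a, b}"
proof (rule spanning[OF _ _ _ a(2) v])
  have ab: "{a, b} \<subseteq> carrier V" using a b d V.homog_closed by auto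
  note sub = V.span_is_subspace[OF ab]
  have *: "act V u w \<in> CC_span V {a, b}" if "u \<in> {g, h}" "w \<in> CC_span V {a, b}" for u w
    by (rule lin_span_image[OF act_linear V_cspace V_cspace ab sub st[OF that(1)] that(2)])
      (use that(1) Q8_pair(1,2)[OF gh] in auto)
  have "\<forall>w \<in> CC_span V {a, b}. act V u w \<in> CC_span V {a, b}" if "u \<in> carrier Q8" for u
    by (rule Q8_generated[OF gh _ _ _ _ that]) (use * act_one act_mult V.span_closed[OF ab] in auto)
  then show "act V u s \<in> CC_span V {a, b}" if "u \<in> carrier Q8" "s \<in> {a, b}" for u s
    using that V.span_base[OF ab] by blast
qed (use a b d in auto)

lemma act_nonzero:
  assumes "u \<in> carrier Q8" "v \<in> carrier V" "v \<noteq> \<zero>\<^bsub>V\<^esub>"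
  shows "act V u v \<noteq> \<zero>\<^bsub>V\<^esub>"
proof
  assume *: "act V u v = \<zero>\<^bsub>V\<^esub>"
  have "v = act V (inv\<^bsub>Q8\<^esub> u) \<zero>\<^bsub>V\<^esub>" using act_mult[of "inv\<^bsub>Q8\<^esub> u" u v] act_one assms * by simp
  also have "\<dots> = \<zero>\<^bsub>V\<^esub>" by (rule lin_zero[OF act_linear V_cspace V_cspace]) (use assms in simp)
  finally show False using assms by simp
qed

text \<open>By \<open>Q8_generated\<close> the linear map \<open>(p, q) \<mapsto> p a + q b\<close> is a morphism once it commutes with \<open>g\<close> and \<open>h\<close>. Its image
contains \<open>a\<close> and \<open>b\<close>, which span \<open>V\<close> by irreducibility; being defined on an irreducible module, it is injective.\<close>

lemma pair_recognition:
  assumes N: "yd_irreducible Q8 (pair_yd \<rho> d e)" and gh: "(g, h) \<in> Q8_pairs"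
    and d: "d \<in> carrier Q8" "e \<in> carrier Q8"
    and a: "a \<in> homog V d" "a \<noteq> \<zero>\<^bsub>V\<^esub>" and b: "b \<in> homog V e"
    and eq: "\<And>u. u \<in> {g, h} \<Longrightarrow> act V u a = fst (\<rho> u (1, 0)) \<odot>\<^bsub>V\<^esub> a \<oplus>\<^bsub>V\<^esub> snd (\<rho> u (1, 0)) \<odot>\<^bsub>V\<^esub> b"
      "\<And>u. u \<in> {g, h} \<Longrightarrow> act V u b = fst (\<rho> u (0, 1)) \<odot>\<^bsub>V\<^esub> a \<oplus>\<^bsub>V\<^esub> snd (\<rho> u (0, 1)) \<odot>\<^bsub>V\<^esub> b"
  shows "yd_isomorphic Q8 V (pair_yd \<rho> d e)"
proof -
  let ?N = "pair_yd \<rho> d e"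
  have N': "yd_module Q8 ?N" using N unfolding yd_irreducible_def by simp
  interpret N: yd_tensor Q8 ?N by (rule yd_tensorI[OF N' Q8_finite])
  have ab [simp]: "a \<in> carrier V" "b \<in> carrier V" using a b d V.homog_closed by auto
  have abs: "{a, b} \<subseteq> carrier V" by simp
  let ?\<phi> = "\<lambda>n. fst n \<odot>\<^bsub>V\<^esub> a \<oplus>\<^bsub>V\<^esub> snd n \<odot>\<^bsub>V\<^esub> b"
  have \<phi>: "?\<phi> \<in> lin_maps ?N V"
  proof (rule linI)
    fix m n :: "complex \<times> complex" and c
    show "?\<phi> (m \<oplus>\<^bsub>?N\<^esub> n) = ?\<phi> m \<oplus>\<^bsub>V\<^esub> ?\<phi> n"
      by (cases m; cases n) (simp add: V.sm_ldistr V.a_ac)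
    show "?\<phi> (c \<odot>\<^bsub>?N\<^esub> m) = c \<odot>\<^bsub>V\<^esub> ?\<phi> m"
      by (cases m) (simp add: V.sm_rdistr V.sm_assoc)
  qed simp
  have gen: "?\<phi> (\<rho> u n) = act V u (?\<phi> n)" if u: "u \<in> {g, h}" for u n
  proof -
    have u': "u \<in> carrier Q8" using u Q8_pair(1,2)[OF gh] by auto
    note l = linD(2,3)[OF N.act_linear[OF u']] and lv = linD(2,3)[OF act_linear[OF u']]
    obtain p q where n: "n = (p, q)" by (cases n)
    have "n = p \<odot>\<^bsub>?N\<^esub> (1, 0) \<oplus>\<^bsub>?N\<^esub> q \<odot>\<^bsub>?N\<^esub> (0, 1)" by (simp add: n)
    then have "\<rho> u n = p \<odot>\<^bsub>?N\<^esub> \<rho> u (1, 0) \<oplus>\<^bsub>?N\<^esub> q \<odot>\<^bsub>?N\<^esub> \<rho> u (0, 1)"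
      using l(1)[of "p \<odot>\<^bsub>?N\<^esub> (1, 0)" "q \<odot>\<^bsub>?N\<^esub> (0, 1)"] l(2)[of "(1, 0)" p] l(2)[of "(0, 1)" q] by simp
    then have "?\<phi> (\<rho> u n) = p \<odot>\<^bsub>V\<^esub> ?\<phi> (\<rho> u (1, 0)) \<oplus>\<^bsub>V\<^esub> q \<odot>\<^bsub>V\<^esub> ?\<phi> (\<rho> u (0, 1))"
      using linD(2)[OF \<phi>, of "p \<odot>\<^bsub>?N\<^esub> \<rho> u (1, 0)" "q \<odot>\<^bsub>?N\<^esub> \<rho> u (0, 1)"]
        linD(3)[OF \<phi>, of "\<rho> u (1, 0)" p] linD(3)[OF \<phi>, of "\<rho> u (0, 1)" q] by simp
    also have "\<dots> = p \<odot>\<^bsub>V\<^esub> act V u a \<oplus>\<^bsub>V\<^esub> q \<odot>\<^bsub>V\<^esub> act V u b" using eq[OF u] by simp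
    also have "\<dots> = act V u (?\<phi> n)" using lv(1)[of "p \<odot>\<^bsub>V\<^esub> a" "q \<odot>\<^bsub>V\<^esub> b"] lv(2)[of a p] lv(2)[of b q] by (simp add: n)
    finally show ?thesis .
  qed
  have equiv: "\<forall>n. ?\<phi> (\<rho> u n) = act V u (?\<phi> n)" if "u \<in> carrier Q8" for u
  proof (rule Q8_generated[OF gh _ _ _ _ that])
    show "\<forall>n. ?\<phi> (\<rho> \<one>\<^bsub>Q8\<^esub> n) = act V \<one>\<^bsub>Q8\<^esub> (?\<phi> n)" using N.act_one act_one by simp
    show "\<forall>n. ?\<phi> (\<rho> g n) = act V g (?\<phi> n)" "\<forall>n. ?\<phi> (\<rho> h n) = act V h (?\<phi> n)"
      using gen by simp_all
    show "\<forall>n. ?\<phi> (\<rho> (u \<otimes>\<^bsub>Q8\<^esub> w) n) = act V (u \<otimes>\<^bsub>Q8\<^esub> w) (?\<phi> n)"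
      if u: "u \<in> carrier Q8" "w \<in> carrier Q8" "\<forall>n. ?\<phi> (\<rho> u n) = act V u (?\<phi> n)" "\<forall>n. ?\<phi> (\<rho> w n) = act V w (?\<phi> n)" for u w
    proof
      fix n
      have "\<rho> (u \<otimes>\<^bsub>Q8\<^esub> w) n = \<rho> u (\<rho> w n)" using N.act_mult[OF u(1,2), of n] by simp
      then have "?\<phi> (\<rho> (u \<otimes>\<^bsub>Q8\<^esub> w) n) = act V u (act V w (?\<phi> n))" using u(3,4) by (simp only:)
      then show "?\<phi> (\<rho> (u \<otimes>\<^bsub>Q8\<^esub> w) n) = act V (u \<otimes>\<^bsub>Q8\<^esub> w) (?\<phi> n)" using act_mult[OF u(1,2), of "?\<phi> n"] by simp
    qed
  qed
  have hom: "?\<phi> \<in> yd_hom Q8 ?N V"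
  proof (rule yd_homI[OF \<phi>])
    fix t n assume t: "t \<in> carrier Q8" and n: "n \<in> homog ?N t"
    note s = V.subspaceD[OF V.homog_sub[OF t]]
    have "fst n \<odot>\<^bsub>V\<^esub> a \<in> homog V t"
      using n a s(2) s(4)[of a "fst n"] by (cases n; cases "t = d") auto
    moreover have "snd n \<odot>\<^bsub>V\<^esub> b \<in> homog V t"
      using n b s(2) s(4)[of b "snd n"] by (cases n; cases "t = e") auto
    ultimately show "?\<phi> n \<in> homog V t" by (rule s(3))
  qed (unfold pair_yd_simps, erule equiv[THEN spec])
  have st: "act V u s \<in> CC_span V {a, b}" if "u \<in> {g, h}" "s \<in> {a, b}" for u s
  proof -
    have "p \<odot>\<^bsub>V\<^esub> a \<oplus>\<^bsub>V\<^esub> q \<odot>\<^bsub>V\<^esub> b \<in> CC_span V {a, b}" for p q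
      by (intro V.span_add[OF abs] V.span_sm[OF abs] V.span_base[OF abs]) auto
    then show ?thesis using that(2) eq[OF that(1)] by auto
  qed
  have span: "v \<in> CC_span V {a, b}" if "v \<in> carrier V" for v
    by (rule pair_spanning[OF gh d a b _ that]) (rule st)
  have "\<exists>n. v = ?\<phi> n" if "v \<in> carrier V" for v
    using abs span[OF that]
  proof (induction rule: V.span_induct)
    case zero
    show ?case by (rule exI[of _ "(0, 0)"]) simp
  next
    case (add v w)
    then obtain m n where "v = ?\<phi> m" "w = ?\<phi> n" by (elim exE)
    then show ?case using linD(2)[OF \<phi>, of m n] by (intro exI[of _ "m \<oplus>\<^bsub>?N\<^esub> n"]) simp
  next
    case (sm c v)
    then obtain m where "v = ?\<phi> m" by (elim exE)
    then show ?case using linD(3)[OF \<phi>, of m c] by (intro exI[of _ "c \<odot>\<^bsub>?N\<^esub> m"]) simp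
  next
    case (base v)
    then consider "v = a" | "v = b" by blast
    then show ?case
    proof cases
      case 1
      then show ?thesis by (intro exI[of _ "(1, 0)"]) simp
    next
      case 2
      then show ?thesis by (intro exI[of _ "(0, 1)"]) simp
    qed
  qed
  then have "?\<phi> ` carrier ?N = carrier V" using linD(1)[OF \<phi>] unfolding image_def by (intro equalityI subsetI) auto
  then have "yd_isomorphic Q8 ?N V"
    using schur_iso[OF N yd_module_axioms Q8_finite hom, of "(1, 0)"] a by simp
  then show ?thesis by (rule yd_isomorphic_sym[OF N' yd_module_axioms Q8_finite])
qed

lemma nonzero_homog: obtains t v where "t \<in> carrier Q8" "v \<in> homog V t" "v \<noteq> \<zero>\<^bsub>V\<^esub>"
proof (cases "\<forall>t\<in>carrier Q8. homog V t \<subseteq> {\<zero>\<^bsub>V\<^esub>}")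
  case True
  have "v = \<zero>\<^bsub>V\<^esub>" if v: "v \<in> carrier V" for v
  proof -
    have "V.part v g = \<zero>\<^bsub>V\<^esub>" if "g \<in> carrier Q8" for g using V.part_homog[OF v that] True that by auto
    then have "finsum V (V.part v) (carrier Q8) = finsum V (\<lambda>_. \<zero>\<^bsub>V\<^esub>) (carrier Q8)"
      by (intro V.finsum_cong) (auto simp: simp_implies_def)
    then show ?thesis using V.part_sum[OF v] by simp
  qed
  then have "carrier V = {\<zero>\<^bsub>V\<^esub>}" by auto
  then show ?thesis using irreducible unfolding yd_irreducible_def by simp
qed (use that in blast)

text \<open>Conjugation fixes a central degree, so the component of that degree is a submodule.\<close>

lemma homog_central:
  assumes c: "c \<in> carrier Q8" and cen: "\<And>u. u \<in> carrier Q8 \<Longrightarrow> u \<otimes>\<^bsub>Q8\<^esub> c = c \<otimes>\<^bsub>Q8\<^esub> u"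
    and v: "v \<in> homog V c" "v \<noteq> \<zero>\<^bsub>V\<^esub>" and w: "w \<in> carrier V"
  shows "w \<in> homog V c"
proof -
  have hc: "homog V c \<subseteq> carrier V" using V.homog_closed[OF c] by blast
  have "w \<in> CC_span V (homog V c)"
  proof (rule spanning[OF _ _ v w])
    show "act V g s \<in> CC_span V (homog V c)" if "g \<in> carrier Q8" "s \<in> homog V c" for g s
      using act_homog[OF that(1) c] Q8_conj[OF that(1) c c cen[OF that(1)]] that(2) by (intro V.span_base[OF hc]) auto
  qed (use c in auto)
  then show ?thesis using V.span_subset[OF V.homog_sub[OF c] subset_refl] by auto
qed

text \<open>The fixed vectors of the central element \<open>z\<close> form a submodule. If it is \<open>V\<close>, the flip criterion applies. Otherwise it
is zero and \<open>z\<close> acts as \<open>-1\<close>; then \<open>x\<^sup>2 = y\<^sup>2 = -1\<close> and \<open>x y = - y x\<close> on \<open>V\<close>, and an eigenvector \<open>a\<close> of \<open>x\<close> for the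
eigenvalue \<open>\<i>\<close> together with \<open>y a\<close> is the standard basis of \<open>\<rho>\<^sub>5\<close>.\<close>

lemma central_case:
  assumes fd: "CC_fin_dim V" "CC_fin_dim (nichols_algebra Q8 V)" and v: "v \<in> homog V (2, 0)" "v \<noteq> \<zero>\<^bsub>V\<^esub>"
  shows "yd_isomorphic Q8 V model_rho5"
proof -
  have c: "(2, 0) \<in> carrier Q8" and x: "(1, 0) \<in> carrier Q8" and y: "(0, 1) \<in> carrier Q8"
    by (auto simp: Q8_carrier)
  have cen: "u \<otimes>\<^bsub>Q8\<^esub> (2, 0) = (2, 0) \<otimes>\<^bsub>Q8\<^esub> u" if "u \<in> carrier Q8" for u
    using that by (auto simp: Q8_carrier Q8_mult)
  have all: "w \<in> homog V (2, 0)" if "w \<in> carrier V" for w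
    by (rule homog_central[OF c _ v that]) (rule cen)
  have vc: "v \<in> carrier V" using v V.homog_closed[OF c] by auto
  let ?K = "{w \<in> carrier V. act V (2, 0) w = w}"
  have sub: "VectorSpace.subspace CC ?K V"
    by (rule V.subspaceI) (use linD[OF act_linear[OF c]] lin_zero[OF act_linear[OF c] V_cspace V_cspace] in auto)
  have K0: "k = \<zero>\<^bsub>V\<^esub>" if k: "k \<in> ?K" for k
  proof (rule ccontr)
    assume "k \<noteq> \<zero>\<^bsub>V\<^esub>"
    have Kc: "?K \<subseteq> carrier V" by auto
    have "w \<in> CC_span V ?K" if w: "w \<in> carrier V" for w
    proof (rule spanning[OF _ _ k \<open>k \<noteq> \<zero>\<^bsub>V\<^esub>\<close> w])
      show "?K \<subseteq> (\<Union>g\<in>carrier Q8. homog V g)" using all c by auto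
      fix u s assume us: "u \<in> carrier Q8" "s \<in> ?K"
      then have "act V (2, 0) (act V u s) = act V u (act V (2, 0) s)"
        using cen[OF us(1)] act_mult[OF c us(1), of s] act_mult[OF us(1) c, of s] by simp
      then show "act V u s \<in> CC_span V ?K" using us by (intro V.span_base[OF Kc]) simp
    qed
    then have "act V (2, 0) w = w" if "w \<in> carrier V" for w
      using V.span_subset[OF sub subset_refl] that by auto
    from nichols_infinite_flip[OF fd(1) c v this] show False using fd(2) by contradiction
  qed
  have cc: "act V (2, 0) w = (- 1) \<odot>\<^bsub>V\<^esub> w" if w: "w \<in> carrier V" for w
  proof -
    \<comment> \<open>\<open>z w + w\<close> is fixed by \<open>z\<close>, hence zero.\<close>
    have "(2, 0) \<otimes>\<^bsub>Q8\<^esub> (2, 0) = \<one>\<^bsub>Q8\<^esub>" by (simp add: Q8_mult Q8_one)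
    then have "act V (2, 0) (act V (2, 0) w) = w" using act_mult[OF c c w] act_one[OF w] by simp
    then have "act V (2, 0) w \<oplus>\<^bsub>V\<^esub> w \<in> ?K"
      using linD(2)[OF act_linear[OF c], of "act V (2, 0) w" w] w c by (simp add: V.a_comm)
    then have "act V (2, 0) w \<oplus>\<^bsub>V\<^esub> w = \<zero>\<^bsub>V\<^esub>" by (rule K0)
    then have "act V (2, 0) w \<oplus>\<^bsub>V\<^esub> (- 1) \<odot>\<^bsub>V\<^esub> ((- 1) \<odot>\<^bsub>V\<^esub> w) = \<zero>\<^bsub>V\<^esub>" using w by (simp add: V.sm_assoc)
    then show ?thesis by (rule V.minus_eq_zeroD[OF act_V_closed[OF c w] V.sm_closed[OF w]])
  qed
  have sq: "act V u (act V u w) = (- 1) \<odot>\<^bsub>V\<^esub> w" if "u \<in> {(1, 0), (0, 1)}" "w \<in> carrier V" for u w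
  proof -
    have "u \<in> carrier Q8" "u \<otimes>\<^bsub>Q8\<^esub> u = (2, 0)" using that(1) by (auto simp: Q8_carrier Q8_mult)
    then show ?thesis using act_mult[of u u w] cc that(2) by simp
  qed
  have xy: "act V (1, 0) (act V (0, 1) w) = (- 1) \<odot>\<^bsub>V\<^esub> act V (0, 1) (act V (1, 0) w)" if w: "w \<in> carrier V" for w
  proof -
    have "(1, 0) \<otimes>\<^bsub>Q8\<^esub> (0, 1) = (2, 0) \<otimes>\<^bsub>Q8\<^esub> ((0, 1) \<otimes>\<^bsub>Q8\<^esub> (1, 0))" by (simp add: Q8_mult)
    then have "act V (1, 0) (act V (0, 1) w) = act V (2, 0) (act V (0, 1) (act V (1, 0) w))"
      using act_mult[OF x y w] act_mult[OF y x w] act_mult[OF c G.m_closed[OF y x] w] by simp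
    then show ?thesis using cc w x y by simp
  qed
  have top: "VectorSpace.subspace CC (carrier V) V" by (rule V.subspaceI) auto
  obtain a0 q where a0: "a0 \<in> carrier V" "a0 \<noteq> \<zero>\<^bsub>V\<^esub>" "act V (1, 0) a0 = q \<odot>\<^bsub>V\<^esub> a0" "q * q = \<i> * \<i>"
    by (rule V.eigenvector[OF act_linear[OF x] top _ vc v(2), of \<i>]) (use sq vc x in auto)
  \<comment> \<open>\<open>y\<close> exchanges the eigenspaces of \<open>x\<close> for \<open>\<i>\<close> and \<open>-\<i>\<close>.\<close>
  obtain a where a: "a \<in> carrier V" "a \<noteq> \<zero>\<^bsub>V\<^esub>" "act V (1, 0) a = \<i> \<odot>\<^bsub>V\<^esub> a"
  proof (cases "q = \<i>")
    case True
    with a0 that show ?thesis by auto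
  next
    case False
    then have "q = - \<i>" using a0(4) by (metis square_eq_iff)
    then have "act V (1, 0) (act V (0, 1) a0) = \<i> \<odot>\<^bsub>V\<^esub> act V (0, 1) a0"
      using xy[OF a0(1)] a0 y linD(3)[OF act_linear[OF y] a0(1), of "- \<i>"] by (simp add: V.sm_assoc)
    then show ?thesis using that[of "act V (0, 1) a0"] a0 y act_nonzero by simp
  qed
  define b where "b = act V (0, 1) a"
  have b: "b \<in> carrier V" using a y by (simp add: b_def)
  have xb: "act V (1, 0) b = (- \<i>) \<odot>\<^bsub>V\<^esub> b"
    using xy[OF a(1)] a y linD(3)[OF act_linear[OF y] a(1), of \<i>] by (simp add: V.sm_assoc b_def)
  have yb: "act V (0, 1) b = (- 1) \<odot>\<^bsub>V\<^esub> a" using sq[of "(0, 1)" a] a by (simp add: b_def)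
  have gh: "((1, 0), (0, 1)) \<in> Q8_pairs" by (simp add: Q8_pairs_def)
  show ?thesis unfolding model_rho5_def
    by (rule pair_recognition[OF model_rho5_irreducible[unfolded model_rho5_def] gh c c all[OF a(1)] a(2) all[OF b]])
      (use a b xb yb b_def[symmetric] in \<open>auto simp: rho5_table rho5_table[unfolded One_nat_def]\<close>)
qed

text \<open>On an eigenvector \<open>a\<close> of \<open>g\<close> with eigenvalue \<open>q\<close> and on \<open>b = h a\<close> the relations of the group determine all actions:
\<open>g b = q\<^sup>3 b\<close>, \<open>h b = q\<^sup>2 a\<close>, and \<open>z g = g\<^sup>3\<close>. The three possibilities for \<open>q\<close> with \<open>q\<^sup>4 = 1\<close> lead to the flip, to the
module induced from \<open>\<phi>\<^sub>2\<close>, and to the affine braiding.\<close>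

lemma noncentral_case:
  assumes fd: "CC_fin_dim V" "CC_fin_dim (nichols_algebra Q8 V)" and gh: "(g, h) \<in> Q8_pairs"
    and v: "v \<in> homog V g" "v \<noteq> \<zero>\<^bsub>V\<^esub>"
  shows "yd_isomorphic Q8 V (model g)"
proof -
  let ?c = "(2, 0) \<otimes>\<^bsub>Q8\<^esub> g"
  note c = Q8_pair(1,2,5,6)[OF gh]
  have rel: "?c = g \<otimes>\<^bsub>Q8\<^esub> (g \<otimes>\<^bsub>Q8\<^esub> g)" "g \<otimes>\<^bsub>Q8\<^esub> h = h \<otimes>\<^bsub>Q8\<^esub> (g \<otimes>\<^bsub>Q8\<^esub> (g \<otimes>\<^bsub>Q8\<^esub> g))"
    "h \<otimes>\<^bsub>Q8\<^esub> h = g \<otimes>\<^bsub>Q8\<^esub> g" "g \<otimes>\<^bsub>Q8\<^esub> (g \<otimes>\<^bsub>Q8\<^esub> (g \<otimes>\<^bsub>Q8\<^esub> g)) = \<one>\<^bsub>Q8\<^esub>" "g \<otimes>\<^bsub>Q8\<^esub> g \<in> carrier Q8"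
    by (rule Q8_pairsE[OF gh]; simp add: Q8_mult Q8_one Q8_carrier)+
  have cube: "act V (g \<otimes>\<^bsub>Q8\<^esub> (g \<otimes>\<^bsub>Q8\<^esub> g)) w = act V g (act V g (act V g w))" if "w \<in> carrier V" for w
    using that c rel(5) by (simp add: act_mult)
  have gst: "act V u w \<in> homog V g" if "u \<in> {g, g \<otimes>\<^bsub>Q8\<^esub> g}" "w \<in> homog V g" for u w
  proof -
    have "u \<in> carrier Q8" "u \<otimes>\<^bsub>Q8\<^esub> g = g \<otimes>\<^bsub>Q8\<^esub> u" using that(1) c rel(5) by (auto simp: G.m_assoc)
    then show ?thesis using Q8_conj[of u g g] act_homog[of u g] that(2) c by auto
  qed
  note hs = V.homog_sub[OF c(1)]
  have hc: "w \<in> carrier V" if "w \<in> homog V g" for w using that V.homog_closed[OF c(1)] by auto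
  \<comment> \<open>The eigenvector is found in two steps: first for \<open>g\<^sup>2\<close>, whose square is the identity, and then for \<open>g\<close>, whose
    square has become a scalar \<open>s = \<plusminus>1\<close>.\<close>
  have v4: "act V (g \<otimes>\<^bsub>Q8\<^esub> g) (act V (g \<otimes>\<^bsub>Q8\<^esub> g) v) = (1 * 1) \<odot>\<^bsub>V\<^esub> v"
    using act_mult[OF c(1) G.m_closed[OF c(1) rel(5)] hc[OF v(1)]] cube[OF hc[OF v(1)]]
      act_mult[OF c(1) c(1)] act_one[OF hc[OF v(1)]] rel(4) c hc[OF v(1)] by simp
  obtain a0 s where a0: "a0 \<in> homog V g" "a0 \<noteq> \<zero>\<^bsub>V\<^esub>" "act V (g \<otimes>\<^bsub>Q8\<^esub> g) a0 = s \<odot>\<^bsub>V\<^esub> a0" "s * s = 1 * 1"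
    by (rule V.eigenvector[OF act_linear[OF rel(5)] hs _ v v4]) (use gst in auto)
  have "s = 1 \<or> s = - 1" using a0(4) by (metis square_eq_iff)
  then obtain r :: complex where r: "s = r * r" using i_squared by (metis mult_1)
  have ff: "act V g (act V g a0) = (r * r) \<odot>\<^bsub>V\<^esub> a0" using act_mult[OF c(1,1) hc[OF a0(1)]] a0(3) r by simp
  obtain a q where a: "a \<in> homog V g" "a \<noteq> \<zero>\<^bsub>V\<^esub>" "act V g a = q \<odot>\<^bsub>V\<^esub> a" "q * q = r * r"
    by (rule V.eigenvector[OF act_linear[OF c(1)] hs _ a0(1,2) ff]) (use gst in auto)
  note ac [simp] = hc[OF a(1)]
  define b where "b = act V h a"
  have bc [simp]: "b \<in> carrier V" using c by (simp add: b_def)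
  have b: "b \<in> homog V ?c"
    using act_homog[OF c(2,1)] Q8_conj[OF c(2,1,4)] Q8_pair(4)[OF gh] a(1) by (auto simp: b_def)
  have b0: "b \<noteq> \<zero>\<^bsub>V\<^esub>" unfolding b_def by (rule act_nonzero[OF c(2) ac a(2)])
  have gsm: "act V g (p \<odot>\<^bsub>V\<^esub> w) = p \<odot>\<^bsub>V\<^esub> act V g w" if "w \<in> carrier V" for p w
    by (rule linD(3)[OF act_linear[OF c(1)] that])
  have gb: "act V g b = (q * q * q) \<odot>\<^bsub>V\<^esub> b"
  proof -
    have "act V g b = act V h (act V g (act V g (act V g a)))"
      using act_mult[OF c(1,2) ac] act_mult[OF c(2) G.m_closed[OF c(1) rel(5)] ac] cube[OF ac] rel(2) by (simp add: b_def)
    also have "\<dots> = act V h ((q * q * q) \<odot>\<^bsub>V\<^esub> a)" using a(3) by (simp add: gsm V.sm_assoc mult.assoc)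
    finally show ?thesis using linD(3)[OF act_linear[OF c(2)] ac] by (simp add: b_def)
  qed
  have hb: "act V h b = (q * q) \<odot>\<^bsub>V\<^esub> a"
    using act_mult[OF c(2,2) ac] act_mult[OF c(1,1) ac] rel(3) a(3) by (simp add: b_def gsm V.sm_assoc)
  have abs: "{a, b} \<subseteq> carrier V" by simp
  have span: "w \<in> CC_span V {a, b}" if "w \<in> carrier V" for w
  proof (rule pair_spanning[OF gh c(1,4) a(1,2) b _ that])
    fix u s assume "u \<in> {g, h}" "s \<in> {a, b}"
    then show "act V u s \<in> CC_span V {a, b}"
      using a(3) gb hb b_def[symmetric] V.span_base[OF abs] V.span_sm[OF abs] by auto
  qed
  have "q = 1 \<or> q = - 1 \<or> q * q = - 1"
    using \<open>s = 1 \<or> s = - 1\<close> a(4) r by (metis mult_1 square_eq_iff)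
  then consider "q = 1" | "q = - 1" | "q * q = - 1" by blast
  then show ?thesis
  proof cases
    case 1
    have "act V g w = w" if "w \<in> carrier V" for w
      by (rule lin_eq_on_span[OF act_linear[OF c(1)] lin_id V_cspace V_cspace _ span[OF that]]) (use 1 a(3) gb in auto)
    from nichols_infinite_flip[OF fd(1) c(1) v this] show ?thesis using fd(2) by contradiction
  next
    case 2
    show ?thesis unfolding model_def
    proof (rule pair_recognition[OF model_irreducible[OF gh, unfolded model_def] gh c(1,4) a(1,2) b])
      note kv = klein_values(2,3)[OF gh] and e = a(3) gb hb b_def[symmetric]
      fix u assume "u \<in> {g, h}"
      then consider "u = g" | "u = h" by blast
      then show "act V u a = fst (klein g u (1, 0)) \<odot>\<^bsub>V\<^esub> a \<oplus>\<^bsub>V\<^esub> snd (klein g u (1, 0)) \<odot>\<^bsub>V\<^esub> b"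
        "act V u b = fst (klein g u (0, 1)) \<odot>\<^bsub>V\<^esub> a \<oplus>\<^bsub>V\<^esub> snd (klein g u (0, 1)) \<odot>\<^bsub>V\<^esub> b"
        by (cases; simp add: kv e 2)+
    qed
  next
    case 3
    have q4: "q * (q * q * q) = 1" using 3 by (metis minus_mult_minus mult.assoc mult_1)
    have ca: "act V ?c a = (q * q * q) \<odot>\<^bsub>V\<^esub> a"
      unfolding rel(1) cube[OF ac] using a(3) by (simp add: gsm V.sm_assoc mult.assoc)
    have cb: "act V ?c b = q \<odot>\<^bsub>V\<^esub> b"
      unfolding rel(1) cube[OF bc] using gb 3 by (simp add: gsm V.sm_assoc)
    from nichols_infinite_affine[OF fd(1) c(1,4) c(3)[symmetric] a(1,2) b b0 span a(3) gb ca cb q4 3]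
    show ?thesis using fd(2) by contradiction
  qed
qed

lemma classification:
  assumes fd: "CC_fin_dim V" "CC_fin_dim (nichols_algebra Q8 V)"
  shows "yd_isomorphic Q8 V (model (1, 0)) \<or> yd_isomorphic Q8 V model_rho5 \<or>
    yd_isomorphic Q8 V (model (0, 1)) \<or> yd_isomorphic Q8 V (model (1, 1))"
proof -
  obtain t v where t: "t \<in> carrier Q8" and v: "v \<in> homog V t" "v \<noteq> \<zero>\<^bsub>V\<^esub>" by (rule nonzero_homog)
  have vc: "v \<in> carrier V" using v t V.homog_closed by auto
  have non: "yd_isomorphic Q8 V (model g)" if gh: "(g, h) \<in> Q8_pairs" "t = g \<or> t = (2, 0) \<otimes>\<^bsub>Q8\<^esub> g" for g h
  proof (cases "t = g")
    case True
    then show ?thesis using noncentral_case[OF fd gh(1)] v by simp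
  next
    case False
    note c = Q8_pair(1,2)[OF gh(1)]
    \<comment> \<open>Now \<open>t = z g\<close>, and conjugation by \<open>h\<close> moves \<open>v\<close> to degree \<open>g\<close>.\<close>
    have "h \<otimes>\<^bsub>Q8\<^esub> t = g \<otimes>\<^bsub>Q8\<^esub> h"
      by (rule Q8_pairsE[OF gh(1)]) (use False gh(2) in \<open>auto simp: Q8_mult\<close>)
    then have "act V h v \<in> homog V g"
      using act_homog[OF c(2) t] Q8_conj[OF c(2) t c(1)] v(1) by auto
    then show ?thesis using noncentral_case[OF fd gh(1)] act_nonzero[OF c(2) vc v(2)] by simp
  qed
  have pairs: "((1, 0), (0, 1)) \<in> Q8_pairs" "((0, 1), (1, 0)) \<in> Q8_pairs" "((1, 1), (1, 0)) \<in> Q8_pairs"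
    by (simp_all add: Q8_pairs_def)
  consider "t = (0, 0)" | "t = (2, 0)" | "t = (1, 0) \<or> t = (2, 0) \<otimes>\<^bsub>Q8\<^esub> (1, 0)"
    | "t = (0, 1) \<or> t = (2, 0) \<otimes>\<^bsub>Q8\<^esub> (0, 1)" | "t = (1, 1) \<or> t = (2, 0) \<otimes>\<^bsub>Q8\<^esub> (1, 1)"
    using t by (force simp: Q8_carrier Q8_mult)
  then show ?thesis
  proof cases
    case 1
    have "act V t w = w" if "w \<in> carrier V" for w using act_one[OF that] 1 Q8_one by simp
    from nichols_infinite_flip[OF fd(1) t v this] show ?thesis using fd(2) by contradiction
  next
    case 2
    then show ?thesis using central_case[OF fd] v by simp
  next
    case 3
    then show ?thesis using non[OF pairs(1)] by simp
  next
    case 4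
    then show ?thesis using non[OF pairs(2)] by simp
  next
    case 5
    then show ?thesis using non[OF pairs(3)] by simp
  qed
qed

end

section \<open>The classification\<close>

lemma nichols_finite_model:
  assumes gh: "(g, h) \<in> Q8_pairs" and V: "yd_module Q8 V" "yd_isomorphic Q8 V (model g)"
  shows "CC_fin_dim (nichols_algebra Q8 V)"
proof (rule nichols_finite_pair[OF V(1), of "klein g" g "(2, 0) \<otimes>\<^bsub>Q8\<^esub> g"])
  show "klein g g (p, q) = (- p, - q)" for p q by (rule klein_values(2)[OF gh])
  show "klein g ((2, 0) \<otimes>\<^bsub>Q8\<^esub> g) (p, q) = (- p, - q)" for p q
    by (rule Q8_pairsE[OF gh]; simp add: klein_def sign_swap_def Q8_mult)
qed (use Q8_pair(1,6)[OF gh] V(2) model_yd[OF gh] in \<open>simp_all add: model_def\<close>)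

lemma nichols_finite_model_rho5:
  assumes V: "yd_module Q8 V" "yd_isomorphic Q8 V model_rho5"
  shows "CC_fin_dim (nichols_algebra Q8 V)"
  by (rule nichols_finite_pair[OF V(1), of rho5 "(2, 0)" "(2, 0)"])
    (use V(2) model_rho5_yd in \<open>simp_all add: model_rho5_def rho5_table Q8_carrier\<close>)

lemma isomorphic_model:
  assumes M: "yd_module Q8 M" "yd_isomorphic Q8 M N" and N: "yd_irreducible Q8 N" "CC_fin_dim N"
  shows "yd_irreducible Q8 M" "CC_fin_dim M" "yd_module Q8 V \<Longrightarrow> yd_isomorphic Q8 V M \<longleftrightarrow> yd_isomorphic Q8 V N"
proof -
  have N': "yd_module Q8 N" using N(1) unfolding yd_irreducible_def by simp
  interpret M: yd_tensor Q8 M by (rule yd_tensorI[OF M(1) Q8_finite])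
  interpret N: yd_tensor Q8 N by (rule yd_tensorI[OF N' Q8_finite])
  note NM = yd_isomorphic_sym[OF M(1) N' Q8_finite M(2)]
  show "yd_irreducible Q8 M" by (rule yd_irreducible_iso[OF M(1) N(1) Q8_finite M(2)])
  obtain f where "f \<in> yd_hom Q8 N M" "bij_betw f (carrier N) (carrier M)"
    using NM unfolding yd_isomorphic_def by blast
  then show "CC_fin_dim M"
    using fin_dim_iso[OF N.V_cspace M.V_cspace N(2)] yd_homD(1) unfolding bij_betw_def by blast
  show "yd_isomorphic Q8 V M \<longleftrightarrow> yd_isomorphic Q8 V N"
    using yd_isomorphic_trans[OF _ M(2)] yd_isomorphic_trans[OF _ NM] by blast
qed

theorem theorem1p2:
  fixes V :: "(nat \<times> nat, 'v) ydmod"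
  shows "(yd_irreducible Q8 V \<and> CC_fin_dim V \<longrightarrow>
      (CC_fin_dim (nichols_algebra Q8 V) \<longleftrightarrow>
        yd_isomorphic Q8 V M_x_phi2 \<or> yd_isomorphic Q8 V M_x2_rho5 \<or>
        yd_isomorphic Q8 V M_y_phi2 \<or> yd_isomorphic Q8 V M_xy_phi2)) \<and>
    (yd_irreducible Q8 M_x_phi2 \<and> CC_fin_dim M_x_phi2) \<and>
    (yd_irreducible Q8 M_x2_rho5 \<and> CC_fin_dim M_x2_rho5) \<and>
    (yd_irreducible Q8 M_y_phi2 \<and> CC_fin_dim M_y_phi2) \<and>
    (yd_irreducible Q8 M_xy_phi2 \<and> CC_fin_dim M_xy_phi2)"
proof -
  have pairs: "((1, 0), (0, 1)) \<in> Q8_pairs" "((0, 1), (1, 0)) \<in> Q8_pairs" "((1, 1), (1, 0)) \<in> Q8_pairs"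
    by (simp_all add: Q8_pairs_def)
  have M: "M_x_phi2 = induced_yd Q8 (1, 0) CC_line (phi2 Q8 (1, 0))" "M_y_phi2 = induced_yd Q8 (0, 1) CC_line (phi2 Q8 (0, 1))"
    "M_xy_phi2 = induced_yd Q8 (1, 1) CC_line (phi2 Q8 (1, 1))" "M_x2_rho5 = induced_yd Q8 (2, 0) C2 rho5"
    by (simp_all add: M_x_phi2_def M_y_phi2_def M_xy_phi2_def M_x2_rho5_def Q8x_def Q8y_def Q8_mult numeral_2_eq_2)
  have fm: "CC_fin_dim (model g)" for g unfolding model_def by (rule pair_fin_dim)
  have f5: "CC_fin_dim model_rho5" unfolding model_rho5_def by (rule pair_fin_dim)
  note x = isomorphic_model[OF induced_phi2[OF pairs(1), folded M] model_irreducible[OF pairs(1)] fm]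
    and y = isomorphic_model[OF induced_phi2[OF pairs(2), folded M] model_irreducible[OF pairs(2)] fm]
    and xy = isomorphic_model[OF induced_phi2[OF pairs(3), folded M] model_irreducible[OF pairs(3)] fm]
    and x2 = isomorphic_model[OF induced_rho5[folded M] model_rho5_irreducible f5]
  have "CC_fin_dim (nichols_algebra Q8 V) \<longleftrightarrow>
      yd_isomorphic Q8 V M_x_phi2 \<or> yd_isomorphic Q8 V M_x2_rho5 \<or>
      yd_isomorphic Q8 V M_y_phi2 \<or> yd_isomorphic Q8 V M_xy_phi2"
    if V: "yd_irreducible Q8 V" "CC_fin_dim V"
  proof -
    have V': "yd_module Q8 V" using V(1) unfolding yd_irreducible_def by simp
    interpret Q8_irreducible V
      by (intro Q8_irreducible.intro Q8_irreducible_axioms.intro yd_tensorI[OF V' Q8_finite] V(1))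
    show ?thesis
      unfolding x(3)[OF V'] y(3)[OF V'] xy(3)[OF V'] x2(3)[OF V']
      using classification[OF V(2)] nichols_finite_model_rho5[OF V'] nichols_finite_model[OF pairs(1) V']
        nichols_finite_model[OF pairs(2) V'] nichols_finite_model[OF pairs(3) V'] by blast
  qed
  then show ?thesis using x(1,2) y(1,2) xy(1,2) x2(1,2) by blast
qed

end
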